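(* Let $\mathcal A$ be an S-ring over a CG-ring $R$. Suppose that $\mathcal I_{max}(\mathcal A)\ne\mathcal I_{max}(R)$. Then $\mathcal A$ is either a non-trivial generalized wreath product, or a tensor product one factor of which is an S-ring of rank $2$ over a non-field.
   Context: All rings are finite, commutative, with identity; the one-element ring is allowed. For a ring $R$, $R^+$ is the additive group, $R^\times$ the group of units, $\mathcal P(R)$ the set of primes dividing $|R|$; $R_p$ is the $p$-component of $R$ (the subring whose additive group is the Sylow $p$-subgroup of $R^+$), and $R_Q=\prod_{p\in Q}R_p$ for $Q\subset\mathcal P(R)$. $R$ is a CG-ring if for every $p\in\mathcal P(R)$ the ring $R_p$ is a Galois ring, i.e. a local ring with radical $pR_p$. S-ring over a finite group $G$: a subring $\mathcal A$ of $\mathbb Z G$ having a $\mathbb Z$-basis consisting of the elements $\sum_{x\in X}x$, where $X$ runs over a partition $\mathcal S(\mathcal A)$ of $G$ into non-empty sets (basic sets) such that $\{1\}\in\mathcal S(\mathcal A)$ and $X\in\mathcal S(\mathcal A)\Rightarrow X^{-1}\in\mathcal S(\mathcal A)$. Its rank is $|\mathcal S(\mathcal A)|$. S-ring over the ring $R$: an S-ring $\mathcal A$ over $R^+$ such that $uX\in\mathcal S(\mathcal A)$ for all $X\in\mathcal S(\mathcal A)$, $u\in R^\times$. An $\mathcal A$-ideal is an ideal of $R$ that is a union of basic sets. $\mathcal I_{max}(R)$ is the set of maximal ideals of $R$, and $\mathcal I_{max}(\mathcal A)$ is the set of maximal $\mathcal A$-ideals, i.e. of the $\mathcal A$-ideals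 maximal by inclusion among those different from $R$. For $X\subset R$, $I_{\rm L}(X)$ is the largest ideal $I$ of $R$ with $X+I=X$. $\mathcal A$ is a non-trivial generalized wreath product if there exist $\mathcal A$-ideals $J\subset I$ with $J\ne0$, $I\ne R$, such that $J\subset I_{\rm L}(X)$ for every basic set $X\subset R\setminus I$. The tensor product $\mathcal A_1\otimes\mathcal A_2$ of S-rings over groups $G_1,G_2$ is the S-ring over $G_1\times G_2$ with basic sets $X_1\times X_2$, $X_i\in\mathcal S(\mathcal A_i)$. Tensor decompositions of an S-ring over $R$ are with respect to $R=R_Q\times R_{\mathcal P(R)\setminus Q}$, the factors being S-rings over the rings $R_Q$ and $R_{\mathcal P(R)\setminus Q}$; the other factor may be over the one-element ring (so an S-ring of rank $2$ over a non-field itself counts). *)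

theory Defs
  imports "HOL-Algebra.Ideal" "HOL-Algebra.Subrings" "HOL-Computational_Algebra.Primes" "HOL-Library.Disjoint_Sets"
    "HOL-Library.Indicator_Function"
begin

section \<open>S-rings over finite groups\<close>

text \<open>
  An element \<open>\<Sum>x\<in>G. f(x) x\<close> of \<open>\<int>G\<close> is represented by its coefficient function \<open>f\<close>, which is
  \<open>0\<close> outside the carrier of \<open>G\<close>. In particular \<open>\<Sum>x\<in>X. x\<close> is the function \<open>indicator X\<close>.
\<close>

definition group_ring :: "('a, 'm) monoid_scheme \<Rightarrow> ('a \<Rightarrow> int) ring" where
  "group_ring G =
    \<lparr> carrier = {f. \<forall>x. x \<notin> carrier G \<longrightarrow> f x = 0},
      monoid.mult = (\<lambda>f g x. \<Sum>(y, z)\<in>{(y, z)\<in>carrier G \<times> carrier G. y \<otimes>\<^bsub>G\<^esub> z = x}. f y * g z),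
      monoid.one = indicator {\<one>\<^bsub>G\<^esub>},
      ring.zero = (\<lambda>x. 0),
      ring.add = (\<lambda>f g x. f x + g x) \<rparr>"

text \<open>The following two notions are meant for finite sets \<open>B\<close>.\<close>

definition int_span :: "('a \<Rightarrow> int) set \<Rightarrow> ('a \<Rightarrow> int) set" where
  "int_span B = {f. \<exists>c. f = (\<lambda>x. \<Sum>b\<in>B. c b * b x)}"

definition int_basis :: "('a \<Rightarrow> int) set \<Rightarrow> ('a \<Rightarrow> int) set \<Rightarrow> bool" where
  "int_basis B A \<longleftrightarrow> A = int_span B \<and>
     (\<forall>c. (\<lambda>x. \<Sum>b\<in>B. c b * b x) = (\<lambda>x. 0) \<longrightarrow> (\<forall>b\<in>B. c b = 0))"

definition schur_partition ::
  "('a, 'm) monoid_scheme \<Rightarrow> ('a \<Rightarrow> int) set \<Rightarrow> 'a set set \<Rightarrow> bool" where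
  "schur_partition G A S \<longleftrightarrow>
     partition_on (carrier G) S \<and> {\<one>\<^bsub>G\<^esub>} \<in> S \<and>
     (\<forall>X\<in>S. (\<lambda>x. inv\<^bsub>G\<^esub> x) ` X \<in> S) \<and>
     int_basis (indicator ` S) A"

definition S_ring :: "('a, 'm) monoid_scheme \<Rightarrow> ('a \<Rightarrow> int) set \<Rightarrow> bool" where
  "S_ring G A \<longleftrightarrow>
     group G \<and> finite (carrier G) \<and> subring A (group_ring G) \<and> (\<exists>S. schur_partition G A S)"

definition basic_sets :: "('a, 'm) monoid_scheme \<Rightarrow> ('a \<Rightarrow> int) set \<Rightarrow> 'a set set" where
  "basic_sets G A = (THE S. schur_partition G A S)"

definition S_rank :: "('a, 'm) monoid_scheme \<Rightarrow> ('a \<Rightarrow> int) set \<Rightarrow> nat" where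
  "S_rank G A = card (basic_sets G A)"

lemma int_span_indicator_const:
  assumes "f \<in> int_span (indicator ` S)" "disjoint S" "X \<in> S" "x \<in> X" "y \<in> X"
  shows "f x = f y"
proof -
  have *: "indicator Y x = (indicator Y y :: int)" if "Y \<in> S" for Y
    using that assms(2-5) by (cases "Y = X") (auto simp: indicator_def disjoint_def)
  from assms(1) obtain c where f: "f = (\<lambda>x. \<Sum>b\<in>indicator ` S. c b * b x)"
    by (auto simp: int_span_def)
  show ?thesis
    unfolding f by (rule sum.cong) (auto simp: *)
qed

lemma schur_partition_mono:
  assumes "finite (carrier G)" "schur_partition G A S" "schur_partition G A T"
  shows "S \<subseteq> T"
proof
  fix X assume X: "X \<in> S"
  have sub: "Y \<subseteq> X"
    if part: "schur_partition G A P" "schur_partition G A Q" and "X \<in> P" "Y \<in> Q" "x \<in> X" "x \<in> Y"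
    for P Q X Y x
  proof
    fix y assume y: "y \<in> Y"
    have "finite P"
      using part(1) assms(1) finite_elements unfolding schur_partition_def by blast
    hence "(\<Sum>b\<in>indicator ` P. (if b = indicator X then 1 else 0) * b z) = (indicator X z :: int)" for z
      using \<open>X \<in> P\<close> by (subst sum.remove[of _ "indicator X"]) auto
    hence "(indicator X :: _ \<Rightarrow> int) = (\<lambda>z. \<Sum>b\<in>indicator ` P. (if b = indicator X then 1 else 0) * b z)"
      by presburger
    hence "(indicator X :: _ \<Rightarrow> int) \<in> int_span (indicator ` P)"
      unfolding int_span_def by (intro CollectI exI)
    hence "(indicator X :: _ \<Rightarrow> int) \<in> int_span (indicator ` Q)"
      using part by (simp add: schur_partition_def int_basis_def)
    moreover have "disjoint Q"
      using part(2) by (simp add: schur_partition_def partition_on_def)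
    ultimately have "indicator X x = (indicator X y :: int)"
      using \<open>Y \<in> Q\<close> \<open>x \<in> Y\<close> y by (rule int_span_indicator_const)
    thus "y \<in> X" using \<open>x \<in> X\<close> by (simp add: indicator_def split: if_splits)
  qed
  have part: "partition_on (carrier G) S"
    using assms(2) by (simp add: schur_partition_def)
  have "X \<noteq> {}" "X \<subseteq> carrier G"
    using X partition_onD1[OF part] partition_onD3[OF part] by auto
  then obtain x where x: "x \<in> X" "x \<in> carrier G" by blast
  then obtain Y where Y: "Y \<in> T" "x \<in> Y"
    using assms(3) unfolding schur_partition_def partition_on_def by blast
  have "X = Y"
    using sub[OF assms(2,3) X Y(1) x(1) Y(2)] sub[OF assms(3,2) Y(1) X Y(2) x(1)] by blast
  thus "X \<in> T" using Y by simp
qed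

lemma schur_partition_basic_sets:
  assumes "S_ring G A"
  shows "schur_partition G A (basic_sets G A)"
proof -
  have "\<exists>!S. schur_partition G A S"
    using assms schur_partition_mono[of G A] unfolding S_ring_def by (meson subset_antisym)
  thus ?thesis unfolding basic_sets_def by (rule theI')
qed

text \<open>An S-ring is the integer span of the simple quantities of its basic sets.\<close>

definition tensor_product ::
  "('a, 'm) monoid_scheme \<Rightarrow> ('a \<Rightarrow> int) set \<Rightarrow> ('b, 'n) monoid_scheme \<Rightarrow> ('b \<Rightarrow> int) set
    \<Rightarrow> ('a \<times> 'b \<Rightarrow> int) set" where
  "tensor_product G1 A1 G2 A2 =
     int_span (indicator ` {X1 \<times> X2 |X1 X2. X1 \<in> basic_sets G1 A1 \<and> X2 \<in> basic_sets G2 A2})"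


section \<open>Components of a finite commutative ring\<close>

definition prime_set :: "('a, 'm) ring_scheme \<Rightarrow> nat set" where
  "prime_set R = {p. Factorial_Ring.prime p \<and> p dvd card (carrier R)}"

definition sylow_part :: "('a, 'm) ring_scheme \<Rightarrow> nat \<Rightarrow> 'a set" where
  "sylow_part R p =
     (THE H. subgroup H (add_monoid R) \<and> card H = p ^ multiplicity p (card (carrier R)))"

text \<open>The identity element of a component is in general different from that of \<open>R\<close>.\<close>

definition component_on :: "('a, 'm) ring_scheme \<Rightarrow> 'a set \<Rightarrow> ('a, 'm) ring_scheme" where
  "component_on R C =
     R\<lparr>carrier := C, one := (THE e. e \<in> C \<and> (\<forall>x\<in>C. e \<otimes>\<^bsub>R\<^esub> x = x \<and> x \<otimes>\<^bsub>R\<^esub> e = x))\<rparr>"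

definition p_component :: "('a, 'm) ring_scheme \<Rightarrow> nat \<Rightarrow> ('a, 'm) ring_scheme" where
  "p_component R p = component_on R (sylow_part R p)"

text \<open>The internal direct product of the rings \<open>p_component R p\<close>, \<open>p \<in> Q\<close>; it is the one-element
  ring if \<open>Q\<close> is empty.\<close>

definition Q_component :: "('a, 'm) ring_scheme \<Rightarrow> nat set \<Rightarrow> ('a, 'm) ring_scheme" where
  "Q_component R Q =
     component_on R {\<Oplus>\<^bsub>R\<^esub>p\<in>Q. x p |x. \<forall>p\<in>Q. x p \<in> carrier (p_component R p)}"

definition maximal_ideals :: "('a, 'm) ring_scheme \<Rightarrow> 'a set set" where
  "maximal_ideals R = {M. maximalideal M R}"

definition galois_ring :: "nat \<Rightarrow> ('a, 'm) ring_scheme \<Rightarrow> bool" where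
  "galois_ring p R \<longleftrightarrow>
     cring R \<and> finite (carrier R) \<and> (\<exists>!M. M \<in> maximal_ideals R) \<and>
     \<Inter>(maximal_ideals R) = {[p] \<cdot>\<^bsub>R\<^esub> x |x. x \<in> carrier R}"

definition CG_ring :: "('a, 'm) ring_scheme \<Rightarrow> bool" where
  "CG_ring R \<longleftrightarrow>
     cring R \<and> finite (carrier R) \<and> (\<forall>p\<in>prime_set R. galois_ring p (p_component R p))"


section \<open>S-rings over finite commutative rings\<close>

abbreviation ring_basic_sets :: "('a, 'm) ring_scheme \<Rightarrow> ('a \<Rightarrow> int) set \<Rightarrow> 'a set set" where
  "ring_basic_sets R A \<equiv> basic_sets (add_monoid R) A"

definition S_ring_over :: "('a, 'm) ring_scheme \<Rightarrow> ('a \<Rightarrow> int) set \<Rightarrow> bool" where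
  "S_ring_over R A \<longleftrightarrow>
     cring R \<and> finite (carrier R) \<and> S_ring (add_monoid R) A \<and>
     (\<forall>X\<in>ring_basic_sets R A. \<forall>u\<in>Units R. (\<lambda>x. u \<otimes>\<^bsub>R\<^esub> x) ` X \<in> ring_basic_sets R A)"

definition S_ideal :: "('a, 'm) ring_scheme \<Rightarrow> ('a \<Rightarrow> int) set \<Rightarrow> 'a set \<Rightarrow> bool" where
  "S_ideal R A I \<longleftrightarrow> ideal I R \<and> (\<exists>T\<subseteq>ring_basic_sets R A. I = \<Union>T)"

definition maximal_S_ideals :: "('a, 'm) ring_scheme \<Rightarrow> ('a \<Rightarrow> int) set \<Rightarrow> 'a set set" where
  "maximal_S_ideals R A =
     {M. S_ideal R A M \<and> M \<noteq> carrier R \<and>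
         (\<forall>J. S_ideal R A J \<and> J \<noteq> carrier R \<and> M \<subseteq> J \<longrightarrow> J = M)}"

definition I_L :: "('a, 'm) ring_scheme \<Rightarrow> 'a set \<Rightarrow> 'a set" where
  "I_L R X = (GREATEST I. ideal I R \<and> X <+>\<^bsub>R\<^esub> I = X)"

definition nontrivial_gen_wreath :: "('a, 'm) ring_scheme \<Rightarrow> ('a \<Rightarrow> int) set \<Rightarrow> bool" where
  "nontrivial_gen_wreath R A \<longleftrightarrow>
     (\<exists>I J. S_ideal R A I \<and> S_ideal R A J \<and> J \<subseteq> I \<and> J \<noteq> {\<zero>\<^bsub>R\<^esub>} \<and> I \<noteq> carrier R \<and>
        (\<forall>X\<in>ring_basic_sets R A. X \<subseteq> carrier R - I \<longrightarrow> J \<subseteq> I_L R X))"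

text \<open>
  \<open>A = A1 \<otimes> A2\<close> with respect to \<open>R = R1 \<times> R2\<close>, where \<open>R1\<close> and \<open>R2\<close> are the components of \<open>R\<close>
  for \<open>Q\<close> and for its complement. The S-ring \<open>A\<close> is transported to the group \<open>R1\<^sup>+ \<times> R2\<^sup>+\<close> along
  the canonical isomorphism \<open>(x, y) \<mapsto> x + y\<close>.
\<close>

definition tensor_decomposition ::
  "('a, 'm) ring_scheme \<Rightarrow> nat set \<Rightarrow> ('a \<Rightarrow> int) set \<Rightarrow> ('a \<Rightarrow> int) set \<Rightarrow> ('a \<Rightarrow> int) set \<Rightarrow> bool"
  where
  "tensor_decomposition R Q A A1 A2 \<longleftrightarrow>
     (let R1 = Q_component R Q; R2 = Q_component R (prime_set R - Q) in
        S_ring_over R1 A1 \<and> S_ring_over R2 A2 \<and>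
        (\<lambda>f (x, y). if x \<in> carrier R1 \<and> y \<in> carrier R2 then f (x \<oplus>\<^bsub>R\<^esub> y) else 0) ` A
          = tensor_product (add_monoid R1) A1 (add_monoid R2) A2)"

definition rank_two_over_non_field :: "('a, 'm) ring_scheme \<Rightarrow> ('a \<Rightarrow> int) set \<Rightarrow> bool" where
  "rank_two_over_non_field R A \<longleftrightarrow>
     S_ring_over R A \<and> S_rank (add_monoid R) A = 2 \<and> \<not> field R"

end

theory Submission
  imports Defs "HOL-Number_Theory.Cong" "HOL-Decision_Procs.Algebra_Aux"
    "HOL-Algebra.Multiplicative_Group" "HOL-Algebra.Sylow"
begin

text \<open>
  \<^bold>\<open>Idea.\<close> Call a union of unit multiples of a basic set rational. If \<open>Z\<close> is a union of basic sets that is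
  stable under the units of \<open>R\<^sub>p\<close>, then the elements \<open>y\<close> near which \<open>Z\<close> fails to be invariant under the
  socle of \<open>R\<^sub>p\<close> again form a union of basic sets; this follows from the congruence
  \<open>(\<Sum>Z)\<^sup>p \<equiv> \<Sum>{pz | z \<in> Z}\<close> modulo \<open>p\<close>. Used relative to \<open>\<A>\<close>-ideals, it shows that
  two elements lying in the same \<open>\<A>\<close>-ideals lie in the same rational basic set, so that everything
  rational is governed by the lattice of \<open>\<A>\<close>-ideals.

  Suppose that \<open>pR\<close> is not an \<open>\<A>\<close>-ideal. If all maximal \<open>\<A>\<close>-ideals contain \<open>R\<^sub>p\<close>, the congruence yields
  a generalized wreath product. Otherwise let \<open>M\<close> be a maximal \<open>\<A>\<close>-ideal without \<open>R\<^sub>p\<close>, let \<open>Q\<close> be the set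
  of primes \<open>r\<close> with \<open>R\<^sub>r\<close> not in \<open>M\<close>, and let \<open>X\<close> be a basic set outside \<open>M\<close> with unit multiples
  covering \<open>W\<close>. For a suitable \<open>h\<close> in the socle of \<open>R\<^sub>Q\<close>, more than half of the \<open>w \<in> W\<close> lie in the same
  basic set as \<open>w + h\<close>. The number of such \<open>w\<close> depends only on the rational class of \<open>h\<close>, and averaging it
  over that class shows that a coset of the \<open>\<A>\<close>-ideal generated by \<open>h\<close> meets only one of the
  multiples of \<open>X\<close> in \<open>W\<close>. Hence \<open>X\<close> is invariant under a non-zero \<open>\<A>\<close>-ideal inside \<open>M\<close>, or \<open>M\<close> and \<open>R\<^sub>Q\<close>
  are complementary \<open>\<A>\<close>-ideals and \<open>X\<close> is the product of \<open>R\<^sub>Q - 0\<close> with its projection to \<open>M\<close>.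
\<close>

section \<open>Cyclic actions of prime order\<close>

text \<open>Why translation by \<open>h\<close> keeps most of a class inside its basic sets: a unit
  that fixes one member of a basic set maps the set to itself. So it suffices to find a unit that
  carries \<open>w\<close> to \<open>w + h\<close> and fixes some member of the basic set of
  \<open>w\<close>. The units used differ from 1 only at one prime \<open>r\<close> of
  \<open>Q\<close>, and the fixed member has a non-invertible \<open>r\<close>-component. It exists
  because \<open>M\<close> is strictly smaller than every \<open>rR\<close> with \<open>r\<close> in
  \<open>Q\<close>; this is where the assumption on \<open>pR\<close> enters. The exceptional
  \<open>w\<close> are those with non-invertible \<open>r\<close>-component, and adding the identity
  of the \<open>r\<close>-component embeds them properly into the others. If the
  \<open>r\<close>-component is a field, the factor \<open>1 + 1/w\<close> is also useless when
  \<open>w\<close> is -1 at \<open>r\<close>. The two exceptional slices leave more than a half for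
  \<open>r > 3\<close>, only more than a third for \<open>r = 3\<close>, and nothing usable for
  \<open>r = 2\<close>. When all components are fields, \<open>Q\<close> contains two primes, and
  the half is available unless one of them is 2. In that case a third is enough, because the number
  of basic sets meeting a coset is then odd.\<close>

lemma funpow_mult_period:
  assumes "(f ^^ d) a = a"
  shows "(f ^^ (d * k)) a = a"
  using assms by (induction k) (auto simp: funpow_add)

text \<open>The iterates of \<open>f\<close> form an action of a cyclic group of order
  \<open>p\<close>, so each orbit off the fixed points has exactly \<open>p\<close> elements. It is
  applied to rotations of tuples, to translations and to negation.\<close>

lemma card_mod_prime_fixpoints:
  assumes fin: "finite A" and p: "Factorial_Ring.prime (p::nat)"
    and fA: "\<And>a. a \<in> A \<Longrightarrow> f a \<in> A" and per: "\<And>a. a \<in> A \<Longrightarrow> (f ^^ p) a = a"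
  shows "card A mod p = card {a\<in>A. f a = a} mod p"
proof -
  define B where "B = {a\<in>A. f a \<noteq> a}"
  define orb where "orb a = (\<lambda>k. (f ^^ k) a) ` {..<p}" for a
  have pow_mem: "(f ^^ k) a \<in> A" if "a \<in> A" for k a
    using that by (induction k) (auto simp: fA)
  have pow_mod: "(f ^^ k) a = (f ^^ (k mod p)) a" if "a \<in> A" for k a
  proof -
    have "(f ^^ k) a = (f ^^ (k mod p + p * (k div p))) a" by simp
    also have "\<dots> = (f ^^ (k mod p)) ((f ^^ (p * (k div p))) a)"
      by (simp only: funpow_add o_apply)
    also have "\<dots> = (f ^^ (k mod p)) a"
      using funpow_mult_period[OF per[OF that]] by simp
    finally show ?thesis .
  qed
  have p0: "p > 0" using p prime_gt_0_nat by blast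
  have in_orb: "(f ^^ k) a \<in> orb a" if "a \<in> A" for k a
    using pow_mod[OF that, of k] p0 by (auto simp: orb_def)
  \<comment> \<open>A period \<open>d\<close> below \<open>p\<close> is invertible modulo
    \<open>p\<close>, so some multiple of \<open>d\<close> is congruent to 1 and \<open>f\<close>
    itself fixes \<open>a\<close>.\<close>
  have fix_back: "f a = a" if a: "a \<in> A" and d: "0 < d" "d < p" and fd: "(f ^^ d) a = a" for a d
  proof -
    have "coprime d p"
      using p d by (metis coprime_commute nat_dvd_not_less prime_imp_coprime)
    then obtain k where k: "[d * k = 1] (mod p)"
      using cong_solve_coprime_nat by auto
    have "(f ^^ (d * k)) a = a" by (rule funpow_mult_period[OF fd])
    moreover have "(f ^^ (d * k)) a = (f ^^ 1) a"
      using pow_mod[OF a, of "d * k"] pow_mod[OF a, of 1] k by (simp add: cong_def)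
    ultimately show ?thesis by simp
  qed
  have cancel: "(f ^^ (p - i)) ((f ^^ i) a) = a" if "a \<in> A" "i \<le> p" for a i
  proof -
    have "(f ^^ (p - i)) ((f ^^ i) a) = (f ^^ (p - i + i)) a" by (simp only: funpow_add o_apply)
    then show ?thesis using per[OF that(1)] that(2) by simp
  qed
  have card_orb: "card (orb a) = p" if a: "a \<in> B" for a
  proof -
    have aA: "a \<in> A" using a by (simp add: B_def)
    have *: False if ij: "i < j" "j < p" "(f ^^ i) a = (f ^^ j) a" for i j
    proof -
      have "a = (f ^^ (p - i)) ((f ^^ j) a)"
        using cancel[OF aA, of i] ij by simp
      also have "\<dots> = (f ^^ (p - i + j)) a" by (simp add: funpow_add)
      also have "\<dots> = (f ^^ ((p - i + j) mod p)) a" by (rule pow_mod[OF aA])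
      also have "(p - i + j) mod p = j - i"
      proof -
        have "p - i + j = (j - i) + p" using ij by simp
        then show ?thesis using ij by (metis less_imp_diff_less mod_add_self2 mod_less)
      qed
      finally have "(f ^^ (j - i)) a = a" using ij by simp
      then have "f a = a" using fix_back[OF aA, of "j - i"] ij by auto
      then show False using a by (simp add: B_def)
    qed
    have "inj_on (\<lambda>k. (f ^^ k) a) {..<p}"
      by (rule inj_onI) (metis * lessThan_iff linorder_neqE_nat)
    then show ?thesis by (simp add: orb_def card_image)
  qed
  have orb_B: "orb a \<subseteq> B" if a: "a \<in> B" for a
  proof
    fix b assume "b \<in> orb a"
    then obtain i where i: "i < p" "b = (f ^^ i) a" by (auto simp: orb_def)
    have aA: "a \<in> A" using a by (simp add: B_def)
    have "f b \<noteq> b"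
    proof
      assume "f b = b"
      then have "(f ^^ k) b = b" for k by (induction k) auto
      then have "b = a" using cancel[OF aA, of i] i by (metis less_imp_le)
      then show False using \<open>f b = b\<close> a by (simp add: B_def)
    qed
    then show "b \<in> B" using i pow_mem[OF aA] by (simp add: B_def)
  qed
  have orb_eq: "orb b \<subseteq> orb a" if a: "a \<in> B" and b: "b \<in> orb a" for a b
  proof
    fix c assume "c \<in> orb b"
    then obtain i where i: "c = (f ^^ i) b" by (auto simp: orb_def)
    obtain j where "b = (f ^^ j) a" using b by (auto simp: orb_def)
    then have "c = (f ^^ (i + j)) a" using i by (simp add: funpow_add)
    then show "c \<in> orb a" using in_orb a by (simp add: B_def)
  qed
  have orb_sym: "a \<in> orb b" if a: "a \<in> B" and b: "b \<in> orb a" for a b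
  proof -
    have aA: "a \<in> A" using a by (simp add: B_def)
    obtain i where i: "i < p" "b = (f ^^ i) a" using b by (auto simp: orb_def)
    then have "a = (f ^^ (p - i)) b" using cancel[OF aA, of i] by simp
    moreover have "b \<in> A" using i pow_mem[OF aA] by simp
    ultimately show ?thesis using in_orb by metis
  qed
  have finB: "finite B" using fin by (simp add: B_def)
  have Un: "\<Union>(orb ` B) = B"
  proof
    show "\<Union>(orb ` B) \<subseteq> B" using orb_B by blast
    show "B \<subseteq> \<Union>(orb ` B)"
    proof
      fix a assume "a \<in> B"
      then have "(f ^^ 0) a \<in> orb a" by (intro in_orb) (simp add: B_def)
      then show "a \<in> \<Union>(orb ` B)" using \<open>a \<in> B\<close> by auto
    qed
  qed
  have disj: "c1 \<inter> c2 = {}" if c12: "c1 \<in> orb ` B" "c2 \<in> orb ` B" "c1 \<noteq> c2" for c1 c2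
  proof (rule ccontr)
    assume "c1 \<inter> c2 \<noteq> {}"
    then obtain x where x: "x \<in> c1" "x \<in> c2" by blast
    obtain a1 a2 where a: "a1 \<in> B" "c1 = orb a1" "a2 \<in> B" "c2 = orb a2" using c12 by blast
    have xB: "x \<in> B" using x(1) a(1,2) orb_B by blast
    have "orb a1 = orb x" "orb a2 = orb x"
      using orb_eq[OF a(1)] orb_eq[OF a(3)] orb_eq[OF xB] orb_sym[OF a(1)] orb_sym[OF a(3)] x a
      by (metis subset_antisym)+
    then show False using c12(3) a by simp
  qed
  have "p * card (orb ` B) = card (\<Union>(orb ` B))"
  proof (rule card_partition)
    show "finite (orb ` B)" using finB by simp
    show "finite (\<Union>(orb ` B))" using finB Un by simp
    show "card c = p" if "c \<in> orb ` B" for c using card_orb that by blast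
  qed (use disj in blast)
  then have "card B mod p = 0" using Un by (metis mod_mult_self1_is_0)
  moreover have "card A = card B + card {a\<in>A. f a = a}"
  proof -
    have "A = B \<union> {a\<in>A. f a = a}" "B \<inter> {a\<in>A. f a = a} = {}" by (auto simp: B_def)
    then show ?thesis using fin by (metis (no_types, lifting) card_Un_disjoint finite_Un)
  qed
  ultimately show ?thesis by (metis add.left_neutral mod_add_left_eq)
qed

text \<open>Every entry of a list becomes its head after some rotation, so invariance under rotation
  makes all entries equal. The predicate \<open>P\<close> later carries the condition on the sum of
  the entries.\<close>

lemma card_constant_lists:
  "card {xs. length xs = k \<and> set xs \<subseteq> X \<and> rotate1 xs = xs \<and> P xs} = card {t\<in>X. P (replicate k t)}"
  if "k > 0"
proof -
  have const: "xs = replicate k (hd xs)" if "rotate1 xs = xs" "length xs = k" for xs :: "'a list"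
  proof (rule replicate_eqI[OF that(2)])
    fix y assume "y \<in> set xs"
    have rot: "rotate n xs = xs" for n using that by (induction n) auto
    obtain n where "n < length xs" "y = xs ! n" using \<open>y \<in> set xs\<close> by (metis in_set_conv_nth)
    then have "y = hd (rotate n xs)" by (metis hd_rotate_conv_nth list.size(3) mod_less not_less_zero)
    then show "y = hd xs" using rot by simp
  qed
  have "bij_betw (\<lambda>t. replicate k t) {t\<in>X. P (replicate k t)}
     {xs. length xs = k \<and> set xs \<subseteq> X \<and> rotate1 xs = xs \<and> P xs}"
  proof (rule bij_betw_imageI)
    show "inj_on (\<lambda>t. replicate k t) {t\<in>X. P (replicate k t)}"
      using that by (auto simp: inj_on_def)
    show "(\<lambda>t. replicate k t) ` {t\<in>X. P (replicate k t)} =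
      {xs. length xs = k \<and> set xs \<subseteq> X \<and> rotate1 xs = xs \<and> P xs}"
    proof (intro equalityI subsetI)
      fix xs assume "xs \<in> {xs. length xs = k \<and> set xs \<subseteq> X \<and> rotate1 xs = xs \<and> P xs}"
      then have xs: "length xs = k" "set xs \<subseteq> X" "rotate1 xs = xs" "P xs" by auto
      have eq: "xs = replicate k (hd xs)" by (rule const[OF xs(3,1)])
      have "hd xs \<in> X" using xs that by (intro subsetD[OF xs(2)] hd_in_set) auto
      moreover have "P (replicate k (hd xs))" using xs(4) eq by (rule back_subst[of P])
      ultimately have "hd xs \<in> {t\<in>X. P (replicate k t)}" by blast
      with eq show "xs \<in> (\<lambda>t. replicate k t) ` {t\<in>X. P (replicate k t)}" by (rule image_eqI)
    next
      fix xs assume "xs \<in> (\<lambda>t. replicate k t) ` {t\<in>X. P (replicate k t)}"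
      then obtain t where "t \<in> X" "P (replicate k t)" "xs = replicate k t" by blast
      moreover have "rotate1 (replicate k t) = replicate k t"
        by (cases k) (auto simp: replicate_append_same)
      ultimately show "xs \<in> {xs. length xs = k \<and> set xs \<subseteq> X \<and> rotate1 xs = xs \<and> P xs}"
        by auto
    qed
  qed
  then show ?thesis by (rule bij_betw_same_card[symmetric])
qed

section \<open>Blocks, rational classes and counting functions\<close>

definition block_const :: "'a set set \<Rightarrow> ('a \<Rightarrow> 'b) \<Rightarrow> bool" where
  "block_const S f \<longleftrightarrow> (\<forall>X\<in>S. \<forall>x\<in>X. \<forall>y\<in>X. f x = f y)"

text \<open>An S-ring seen only through its partition: closure under multiplication becomes
  \<open>conv\<close>, a statement on convolutions of functions that are constant on the blocks.
  Integer spans reappear only where S-rings over \<open>R\<close> and their tensor factors are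
  translated.\<close>

locale schur_ring = cring R for R (structure) +
  fixes S :: "'a set set"
  assumes finR: "finite (carrier R)"
    and part: "partition_on (carrier R) S"
    and zero_block: "{\<zero>} \<in> S"
    and neg_block: "X \<in> S \<Longrightarrow> (\<lambda>x. \<ominus> x) ` X \<in> S"
    and conv: "block_const S f \<Longrightarrow> block_const S g \<Longrightarrow>
      block_const S (\<lambda>x. \<Sum>y\<in>carrier R. f y * g (x \<ominus> y) :: int)"
    and unit_block: "X \<in> S \<Longrightarrow> u \<in> Units R \<Longrightarrow> (\<lambda>x. u \<otimes> x) ` X \<in> S"
begin

definition same :: "'a \<Rightarrow> 'a \<Rightarrow> bool" where
  "same x y \<longleftrightarrow> (\<exists>X\<in>S. x \<in> X \<and> y \<in> X)"

definition rsame :: "'a \<Rightarrow> 'a \<Rightarrow> bool" where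
  "rsame x y \<longleftrightarrow> (\<exists>u\<in>Units R. same (u \<otimes> x) y)"

definition blockset :: "'a set \<Rightarrow> bool" where
  "blockset W \<longleftrightarrow> W \<subseteq> carrier R \<and> (\<forall>x y. same x y \<longrightarrow> x \<in> W \<longrightarrow> y \<in> W)"

definition rational :: "'a set \<Rightarrow> bool" where
  "rational W \<longleftrightarrow> blockset W \<and> (\<forall>u\<in>Units R. \<forall>w\<in>W. u \<otimes> w \<in> W)"

definition stab :: "'a set \<Rightarrow> 'a set" where
  "stab W = {g\<in>carrier R. \<forall>z\<in>W. z \<oplus> g \<in> W}"

definition block_ideal :: "'a set \<Rightarrow> bool" where
  "block_ideal I \<longleftrightarrow> ideal I R \<and> blockset I"

lemma finS: "finite S"
  using finite_elements[OF finR part] .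

lemma block_sub: "X \<in> S \<Longrightarrow> X \<subseteq> carrier R"
  using part by (auto simp: partition_on_def)

lemma block_finite: "X \<in> S \<Longrightarrow> finite X"
  using block_sub finR finite_subset by blast

lemma block_ne: "X \<in> S \<Longrightarrow> X \<noteq> {}"
  using part by (auto simp: partition_on_def)

lemma block_unique: "X \<in> S \<Longrightarrow> Y \<in> S \<Longrightarrow> x \<in> X \<Longrightarrow> x \<in> Y \<Longrightarrow> X = Y"
  using part by (auto simp: partition_on_def disjoint_def)

lemma block_ex: "x \<in> carrier R \<Longrightarrow> \<exists>X\<in>S. x \<in> X"
  using part by (auto simp: partition_on_def)

lemma same_refl: "x \<in> carrier R \<Longrightarrow> same x x"
  using block_ex by (auto simp: same_def)

lemma same_sym: "same x y \<Longrightarrow> same y x"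
  by (auto simp: same_def)

lemma same_trans: "same x y \<Longrightarrow> same y z \<Longrightarrow> same x z"
  unfolding same_def using block_unique by metis

lemma same_carr: "same x y \<Longrightarrow> x \<in> carrier R" "same x y \<Longrightarrow> y \<in> carrier R"
  using block_sub by (auto simp: same_def)

lemma same_zero: "same \<zero> y \<Longrightarrow> y = \<zero>"
  using zero_block block_unique by (auto simp: same_def)

lemma same_neg: "same x y \<Longrightarrow> same (\<ominus> x) (\<ominus> y)"
  unfolding same_def using neg_block by blast

lemma same_unit: "u \<in> Units R \<Longrightarrow> same x y \<Longrightarrow> same (u \<otimes> x) (u \<otimes> y)"
  unfolding same_def using unit_block by blast

lemma block_const_iff: "block_const S f \<longleftrightarrow> (\<forall>x y. same x y \<longrightarrow> f x = f y)"
  by (auto simp: block_const_def same_def)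

lemma same_in_block: "X \<in> S \<Longrightarrow> x \<in> X \<Longrightarrow> y \<in> X \<longleftrightarrow> same x y"
  unfolding same_def using block_unique by blast

lemma block_is_blockset: "X \<in> S \<Longrightarrow> blockset X"
  unfolding blockset_def using block_sub same_def block_unique by blast

lemma blockset_Un: "blockset U \<Longrightarrow> blockset V \<Longrightarrow> blockset (U \<union> V)"
  and blockset_Diff: "blockset U \<Longrightarrow> blockset V \<Longrightarrow> blockset (U - V)"
  unfolding blockset_def using same_sym by blast+

lemma blockset_carrier: "blockset (carrier R)"
  unfolding blockset_def using same_carr by blast

lemma blockset_iff_Union: "blockset W \<longleftrightarrow> (\<exists>T\<subseteq>S. W = \<Union>T)"
proof
  assume W: "blockset W"
  have "W = \<Union>{X\<in>S. X \<subseteq> W}"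
  proof
    show "W \<subseteq> \<Union>{X\<in>S. X \<subseteq> W}"
    proof
      fix x assume x: "x \<in> W"
      then have "x \<in> carrier R" using W by (auto simp: blockset_def)
      then obtain X where "X \<in> S" "x \<in> X" using block_ex by blast
      moreover then have "X \<subseteq> W" using W x unfolding blockset_def same_def by blast
      ultimately show "x \<in> \<Union>{X\<in>S. X \<subseteq> W}" by blast
    qed
  qed blast
  then show "\<exists>T\<subseteq>S. W = \<Union>T" by (metis (no_types, lifting) mem_Collect_eq subsetI)
next
  assume "\<exists>T\<subseteq>S. W = \<Union>T"
  then obtain T where T: "T \<subseteq> S" "W = \<Union>T" by blast
  show "blockset W" unfolding blockset_def
  proof (intro conjI allI impI)
    show "W \<subseteq> carrier R" using T block_sub by blast
    fix x y assume xy: "same x y" "x \<in> W"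
    then obtain X Y where "X \<in> S" "x \<in> X" "y \<in> X" "Y \<in> T" "x \<in> Y"
      using T by (auto simp: same_def)
    moreover then have "X = Y" using T block_unique by blast
    ultimately show "y \<in> W" using T by blast
  qed
qed

lemma blockset_neg_image: "blockset W \<Longrightarrow> blockset ((\<lambda>x. \<ominus> x) ` W)"
proof -
  assume W: "blockset W"
  show ?thesis unfolding blockset_def
  proof (intro conjI allI impI)
    show "(\<lambda>x. \<ominus> x) ` W \<subseteq> carrier R" using W by (auto simp: blockset_def)
    fix x y assume xy: "same x y" "x \<in> (\<lambda>x. \<ominus> x) ` W"
    then obtain w where w: "w \<in> W" "x = \<ominus> w" by blast
    then have wc: "w \<in> carrier R" using W by (auto simp: blockset_def)
    have yc: "y \<in> carrier R" using xy same_carr by blast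
    have "same w (\<ominus> y)" using same_neg[OF xy(1)] w wc by simp
    then have "\<ominus> y \<in> W" using W w unfolding blockset_def by blast
    moreover have "y = \<ominus> (\<ominus> y)" using yc by simp
    ultimately show "y \<in> (\<lambda>x. \<ominus> x) ` W" by blast
  qed
qed

section \<open>Coefficients of products as counting functions\<close>

lemma conv_sum:
  fixes c :: "'a \<Rightarrow> nat"
  assumes "block_const S c" "blockset Z"
  shows "block_const S (\<lambda>x. \<Sum>z\<in>Z. c (x \<ominus> z))"
proof -
  have ZR: "Z \<subseteq> carrier R" using assms(2) by (simp add: blockset_def)
  have 1: "block_const S (\<lambda>y. if y \<in> Z then 1 else 0 :: int)"
    unfolding block_const_iff using assms(2) same_sym unfolding blockset_def by (simp; blast)
  have 2: "block_const S (\<lambda>y. int (c y))" using assms(1) by (simp add: block_const_iff)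
  have "(\<Sum>y\<in>carrier R. (if y \<in> Z then 1 else 0) * int (c (x \<ominus> y))) = int (\<Sum>z\<in>Z. c (x \<ominus> z))" for x
  proof -
    have "(\<Sum>y\<in>carrier R. (if y \<in> Z then 1 else 0) * int (c (x \<ominus> y)))
        = (\<Sum>y\<in>carrier R. if y \<in> Z then int (c (x \<ominus> y)) else 0)"
      by (rule sum.cong) auto
    also have "\<dots> = (\<Sum>y\<in>carrier R \<inter> Z. int (c (x \<ominus> y)))"
      using finR by (simp add: sum.inter_restrict)
    also have "carrier R \<inter> Z = Z" using ZR by blast
    finally show ?thesis by simp
  qed
  then have "block_const S (\<lambda>x. int (\<Sum>z\<in>Z. c (x \<ominus> z)))" using conv[OF 1 2] by simp
  then show ?thesis unfolding block_const_iff by (metis of_nat_eq_iff)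
qed

lemma conv_card:
  assumes "blockset U" "blockset V"
  shows "block_const S (\<lambda>x. card {y\<in>U. x \<ominus> y \<in> V})"
proof -
  have "block_const S (\<lambda>y. if y \<in> V then 1 else 0 :: nat)"
    unfolding block_const_iff using assms(2) same_sym unfolding blockset_def by (simp; blast)
  from conv_sum[OF this assms(1)]
  have "block_const S (\<lambda>x. \<Sum>y\<in>U. if x \<ominus> y \<in> V then 1 else 0 :: nat)" .
  moreover have "(\<Sum>y\<in>U. if x \<ominus> y \<in> V then 1 else 0 :: nat) = card {y\<in>U. x \<ominus> y \<in> V}" for x
  proof -
    have "finite U" using assms(1) finR finite_subset by (auto simp: blockset_def)
    then show ?thesis by (simp add: sum.If_cases Int_def)
  qed
  ultimately show ?thesis by simp
qed

text \<open>The number is the coefficient of \<open>g\<close> in the product of the sums over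
  \<open>-W\<close> and over \<open>W\<close>.\<close>

lemma shift_card:
  assumes "blockset W"
  shows "block_const S (\<lambda>g. card {z\<in>W. z \<oplus> g \<in> W})"
  unfolding block_const_iff
proof (intro allI impI)
  fix x y assume xy: "same x y"
  have WR: "W \<subseteq> carrier R" using assms by (simp add: blockset_def)
  have eq: "card {z\<in>W. z \<oplus> g \<in> W} = card {y\<in>(\<lambda>x. \<ominus> x) ` W. g \<ominus> y \<in> W}" if g: "g \<in> carrier R" for g
  proof -
    have "{y\<in>(\<lambda>x. \<ominus> x) ` W. g \<ominus> y \<in> W} = (\<lambda>x. \<ominus> x) ` {z\<in>W. z \<oplus> g \<in> W}"
      using WR g by (auto simp: minus_eq a_comm subset_iff)
    moreover have "inj_on (\<lambda>x. \<ominus> x) {z\<in>W. z \<oplus> g \<in> W}"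
    proof (rule inj_onI)
      fix a b assume "a \<in> {z \<in> W. z \<oplus> g \<in> W}" "b \<in> {z \<in> W. z \<oplus> g \<in> W}" "\<ominus> a = \<ominus> b"
      then show "a = b" using WR by (metis (no_types, lifting) mem_Collect_eq minus_minus subset_iff)
    qed
    ultimately show ?thesis by (simp add: card_image)
  qed
  show "card {z\<in>W. z \<oplus> x \<in> W} = card {z\<in>W. z \<oplus> y \<in> W}"
    using conv_card[OF blockset_neg_image[OF assms] assms] xy same_carr[OF xy] eq
    by (simp add: block_const_iff)
qed

text \<open>The elements of \<open>stab W\<close> are those where the coefficient of
  \<open>shift_card\<close> attains its maximal value \<open>card W\<close>, and a level set of a
  block-constant function is a union of blocks.\<close>

lemma stab_blockset: assumes "blockset W" shows "blockset (stab W)"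
proof -
  have WR: "W \<subseteq> carrier R" using assms by (simp add: blockset_def)
  then have finW: "finite W" using finR finite_subset by blast
  have *: "g \<in> stab W \<longleftrightarrow> g \<in> carrier R \<and> card {z\<in>W. z \<oplus> g \<in> W} = card W" for g
  proof -
    have "(card {z\<in>W. z \<oplus> g \<in> W} = card W) \<longleftrightarrow> {z\<in>W. z \<oplus> g \<in> W} = W"
      using card_subset_eq[OF finW, of "{z\<in>W. z \<oplus> g \<in> W}"] by auto
    then show ?thesis by (auto simp: stab_def)
  qed
  show ?thesis unfolding blockset_def
    using shift_card[OF assms] same_carr unfolding block_const_iff
    by (metis (no_types, lifting) * subsetI)
qed

lemma stab_zero: "W \<subseteq> carrier R \<Longrightarrow> \<zero> \<in> stab W"
  by (auto simp: stab_def subset_iff)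

lemma stab_add: "W \<subseteq> carrier R \<Longrightarrow> a \<in> stab W \<Longrightarrow> b \<in> stab W \<Longrightarrow> a \<oplus> b \<in> stab W"
  unfolding stab_def by (auto simp: a_assoc[symmetric] subset_iff)

lemma stab_carr: "stab W \<subseteq> carrier R"
  by (auto simp: stab_def)

lemma stab_unit: assumes "rational W" "g \<in> stab W" "u \<in> Units R" shows "u \<otimes> g \<in> stab W"
proof -
  have WR: "W \<subseteq> carrier R" and uW: "\<And>u w. u \<in> Units R \<Longrightarrow> w \<in> W \<Longrightarrow> u \<otimes> w \<in> W"
    using assms(1) by (auto simp: rational_def blockset_def)
  have g: "g \<in> carrier R" using assms by (simp add: stab_def)
  have uc: "u \<in> carrier R" "inv u \<in> carrier R" using assms(3) by auto
  have "z \<oplus> u \<otimes> g \<in> W" if z: "z \<in> W" for z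
  proof -
    have zc: "z \<in> carrier R" using z WR by blast
    have "inv u \<otimes> z \<in> W" using uW[of "inv u" z] assms z by simp
    then have "inv u \<otimes> z \<oplus> g \<in> W" using assms(2) by (simp add: stab_def)
    then have "u \<otimes> (inv u \<otimes> z \<oplus> g) \<in> W" using uW assms by blast
    moreover have "u \<otimes> (inv u \<otimes> z \<oplus> g) = z \<oplus> u \<otimes> g"
      using assms(3) uc zc g by (simp add: r_distr m_assoc[symmetric])
    ultimately show ?thesis by simp
  qed
  then show ?thesis using uc g by (simp add: stab_def)
qed

lemma rsame_refl: "x \<in> carrier R \<Longrightarrow> rsame x x"
  unfolding rsame_def using same_refl by (intro bexI[of _ \<one>]) auto

lemma same_rsame: "same x y \<Longrightarrow> rsame x y"
  unfolding rsame_def using same_carr[of x y] by (intro bexI[of _ \<one>]) auto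

lemma unit_rsame: "x \<in> carrier R \<Longrightarrow> u \<in> Units R \<Longrightarrow> rsame x (u \<otimes> x)"
  unfolding rsame_def using same_refl by (intro bexI[of _ u]) auto

lemma rsame_carr:
  assumes "rsame x y" "x \<in> carrier R" shows "y \<in> carrier R"
  using assms same_carr by (auto simp: rsame_def)

lemma rsame_trans:
  assumes "rsame x y" "rsame y z" "x \<in> carrier R" shows "rsame x z"
proof -
  obtain u v where u: "u \<in> Units R" "same (u \<otimes> x) y" and v: "v \<in> Units R" "same (v \<otimes> y) z"
    using assms by (auto simp: rsame_def)
  have "same (v \<otimes> (u \<otimes> x)) z" using same_trans[OF same_unit[OF v(1) u(2)] v(2)] .
  moreover have "v \<otimes> (u \<otimes> x) = (v \<otimes> u) \<otimes> x" using u v assms by (simp add: m_assoc Units_closed)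
  ultimately show ?thesis unfolding rsame_def using u v by (metis Units_m_closed)
qed

lemma rsame_sym:
  assumes "rsame x y" "x \<in> carrier R" shows "rsame y x"
proof -
  obtain u where u: "u \<in> Units R" "same (u \<otimes> x) y" using assms by (auto simp: rsame_def)
  have "same (inv u \<otimes> y) (inv u \<otimes> (u \<otimes> x))" using same_unit[of "inv u"] u same_sym by simp
  moreover have "inv u \<otimes> (u \<otimes> x) = x" using u assms
    by (simp add: m_assoc[symmetric] Units_closed)
  ultimately show ?thesis unfolding rsame_def using u by (metis Units_inv_Units)
qed

lemma rational_rsame: assumes "rational W" "w \<in> W" "rsame w x" shows "x \<in> W"
  using assms unfolding rational_def rsame_def blockset_def by blast

definition rclass :: "'a \<Rightarrow> 'a set" where
  "rclass w = {x. rsame w x}"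

lemma rational_rclass: assumes "w \<in> carrier R" shows "rational (rclass w)"
  unfolding rational_def blockset_def rclass_def
  using assms rsame_carr[OF _ assms] rsame_trans[OF _ _ assms] same_rsame unit_rsame by blast

lemma rclass_self: "w \<in> carrier R \<Longrightarrow> w \<in> rclass w"
  by (simp add: rclass_def rsame_refl)

lemma rclass_carr: "w \<in> carrier R \<Longrightarrow> rclass w \<subseteq> carrier R"
  using rsame_carr by (auto simp: rclass_def)

lemma rational_finite: "rational W \<Longrightarrow> finite W"
  using finR finite_subset by (auto simp: rational_def blockset_def)

lemma block_ideal_zero: "block_ideal I \<Longrightarrow> \<zero> \<in> I"
  and block_ideal_add: "block_ideal I \<Longrightarrow> a \<in> I \<Longrightarrow> b \<in> I \<Longrightarrow> a \<oplus> b \<in> I"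
  and block_ideal_neg: "block_ideal I \<Longrightarrow> a \<in> I \<Longrightarrow> \<ominus> a \<in> I"
  and block_ideal_minus: "block_ideal I \<Longrightarrow> a \<in> I \<Longrightarrow> b \<in> I \<Longrightarrow> a \<ominus> b \<in> I"
  and block_ideal_mult: "block_ideal I \<Longrightarrow> a \<in> I \<Longrightarrow> r \<in> carrier R \<Longrightarrow> r \<otimes> a \<in> I"
  and block_ideal_sub: "block_ideal I \<Longrightarrow> I \<subseteq> carrier R"
  unfolding block_ideal_def
  using additive_subgroup.zero_closed additive_subgroup.a_closed additive_subgroup.a_inv_closed
    ideal.axioms(1) ideal.I_l_closed additive_subgroup.a_subset
  by (fastforce simp: a_minus_def)+

lemma block_ideal_same: "block_ideal I \<Longrightarrow> same x y \<Longrightarrow> x \<in> I \<longleftrightarrow> y \<in> I"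
  unfolding block_ideal_def blockset_def using same_sym by blast

lemma block_ideal_Inter:
  assumes "\<And>I. I \<in> F \<Longrightarrow> block_ideal I" "F \<noteq> {}" shows "block_ideal (\<Inter>F)"
  unfolding block_ideal_def
proof
  show "ideal (\<Inter>F) R" using assms by (intro i_Intersect) (auto simp: block_ideal_def)
  show "blockset (\<Inter>F)" using assms unfolding blockset_def block_ideal_def by blast
qed

lemma block_ideal_carrier: "block_ideal (carrier R)"
  by (simp add: block_ideal_def oneideal blockset_carrier)

definition gen :: "'a set \<Rightarrow> 'a set" where
  "gen D = \<Inter>{L. block_ideal L \<and> D \<subseteq> L}"

lemma gen_block_ideal: assumes "D \<subseteq> carrier R" shows "block_ideal (gen D)"
  unfolding gen_def by (rule block_ideal_Inter) (use assms block_ideal_carrier in auto)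

lemma gen_sub: "D \<subseteq> gen D"
  by (auto simp: gen_def)

lemma gen_least: "block_ideal L \<Longrightarrow> D \<subseteq> L \<Longrightarrow> gen D \<subseteq> L"
  by (auto simp: gen_def)

text \<open>The sum of two block ideals is the support of the product of their indicator functions,
  so membership can be read off a block-constant count.\<close>

lemma block_ideal_sum:
  assumes "block_ideal I" "block_ideal J" shows "block_ideal (I <+>\<^bsub>R\<^esub> J)"
  unfolding block_ideal_def
proof
  show "ideal (I <+>\<^bsub>R\<^esub> J) R" using assms by (intro add_ideals) (auto simp: block_ideal_def)
  have mem: "x \<in> I <+>\<^bsub>R\<^esub> J \<longleftrightarrow> x \<in> carrier R \<and> card {y\<in>I. x \<ominus> y \<in> J} \<noteq> 0" for x
  proof
    assume "x \<in> I <+>\<^bsub>R\<^esub> J"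
    then obtain a b where ab: "a \<in> I" "b \<in> J" "x = a \<oplus> b" by (auto simp: set_add_def')
    then have c: "a \<in> carrier R" "b \<in> carrier R" using assms block_ideal_sub by blast+
    have "x \<ominus> a = b" using c ab by (simp add: minus_eq a_comm[of a b] a_assoc r_neg)
    then have "a \<in> {y\<in>I. x \<ominus> y \<in> J}" using ab by simp
    moreover have "finite {y\<in>I. x \<ominus> y \<in> J}" using block_ideal_sub[OF assms(1)] finR
      by (metis (no_types, lifting) finite_subset mem_Collect_eq subset_iff)
    ultimately show "x \<in> carrier R \<and> card {y\<in>I. x \<ominus> y \<in> J} \<noteq> 0" using c ab
      by (metis a_closed card_0_eq empty_iff)
  next
    assume x: "x \<in> carrier R \<and> card {y\<in>I. x \<ominus> y \<in> J} \<noteq> 0"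
    then have "{y\<in>I. x \<ominus> y \<in> J} \<noteq> {}" by (metis card.empty)
    then obtain y where y: "y \<in> I" "x \<ominus> y \<in> J" by blast
    then have "y \<in> carrier R" using block_ideal_sub assms by blast
    then have "x = y \<oplus> (x \<ominus> y)" using x by (simp add: minus_eq a_lcomm[of y] r_neg)
    then show "x \<in> I <+>\<^bsub>R\<^esub> J" using y by (auto simp: set_add_def')
  qed
  show "blockset (I <+>\<^bsub>R\<^esub> J)"
    unfolding blockset_def
  proof (intro conjI allI impI)
    show "I <+>\<^bsub>R\<^esub> J \<subseteq> carrier R" using mem by blast
    fix x y assume xy: "same x y" "x \<in> I <+>\<^bsub>R\<^esub> J"
    have "card {z\<in>I. x \<ominus> z \<in> J} = card {z\<in>I. y \<ominus> z \<in> J}"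
      using conv_card[of I J] assms xy(1) by (simp add: block_const_iff block_ideal_def)
    then show "y \<in> I <+>\<^bsub>R\<^esub> J" using xy mem same_carr[OF xy(1)] by simp
  qed
qed

definition agree :: "'a set \<Rightarrow> 'a \<Rightarrow> nat" where
  "agree W g = card {w\<in>W. same w (w \<oplus> g)}"

text \<open>The basic sets inside \<open>W\<close> contribute separately, and the contribution of
  \<open>X\<close> is the coefficient of \<open>g\<close> in the product of \<open>-X\<close> and
  \<open>X\<close>.\<close>

lemma agree_same:
  assumes "blockset W" "same g h" shows "agree W g = agree W h"
proof -
  have WR: "W \<subseteq> carrier R" using assms by (simp add: blockset_def)
  have "agree W g = (\<Sum>X\<in>{X\<in>S. X \<subseteq> W}. card {z\<in>X. z \<oplus> g \<in> X})" for g
  proof -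
    have "{w\<in>W. same w (w \<oplus> g)} = (\<Union>X\<in>{X\<in>S. X \<subseteq> W}. {z\<in>X. z \<oplus> g \<in> X})"
    proof (intro equalityI subsetI)
      fix w assume w: "w \<in> {w\<in>W. same w (w \<oplus> g)}"
      then obtain X where X: "X \<in> S" "w \<in> X" "w \<oplus> g \<in> X" by (auto simp: same_def)
      moreover have "X \<subseteq> W" using assms(1) w X unfolding blockset_def same_def by blast
      ultimately show "w \<in> (\<Union>X\<in>{X\<in>S. X \<subseteq> W}. {z\<in>X. z \<oplus> g \<in> X})" by blast
    qed (auto simp: same_def)
    moreover have "card (\<Union>X\<in>{X\<in>S. X \<subseteq> W}. {z\<in>X. z \<oplus> g \<in> X})
      = (\<Sum>X\<in>{X\<in>S. X \<subseteq> W}. card {z\<in>X. z \<oplus> g \<in> X})"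
    proof (rule card_UN_disjoint)
      show "finite {X \<in> S. X \<subseteq> W}" using finS by simp
      show "\<forall>X\<in>{X \<in> S. X \<subseteq> W}. finite {z \<in> X. z \<oplus> g \<in> X}"
        using block_finite by auto
      show "\<forall>i\<in>{X \<in> S. X \<subseteq> W}. \<forall>j\<in>{X \<in> S. X \<subseteq> W}. i \<noteq> j \<longrightarrow>
        {z \<in> i. z \<oplus> g \<in> i} \<inter> {z \<in> j. z \<oplus> g \<in> j} = {}"
        using block_unique by blast
    qed
    ultimately show ?thesis by (simp add: agree_def)
  qed
  moreover have "card {z\<in>X. z \<oplus> g \<in> X} = card {z\<in>X. z \<oplus> h \<in> X}" if "X \<in> S" for X
    using shift_card[OF block_is_blockset[OF that]] assms(2) by (simp add: block_const_iff)
  ultimately show ?thesis by simp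
qed

text \<open>Multiplication by a unit permutes \<open>W\<close> and maps basic sets to basic sets, so
  it turns translation by \<open>g\<close> into translation by \<open>u \<otimes> g\<close>.\<close>

lemma agree_rsame:
  assumes W: "rational W" and g: "g \<in> carrier R" and gh: "rsame g h"
  shows "agree W g = agree W h"
proof -
  obtain u where u: "u \<in> Units R" "same (u \<otimes> g) h" using gh by (auto simp: rsame_def)
  have uc: "u \<in> carrier R" "inv u \<in> carrier R" using u by auto
  have WR: "W \<subseteq> carrier R" and sW: "blockset W" and uW: "\<And>u w. u \<in> Units R \<Longrightarrow> w \<in> W \<Longrightarrow> u \<otimes> w \<in> W"
    using W by (auto simp: rational_def blockset_def)
  have "bij_betw (\<lambda>w. u \<otimes> w) {w\<in>W. same w (w \<oplus> g)} {w\<in>W. same w (w \<oplus> u \<otimes> g)}"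
  proof (rule bij_betw_byWitness[where f' = "\<lambda>w. inv u \<otimes> w"])
    show "\<forall>a\<in>{w \<in> W. same w (w \<oplus> g)}. inv u \<otimes> (u \<otimes> a) = a"
      using WR u uc by (auto simp: m_assoc[symmetric])
    show "\<forall>a\<in>{w \<in> W. same w (w \<oplus> u \<otimes> g)}. u \<otimes> (inv u \<otimes> a) = a"
      using WR u uc by (auto simp: m_assoc[symmetric])
    show "(\<lambda>w. u \<otimes> w) ` {w \<in> W. same w (w \<oplus> g)} \<subseteq> {w \<in> W. same w (w \<oplus> u \<otimes> g)}"
    proof (clarify, intro conjI)
      fix w assume w: "w \<in> W" "same w (w \<oplus> g)"
      then show "u \<otimes> w \<in> W" using uW u by blast
      show "same (u \<otimes> w) (u \<otimes> w \<oplus> u \<otimes> g)" using same_unit[OF u(1) w(2)] WR w g uc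
        by (simp add: r_distr subset_iff)
    qed
    show "(\<lambda>w. inv u \<otimes> w) ` {w \<in> W. same w (w \<oplus> u \<otimes> g)} \<subseteq> {w \<in> W. same w (w \<oplus> g)}"
    proof (clarify, intro conjI)
      fix w assume w: "w \<in> W" "same w (w \<oplus> u \<otimes> g)"
      then show "inv u \<otimes> w \<in> W" using uW[of "inv u"] u by simp
      show "same (inv u \<otimes> w) (inv u \<otimes> w \<oplus> g)" using same_unit[of "inv u", OF _ w(2)] WR w g uc u
        by (simp add: r_distr subset_iff m_assoc[symmetric])
    qed
  qed
  then have "agree W g = agree W (u \<otimes> g)" unfolding agree_def by (rule bij_betw_same_card)
  also have "\<dots> = agree W h" by (rule agree_same[OF sW u(2)])
  finally show ?thesis .
qed

section \<open>Counting along the cosets of a block ideal\<close>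

definition coset_count :: "'a set \<Rightarrow> 'a \<Rightarrow> nat" where
  "coset_count J w = card {x. same w x \<and> x \<ominus> w \<in> J}"

lemma block_ideal_minus_comm:
  assumes "block_ideal J" "x \<in> carrier R" "y \<in> carrier R" shows "x \<ominus> y \<in> J \<longleftrightarrow> y \<ominus> x \<in> J"
  using block_ideal_neg[OF assms(1), of "x \<ominus> y"] block_ideal_neg[OF assms(1), of "y \<ominus> x"] assms
  by (auto simp: minus_eq minus_add a_comm)

text \<open>If \<open>X\<close> is the basic set of \<open>w\<close>, the count is the size of the
  intersection of \<open>X\<close> with \<open>w + J\<close>, that is the coefficient of
  \<open>w\<close> in the product of \<open>X\<close> and \<open>J\<close>.\<close>

lemma coset_count_same:
  assumes J: "block_ideal J" and ww: "same w w'" shows "coset_count J w = coset_count J w'"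
proof -
  obtain X where X: "X \<in> S" "w \<in> X" "w' \<in> X" using ww by (auto simp: same_def)
  have *: "coset_count J v = card {y\<in>X. v \<ominus> y \<in> J}" if v: "v \<in> X" for v
  proof -
    have "{x. same v x \<and> x \<ominus> v \<in> J} = {y\<in>X. v \<ominus> y \<in> J}"
      using same_in_block[OF X(1) v] block_ideal_minus_comm[OF J] block_sub[OF X(1)] v
      by (auto simp: subset_iff)
    then show ?thesis by (simp add: coset_count_def)
  qed
  have "card {y\<in>X. w \<ominus> y \<in> J} = card {y\<in>X. w' \<ominus> y \<in> J}"
    using conv_card[OF block_is_blockset[OF X(1)], of J] J ww
      by (auto simp: block_const_iff block_ideal_def)
  then show ?thesis using * X by simp
qed

lemma coset_count_rsame:
  assumes J: "block_ideal J" and w: "w \<in> carrier R" and ww: "rsame w w'"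
  shows "coset_count J w = coset_count J w'"
proof -
  obtain u where u: "u \<in> Units R" "same (u \<otimes> w) w'" using ww by (auto simp: rsame_def)
  have uc: "u \<in> carrier R" "inv u \<in> carrier R" using u by auto
  have inv_eq: "inv u \<otimes> (u \<otimes> a) = a" "u \<otimes> (inv u \<otimes> a) = a" if "a \<in> carrier R" for a
    using that u uc by (auto simp: m_assoc[symmetric])
  have "bij_betw (\<lambda>w. u \<otimes> w) {x. same w x \<and> x \<ominus> w \<in> J} {x. same (u \<otimes> w) x \<and> x \<ominus> u \<otimes> w \<in> J}"
  proof (rule bij_betw_byWitness[where f' = "\<lambda>w. inv u \<otimes> w"])
    show "\<forall>a\<in>{x. same w x \<and> x \<ominus> w \<in> J}. inv u \<otimes> (u \<otimes> a) = a"
      using inv_eq same_carr by blast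
    show "\<forall>a\<in>{x. same (u \<otimes> w) x \<and> x \<ominus> u \<otimes> w \<in> J}. u \<otimes> (inv u \<otimes> a) = a"
      using inv_eq same_carr by blast
    show "(\<lambda>w. u \<otimes> w) ` {x. same w x \<and> x \<ominus> w \<in> J} \<subseteq> {x. same (u \<otimes> w) x \<and> x \<ominus> u \<otimes> w \<in> J}"
    proof (clarify, intro conjI)
      fix x assume x: "same w x" "x \<ominus> w \<in> J"
      show "same (u \<otimes> w) (u \<otimes> x)" using same_unit[OF u(1) x(1)] .
      have "u \<otimes> (x \<ominus> w) \<in> J" using block_ideal_mult[OF J x(2) uc(1)] .
      then show "u \<otimes> x \<ominus> u \<otimes> w \<in> J" using same_carr[OF x(1)] uc by (simp add: minus_eq r_distr r_minus)
    qed
    show "(\<lambda>w. inv u \<otimes> w) ` {x. same (u \<otimes> w) x \<and> x \<ominus> u \<otimes> w \<in> J} \<subseteq> {x. same w x \<and> x \<ominus> w \<in> J}"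
    proof (clarify, intro conjI)
      fix x assume x: "same (u \<otimes> w) x" "x \<ominus> u \<otimes> w \<in> J"
      have xc: "x \<in> carrier R" using same_carr x by blast
      show "same w (inv u \<otimes> x)" using same_unit[of "inv u", OF _ x(1)] u inv_eq w by simp
      have "inv u \<otimes> (x \<ominus> u \<otimes> w) \<in> J" using block_ideal_mult[OF J x(2) uc(2)] .
      moreover have "inv u \<otimes> (x \<ominus> u \<otimes> w) = inv u \<otimes> x \<ominus> w"
        using xc uc w inv_eq[OF w] by (simp add: minus_eq r_distr r_minus)
      ultimately show "inv u \<otimes> x \<ominus> w \<in> J" by simp
    qed
  qed
  then have "coset_count J w = coset_count J (u \<otimes> w)"
    unfolding coset_count_def by (rule bij_betw_same_card)
  then show ?thesis using coset_count_same[OF J u(2)] by simp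
qed

lemma coset_count_shift:
  assumes J: "block_ideal J" and w: "w \<in> carrier R"
  shows "coset_count J w = card {j\<in>J. same w (w \<oplus> j)}"
proof -
  have Jc: "\<And>j. j \<in> J \<Longrightarrow> j \<in> carrier R" using block_ideal_sub[OF J] by blast
  have "bij_betw (\<lambda>j. w \<oplus> j) {j\<in>J. same w (w \<oplus> j)} {x. same w x \<and> x \<ominus> w \<in> J}"
  proof (rule bij_betw_byWitness[where f' = "\<lambda>x. x \<ominus> w"])
    show "\<forall>a\<in>{j \<in> J. same w (w \<oplus> j)}. w \<oplus> a \<ominus> w = a"
      using Jc w by (auto simp: minus_eq a_comm[of w] a_assoc r_neg)
    have *: "w \<oplus> (a \<ominus> w) = a" if "a \<in> carrier R" for a
      using that w by (simp add: minus_eq a_lcomm[of w] r_neg)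
    show "\<forall>a\<in>{x. same w x \<and> x \<ominus> w \<in> J}. w \<oplus> (a \<ominus> w) = a" using * same_carr by blast
    show "(\<lambda>j. w \<oplus> j) ` {j \<in> J. same w (w \<oplus> j)} \<subseteq> {x. same w x \<and> x \<ominus> w \<in> J}"
      using Jc w by (auto simp: minus_eq a_comm[of w] a_assoc r_neg)
    show "(\<lambda>x. x \<ominus> w) ` {x. same w x \<and> x \<ominus> w \<in> J} \<subseteq> {j \<in> J. same w (w \<oplus> j)}"
      using * same_carr by auto
  qed
  then show ?thesis unfolding coset_count_def by (rule bij_betw_same_card[symmetric])
qed

definition block_count :: "'a set \<Rightarrow> 'a set \<Rightarrow> 'a \<Rightarrow> nat" where
  "block_count W J w = card {X\<in>S. \<exists>x\<in>X. x \<in> W \<and> x \<ominus> w \<in> J}"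

text \<open>By \<open>coset_count_rsame\<close>, all basic sets of the class that meet the coset
  \<open>w + J\<close> meet it in the same number of points.\<close>

lemma block_count_coset_count:
  assumes J: "block_ideal J" and w0: "w0 \<in> carrier R" and w: "w \<in> rclass w0"
  shows "block_count (rclass w0) J w * coset_count J w = card {x\<in>rclass w0. x \<ominus> w \<in> J}"
proof -
  let ?W = "rclass w0"
  let ?B = "{X\<in>S. \<exists>x\<in>X. x \<in> ?W \<and> x \<ominus> w \<in> J}"
  have sW: "blockset ?W" and WR: "?W \<subseteq> carrier R"
    using rational_rclass[OF w0] by (auto simp: rational_def blockset_def)
  have wR: "w \<in> carrier R" using w WR by blast
  have XW: "X \<subseteq> ?W" if "X \<in> ?B" for X using that sW unfolding blockset_def same_def by blast
  have "{x\<in>?W. x \<ominus> w \<in> J} = (\<Union>X\<in>?B. {x\<in>X. x \<ominus> w \<in> J})"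
  proof (intro equalityI subsetI)
    fix x assume x: "x \<in> {x\<in>?W. x \<ominus> w \<in> J}"
    then obtain X where "X \<in> S" "x \<in> X" using block_ex WR by blast
    then show "x \<in> (\<Union>X\<in>?B. {x\<in>X. x \<ominus> w \<in> J})" using x by blast
  qed (use XW in blast)
  moreover have "card (\<Union>X\<in>?B. {x\<in>X. x \<ominus> w \<in> J}) = (\<Sum>X\<in>?B. card {x\<in>X. x \<ominus> w \<in> J})"
  proof (rule card_UN_disjoint)
    show "finite ?B" using finS by simp
    show "\<forall>X\<in>?B. finite {x \<in> X. x \<ominus> w \<in> J}"
      using block_finite by auto
    show "\<forall>i\<in>?B. \<forall>j\<in>?B. i \<noteq> j \<longrightarrow> {x \<in> i. x \<ominus> w \<in> J} \<inter> {x \<in> j. x \<ominus> w \<in> J} = {}"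
      using block_unique by blast
  qed
  moreover have "card {x\<in>X. x \<ominus> w \<in> J} = coset_count J w" if X: "X \<in> ?B" for X
  proof -
    obtain x0 where x0: "x0 \<in> X" "x0 \<in> ?W" "x0 \<ominus> w \<in> J" using X by blast
    have x0R: "x0 \<in> carrier R" using x0 WR by blast
    have "{x. same x0 x \<and> x \<ominus> x0 \<in> J} = {x\<in>X. x \<ominus> w \<in> J}"
    proof -
      have "x \<ominus> x0 \<in> J \<longleftrightarrow> x \<ominus> w \<in> J" if x: "x \<in> X" for x
      proof -
        have xR: "x \<in> carrier R" using x X XW WR by blast
        have 1: "x \<ominus> w = (x \<ominus> x0) \<oplus> (x0 \<ominus> w)"
          using xR x0R wR by (simp add: minus_eq a_assoc) (simp add: a_assoc[symmetric] l_neg)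
        have 2: "x \<ominus> x0 = (x \<ominus> w) \<ominus> (x0 \<ominus> w)"
          using xR x0R wR by (simp add: minus_eq minus_add a_ac r_neg1 r_neg2 l_neg r_neg)
        show ?thesis using 1 2 x0(3) block_ideal_add[OF J] block_ideal_minus[OF J] by metis
      qed
      then show ?thesis using same_in_block[OF _ x0(1)] X by blast
    qed
    then have "card {x\<in>X. x \<ominus> w \<in> J} = coset_count J x0" by (simp add: coset_count_def)
    also have "\<dots> = coset_count J w"
    proof -
      have "rsame x0 w0" using x0(2) w0 rsame_sym by (simp add: rclass_def)
      then have "rsame x0 w" using w x0R rsame_trans by (auto simp: rclass_def)
      then show ?thesis using coset_count_rsame[OF J x0R] by simp
    qed
    finally show ?thesis .
  qed
  ultimately show ?thesis by (simp add: block_count_def)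
qed

text \<open>Averaging \<open>agree\<close> over \<open>J - J0\<close>: if \<open>k\<close> basic sets of the class meet a coset of \<open>J\<close>, then at most a
  \<open>k\<close>-th of the class stays in its basic set under translation by \<open>h\<close>.\<close>

lemma block_count_agree:
  assumes J: "block_ideal J" and J0: "block_ideal J0" and J0J: "J0 \<subseteq> J"
    and w0: "w0 \<in> carrier R" and w: "w \<in> rclass w0" and J0st: "J0 \<subseteq> stab (rclass w0)"
    and h: "h \<in> J - J0" and cst: "\<And>g. g \<in> J - J0 \<Longrightarrow> rsame h g"
  shows "block_count (rclass w0) J w * agree (rclass w0) h \<le> card (rclass w0)"
proof -
  let ?W = "rclass w0"
  let ?k = "block_count ?W J w" and ?kz = "block_count ?W J0 w"
  let ?c = "coset_count J w0" and ?cz = "coset_count J0 w0"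
  have rW: "rational ?W" and WR: "?W \<subseteq> carrier R"
    using rational_rclass[OF w0] by (auto simp: rational_def blockset_def)
  have finW: "finite ?W" using rational_finite[OF rW] .
  have JR: "J \<subseteq> carrier R" using block_ideal_sub[OF J] .
  have finJ: "finite J" using JR finR finite_subset by blast
  have finJ0: "finite J0" using J0J finJ finite_subset by blast
  have hR: "h \<in> carrier R" using h JR by blast
  have wR: "w \<in> carrier R" using w WR by blast
  have cw: "coset_count L x = coset_count L w0" if "block_ideal L" "x \<in> ?W" for L x
    using coset_count_rsame[OF that(1) w0, of x] that(2) by (simp add: rclass_def)
  have kc: "?k * ?c \<le> card J"
  proof -
    have "?k * ?c = card {x\<in>?W. x \<ominus> w \<in> J}" using block_count_coset_count[OF J w0 w] cw[OF J w] by simp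
    also have "\<dots> \<le> card J"
    proof (rule card_inj_on_le[where f = "\<lambda>x. x \<ominus> w"])
      show "inj_on (\<lambda>x. x \<ominus> w) {x \<in> ?W. x \<ominus> w \<in> J}"
        using WR wR by (auto simp: inj_on_def minus_eq subset_iff)
    qed (use finJ in auto)
    finally show ?thesis .
  qed
  \<comment> \<open>As \<open>J0\<close> stabilizes the class, the whole coset \<open>w + J0\<close>
    belongs to it; so equality holds here, whereas \<open>kc\<close> is only a bound.\<close>
  have kc0: "?kz * ?cz = card J0"
  proof -
    have "?kz * ?cz = card {x\<in>?W. x \<ominus> w \<in> J0}"
      using block_count_coset_count[OF J0 w0 w] cw[OF J0 w] by simp
    also have "{x\<in>?W. x \<ominus> w \<in> J0} = (\<lambda>j. w \<oplus> j) ` J0"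
    proof (intro equalityI subsetI)
      fix x assume x: "x \<in> {x\<in>?W. x \<ominus> w \<in> J0}"
      then have "x \<in> carrier R" using WR by blast
      then have "x = w \<oplus> (x \<ominus> w)" using wR by (simp add: minus_eq a_lcomm[of w] r_neg)
      then show "x \<in> (\<lambda>j. w \<oplus> j) ` J0" using x by blast
    next
      fix x assume "x \<in> (\<lambda>j. w \<oplus> j) ` J0"
      then obtain j where j: "j \<in> J0" "x = w \<oplus> j" by blast
      then have "j \<in> carrier R" using J0J JR by blast
      then have "x \<ominus> w = j" using j wR by (simp add: minus_eq a_comm[of w] a_assoc r_neg)
      moreover have "x \<in> ?W" using j w J0st by (auto simp: stab_def)
      ultimately show "x \<in> {x\<in>?W. x \<ominus> w \<in> J0}" using j by simp
    qed
    also have "card ((\<lambda>j. w \<oplus> j) ` J0) = card J0"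
      using J0J JR wR by (intro card_image) (auto simp: inj_on_def subset_iff)
    finally show ?thesis .
  qed
  \<comment> \<open>A basic set meeting the coset of \<open>J0\<close> meets the larger coset of
    \<open>J\<close>. Together with \<open>kc\<close> and \<open>kc0\<close> this bounds
    \<open>?k * (?c - ?cz)\<close> by \<open>card J - card J0\<close>.\<close>
  have kk: "?kz \<le> ?k" unfolding block_count_def using J0J finS by (intro card_mono) auto
  \<comment> \<open>Double count of the pairs \<open>(x, j)\<close> with \<open>x\<close> in the
    class, \<open>j \<in> J - J0\<close> and \<open>x\<close>, \<open>x \<oplus> j\<close> in one
    basic set; \<open>agree\<close> is constant on \<open>J - J0\<close> by the assumption
    \<open>cst\<close>.\<close>
  have sum: "card (J - J0) * agree ?W h = card ?W * (?c - ?cz)"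
  proof -
    have "card (J - J0) * agree ?W h = (\<Sum>j\<in>J - J0. agree ?W j)"
    proof -
      have "(\<Sum>j\<in>J - J0. agree ?W j) = (\<Sum>j\<in>J - J0. agree ?W h)"
        by (rule sum.cong) (simp_all add: agree_rsame[OF rW hR cst])
      then show ?thesis by simp
    qed
    also have "\<dots> = (\<Sum>j\<in>J - J0. \<Sum>x\<in>?W. if same x (x \<oplus> j) then 1 else 0)"
      using finW by (simp add: agree_def sum.If_cases Int_def)
    also have "\<dots> = (\<Sum>x\<in>?W. \<Sum>j\<in>J - J0. if same x (x \<oplus> j) then 1 else 0)"
      by (rule sum.swap)
    also have "\<dots> = (\<Sum>x\<in>?W. ?c - ?cz)"
    proof (rule sum.cong)
      fix x assume x: "x \<in> ?W"
      have xR: "x \<in> carrier R" using x WR by blast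
      have "(\<Sum>j\<in>J - J0. if same x (x \<oplus> j) then 1 else 0) = card {j\<in>J - J0. same x (x \<oplus> j)}"
        using finJ by (simp add: sum.If_cases Int_def)
      also have "{j\<in>J - J0. same x (x \<oplus> j)} = {j\<in>J. same x (x \<oplus> j)} - {j\<in>J0. same x (x \<oplus> j)}"
        by blast
      also have "card \<dots> = card {j\<in>J. same x (x \<oplus> j)} - card {j\<in>J0. same x (x \<oplus> j)}"
        using J0J finJ0 by (intro card_Diff_subset) auto
      also have "\<dots> = ?c - ?cz"
        using coset_count_shift[OF J xR] coset_count_shift[OF J0 xR] cw[OF J x] cw[OF J0 x] by simp
      finally show "(\<Sum>j\<in>J - J0. if same x (x \<oplus> j) then 1 else 0) = ?c - ?cz" .
    qed simp
    finally show ?thesis by simp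
  qed
  have "card (J - J0) * (?k * agree ?W h) = card ?W * (?k * ?c - ?k * ?cz)"
    using sum by (metis (no_types, lifting) diff_mult_distrib2 mult.left_commute)
  also have "\<dots> \<le> card ?W * (card J - card J0)"
  proof (rule mult_le_mono2)
    have "card J0 \<le> ?k * ?cz" using kc0 kk by (metis mult_le_mono1)
    then show "?k * ?c - ?k * ?cz \<le> card J - card J0" using kc by linarith
  qed
  also have "card J - card J0 = card (J - J0)" using J0J finJ0 by (simp add: card_Diff_subset)
  finally have "card (J - J0) * (?k * agree ?W h) \<le> card (J - J0) * card ?W" by (simp add: mult.commute)
  moreover have "card (J - J0) > 0" using h finJ by (auto simp: card_gt_0_iff)
  ultimately show ?thesis by simp
qed

end

section \<open>Rings with idempotents for the primes\<close>

context cring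
begin

lemma ideal_closedI:
  assumes "I \<subseteq> carrier R" "\<zero> \<in> I" "\<And>a b. a \<in> I \<Longrightarrow> b \<in> I \<Longrightarrow> a \<oplus> b \<in> I"
    and mult: "\<And>r a. r \<in> carrier R \<Longrightarrow> a \<in> I \<Longrightarrow> r \<otimes> a \<in> I"
  shows "ideal I R"
proof (rule idealI)
  show "ring R" by (rule ring_axioms)
  have neg: "\<ominus> a \<in> I" if "a \<in> I" for a
  proof -
    have "a \<in> carrier R" using that assms by blast
    then show ?thesis using mult[of "\<ominus> \<one>" a] that by (simp add: l_minus)
  qed
  show "subgroup I (add_monoid R)"
    using assms neg by (unfold_locales) (auto simp: a_inv_def)
  show "x \<otimes> a \<in> I" "a \<otimes> x \<in> I" if "a \<in> I" "x \<in> carrier R" for a x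
  proof -
    show "x \<otimes> a \<in> I" using mult that by blast
    then show "a \<otimes> x \<in> I" using that assms(1) m_comm by (metis subsetD)
  qed
qed

lemma ideal_memb:
  assumes "ideal I R"
  shows "I \<subseteq> carrier R" "\<zero> \<in> I" "a \<in> I \<Longrightarrow> b \<in> I \<Longrightarrow> a \<oplus> b \<in> I" "a \<in> I \<Longrightarrow> b \<in> I \<Longrightarrow> a \<ominus> b \<in> I"
    "a \<in> I \<Longrightarrow> \<ominus> a \<in> I" "a \<in> I \<Longrightarrow> r \<in> carrier R \<Longrightarrow> r \<otimes> a \<in> I"
  using assms additive_subgroup.zero_closed additive_subgroup.a_closed additive_subgroup.a_inv_closed
    ideal.axioms(1) ideal.I_l_closed additive_subgroup.a_subset
  by (fastforce simp: a_minus_def)+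

lemma finsum_in:
  assumes "finite F" "G \<subseteq> carrier R" "\<zero> \<in> G" "\<And>a b. a \<in> G \<Longrightarrow> b \<in> G \<Longrightarrow> a \<oplus> b \<in> G"
    and "\<And>p. p \<in> F \<Longrightarrow> f p \<in> G"
  shows "finsum R f F \<in> G"
  using assms(1,5)
proof (induction F rule: finite_induct)
  case empty
  then show ?case using assms by simp
next
  case (insert x F)
  then have "finsum R f (insert x F) = f x \<oplus> finsum R f F"
    using assms(2) by (intro finsum_insert) auto
  then show ?case using insert assms by auto
qed

end

text \<open>A CG-ring described by orthogonal idempotents: \<open>e p\<close> is the identity of the
  \<open>p\<close>-component, \<open>e_nil\<close> makes this component a \<open>p\<close>-group,
  and \<open>e_loc\<close> with \<open>e_nonunit\<close> makes it local with radical generated by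
  \<open>p\<close>. Since \<open>e p\<close> is an integer multiple of 1 by \<open>e_int\<close>,
  every additive subgroup is stable under it.\<close>

locale cg_ring = cring R for R (structure) +
  fixes P :: "nat set" and e :: "nat \<Rightarrow> 'a"
  assumes finP: "finite P"
    and primeP: "p \<in> P \<Longrightarrow> Factorial_Ring.prime p"
    and e_closed: "p \<in> P \<Longrightarrow> e p \<in> carrier R"
    and e_idem: "p \<in> P \<Longrightarrow> e p \<otimes> e p = e p"
    and e_orth: "p \<in> P \<Longrightarrow> r \<in> P \<Longrightarrow> p \<noteq> r \<Longrightarrow> e p \<otimes> e r = \<zero>"
    and e_one: "finsum R e P = \<one>"
    and e_int: "p \<in> P \<Longrightarrow> \<exists>c. e p = \<guillemotleft>c\<guillemotright>"
    and e_nil: "p \<in> P \<Longrightarrow> \<exists>n::nat. \<guillemotleft>int p\<guillemotright> [^] n \<otimes> e p = \<zero>"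
    and e_loc: "p \<in> P \<Longrightarrow> x \<in> carrier R \<Longrightarrow>
      (\<exists>y\<in>carrier R. e p \<otimes> x \<otimes> y = e p) \<or> (\<exists>y\<in>carrier R. e p \<otimes> x = \<guillemotleft>int p\<guillemotright> \<otimes> e p \<otimes> y)"
    and e_nonunit: "p \<in> P \<Longrightarrow> y \<in> carrier R \<Longrightarrow> e p \<noteq> \<guillemotleft>int p\<guillemotright> \<otimes> e p \<otimes> y"
begin

abbreviation q :: "nat \<Rightarrow> 'a" where "q p \<equiv> \<guillemotleft>int p\<guillemotright>"

text \<open>The inverse image in \<open>R\<close> of the radical of the \<open>p\<close>-component.
  It equals \<open>pR\<close>, because \<open>p\<close> is invertible in the other
  components.\<close>

definition max_ideal :: "nat \<Rightarrow> 'a set" where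
  "max_ideal p = {x\<in>carrier R. \<exists>y\<in>carrier R. e p \<otimes> x = q p \<otimes> e p \<otimes> y}"

text \<open>In a Galois ring the annihilator of \<open>p\<close> is the unique minimal non-zero
  ideal, see \<open>socle_min\<close>.\<close>

definition socle :: "nat \<Rightarrow> 'a set" where
  "socle p = {x\<in>carrier R. e p \<otimes> x = x \<and> q p \<otimes> x = \<zero>}"

definition glue :: "(nat \<Rightarrow> 'a) \<Rightarrow> 'a" where
  "glue f = (\<Oplus>p\<in>P. e p \<otimes> f p)"

definition idem :: "nat set \<Rightarrow> 'a" where
  "idem F = glue (\<lambda>p. if p \<in> F then \<one> else \<zero>)"

definition local_units :: "nat \<Rightarrow> 'a set" where
  "local_units p = {u\<in>Units R. \<forall>r\<in>P. r \<noteq> p \<longrightarrow> e r \<otimes> u = e r}"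

lemma e_mult: "p \<in> P \<Longrightarrow> r \<in> P \<Longrightarrow> x \<in> carrier R \<Longrightarrow>
    e r \<otimes> (e p \<otimes> x) = (if r = p then e p \<otimes> x else \<zero>)"
  using e_orth[of r p] e_idem[of p] e_closed by (auto simp: m_assoc[symmetric])

lemma max_ideal_iff:
  assumes "p \<in> P" "x \<in> carrier R"
  shows "x \<notin> max_ideal p \<longleftrightarrow> (\<exists>y\<in>carrier R. e p \<otimes> x \<otimes> y = e p)"
proof
  assume "x \<notin> max_ideal p"
  then show "\<exists>y\<in>carrier R. e p \<otimes> x \<otimes> y = e p" using e_loc[OF assms] assms by (auto simp: max_ideal_def)
next
  assume "\<exists>y\<in>carrier R. e p \<otimes> x \<otimes> y = e p"
  then obtain y where y: "y \<in> carrier R" "e p \<otimes> x \<otimes> y = e p" by blast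
  show "x \<notin> max_ideal p"
  proof
    assume "x \<in> max_ideal p"
    then obtain z where z: "z \<in> carrier R" "e p \<otimes> x = q p \<otimes> e p \<otimes> z" by (auto simp: max_ideal_def)
    then have "e p = q p \<otimes> e p \<otimes> (z \<otimes> y)"
      using y e_closed[OF assms(1)] by (simp add: m_assoc)
    then show False using e_nonunit[OF assms(1), of "z \<otimes> y"] y z by simp
  qed
qed

lemma ideal_max_ideal: assumes "p \<in> P" shows "ideal (max_ideal p) R"
proof (rule ideal_closedI)
  have ep: "e p \<in> carrier R" using e_closed assms by simp
  show "max_ideal p \<subseteq> carrier R" by (auto simp: max_ideal_def)
  show "\<zero> \<in> max_ideal p" using ep by (auto simp: max_ideal_def intro!: bexI[of _ \<zero>])
  fix a assume "a \<in> max_ideal p"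
  then obtain y where a: "a \<in> carrier R" "y \<in> carrier R" "e p \<otimes> a = q p \<otimes> e p \<otimes> y"
    by (auto simp: max_ideal_def)
  { fix b assume "b \<in> max_ideal p"
    then obtain z where b: "b \<in> carrier R" "z \<in> carrier R" "e p \<otimes> b = q p \<otimes> e p \<otimes> z"
      by (auto simp: max_ideal_def)
    then have "e p \<otimes> (a \<oplus> b) = q p \<otimes> e p \<otimes> (y \<oplus> z)" using a ep by (simp add: r_distr)
    then show "a \<oplus> b \<in> max_ideal p" using a b by (auto simp: max_ideal_def) }
  { fix r assume r: "r \<in> carrier R"
    have "e p \<otimes> (r \<otimes> a) = q p \<otimes> e p \<otimes> (y \<otimes> r)"
    proof -
      have "e p \<otimes> (r \<otimes> a) = (e p \<otimes> a) \<otimes> r" using ep a(1) r by (simp add: m_ac)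
      then show ?thesis using ep a r by (simp add: m_assoc)
    qed
    then show "r \<otimes> a \<in> max_ideal p" using a r by (auto simp: max_ideal_def) }
qed

lemma one_notin_max_ideal: "p \<in> P \<Longrightarrow> \<one> \<notin> max_ideal p"
  using max_ideal_iff[of p \<one>] e_closed e_idem by auto

lemma e_notin_max_ideal: "p \<in> P \<Longrightarrow> e p \<notin> max_ideal p"
  using max_ideal_iff[of p "e p"] e_closed e_idem by auto

section \<open>Componentwise computation and units\<close>

lemma decomp: assumes "x \<in> carrier R" shows "x = (\<Oplus>p\<in>P. e p \<otimes> x)"
proof -
  have "x = finsum R e P \<otimes> x" using assms e_one by simp
  also have "\<dots> = (\<Oplus>p\<in>P. e p \<otimes> x)"
    using assms finP e_closed by (intro finsum_ldistr) auto
  finally show ?thesis .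
qed

lemma comp_ext:
  assumes "x \<in> carrier R" "y \<in> carrier R" "\<And>p. p \<in> P \<Longrightarrow> e p \<otimes> x = e p \<otimes> y"
  shows "x = y"
proof -
  have "(\<Oplus>p\<in>P. e p \<otimes> x) = (\<Oplus>p\<in>P. e p \<otimes> y)"
    using assms e_closed by (intro finsum_cong') auto
  then show ?thesis using decomp assms by metis
qed

lemma comp_in:
  assumes "x \<in> carrier R" "G \<subseteq> carrier R" "\<zero> \<in> G" "\<And>a b. a \<in> G \<Longrightarrow> b \<in> G \<Longrightarrow> a \<oplus> b \<in> G"
    and "\<And>p. p \<in> P \<Longrightarrow> e p \<otimes> x \<in> G"
  shows "x \<in> G"
proof -
  have "(\<Oplus>p\<in>P. e p \<otimes> x) \<in> G" by (rule finsum_in[OF finP assms(2-5)])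
  then show ?thesis using decomp[OF assms(1)] by simp
qed

lemma comp_ideal:
  assumes "ideal J R" "x \<in> carrier R" "\<And>p. p \<in> P \<Longrightarrow> e p \<otimes> x \<in> J"
  shows "x \<in> J"
  using comp_in[OF assms(2), of J] ideal_memb[OF assms(1)] assms(3) by blast

lemma glue_closed: assumes "\<And>p. p \<in> P \<Longrightarrow> f p \<in> carrier R" shows "glue f \<in> carrier R"
  unfolding glue_def using assms e_closed by (intro finsum_closed) auto

lemma e_glue:
  assumes r: "r \<in> P" and f: "\<And>p. p \<in> P \<Longrightarrow> f p \<in> carrier R"
  shows "e r \<otimes> glue f = e r \<otimes> f r"
proof -
  have "e r \<otimes> glue f = (\<Oplus>p\<in>P. e r \<otimes> (e p \<otimes> f p))"
    unfolding glue_def using finP e_closed f r by (intro finsum_rdistr) auto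
  also have "\<dots> = (\<Oplus>p\<in>P. if r = p then e p \<otimes> f p else \<zero>)"
    using e_mult f r e_closed by (intro finsum_cong') auto
  also have "\<dots> = e r \<otimes> f r"
    using finP e_closed f r by (intro add.finprod_singleton) auto
  finally show ?thesis .
qed

lemma idem_closed [simp]: "idem F \<in> carrier R"
  unfolding idem_def by (rule glue_closed) auto

lemma e_idem_set: "p \<in> P \<Longrightarrow> e p \<otimes> idem F = (if p \<in> F then e p else \<zero>)"
  unfolding idem_def by (subst e_glue) (auto simp: e_closed)

lemma e_idem_set': "p \<in> P \<Longrightarrow> x \<in> carrier R \<Longrightarrow> e p \<otimes> (idem F \<otimes> x) = (if p \<in> F then e p \<otimes> x else \<zero>)"
  using e_idem_set[of p F] e_closed by (simp add: m_assoc[symmetric])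

lemma idem_idem: "idem F \<otimes> idem F = idem F"
  by (rule comp_ext) (auto simp: e_idem_set e_idem_set')

lemma unitI:
  assumes x: "x \<in> carrier R" and nm: "\<And>p. p \<in> P \<Longrightarrow> x \<notin> max_ideal p"
  shows "x \<in> Units R"
proof -
  have "\<forall>p\<in>P. \<exists>y\<in>carrier R. e p \<otimes> x \<otimes> y = e p" using max_ideal_iff[OF _ x] nm by blast
  then obtain f where f: "\<And>p. p \<in> P \<Longrightarrow> f p \<in> carrier R \<and> e p \<otimes> x \<otimes> f p = e p" by metis
  have g: "glue f \<in> carrier R" by (rule glue_closed) (use f in blast)
  have "x \<otimes> glue f = \<one>"
  proof (rule comp_ext)
    fix p assume p: "p \<in> P"
    have "e p \<otimes> (x \<otimes> glue f) = x \<otimes> (e p \<otimes> glue f)" using p x g e_closed by (simp add: m_lcomm)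
    also have "\<dots> = x \<otimes> (e p \<otimes> f p)" using e_glue[OF p, of f] f by simp
    also have "\<dots> = e p \<otimes> x \<otimes> f p" using p x f e_closed by (simp add: m_ac)
    finally show "e p \<otimes> (x \<otimes> glue f) = e p \<otimes> \<one>" using f p e_closed by simp
  qed (use x g in auto)
  moreover have "glue f \<otimes> x = \<one>" using calculation m_comm[OF g x] by simp
  ultimately show ?thesis using x g unfolding Units_def by blast
qed

lemma local_unit_glue:
  assumes p: "p \<in> P" and a: "a \<in> carrier R" "a \<notin> max_ideal p"
  shows "glue (\<lambda>r. if r = p then a else \<one>) \<in> local_units p"
    and "e p \<otimes> glue (\<lambda>r. if r = p then a else \<one>) = e p \<otimes> a"
proof -
  let ?u = "glue (\<lambda>r. if r = p then a else \<one>)"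
  have uc: "?u \<in> carrier R" by (rule glue_closed) (use a in auto)
  have eu: "e r \<otimes> ?u = e r \<otimes> (if r = p then a else \<one>)" if "r \<in> P" for r
    by (rule e_glue[OF that]) (use a in auto)
  show "e p \<otimes> ?u = e p \<otimes> a" using eu[OF p] by simp
  have "?u \<notin> max_ideal r" if r: "r \<in> P" for r
  proof (cases "r = p")
    case True
    then show ?thesis using max_ideal_iff[OF p uc] max_ideal_iff[OF p a(1)] a eu[OF p] by simp
  next
    case False
    then show ?thesis using max_ideal_iff[OF r uc] eu[OF r] e_closed[OF r] by (auto intro!: bexI[of _ \<one>])
  qed
  then have "?u \<in> Units R" using unitI uc by blast
  then show "?u \<in> local_units p" unfolding local_units_def using eu e_closed by auto
qed

text \<open>By a Bezout relation between \<open>p\<close> and \<open>r\<close>, if \<open>r\<close>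
  divided \<open>p\<close> in the \<open>r\<close>-component, then it would divide the identity
  there as well.\<close>

lemma other_prime:
  assumes p: "p \<in> P" and r: "r \<in> P" and pr: "p \<noteq> r"
  shows "q p \<notin> max_ideal r"
proof
  assume "q p \<in> max_ideal r"
  then obtain z where z: "z \<in> carrier R" "e r \<otimes> q p = q r \<otimes> e r \<otimes> z" by (auto simp: max_ideal_def)
  have "coprime (int p) (int r)" using primes_coprime primeP[OF p] primeP[OF r] pr by simp
  then obtain a b where ab: "a * int p + b * int r = 1"
    using bezout_int[of "int p" "int r"] by auto
  have er: "e r \<in> carrier R" using e_closed r by simp
  have "\<guillemotleft>a\<guillemotright> \<otimes> q p \<oplus> \<guillemotleft>b\<guillemotright> \<otimes> q r = \<one>"
    using arg_cong[OF ab, of "\<lambda>i. \<guillemotleft>i\<guillemotright>"] by simp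
  then have "e r = e r \<otimes> (\<guillemotleft>a\<guillemotright> \<otimes> q p \<oplus> \<guillemotleft>b\<guillemotright> \<otimes> q r)" using er by simp
  also have "\<dots> = \<guillemotleft>a\<guillemotright> \<otimes> (e r \<otimes> q p) \<oplus> \<guillemotleft>b\<guillemotright> \<otimes> (q r \<otimes> e r)" using er by (simp add: r_distr m_ac)
  also have "\<dots> = \<guillemotleft>a\<guillemotright> \<otimes> (q r \<otimes> e r \<otimes> z) \<oplus> \<guillemotleft>b\<guillemotright> \<otimes> (q r \<otimes> e r)" using z by simp
  also have "\<dots> = q r \<otimes> e r \<otimes> (\<guillemotleft>a\<guillemotright> \<otimes> z \<oplus> \<guillemotleft>b\<guillemotright>)" using er z by (simp add: r_distr m_ac)
  finally show False using e_nonunit[OF r] z by simp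
qed

text \<open>Since \<open>p\<close> is invertible in the \<open>r\<close>-component, one may divide
  by \<open>p\<close> there without leaving \<open>J\<close>.\<close>

lemma comp_other:
  assumes J: "ideal J R" and p: "p \<in> P" and r: "r \<in> P" "r \<noteq> p" and b: "b \<in> carrier R" "q p \<otimes> b \<in> J"
  shows "e r \<otimes> b \<in> J"
proof -
  obtain y where y: "y \<in> carrier R" "e r \<otimes> q p \<otimes> y = e r"
    using other_prime[OF p r(1)] r max_ideal_iff[of r "q p"] by auto
  have er: "e r \<in> carrier R" using e_closed r by simp
  have "e r \<otimes> b = (e r \<otimes> y) \<otimes> (q p \<otimes> b)"
  proof -
    have "(e r \<otimes> y) \<otimes> (q p \<otimes> b) = (e r \<otimes> q p \<otimes> y) \<otimes> b" using er y b by (simp add: m_ac)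
    then show ?thesis using y by simp
  qed
  then show ?thesis using ideal_memb(6)[OF J b(2)] er y by simp
qed

text \<open>Each component is a chain ring: while the cofactor lies in the radical, another factor
  \<open>p\<close> can be split off, and this ends because \<open>p\<close> is nilpotent in the
  component.\<close>

lemma valuation:
  assumes p: "p \<in> P" and x: "x \<in> carrier R" and ne: "e p \<otimes> x \<noteq> \<zero>"
  obtains i :: nat and a where "a \<in> carrier R" "a \<notin> max_ideal p" "e p \<otimes> x = q p [^] i \<otimes> (e p \<otimes> a)"
proof -
  have ep: "e p \<in> carrier R" using e_closed p by simp
  have *: "(\<exists>i a. a \<in> carrier R \<and> a \<notin> max_ideal p \<and> e p \<otimes> x = q p [^] (i::nat) \<otimes> (e p \<otimes> a)) \<or>
    (\<exists>y\<in>carrier R. e p \<otimes> x = q p [^] n \<otimes> (e p \<otimes> y))" for n :: nat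
  proof (induction n)
    case 0
    then show ?case using x ep by (auto intro!: bexI[of _ x])
  next
    case (Suc n)
    from Suc.IH show ?case
    proof
      assume "\<exists>y\<in>carrier R. e p \<otimes> x = q p [^] n \<otimes> (e p \<otimes> y)"
      then obtain y where y: "y \<in> carrier R" "e p \<otimes> x = q p [^] n \<otimes> (e p \<otimes> y)" by blast
      show ?thesis
      proof (cases "y \<in> max_ideal p")
        case False
        then show ?thesis using y by blast
      next
        case True
        then obtain z where z: "z \<in> carrier R" "e p \<otimes> y = q p \<otimes> e p \<otimes> z" by (auto simp: max_ideal_def)
        then have "e p \<otimes> x = q p [^] Suc n \<otimes> (e p \<otimes> z)" using y ep by (simp add: m_assoc)
        then show ?thesis using z by blast
      qed
    qed blast
  qed
  obtain n :: nat where n: "q p [^] n \<otimes> e p = \<zero>" using e_nil p by blast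
  have "q p [^] n \<otimes> (e p \<otimes> y) = \<zero>" if "y \<in> carrier R" for y
    using that n ep by (simp add: m_assoc[symmetric])
  then show ?thesis using *[of n] ne that by metis
qed

lemma socle_ideal: assumes "p \<in> P" shows "ideal (socle p) R"
proof (rule ideal_closedI)
  have ep: "e p \<in> carrier R" using e_closed assms by simp
  show "socle p \<subseteq> carrier R" "\<zero> \<in> socle p" using ep by (auto simp: socle_def)
  show "a \<oplus> b \<in> socle p" if "a \<in> socle p" "b \<in> socle p" for a b
    using that ep by (auto simp: socle_def r_distr)
  show "r \<otimes> a \<in> socle p" if "r \<in> carrier R" "a \<in> socle p" for r a
    using that ep by (auto simp: socle_def m_lcomm)
qed

lemma socI:
  assumes "p \<in> P" "x \<in> carrier R" "q p \<otimes> x = \<zero>"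
  shows "e p \<otimes> x \<in> socle p"
proof -
  have "e p \<otimes> (e p \<otimes> x) = e p \<otimes> x" using e_mult[of p p x] assms by simp
  moreover have "q p \<otimes> (e p \<otimes> x) = e p \<otimes> (q p \<otimes> x)"
    using assms(1,2) e_closed by (simp add: m_lcomm)
  ultimately show ?thesis using assms e_closed by (simp add: socle_def)
qed

lemma pow_mult_split: "(j::nat) \<le> i \<Longrightarrow> x \<in> carrier R \<Longrightarrow> x [^] i = x [^] (i - j) \<otimes> x [^] j"
  by (simp add: nat_pow_mult)

text \<open>An ideal with non-zero \<open>p\<close>-component contains a non-zero power
  \<open>p^j\<close> of the component. A non-zero element killed by \<open>p\<close> is a unit times
  some \<open>p^i\<close> with \<open>p^(i+1) = 0\<close> there. Hence \<open>j \<le> i\<close>, and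
  the element is a multiple of \<open>p^j\<close>.\<close>

lemma socle_min:
  assumes L: "ideal L R" and p: "p \<in> P" and x: "x \<in> L" "e p \<otimes> x \<noteq> \<zero>"
  shows "socle p \<subseteq> L"
proof
  fix h assume h: "h \<in> socle p"
  have ep: "e p \<in> carrier R" using e_closed p by simp
  have xc: "x \<in> carrier R" using x ideal_memb(1)[OF L] by blast
  obtain j a where a: "a \<in> carrier R" "a \<notin> max_ideal p" "e p \<otimes> x = q p [^] (j::nat) \<otimes> (e p \<otimes> a)"
    using valuation[OF p xc x(2)] .
  obtain b where b: "b \<in> carrier R" "e p \<otimes> a \<otimes> b = e p" using max_ideal_iff[OF p a(1)] a(2) by blast
  have "q p [^] j \<otimes> e p = b \<otimes> e p \<otimes> x"
  proof -
    have "b \<otimes> e p \<otimes> x = b \<otimes> (q p [^] j \<otimes> (e p \<otimes> a))" using a(3) b xc ep by (simp add: m_assoc)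
    also have "\<dots> = q p [^] j \<otimes> (e p \<otimes> a \<otimes> b)" using a(1) b(1) ep by (simp add: m_ac)
    finally show ?thesis using b by simp
  qed
  then have gL: "q p [^] j \<otimes> e p \<in> L" using ideal_memb(6)[OF L x(1), of "b \<otimes> e p"] b ep by simp
  have gne: "q p [^] j \<otimes> e p \<noteq> \<zero>"
  proof
    assume "q p [^] j \<otimes> e p = \<zero>"
    then have "e p \<otimes> x = \<zero>" using a ep by (simp add: m_assoc[symmetric])
    then show False using x by simp
  qed
  have hc: "h \<in> carrier R" "e p \<otimes> h = h" "q p \<otimes> h = \<zero>" using h by (auto simp: socle_def)
  show "h \<in> L"
  proof (cases "h = \<zero>")
    case True
    then show ?thesis using ideal_memb(2)[OF L] by simp
  next
    case False
    then have "e p \<otimes> h \<noteq> \<zero>" using hc by simp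
    then obtain i c where c: "c \<in> carrier R" "c \<notin> max_ideal p" "e p \<otimes> h = q p [^] (i::nat) \<otimes> (e p \<otimes> c)"
      using valuation[OF p hc(1)] by blast
    obtain d where d: "d \<in> carrier R" "e p \<otimes> c \<otimes> d = e p" using max_ideal_iff[OF p c(1)] c(2) by blast
    have z: "q p [^] Suc i \<otimes> e p = \<zero>"
    proof -
      have "q p [^] Suc i \<otimes> e p = q p [^] Suc i \<otimes> (e p \<otimes> c \<otimes> d)" using d by simp
      also have "\<dots> = q p \<otimes> (q p [^] i \<otimes> (e p \<otimes> c)) \<otimes> d" using c(1) d(1) ep by (simp add: m_ac)
      also have "\<dots> = q p \<otimes> h \<otimes> d" using c(3) hc by simp
      finally show ?thesis using hc d by simp
    qed
    have "j \<le> i"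
    proof (rule ccontr)
      assume "\<not> j \<le> i"
      then have "q p [^] j = q p [^] (j - Suc i) \<otimes> q p [^] Suc i" by (intro pow_mult_split) auto
      then have "q p [^] j \<otimes> e p = q p [^] (j - Suc i) \<otimes> (q p [^] Suc i \<otimes> e p)"
        using ep by (simp add: m_assoc del: nat_pow_Suc)
      then show False using gne z by simp
    qed
    then have pw: "q p [^] i = q p [^] (i - j) \<otimes> q p [^] j" by (intro pow_mult_split) auto
    have "h = (q p [^] (i - j) \<otimes> c) \<otimes> (q p [^] j \<otimes> e p)"
    proof -
      have "h = q p [^] i \<otimes> (e p \<otimes> c)" using c(3) hc by simp
      then show ?thesis unfolding pw using ep c by (simp add: m_ac)
    qed
    then show ?thesis using ideal_memb(6)[OF L gL, of "q p [^] (i - j) \<otimes> c"] c by simp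
  qed
qed

text \<open>The last non-zero power of \<open>p\<close> in the component is such an element.\<close>

lemma socle_nontrivial:
  assumes p: "p \<in> P" obtains h where "h \<in> socle p" "h \<noteq> \<zero>"
proof -
  have ep: "e p \<in> carrier R" using e_closed p by simp
  define n where "n = (LEAST n::nat. q p [^] n \<otimes> e p = \<zero>)"
  have n: "q p [^] n \<otimes> e p = \<zero>" unfolding n_def using e_nil[OF p] by (rule LeastI_ex)
  have "n \<noteq> 0"
  proof
    assume "n = 0"
    then have "e p = \<zero>" using n ep by simp
    then show False using e_nonunit[OF p, of \<zero>] by simp
  qed
  then obtain m where m: "n = Suc m" by (cases n) auto
  then have nz: "q p [^] m \<otimes> e p \<noteq> \<zero>"
    using not_less_Least[of m "\<lambda>n. q p [^] n \<otimes> e p = \<zero>"] unfolding n_def by simp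
  have "e p \<otimes> (q p [^] m \<otimes> e p) \<in> socle p"
  proof (rule socI[OF p])
    show "q p \<otimes> (q p [^] m \<otimes> e p) = \<zero>" using n m ep by (simp add: m_ac)
  qed (use ep in auto)
  moreover have "e p \<otimes> (q p [^] m \<otimes> e p) = q p [^] m \<otimes> e p"
    using m_lcomm[of "e p" "q p [^] m" "e p"] ep e_idem[OF p] by simp
  ultimately show ?thesis using that nz by simp
qed

text \<open>The difference of two elements of different valuations has the smaller valuation
  \<open>i\<close>. Multiplied by \<open>p\<close> it generates \<open>p^(i+1)\<close> in the
  component, and with it everything of valuation \<open>j > i\<close>.\<close>

lemma valuation_gap:
  assumes J: "ideal J R" and p: "p \<in> P" and ij: "(i::nat) < j"
    and a: "a \<in> carrier R" "a \<notin> max_ideal p" and b: "b \<in> carrier R"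
    and d: "q p \<otimes> (q p [^] i \<otimes> (e p \<otimes> a) \<ominus> q p [^] j \<otimes> (e p \<otimes> b)) \<in> J"
  shows "q p [^] j \<otimes> (e p \<otimes> b) \<in> J"
proof -
  have ep: "e p \<in> carrier R" using e_closed p by simp
  have pj: "q p [^] j = q p [^] (j - Suc i) \<otimes> q p [^] Suc i" using ij by (intro pow_mult_split) auto
  define t where "t = q p [^] (j - Suc i)"
  have tc: "t \<in> carrier R" by (simp add: t_def)
  \<comment> \<open>What remains of the difference after extraction of \<open>p^i\<close>; it
    differs from \<open>a\<close> by a multiple of \<open>p\<close>, so it is again invertible in
    the component.\<close>
  define g where "g = a \<ominus> q p \<otimes> (t \<otimes> b)"
  have gc: "g \<in> carrier R" using a b tc by (simp add: g_def)
  have "g \<notin> max_ideal p"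
  proof
    assume "g \<in> max_ideal p"
    moreover have "q p \<otimes> (t \<otimes> b) \<in> max_ideal p" unfolding max_ideal_def using ep tc b
      by (auto intro!: bexI[of _ "t \<otimes> b"] simp: m_ac)
    ultimately have "g \<oplus> q p \<otimes> (t \<otimes> b) \<in> max_ideal p"
      using ideal_memb(3)[OF ideal_max_ideal[OF p]] by blast
    moreover have "g \<oplus> q p \<otimes> (t \<otimes> b) = a" using a b tc
      by (simp add: g_def minus_eq a_assoc l_neg)
    ultimately show False using a by simp
  qed
  then obtain c where c: "c \<in> carrier R" "e p \<otimes> g \<otimes> c = e p" using max_ideal_iff[OF p gc] by blast
  define s where "s = q p [^] i"
  have sc: "s \<in> carrier R" by (simp add: s_def)
  define E where "E = e p"
  have Ec: "E \<in> carrier R" using ep by (simp add: E_def)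
  define Q where "Q = q p"
  have Qc: "Q \<in> carrier R" by (simp add: Q_def)
  have pj': "q p [^] j = t \<otimes> (s \<otimes> Q)" using pj by (simp add: t_def s_def Q_def)
  have "q p \<otimes> (q p [^] i \<otimes> (e p \<otimes> a) \<ominus> q p [^] j \<otimes> (e p \<otimes> b)) = s \<otimes> Q \<otimes> (E \<otimes> g)"
  proof -
    have ac: "a \<in> carrier R" and bc: "b \<in> carrier R" using a b by auto
    have "Q \<otimes> (s \<otimes> (E \<otimes> a) \<ominus> t \<otimes> (s \<otimes> Q) \<otimes> (E \<otimes> b)) = s \<otimes> Q \<otimes> (E \<otimes> (a \<ominus> Q \<otimes> (t \<otimes> b)))"
      using ac bc Ec Qc sc tc by (simp add: minus_eq r_distr r_minus m_ac)
    then show ?thesis unfolding pj' g_def by (simp add: s_def E_def Q_def)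
  qed
  then have "s \<otimes> Q \<otimes> (E \<otimes> g) \<in> J" using d by simp
  then have "(t \<otimes> b \<otimes> c) \<otimes> (s \<otimes> Q \<otimes> (E \<otimes> g)) \<in> J" using ideal_memb(6)[OF J] tc b c by simp
  moreover have "(t \<otimes> b \<otimes> c) \<otimes> (s \<otimes> Q \<otimes> (E \<otimes> g)) = t \<otimes> (s \<otimes> Q) \<otimes> ((E \<otimes> g \<otimes> c) \<otimes> b)"
    using tc b c sc Qc Ec gc by (simp add: m_ac)
  ultimately show ?thesis using c(2) unfolding pj' by (simp add: E_def)
qed

text \<open>By \<open>valuation_gap\<close> the \<open>p\<close>-components of \<open>v\<close> and
  \<open>w\<close> have the same valuation, so a unit of that component carries one to the other. In
  the remaining components they already agree modulo \<open>J\<close> by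
  \<open>comp_other\<close>.\<close>

lemma local_associate:
  assumes J: "ideal J R" and p: "p \<in> P" and v: "v \<in> carrier R" and w: "w \<in> carrier R"
    and vw: "q p \<otimes> (w \<ominus> v) \<in> J" and ev: "e p \<otimes> v \<notin> J" and ew: "e p \<otimes> w \<notin> J"
  obtains u where "u \<in> local_units p" "u \<otimes> v \<ominus> w \<in> J"
proof -
  have ep: "e p \<in> carrier R" using e_closed p by simp
  have z: "\<zero> \<in> J" by (rule ideal_memb(2)[OF J])
  have "e p \<otimes> v \<noteq> \<zero>" using ev z by metis
  then obtain i a where a: "a \<in> carrier R" "a \<notin> max_ideal p" "e p \<otimes> v = q p [^] (i::nat) \<otimes> (e p \<otimes> a)"
    using valuation[OF p v] by blast
  have "e p \<otimes> w \<noteq> \<zero>" using ew z by metis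
  then obtain j b where b: "b \<in> carrier R" "b \<notin> max_ideal p" "e p \<otimes> w = q p [^] (j::nat) \<otimes> (e p \<otimes> b)"
    using valuation[OF p w] by blast
  define E where "E = e p"
  have Ec: "E \<in> carrier R" using ep by (simp add: E_def)
  define Q where "Q = q p"
  have Qc: "Q \<in> carrier R" by (simp add: Q_def)
  have m1: "q p \<otimes> (e p \<otimes> w \<ominus> e p \<otimes> v) \<in> J"
  proof -
    have "E \<otimes> (Q \<otimes> (w \<ominus> v)) = Q \<otimes> (E \<otimes> w \<ominus> E \<otimes> v)"
      using Ec Qc v w by (simp add: minus_eq r_distr r_minus m_ac)
    moreover have "e p \<otimes> (q p \<otimes> (w \<ominus> v)) \<in> J" by (rule ideal_memb(6)[OF J vw ep])
    ultimately show ?thesis by (simp add: E_def Q_def)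
  qed
  have m2: "q p \<otimes> (e p \<otimes> v \<ominus> e p \<otimes> w) \<in> J"
  proof -
    have "\<ominus> (Q \<otimes> (E \<otimes> w \<ominus> E \<otimes> v)) = Q \<otimes> (E \<otimes> v \<ominus> E \<otimes> w)"
      using Ec Qc v w by (simp add: minus_eq r_distr r_minus m_ac minus_add a_comm)
    moreover have "\<ominus> (q p \<otimes> (e p \<otimes> w \<ominus> e p \<otimes> v)) \<in> J" by (rule ideal_memb(5)[OF J m1])
    ultimately show ?thesis by (simp add: E_def Q_def)
  qed
  have ij: "i = j"
  proof (rule ccontr)
    assume "i \<noteq> j"
    then consider "i < j" | "j < i" by linarith
    then show False
    proof cases
      case 1
      then have "q p [^] j \<otimes> (e p \<otimes> b) \<in> J"
        using valuation_gap[OF J p 1 a(1,2) b(1)] m2 a(3) b(3) by simp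
      then show False using b(3) ew by simp
    next
      case 2
      then have "q p [^] i \<otimes> (e p \<otimes> a) \<in> J"
        using valuation_gap[OF J p 2 b(1,2) a(1)] m1 a(3) b(3) by simp
      then show False using a(3) ev by simp
    qed
  qed
  obtain a' where a': "a' \<in> carrier R" "e p \<otimes> a \<otimes> a' = e p" using max_ideal_iff[OF p a(1)] a(2) by blast
  obtain b' where b': "b' \<in> carrier R" "e p \<otimes> b \<otimes> b' = e p" using max_ideal_iff[OF p b(1)] b(2) by blast
  have bb: "b \<otimes> a' \<in> carrier R" using a' b by simp
  have "b \<otimes> a' \<notin> max_ideal p" unfolding max_ideal_iff[OF p bb]
  proof (intro bexI)
    show "b' \<otimes> a \<in> carrier R" using b' a by simp
    have "E \<otimes> E = E" using e_idem[OF p] by (simp add: E_def)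
    moreover have "E \<otimes> a \<otimes> a' = E" "E \<otimes> b \<otimes> b' = E" using a' b' by (auto simp: E_def)
    moreover have "E \<otimes> E \<otimes> (b \<otimes> a') \<otimes> (b' \<otimes> a) = (E \<otimes> b \<otimes> b') \<otimes> (E \<otimes> a \<otimes> a')"
      using Ec a a' b b' by (simp add: m_ac)
    ultimately show "e p \<otimes> (b \<otimes> a') \<otimes> (b' \<otimes> a) = e p" by (simp add: E_def)
  qed
  define u where "u = glue (\<lambda>r. if r = p then b \<otimes> a' else \<one>)"
  have u: "u \<in> local_units p" "e p \<otimes> u = e p \<otimes> (b \<otimes> a')"
    unfolding u_def using local_unit_glue[OF p bb \<open>b \<otimes> a' \<notin> max_ideal p\<close>] by auto
  have uc: "u \<in> carrier R" using u by (auto simp: local_units_def)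
  have "u \<otimes> v \<ominus> w \<in> J"
  proof (rule comp_ideal[OF J])
    show "u \<otimes> v \<ominus> w \<in> carrier R" using uc v w by simp
    fix r assume r: "r \<in> P"
    have er: "e r \<in> carrier R" using e_closed r by simp
    show "e r \<otimes> (u \<otimes> v \<ominus> w) \<in> J"
    proof (cases "r = p")
      case True
      have "e p \<otimes> (u \<otimes> v \<ominus> w) = e p \<otimes> (e p \<otimes> (u \<otimes> v \<ominus> w))"
        using ep e_idem[OF p] uc v w by (simp add: m_assoc[symmetric])
      also have "\<dots> = (e p \<otimes> u) \<otimes> (e p \<otimes> v) \<ominus> e p \<otimes> (e p \<otimes> w)"
        using ep uc v w by (simp add: minus_eq r_distr r_minus m_ac)
      also have "e p \<otimes> (e p \<otimes> w) = e p \<otimes> w" using ep e_idem[OF p] w by (simp add: m_assoc[symmetric])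
      also have "(e p \<otimes> u) \<otimes> (e p \<otimes> v) = (e p \<otimes> (b \<otimes> a')) \<otimes> (q p [^] i \<otimes> (e p \<otimes> a))"
        using u a by simp
      also have "\<dots> = q p [^] i \<otimes> (e p \<otimes> b) \<otimes> (e p \<otimes> a \<otimes> a')" using a(1) a'(1) b(1) ep by (simp add: m_ac)
      also have "\<dots> = q p [^] i \<otimes> (e p \<otimes> b)"
      proof -
        have "(e p \<otimes> b) \<otimes> e p = (e p \<otimes> e p) \<otimes> b" using ep b by (simp add: m_ac)
        then show ?thesis using a' e_idem[OF p] ep b by (simp add: m_assoc)
      qed
      finally have "e p \<otimes> (u \<otimes> v \<ominus> w) = \<zero>" using b ij ep w by (simp add: minus_eq r_neg)
      then show ?thesis using z True by simp
    next
      case False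
      then have "e r \<otimes> u = e r" using u r by (auto simp: local_units_def)
      then have "e r \<otimes> (u \<otimes> v) = e r \<otimes> v" using er uc v by (simp add: m_assoc[symmetric])
      then have "e r \<otimes> (u \<otimes> v \<ominus> w) = \<ominus> (e r \<otimes> (w \<ominus> v))"
        using er uc v w by (simp add: minus_eq r_distr r_minus minus_add a_comm)
      moreover have "e r \<otimes> (w \<ominus> v) \<in> J" using comp_other[OF J p r False] vw v w by simp
      ultimately show ?thesis using ideal_memb(5)[OF J] by simp
    qed
  qed
  then show ?thesis using that u by blast
qed

text \<open>Every element is a sum of integer multiples of units.\<close>

lemma unit_invariant_ideal:
  assumes GR: "G \<subseteq> carrier R" and z: "\<zero> \<in> G" and add: "\<And>a b. a \<in> G \<Longrightarrow> b \<in> G \<Longrightarrow> a \<oplus> b \<in> G"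
    and unit: "\<And>u a. u \<in> Units R \<Longrightarrow> a \<in> G \<Longrightarrow> u \<otimes> a \<in> G"
  shows "ideal G R"
proof (rule ideal_closedI[OF GR z add])
  fix r x assume r: "r \<in> carrier R" and x: "x \<in> G"
  have neg: "\<ominus> a \<in> G" if "a \<in> G" for a
  proof -
    have "\<ominus> \<one> \<in> Units R" unfolding Units_def by (auto intro!: bexI[of _ "\<ominus> \<one>"] simp: l_minus)
    from unit[OF this that] show ?thesis using that GR by (auto simp: l_minus)
  qed
  have nat_mult: "\<guillemotleft>n\<guillemotright>\<^sub>\<nat> \<otimes> a \<in> G" if "a \<in> G" for n a
  proof (induction n)
    case 0
    have "a \<in> carrier R" using that GR by blast
    then show ?case using z by simp
  next
    case (Suc n)
    have "a \<in> carrier R" using that GR by blast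
    then show ?case using add[OF that Suc] by (simp add: l_distr)
  qed
  have int_mult: "\<guillemotleft>c\<guillemotright> \<otimes> a \<in> G" if "a \<in> G" for c a
    using nat_mult[OF that] neg that GR by (auto simp: of_integer_def l_minus subset_iff)
  have e_mem: "e p \<otimes> a \<in> G" if "p \<in> P" "a \<in> G" for p a
    using e_int[OF that(1)] int_mult[OF that(2)] by auto
  have xc: "x \<in> carrier R" using x GR by blast
  have unit_case: "e p \<otimes> s \<otimes> x \<in> G" if p: "p \<in> P" and s: "s \<in> carrier R" "s \<notin> max_ideal p" for p s
  proof -
    have ep: "e p \<in> carrier R" using e_closed p by simp
    define u where "u = glue (\<lambda>r. if r = p then s else \<one>)"
    have u: "u \<in> local_units p" "e p \<otimes> u = e p \<otimes> s"
      unfolding u_def using local_unit_glue[OF p s] by auto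
    have uU: "u \<in> Units R" using u by (simp add: local_units_def)
    have "e p \<otimes> (u \<otimes> x) \<in> G" using e_mem[OF p unit[OF uU x]] .
    moreover have "e p \<otimes> (u \<otimes> x) = e p \<otimes> s \<otimes> x"
      using ep u xc uU s by (simp add: m_assoc[symmetric] Units_closed)
    ultimately show ?thesis by simp
  qed
  show "r \<otimes> x \<in> G"
  proof (rule comp_in[OF _ GR z add])
    show "r \<otimes> x \<in> carrier R" using r xc by simp
    fix p assume p: "p \<in> P"
    have ep: "e p \<in> carrier R" using e_closed p by simp
    show "e p \<otimes> (r \<otimes> x) \<in> G"
    proof (cases "r \<in> max_ideal p")
      case False
      then show ?thesis using unit_case[OF p r] ep r xc by (simp add: m_assoc)
    next
      case True
      \<comment> \<open>For \<open>r\<close> in the radical, \<open>r \<oplus> \<one>\<close> is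
        invertible in the component, and multiplication by \<open>r\<close> is the difference of two
        multiplications already handled.\<close>
      have "r \<oplus> \<one> \<notin> max_ideal p"
      proof
        assume "r \<oplus> \<one> \<in> max_ideal p"
        then have "(r \<oplus> \<one>) \<ominus> r \<in> max_ideal p" using True ideal_memb(4)[OF ideal_max_ideal[OF p]] by blast
        moreover have "(r \<oplus> \<one>) \<ominus> r = \<one>" using r by (simp add: minus_eq a_comm[of r] a_assoc r_neg)
        ultimately show False using one_notin_max_ideal[OF p] by simp
      qed
      then have "e p \<otimes> (r \<oplus> \<one>) \<otimes> x \<in> G" using unit_case[OF p] r by simp
      then have "e p \<otimes> (r \<oplus> \<one>) \<otimes> x \<oplus> \<ominus> (e p \<otimes> x) \<in> G" using add neg e_mem[OF p x] by blast
      moreover have "e p \<otimes> (r \<oplus> \<one>) \<otimes> x \<oplus> \<ominus> (e p \<otimes> x) = e p \<otimes> (r \<otimes> x)"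
        using ep r xc by (simp add: r_distr l_distr m_assoc a_assoc r_neg)
      ultimately show ?thesis by simp
    qed
  qed
qed

end

section \<open>Relative prime powers\<close>

context cring
begin

text \<open>Rewriting with \<open>a_ac\<close> may leave other summands between an element and its
  negative; these rules cancel the pairs that \<open>r_neg1\<close> and \<open>r_neg2\<close> do not
  reach.\<close>

lemma add_cancels:
  assumes "x \<in> carrier R" "y \<in> carrier R"
  shows "x \<oplus> (y \<oplus> \<ominus> x) = y" "\<ominus> x \<oplus> (y \<oplus> x) = y"
    and "w \<in> carrier R \<Longrightarrow> x \<oplus> (y \<oplus> (\<ominus> x \<oplus> w)) = y \<oplus> w"
    and "w \<in> carrier R \<Longrightarrow> \<ominus> x \<oplus> (y \<oplus> (x \<oplus> w)) = y \<oplus> w"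
    and "w \<in> carrier R \<Longrightarrow> x \<oplus> (y \<oplus> (w \<oplus> \<ominus> x)) = y \<oplus> w"
    and "w \<in> carrier R \<Longrightarrow> \<ominus> x \<oplus> (y \<oplus> (w \<oplus> x)) = y \<oplus> w"
    and "w \<in> carrier R \<Longrightarrow> v \<in> carrier R \<Longrightarrow> x \<oplus> (y \<oplus> (w \<oplus> (\<ominus> x \<oplus> v))) = y \<oplus> (w \<oplus> v)"
    and "w \<in> carrier R \<Longrightarrow> v \<in> carrier R \<Longrightarrow> \<ominus> x \<oplus> (y \<oplus> (w \<oplus> (x \<oplus> v))) = y \<oplus> (w \<oplus> v)"
  using assms by (simp_all add: a_lcomm[of x] a_lcomm[of "\<ominus> x"] r_neg l_neg r_neg1 r_neg2)

lemmas add_normal = minus_eq minus_add a_ac r_neg l_neg r_neg1 r_neg2 add_cancels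

end

context schur_ring
begin

text \<open>Representatives of the cosets of \<open>J\<close>, used in place of a quotient ring. The
  predicate under the choice operator depends only on the coset of \<open>x\<close>, so equal cosets
  receive the same representative.\<close>

definition rep :: "'a set \<Rightarrow> 'a \<Rightarrow> 'a" where
  "rep J x = (SOME y. y \<in> carrier R \<and> y \<ominus> x \<in> J)"

definition list_sum :: "'a list \<Rightarrow> 'a" where
  "list_sum xs = foldr (\<oplus>) xs \<zero>"

lemma list_sum_simps [simp]: "list_sum [] = \<zero>" "list_sum (x # xs) = x \<oplus> list_sum xs"
  by (simp_all add: list_sum_def)

lemma list_sum_closed: "set xs \<subseteq> carrier R \<Longrightarrow> list_sum xs \<in> carrier R"
  by (induction xs) auto

lemma list_sum_snoc: "set xs \<subseteq> carrier R \<Longrightarrow> x \<in> carrier R \<Longrightarrow> list_sum (xs @ [x]) = x \<oplus> list_sum xs"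
  by (induction xs) (auto simp: list_sum_closed a_lcomm)

lemma list_sum_rotate1: "set xs \<subseteq> carrier R \<Longrightarrow> list_sum (rotate1 xs) = list_sum xs"
  by (cases xs) (auto simp: list_sum_snoc)

lemma list_sum_replicate: "t \<in> carrier R \<Longrightarrow> list_sum (replicate n t) = \<guillemotleft>int n\<guillemotright> \<otimes> t"
  by (induction n) (auto simp: l_distr)

lemma minus_self: "x \<in> carrier R \<Longrightarrow> x \<ominus> x = \<zero>"
  by (simp add: minus_eq r_neg)

lemma minus_add_cancel: "x \<in> carrier R \<Longrightarrow> y \<in> carrier R \<Longrightarrow> (x \<ominus> y) \<oplus> y = x"
  "x \<in> carrier R \<Longrightarrow> y \<in> carrier R \<Longrightarrow> y \<oplus> (x \<ominus> y) = x"
  "x \<in> carrier R \<Longrightarrow> y \<in> carrier R \<Longrightarrow> (y \<oplus> x) \<ominus> y = x"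
  "x \<in> carrier R \<Longrightarrow> y \<in> carrier R \<Longrightarrow> (x \<oplus> y) \<ominus> y = x"
  by (simp_all add: minus_eq a_ac r_neg r_neg1 r_neg2 l_neg)

lemma minus_trans:
  assumes "x \<in> carrier R" "y \<in> carrier R" "z \<in> carrier R"
  shows "(x \<ominus> y) \<oplus> (y \<ominus> z) = x \<ominus> z" "(x \<ominus> z) \<ominus> (y \<ominus> z) = x \<ominus> y"
    "(x \<ominus> y) \<ominus> (x \<ominus> z) = z \<ominus> y"
  using assms by (simp_all add: add_normal)

lemma stab_minus:
  assumes "block_ideal J" "J \<subseteq> stab W" "w \<in> W" "j \<in> J" shows "w \<ominus> j \<in> W"
proof -
  have "\<ominus> j \<in> stab W" using assms block_ideal_neg by blast
  then show ?thesis using assms(3) by (simp add: stab_def minus_eq)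
qed

lemma stab_plus: "J \<subseteq> stab W \<Longrightarrow> w \<in> W \<Longrightarrow> j \<in> J \<Longrightarrow> w \<oplus> j \<in> W"
  by (auto simp: stab_def)

lemma stab_iff:
  assumes "block_ideal J" "J \<subseteq> stab W" "w \<in> carrier R" "j \<in> J" shows "w \<oplus> j \<in> W \<longleftrightarrow> w \<in> W"
proof
  assume "w \<oplus> j \<in> W"
  then have "w \<oplus> j \<ominus> j \<in> W" using stab_minus assms by blast
  then show "w \<in> W" using assms block_ideal_sub[OF assms(1)] minus_add_cancel(4)[of w j] by auto
qed (use assms stab_plus in blast)

lemma stab_diff_iff:
  assumes J: "block_ideal J" "J \<subseteq> stab W" and wv: "w \<in> carrier R" "v \<in> carrier R" "w \<ominus> v \<in> J"
  shows "w \<in> W \<longleftrightarrow> v \<in> W"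
  using stab_iff[OF J wv(2,3)] minus_add_cancel(2)[OF wv(1,2)] by simp

lemma rep_prop:
  assumes J: "block_ideal J" and x: "x \<in> carrier R"
  shows "rep J x \<in> carrier R" "rep J x \<ominus> x \<in> J"
proof -
  have "\<exists>y. y \<in> carrier R \<and> y \<ominus> x \<in> J"
    using x block_ideal_zero[OF J] by (auto intro!: exI[of _ x] simp: minus_self)
  from someI_ex[OF this] show "rep J x \<in> carrier R" "rep J x \<ominus> x \<in> J" by (auto simp: rep_def)
qed

lemma rep_eq_iff:
  assumes J: "block_ideal J" and x: "x \<in> carrier R" and y: "y \<in> carrier R"
  shows "rep J x = rep J y \<longleftrightarrow> x \<ominus> y \<in> J"
proof
  assume eq: "rep J x = rep J y"
  have "(rep J x \<ominus> y) \<ominus> (rep J x \<ominus> x) \<in> J"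
    using rep_prop[OF J x] rep_prop[OF J y] eq block_ideal_minus[OF J] by simp
  then show "x \<ominus> y \<in> J" using minus_trans(3)[of "rep J x" y x] rep_prop[OF J x] x y by simp
next
  assume xy: "x \<ominus> y \<in> J"
  have "z \<ominus> x \<in> J \<longleftrightarrow> z \<ominus> y \<in> J" if z: "z \<in> carrier R" for z
  proof
    assume "z \<ominus> x \<in> J"
    then show "z \<ominus> y \<in> J" using block_ideal_add[OF J _ xy] minus_trans(1)[OF z x y] by metis
  next
    assume "z \<ominus> y \<in> J"
    then show "z \<ominus> x \<in> J" using block_ideal_minus[OF J _ xy] minus_trans(2)[OF z x y] by metis
  qed
  then have "(\<lambda>z. z \<in> carrier R \<and> z \<ominus> x \<in> J) = (\<lambda>z. z \<in> carrier R \<and> z \<ominus> y \<in> J)" by blast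
  then show "rep J x = rep J y" by (simp add: rep_def)
qed

lemma rep_rep: "block_ideal J \<Longrightarrow> x \<in> carrier R \<Longrightarrow> rep J (rep J x) = rep J x"
  using rep_eq_iff[of J "rep J x" x] rep_prop[of J x] by simp

text \<open>A set stabilized by \<open>J\<close> is a union of cosets, hence the bijective image of
  its representatives times \<open>J\<close> under addition.\<close>

lemma sum_rep:
  fixes g :: "'a \<Rightarrow> nat"
  assumes J: "block_ideal J" and UR: "U \<subseteq> carrier R" and JU: "J \<subseteq> stab U"
  shows "(\<Sum>z\<in>U. g (rep J z)) = card J * (\<Sum>t\<in>rep J ` U. g t)"
proof -
  have JR: "J \<subseteq> carrier R" using block_ideal_sub[OF J] .
  have finU: "finite U" using UR finR finite_subset by blast
  have repU: "rep J z \<in> U" if z: "z \<in> U" for z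
  proof -
    have zc: "z \<in> carrier R" using z UR by blast
    show ?thesis using stab_diff_iff[OF J JU rep_prop(1)[OF J zc] zc rep_prop(2)[OF J zc]] z by simp
  qed
  have bij: "bij_betw (\<lambda>(t, j). t \<oplus> j) (rep J ` U \<times> J) U"
  proof (rule bij_betw_byWitness[where f' = "\<lambda>z. (rep J z, z \<ominus> rep J z)"])
    show "\<forall>a\<in>rep J ` U \<times> J. (rep J ((\<lambda>(t, j). t \<oplus> j) a), (\<lambda>(t, j). t \<oplus> j) a \<ominus> rep J ((\<lambda>(t, j). t \<oplus> j) a)) = a"
    proof clarify
      fix z j assume z: "z \<in> U" and j: "j \<in> J"
      have zc: "z \<in> carrier R" and jc: "j \<in> carrier R" using z j UR JR by auto
      have rc: "rep J z \<in> carrier R" using rep_prop[OF J zc] by simp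
      have "rep J (rep J z \<oplus> j) = rep J (rep J z)"
        using rep_eq_iff[OF J, of "rep J z \<oplus> j" "rep J z"] rc jc j minus_add_cancel(3)[OF jc rc] by simp
      then have *: "rep J (rep J z \<oplus> j) = rep J z" using rep_rep[OF J zc] by simp
      show "rep J (rep J z \<oplus> j) = rep J z \<and> rep J z \<oplus> j \<ominus> rep J (rep J z \<oplus> j) = j"
        unfolding * using minus_add_cancel(3)[OF jc rc] by simp
    qed
    show "\<forall>a\<in>U. (\<lambda>(t, j). t \<oplus> j) (rep J a, a \<ominus> rep J a) = a"
      using UR minus_add_cancel(2) rep_prop[OF J] by auto
    show "(\<lambda>(t, j). t \<oplus> j) ` (rep J ` U \<times> J) \<subseteq> U"
      using stab_plus[OF JU] repU by auto
    show "(\<lambda>z. (rep J z, z \<ominus> rep J z)) ` U \<subseteq> rep J ` U \<times> J"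
      using UR rep_prop[OF J] block_ideal_minus_comm[OF J] by auto
  qed
  have "(\<Sum>z\<in>U. g (rep J z)) = (\<Sum>a\<in>rep J ` U \<times> J. g (rep J ((\<lambda>(t, j). t \<oplus> j) a)))"
    using sum.reindex_bij_betw[OF bij, of "\<lambda>z. g (rep J z)"] by simp
  also have "\<dots> = (\<Sum>a\<in>rep J ` U \<times> J. g (fst a))"
  proof (rule sum.cong[OF refl])
    fix a assume "a \<in> rep J ` U \<times> J"
    then obtain z j where z: "z \<in> U" and j: "j \<in> J" and a: "a = (rep J z, j)" by blast
    have zc: "z \<in> carrier R" and jc: "j \<in> carrier R" using z j UR JR by auto
    have rc: "rep J z \<in> carrier R" using rep_prop[OF J zc] by simp
    have "rep J (rep J z \<oplus> j) = rep J (rep J z)"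
      using rep_eq_iff[OF J, of "rep J z \<oplus> j" "rep J z"] rc jc j minus_add_cancel(3)[OF jc rc] by simp
    then show "g (rep J ((\<lambda>(t, j). t \<oplus> j) a)) = g (fst a)" using rep_rep[OF J zc] a by simp
  qed
  also have "\<dots> = (\<Sum>t\<in>rep J ` U. \<Sum>j\<in>J. g t)"
    by (subst sum.cartesian_product) (simp add: split_def)
  finally show ?thesis by (simp add: sum_distrib_left)
qed

lemma card_rep:
  assumes "block_ideal J" "U \<subseteq> carrier R" "J \<subseteq> stab U"
  shows "card U = card J * card (rep J ` U)"
  using sum_rep[OF assms, of "\<lambda>_. 1"] by simp

text \<open>For a set \<open>X\<close> of coset representatives, the cardinality is the coefficient
  of \<open>x + J\<close> in the \<open>k\<close>-th power of the sum of \<open>X\<close> in the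
  group ring of \<open>R/J\<close>.\<close>

definition tuples :: "'a set \<Rightarrow> 'a set \<Rightarrow> nat \<Rightarrow> 'a \<Rightarrow> 'a list set" where
  "tuples J X k x = {xs. length xs = k \<and> set xs \<subseteq> X \<and> list_sum xs \<ominus> x \<in> J}"

lemma finite_tuples: "finite X \<Longrightarrow> finite (tuples J X k x)"
  using finite_lists_length_eq[of X k] by (auto simp: tuples_def intro: finite_subset[rotated])

text \<open>Splitting off the first entry writes the count for \<open>Suc k\<close> as a sum over
  representatives. Multiplied by \<open>card J\<close> this becomes a sum over all of
  \<open>Z\<close>, to which \<open>conv_sum\<close> applies.\<close>

lemma tuples_const:
  assumes J: "block_ideal J" and Z: "blockset Z" and JZ: "J \<subseteq> stab Z"
  shows "block_const S (\<lambda>x. card (tuples J (rep J ` Z) k x))"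
proof (induction k)
  case 0
  have "card (tuples J (rep J ` Z) 0 x) = (if x \<in> J then 1 else 0)" if x: "x \<in> carrier R" for x
  proof -
    have "tuples J (rep J ` Z) 0 x = (if x \<in> J then {[]} else {})"
      using block_ideal_minus_comm[OF J, of \<zero> x] x block_ideal_neg[OF J, of x] block_ideal_neg[OF J, of "\<ominus> x"]
      by (auto simp: tuples_def minus_eq)
    then show ?thesis by simp
  qed
  then show ?case unfolding block_const_iff using same_carr block_ideal_same[OF J] by simp
next
  case (Suc k)
  let ?X = "rep J ` Z"
  let ?c = "\<lambda>x. card (tuples J ?X k x)"
  have ZR: "Z \<subseteq> carrier R" using Z by (simp add: blockset_def)
  have XR: "?X \<subseteq> carrier R" using ZR rep_prop[OF J] by auto
  have finX: "finite ?X" using XR finR finite_subset by blast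
  have step: "card (tuples J ?X (Suc k) x) = (\<Sum>t\<in>?X. ?c (x \<ominus> t))" if x: "x \<in> carrier R" for x
  proof -
    have "bij_betw (\<lambda>(t, xs). t # xs) (SIGMA t:?X. tuples J ?X k (x \<ominus> t)) (tuples J ?X (Suc k) x)"
    proof (rule bij_betw_byWitness[where f' = "\<lambda>xs. (hd xs, tl xs)"])
      have eq: "t \<oplus> list_sum xs \<ominus> x = list_sum xs \<ominus> (x \<ominus> t)" if "t \<in> ?X" "set xs \<subseteq> ?X" for t xs
      proof -
        have "t \<in> carrier R" "list_sum xs \<in> carrier R" using that XR list_sum_closed[of xs] by auto
        then show ?thesis using x by (simp add: minus_eq minus_add a_ac)
      qed
      show "(\<lambda>(t, xs). t # xs) ` (SIGMA t:?X. tuples J ?X k (x \<ominus> t)) \<subseteq> tuples J ?X (Suc k) x"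
        using eq by (auto simp: tuples_def)
      show "(\<lambda>xs. (hd xs, tl xs)) ` tuples J ?X (Suc k) x \<subseteq> (SIGMA t:?X. tuples J ?X k (x \<ominus> t))"
      proof
        fix a assume "a \<in> (\<lambda>xs. (hd xs, tl xs)) ` tuples J ?X (Suc k) x"
        then obtain xs where "xs \<in> tuples J ?X (Suc k) x" "a = (hd xs, tl xs)" by blast
        then show "a \<in> (SIGMA t:?X. tuples J ?X k (x \<ominus> t))"
          using eq by (cases xs) (auto simp: tuples_def)
      qed
      show "\<forall>a\<in>tuples J ?X (Suc k) x. (\<lambda>(t, xs). t # xs) (hd a, tl a) = a"
      proof
        fix a assume "a \<in> tuples J ?X (Suc k) x"
        then show "(\<lambda>(t, xs). t # xs) (hd a, tl a) = a" by (cases a) (auto simp: tuples_def)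
      qed
    qed auto
    then have "card (tuples J ?X (Suc k) x) = card (SIGMA t:?X. tuples J ?X k (x \<ominus> t))"
      by (rule bij_betw_same_card[symmetric])
    then show ?thesis using finX finite_tuples[OF finX] by simp
  qed
  have c_shift: "?c (x \<ominus> z) = ?c (x \<ominus> rep J z)" if x: "x \<in> carrier R" and z: "z \<in> carrier R" for x z
  proof -
    have rc: "rep J z \<in> carrier R" using rep_prop[OF J z] by simp
    have "s \<ominus> (x \<ominus> z) \<in> J \<longleftrightarrow> s \<ominus> (x \<ominus> rep J z) \<in> J" if s: "s \<in> carrier R" for s
    proof -
      have "s \<ominus> (x \<ominus> rep J z) = (s \<ominus> (x \<ominus> z)) \<oplus> (rep J z \<ominus> z)"
        using s x z rc by (simp add: add_normal)
      moreover have "s \<ominus> (x \<ominus> z) = (s \<ominus> (x \<ominus> rep J z)) \<ominus> (rep J z \<ominus> z)"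
        using s x z rc by (simp add: add_normal)
      ultimately show ?thesis
        using rep_prop(2)[OF J z] block_ideal_add[OF J] block_ideal_minus[OF J] by metis
    qed
    then have "tuples J ?X k (x \<ominus> z) = tuples J ?X k (x \<ominus> rep J z)"
      using list_sum_closed XR by (force simp: tuples_def)
    then show ?thesis by simp
  qed
  have tot: "card J * card (tuples J ?X (Suc k) x) = (\<Sum>z\<in>Z. ?c (x \<ominus> z))" if x: "x \<in> carrier R" for x
  proof -
    have "(\<Sum>z\<in>Z. ?c (x \<ominus> z)) = (\<Sum>z\<in>Z. ?c (x \<ominus> rep J z))"
      using c_shift[OF x] ZR by (intro sum.cong) auto
    also have "\<dots> = card J * (\<Sum>t\<in>?X. ?c (x \<ominus> t))"
      using sum_rep[OF J ZR JZ, of "\<lambda>t. ?c (x \<ominus> t)"] .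
    finally show ?thesis using step[OF x] by simp
  qed
  have "card J > 0" using block_ideal_zero[OF J] block_ideal_sub[OF J] finR finite_subset
    by (metis card_gt_0_iff empty_iff)
  show ?case unfolding block_const_iff
  proof (intro allI impI)
    fix x y assume xy: "same x y"
    then have "(\<Sum>z\<in>Z. ?c (x \<ominus> z)) = (\<Sum>z\<in>Z. ?c (y \<ominus> z))"
      using conv_sum[OF Suc Z] by (simp add: block_const_iff)
    then have "card J * card (tuples J ?X (Suc k) x) = card J * card (tuples J ?X (Suc k) y)"
      using tot same_carr[OF xy] by simp
    then show "card (tuples J ?X (Suc k) x) = card (tuples J ?X (Suc k) y)"
      using \<open>card J > 0\<close> by simp
  qed
qed

text \<open>The \<open>p\<close>-th power of \<open>\<Sum>Z\<close> in the group ring of \<open>R/J\<close>, modulo \<open>p\<close>: rotating \<open>p\<close>-tuples of cosets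
  leaves the constant ones. The factor \<open>card J\<close> avoids passing to the quotient.\<close>

lemma prime_power_const:
  assumes J: "block_ideal J" and Z: "blockset Z" and JZ: "J \<subseteq> stab Z" and p: "Factorial_Ring.prime p"
  shows "block_const S (\<lambda>x. card {z\<in>Z. \<guillemotleft>int p\<guillemotright> \<otimes> z \<ominus> x \<in> J} mod (card J * p))"
  unfolding block_const_iff
proof (intro allI impI)
  fix x y assume xy: "same x y"
  let ?X = "rep J ` Z"
  let ?q = "\<guillemotleft>int p\<guillemotright>"
  have ZR: "Z \<subseteq> carrier R" using Z by (simp add: blockset_def)
  have XR: "?X \<subseteq> carrier R" using ZR rep_prop[OF J] by auto
  have finX: "finite ?X" using XR finR finite_subset by blast
  have p0: "p > 0" using p prime_gt_0_nat by blast
  have *: "card {z\<in>Z. ?q \<otimes> z \<ominus> x \<in> J} mod (card J * p) = card J * (card (tuples J ?X p x) mod p)"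
    if x: "x \<in> carrier R" for x
  proof -
    let ?U = "{z\<in>Z. ?q \<otimes> z \<ominus> x \<in> J}"
    have shift: "?q \<otimes> z \<ominus> x \<in> J \<longleftrightarrow> ?q \<otimes> z' \<ominus> x \<in> J"
      if z: "z \<in> carrier R" "z' \<in> carrier R" "z \<ominus> z' \<in> J" for z z'
    proof -
      have m: "?q \<otimes> (z \<ominus> z') \<in> J" using block_ideal_mult[OF J z(3)] by simp
      have "?q \<otimes> z \<ominus> x = (?q \<otimes> z' \<ominus> x) \<oplus> ?q \<otimes> (z \<ominus> z')"
        "?q \<otimes> z' \<ominus> x = (?q \<otimes> z \<ominus> x) \<ominus> ?q \<otimes> (z \<ominus> z')"
        using z x by (simp_all add: r_distr r_minus add_normal)
      then show ?thesis using m block_ideal_add[OF J] block_ideal_minus[OF J] by metis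
    qed
    have UR: "?U \<subseteq> carrier R" using ZR by blast
    have JU: "J \<subseteq> stab ?U"
    proof
      fix j assume j: "j \<in> J"
      then have jc: "j \<in> carrier R" using block_ideal_sub[OF J] by blast
      have "z \<oplus> j \<in> ?U" if z: "z \<in> ?U" for z
      proof -
        have zc: "z \<in> carrier R" using z ZR by blast
        have "z \<oplus> j \<in> Z" using stab_plus[OF JZ] z j by blast
        moreover have "?q \<otimes> (z \<oplus> j) \<ominus> x \<in> J"
          using shift[of "z \<oplus> j" z] zc jc j z minus_add_cancel(3)[OF jc zc] by simp
        ultimately show ?thesis by simp
      qed
      then show "j \<in> stab ?U" using jc by (simp add: stab_def)
    qed
    have repZ: "rep J z \<in> Z" if z: "z \<in> Z" for z
    proof -
      have zc: "z \<in> carrier R" using z ZR by blast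
      show ?thesis using stab_diff_iff[OF J JZ rep_prop(1)[OF J zc] zc rep_prop(2)[OF J zc]] z by simp
    qed
    have img: "rep J ` ?U = {t\<in>?X. ?q \<otimes> t \<ominus> x \<in> J}"
    proof -
      have "?q \<otimes> rep J z \<ominus> x \<in> J \<longleftrightarrow> ?q \<otimes> z \<ominus> x \<in> J" if "z \<in> Z" for z
        using shift[of "rep J z" z] rep_prop[OF J, of z] that ZR by auto
      then show ?thesis by auto
    qed
    have cardU: "card ?U = card J * card {t\<in>?X. ?q \<otimes> t \<ominus> x \<in> J}"
      unfolding img[symmetric] by (rule card_rep[OF J UR JU])
    \<comment> \<open>The constant tuple with entry \<open>t\<close> has sum \<open>p t\<close>, so
      the fixed points of rotation are the representatives solving
      \<open>p t \<in> x + J\<close>.\<close>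
    have tup: "card (tuples J ?X p x) mod p = card {t\<in>?X. ?q \<otimes> t \<ominus> x \<in> J} mod p"
    proof -
      have "card (tuples J ?X p x) mod p = card {xs\<in>tuples J ?X p x. rotate1 xs = xs} mod p"
      proof (rule card_mod_prime_fixpoints[OF finite_tuples[OF finX] p])
        show "rotate1 xs \<in> tuples J ?X p x" if "xs \<in> tuples J ?X p x" for xs
          using that list_sum_rotate1 XR by (force simp: tuples_def)
        show "(rotate1 ^^ p) xs = xs" if "xs \<in> tuples J ?X p x" for xs
          using that rotate_id[of p xs] by (simp add: tuples_def rotate_def)
      qed
      also have "{xs\<in>tuples J ?X p x. rotate1 xs = xs}
        = {xs. length xs = p \<and> set xs \<subseteq> ?X \<and> rotate1 xs = xs \<and> list_sum xs \<ominus> x \<in> J}"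
        by (auto simp: tuples_def)
      also have "card \<dots> = card {t\<in>?X. list_sum (replicate p t) \<ominus> x \<in> J}"
        by (rule card_constant_lists[OF p0])
      also have "{t\<in>?X. list_sum (replicate p t) \<ominus> x \<in> J} = {t\<in>?X. ?q \<otimes> t \<ominus> x \<in> J}"
        using list_sum_replicate XR by (force simp: subset_iff)
      finally show ?thesis .
    qed
    show ?thesis unfolding cardU tup by (rule mult_mod_right[symmetric])
  qed
  show "card {z\<in>Z. ?q \<otimes> z \<ominus> x \<in> J} mod (card J * p) = card {z\<in>Z. ?q \<otimes> z \<ominus> y \<in> J} mod (card J * p)"
    using * same_carr[OF xy] tuples_const[OF J Z JZ, of p] xy by (simp add: block_const_iff)
qed

end

section \<open>Rational classes are separated by block ideals\<close>

locale cg_schur_ring = schur_ring R S + cg_ring R P e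
  for R (structure) and S P e
begin

lemma block_ideal_imp_ideal: "block_ideal J \<Longrightarrow> ideal J R"
  by (simp add: block_ideal_def)

text \<open>The ideal \<open>(J : p)\<close>. Its quotient by \<open>J\<close> is the
  \<open>p\<close>-torsion of \<open>R/J\<close> and replaces the socle when one works relative to
  \<open>J\<close>.\<close>

definition colon :: "'a set \<Rightarrow> nat \<Rightarrow> 'a set" where
  "colon J p = {b\<in>carrier R. q p \<otimes> b \<in> J}"

text \<open>Restricting to \<open>y\<close> with \<open>p\<close>-component in \<open>J\<close>
  loses nothing for sets stable under \<open>local_units p\<close>: the other points of a coset of
  \<open>colon J p\<close> are associates of each other, so a failure of invariance in the coset
  involves a point of the listed kind.\<close>

definition defect :: "'a set \<Rightarrow> nat \<Rightarrow> 'a set \<Rightarrow> 'a set" where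
  "defect J p Z = {y\<in>carrier R. e p \<otimes> y \<in> J \<and> (\<exists>b\<in>colon J p. (y \<in> Z) \<noteq> (y \<oplus> b \<in> Z))}"

lemma colon_ideal: assumes "block_ideal J" shows "ideal (colon J p) R"
proof (rule ideal_closedI)
  show "colon J p \<subseteq> carrier R" "\<zero> \<in> colon J p" using block_ideal_zero[OF assms] by (auto simp: colon_def)
  show "a \<oplus> b \<in> colon J p" if "a \<in> colon J p" "b \<in> colon J p" for a b
    using that block_ideal_add[OF assms] by (auto simp: colon_def r_distr)
  show "r \<otimes> a \<in> colon J p" if "r \<in> carrier R" "a \<in> colon J p" for r a
    using that block_ideal_mult[OF assms, of "q p \<otimes> a" r] by (auto simp: colon_def m_lcomm)
qed

lemma colon_sup: "block_ideal J \<Longrightarrow> J \<subseteq> colon J p"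
  using block_ideal_sub block_ideal_mult by (auto simp: colon_def)

lemma colon_comp:
  assumes J: "block_ideal J" and p: "p \<in> P" and b: "b \<in> colon J p" and eb: "e p \<otimes> b \<in> J"
  shows "b \<in> J"
proof (rule comp_ideal[OF block_ideal_imp_ideal[OF J]])
  show bc: "b \<in> carrier R" using b by (simp add: colon_def)
  show "e r \<otimes> b \<in> J" if "r \<in> P" for r
  proof (cases "r = p")
    case False
    show ?thesis
      by (rule comp_other[OF block_ideal_imp_ideal[OF J] p that False bc]) (use b in \<open>simp add: colon_def\<close>)
  qed (use eb in simp)
qed

text \<open>By \<open>local_associate\<close>, a local unit followed by a translation from
  \<open>J\<close> carries \<open>v\<close> to \<open>w\<close>, and both operations preserve
  \<open>Z\<close>.\<close>

lemma assoc_mem: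
  assumes J: "block_ideal J" and p: "p \<in> P" and Z: "Z \<subseteq> carrier R" "J \<subseteq> stab Z"
    and Zinv: "\<And>u z. u \<in> local_units p \<Longrightarrow> z \<in> Z \<Longrightarrow> u \<otimes> z \<in> Z"
    and v: "v \<in> Z" and w: "w \<in> carrier R" and vw: "w \<ominus> v \<in> colon J p"
    and ev: "e p \<otimes> v \<notin> J" and ew: "e p \<otimes> w \<notin> J"
  shows "w \<in> Z"
proof -
  have vc: "v \<in> carrier R" using v Z by blast
  obtain u where u: "u \<in> local_units p" "u \<otimes> v \<ominus> w \<in> J"
    using local_associate[OF block_ideal_imp_ideal[OF J] p vc w _ ev ew] vw by (auto simp: colon_def)
  have uv: "u \<otimes> v \<in> Z" by (rule Zinv[OF u(1) v])
  then show ?thesis using stab_diff_iff[OF J Z(2) _ w u(2)] Z(1) by blast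
qed

text \<open>Translation by an element of \<open>colon J p\<close> outside \<open>J\<close> permutes
  the cosets of \<open>J\<close> in \<open>colon J p\<close> with period \<open>p\<close> and
  without fixed points.\<close>

lemma card_colon:
  assumes J: "block_ideal J" and p: "p \<in> P" and ne: "colon J p \<noteq> J"
  shows "card J * p dvd card (colon J p)"
proof -
  let ?B = "colon J p"
  have id: "ideal ?B R" by (rule colon_ideal[OF J])
  have BR: "?B \<subseteq> carrier R" by (auto simp: colon_def)
  have JB: "J \<subseteq> stab ?B" using colon_sup[OF J] ideal_memb(3)[OF id] block_ideal_sub[OF J]
    by (auto simp: stab_def)
  have finB: "finite ?B" using BR finR finite_subset by blast
  obtain z where z: "z \<in> ?B" "z \<notin> J" using ne colon_sup[OF J] by blast
  have zc: "z \<in> carrier R" using z BR by blast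
  define f where "f t = rep J (t \<oplus> z)" for t
  have repB: "rep J b \<in> ?B" if b: "b \<in> ?B" for b
  proof -
    have bc: "b \<in> carrier R" using b BR by blast
    show ?thesis using stab_diff_iff[OF J JB rep_prop(1)[OF J bc] bc rep_prop(2)[OF J bc]] b by simp
  qed
  have pow: "(f ^^ k) (rep J b) = rep J (b \<oplus> \<guillemotleft>int k\<guillemotright> \<otimes> z)" if b: "b \<in> carrier R" for k b
  proof (induction k)
    case 0
    then show ?case using b zc by simp
  next
    case (Suc k)
    let ?y = "b \<oplus> \<guillemotleft>int k\<guillemotright> \<otimes> z"
    have yc: "?y \<in> carrier R" using b zc by simp
    have "(rep J ?y \<oplus> z) \<ominus> (?y \<oplus> z) = rep J ?y \<ominus> ?y"
      using rep_prop(1)[OF J yc] yc zc by (simp add: add_normal)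
    then have "rep J (rep J ?y \<oplus> z) = rep J (?y \<oplus> z)"
      using rep_eq_iff[OF J, of "rep J ?y \<oplus> z" "?y \<oplus> z"] rep_prop[OF J yc] yc zc by simp
    moreover have "?y \<oplus> z = b \<oplus> \<guillemotleft>int (Suc k)\<guillemotright> \<otimes> z" using b zc by (simp add: l_distr a_ac)
    ultimately show ?case using Suc by (simp add: f_def)
  qed
  have "card (rep J ` ?B) mod p = card {a\<in>rep J ` ?B. f a = a} mod p"
  proof (rule card_mod_prime_fixpoints)
    show "finite (rep J ` ?B)" using finB by simp
    show "Factorial_Ring.prime p" by (rule primeP[OF p])
    fix a assume "a \<in> rep J ` ?B"
    then obtain b where b: "b \<in> ?B" "a = rep J b" by blast
    have bc: "b \<in> carrier R" using b BR by blast
    have "f a \<in> rep J ` ?B"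
    proof -
      have "rep J b \<oplus> z \<in> ?B" using repB[OF b(1)] z ideal_memb(3)[OF id] by blast
      then show ?thesis by (simp add: f_def b)
    qed
    then show "f a \<in> rep J ` ?B" .
    have "(f ^^ p) a = rep J (b \<oplus> q p \<otimes> z)" using pow[OF bc] b by simp
    also have "\<dots> = rep J b"
    proof -
      have "q p \<otimes> z \<in> J" using z by (simp add: colon_def)
      then show ?thesis using rep_eq_iff[OF J, of "b \<oplus> q p \<otimes> z" b] bc zc
        by (simp add: minus_add_cancel)
    qed
    finally show "(f ^^ p) a = a" using b by simp
  qed
  also have "{a\<in>rep J ` ?B. f a = a} = {}"
  proof -
    have False if b: "b \<in> ?B" and fx: "f (rep J b) = rep J b" for b
    proof -
      have bc: "b \<in> carrier R" using b BR by blast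
      have rc: "rep J b \<in> carrier R" using rep_prop[OF J bc] by simp
      have "rep J (rep J b \<oplus> z) = rep J (rep J b)" using fx rep_rep[OF J bc] by (simp add: f_def)
      then have "rep J b \<oplus> z \<ominus> rep J b \<in> J"
        using rep_eq_iff[OF J, of "rep J b \<oplus> z" "rep J b"] rc zc by simp
      then show False using z minus_add_cancel(3)[OF zc rc] by simp
    qed
    then show ?thesis by blast
  qed
  finally have "p dvd card (rep J ` ?B)" by (simp add: dvd_eq_mod_eq_0)
  then show ?thesis using card_rep[OF J BR JB] by simp
qed

text \<open>The defect consists of those \<open>y\<close> for which the number of \<open>z \<in> Z\<close> with \<open>pz - uy \<in> J\<close> is not divisible
  by \<open>p\<close> times \<open>card J\<close>, where the unit \<open>u\<close> is \<open>1\<close> in \<open>R\<^sub>p\<close> and \<open>p\<close> in the other components.\<close>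

lemma defect_blockset:
  assumes J: "block_ideal J" and p: "p \<in> P" and Z: "blockset Z" "J \<subseteq> stab Z"
    and Zinv: "\<And>u z. u \<in> local_units p \<Longrightarrow> z \<in> Z \<Longrightarrow> u \<otimes> z \<in> Z"
  shows "blockset (defect J p Z)"
proof (cases "colon J p = J")
  case True
  have "defect J p Z = {}"
    unfolding defect_def True using stab_iff[OF J Z(2)] by auto
  then show ?thesis by (simp add: blockset_def)
next
  case BJ: False
  let ?B = "colon J p" and ?N = "card J * p"
  have id: "ideal ?B R" by (rule colon_ideal[OF J])
  have Jid: "ideal J R" by (rule block_ideal_imp_ideal[OF J])
  have ZR: "Z \<subseteq> carrier R" using Z by (simp add: blockset_def)
  have BR: "?B \<subseteq> carrier R" by (auto simp: colon_def)
  have finB: "finite ?B" using BR finR finite_subset by blast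
  have ep: "e p \<in> carrier R" using e_closed p by simp
  define u where "u = glue (\<lambda>r. if r = p then \<one> else q p)"
  have uc: "u \<in> carrier R" unfolding u_def by (rule glue_closed) auto
  have eu: "e r \<otimes> u = e r \<otimes> (if r = p then \<one> else q p)" if "r \<in> P" for r
    unfolding u_def by (rule e_glue[OF that]) auto
  have uU: "u \<in> Units R"
  proof (rule unitI[OF uc])
    fix r assume r: "r \<in> P"
    show "u \<notin> max_ideal r"
    proof (cases "r = p")
      case True
      then show ?thesis
        using max_ideal_iff[OF p uc] max_ideal_iff[OF p, of \<one>] one_notin_max_ideal[OF p] eu[OF p] by simp
    next
      case False
      then show ?thesis
        using max_ideal_iff[OF r uc] max_ideal_iff[OF r, of "q p"] other_prime[OF p r] eu[OF r] by simp
    qed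
  qed
  have shiftB: "q p \<otimes> z' \<ominus> u \<otimes> y \<in> J \<longleftrightarrow> z' \<ominus> z \<in> ?B"
    if z: "z \<in> carrier R" "z' \<in> carrier R" "y \<in> carrier R" "q p \<otimes> z \<ominus> u \<otimes> y \<in> J" for z z' y
  proof -
    have 1: "q p \<otimes> z' \<ominus> u \<otimes> y = q p \<otimes> (z' \<ominus> z) \<oplus> (q p \<otimes> z \<ominus> u \<otimes> y)"
     and 2: "q p \<otimes> (z' \<ominus> z) = (q p \<otimes> z' \<ominus> u \<otimes> y) \<ominus> (q p \<otimes> z \<ominus> u \<otimes> y)"
      using z uc by (simp_all add: r_distr r_minus add_normal)
    have "q p \<otimes> z' \<ominus> u \<otimes> y \<in> J \<longleftrightarrow> q p \<otimes> (z' \<ominus> z) \<in> J"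
      using z(4) 1 2 block_ideal_add[OF J] block_ideal_minus[OF J] by metis
    then show ?thesis using z by (simp add: colon_def)
  qed
  \<comment> \<open>This explains \<open>u\<close>: if the \<open>p\<close>-component of
    \<open>y\<close> lies in \<open>J\<close>, then \<open>z = y\<close> solves
    \<open>p z = u y\<close> modulo \<open>J\<close>, so by \<open>shiftB\<close> the solutions form
    the coset of \<open>colon J p\<close> through \<open>y\<close>.\<close>
  have self: "q p \<otimes> y \<ominus> u \<otimes> y \<in> J" if y: "y \<in> carrier R" "e p \<otimes> y \<in> J" for y
  proof (rule comp_ideal[OF Jid])
    show "q p \<otimes> y \<ominus> u \<otimes> y \<in> carrier R" using y uc by simp
    fix r assume r: "r \<in> P"
    have er: "e r \<in> carrier R" using e_closed r by simp
    have exp: "e r \<otimes> (q p \<otimes> y \<ominus> u \<otimes> y) = (e r \<otimes> q p) \<otimes> y \<ominus> (e r \<otimes> u) \<otimes> y"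
      using er y uc by (simp add: minus_eq r_distr r_minus m_assoc)
    show "e r \<otimes> (q p \<otimes> y \<ominus> u \<otimes> y) \<in> J"
    proof (cases "r = p")
      case True
      have "e r \<otimes> (q p \<otimes> y \<ominus> u \<otimes> y) = q p \<otimes> (e p \<otimes> y) \<ominus> e p \<otimes> y"
        unfolding exp using True eu[OF r] er y by (simp add: m_ac)
      then show ?thesis using block_ideal_minus[OF J block_ideal_mult[OF J y(2)] y(2)] by simp
    next
      case False
      have "e r \<otimes> (q p \<otimes> y \<ominus> u \<otimes> y) = \<zero>"
        unfolding exp using False eu[OF r] er y by (simp add: minus_self)
      then show ?thesis using block_ideal_zero[OF J] by simp
    qed
  qed
  have compo: "e p \<otimes> y \<in> J"
    if z: "z \<in> carrier R" "y \<in> carrier R" "q p \<otimes> z \<ominus> u \<otimes> y \<in> J" "e p \<otimes> z \<in> J" for z y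
  proof -
    have "e p \<otimes> (q p \<otimes> z \<ominus> u \<otimes> y) = q p \<otimes> (e p \<otimes> z) \<ominus> (e p \<otimes> u) \<otimes> y"
      using ep z uc by (simp add: minus_eq r_distr r_minus m_ac)
    also have "(e p \<otimes> u) \<otimes> y = e p \<otimes> y" using eu[OF p] ep by simp
    finally have "q p \<otimes> (e p \<otimes> z) \<ominus> e p \<otimes> y \<in> J" using block_ideal_mult[OF J z(3) ep] by simp
    moreover have "q p \<otimes> (e p \<otimes> z) \<in> J" using block_ideal_mult[OF J z(4)] by simp
    ultimately have "q p \<otimes> (e p \<otimes> z) \<ominus> (q p \<otimes> (e p \<otimes> z) \<ominus> e p \<otimes> y) \<in> J"
      using block_ideal_minus[OF J] by blast
    then show ?thesis using ep z by (simp add: add_normal)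
  qed
  have finJ: "finite J" using block_ideal_sub[OF J] finR finite_subset by blast
  have cardJ: "card J > 0" using block_ideal_zero[OF J] finJ by (auto simp: card_gt_0_iff)
  have p2: "p \<ge> 2" using primeP[OF p] prime_ge_2_nat by blast
  have dvdB: "?N dvd card ?B" by (rule card_colon[OF J p BJ])
  have NJ: "card J mod ?N \<noteq> 0" using cardJ p2 by (simp add: mod_less)
  \<comment> \<open>Possible sizes of the intersection of \<open>Z\<close> with the coset are 0,
    \<open>card ?B\<close>, \<open>card J\<close> and \<open>card ?B - card J\<close>. The first two
    vanish modulo \<open>?N\<close> by \<open>dvdB\<close>, the last two do not.\<close>
  have key: "y \<in> defect J p Z \<longleftrightarrow> card {z\<in>Z. q p \<otimes> z \<ominus> u \<otimes> y \<in> J} mod ?N \<noteq> 0"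
    if y: "y \<in> carrier R" for y
  proof
    assume ne: "card {z\<in>Z. q p \<otimes> z \<ominus> u \<otimes> y \<in> J} mod ?N \<noteq> 0"
    then have "{z\<in>Z. q p \<otimes> z \<ominus> u \<otimes> y \<in> J} \<noteq> {}" by (metis card.empty mod_0)
    then obtain z0 where z0: "z0 \<in> Z" "q p \<otimes> z0 \<ominus> u \<otimes> y \<in> J" by blast
    have z0c: "z0 \<in> carrier R" using z0 ZR by blast
    have "\<exists>b\<in>?B. z0 \<oplus> b \<notin> Z"
    proof (rule ccontr)
      assume all: "\<not> (\<exists>b\<in>?B. z0 \<oplus> b \<notin> Z)"
      have "{z\<in>Z. q p \<otimes> z \<ominus> u \<otimes> y \<in> J} = (\<lambda>b. z0 \<oplus> b) ` ?B"
      proof (intro equalityI subsetI)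
        fix z assume z: "z \<in> {z\<in>Z. q p \<otimes> z \<ominus> u \<otimes> y \<in> J}"
        then have zc: "z \<in> carrier R" using ZR by blast
        then have "z \<ominus> z0 \<in> ?B" using shiftB[OF z0c zc y z0(2)] z by blast
        moreover have "z = z0 \<oplus> (z \<ominus> z0)" using minus_add_cancel(2)[OF zc z0c] by simp
        ultimately show "z \<in> (\<lambda>b. z0 \<oplus> b) ` ?B" by blast
      next
        fix z assume "z \<in> (\<lambda>b. z0 \<oplus> b) ` ?B"
        then obtain b where b: "b \<in> ?B" "z = z0 \<oplus> b" by blast
        have bc: "b \<in> carrier R" using b BR by blast
        then have "z \<ominus> z0 = b" using b minus_add_cancel(3)[OF bc z0c] by simp
        then have "q p \<otimes> z \<ominus> u \<otimes> y \<in> J" using shiftB[OF z0c _ y z0(2), of z] b bc z0c by simp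
        then show "z \<in> {z\<in>Z. q p \<otimes> z \<ominus> u \<otimes> y \<in> J}" using b all by blast
      qed
      moreover have "inj_on (\<lambda>b. z0 \<oplus> b) ?B" using BR z0c by (auto simp: inj_on_def subset_iff)
      ultimately have "card {z\<in>Z. q p \<otimes> z \<ominus> u \<otimes> y \<in> J} = card ?B" by (simp add: card_image)
      then show False using ne dvdB by simp
    qed
    then obtain b where b: "b \<in> ?B" "z0 \<oplus> b \<notin> Z" by blast
    have bc: "b \<in> carrier R" using b BR by blast
    have zbJ: "q p \<otimes> (z0 \<oplus> b) \<ominus> u \<otimes> y \<in> J"
      using shiftB[OF z0c _ y z0(2), of "z0 \<oplus> b"] b bc z0c minus_add_cancel(3)[OF bc z0c] by simp
    have "e p \<otimes> z0 \<in> J \<or> e p \<otimes> (z0 \<oplus> b) \<in> J"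
      using assoc_mem[OF J p ZR Z(2) Zinv z0(1), of "z0 \<oplus> b"] b bc z0c minus_add_cancel(3)[OF bc z0c]
      by auto
    then have ey: "e p \<otimes> y \<in> J" using compo[OF z0c y z0(2)] compo[OF _ y zbJ] z0c bc by auto
    have "\<exists>b\<in>?B. (y \<in> Z) \<noteq> (y \<oplus> b \<in> Z)"
    proof (cases "y \<in> Z")
      case False
      have "z0 \<ominus> y \<in> ?B" using shiftB[OF y z0c y self[OF y ey]] z0 by blast
      then show ?thesis using False z0 minus_add_cancel(2)[OF z0c y] by (metis (no_types, lifting))
    next
      case True
      have zb: "z0 \<oplus> b \<in> carrier R" using z0c bc by simp
      have "(z0 \<oplus> b) \<ominus> y \<in> ?B" using shiftB[OF y zb y self[OF y ey]] zbJ by blast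
      then show ?thesis using True b minus_add_cancel(2)[OF zb y] by (metis (no_types, lifting))
    qed
    then show "y \<in> defect J p Z" using y ey by (simp add: defect_def)
  next
    assume "y \<in> defect J p Z"
    then obtain b0 where ey: "e p \<otimes> y \<in> J" and b0: "b0 \<in> ?B" "(y \<in> Z) \<noteq> (y \<oplus> b0 \<in> Z)"
      by (auto simp: defect_def)
    have F: "{z\<in>Z. q p \<otimes> z \<ominus> u \<otimes> y \<in> J} = {z\<in>Z. z \<ominus> y \<in> ?B}"
      using shiftB[OF y _ y self[OF y ey]] ZR by blast
    have b0c: "b0 \<in> carrier R" using b0 BR by blast
    have e_out: "e p \<otimes> (y \<oplus> b) \<notin> J" if b: "b \<in> ?B" "b \<notin> J" for b
    proof
      assume m: "e p \<otimes> (y \<oplus> b) \<in> J"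
      have bc: "b \<in> carrier R" using b BR by blast
      have "e p \<otimes> (y \<oplus> b) \<ominus> e p \<otimes> y = e p \<otimes> b" using ep y bc by (simp add: r_distr minus_add_cancel)
      then have "e p \<otimes> b \<in> J" using block_ideal_minus[OF J m ey] by simp
      then show False using colon_comp[OF J p b(1)] b by blast
    qed
    have move: "y \<oplus> b' \<in> Z" if b: "b \<in> ?B" "b \<notin> J" "y \<oplus> b \<in> Z" "b' \<in> ?B" "b' \<notin> J" for b b'
    proof (rule assoc_mem[OF J p ZR Z(2) Zinv b(3)])
      have bc: "b \<in> carrier R" "b' \<in> carrier R" using b BR by auto
      show "y \<oplus> b' \<in> carrier R" using y bc by simp
      have "(y \<oplus> b') \<ominus> (y \<oplus> b) = b' \<ominus> b" using y bc by (simp add: add_normal)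
      then show "(y \<oplus> b') \<ominus> (y \<oplus> b) \<in> ?B" using ideal_memb(4)[OF id] b by simp
      show "e p \<otimes> (y \<oplus> b) \<notin> J" "e p \<otimes> (y \<oplus> b') \<notin> J" using e_out b by auto
    qed
    have b0J: "b0 \<notin> J" using b0 stab_iff[OF J Z(2) y] by blast
    show "card {z\<in>Z. q p \<otimes> z \<ominus> u \<otimes> y \<in> J} mod ?N \<noteq> 0"
    proof (cases "y \<in> Z")
      case True
      have "{z\<in>Z. z \<ominus> y \<in> ?B} = (\<lambda>j. y \<oplus> j) ` J"
      proof (intro equalityI subsetI)
        fix z assume z: "z \<in> {z\<in>Z. z \<ominus> y \<in> ?B}"
        then have zc: "z \<in> carrier R" using ZR by blast
        have zy: "z = y \<oplus> (z \<ominus> y)" using minus_add_cancel(2)[OF zc y] by simp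
        have "z \<ominus> y \<in> J"
        proof (rule ccontr)
          assume "z \<ominus> y \<notin> J"
          then have "y \<oplus> b0 \<in> Z" using move[of "z \<ominus> y" b0] z zy b0 b0J by simp
          then show False using b0 True by simp
        qed
        then show "z \<in> (\<lambda>j. y \<oplus> j) ` J" using zy by blast
      next
        fix z assume "z \<in> (\<lambda>j. y \<oplus> j) ` J"
        then obtain j where j: "j \<in> J" "z = y \<oplus> j" by blast
        have jc: "j \<in> carrier R" using j block_ideal_sub[OF J] by blast
        show "z \<in> {z\<in>Z. z \<ominus> y \<in> ?B}"
          using j stab_plus[OF Z(2) True] colon_sup[OF J] minus_add_cancel(3)[OF jc y] by auto
      qed
      moreover have "inj_on (\<lambda>j. y \<oplus> j) J"
        using block_ideal_sub[OF J] y by (auto simp: inj_on_def subset_iff)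
      ultimately show ?thesis using F NJ by (simp add: card_image)
    next
      case False
      have "{z\<in>Z. z \<ominus> y \<in> ?B} = (\<lambda>b. y \<oplus> b) ` (?B - J)"
      proof (intro equalityI subsetI)
        fix z assume z: "z \<in> {z\<in>Z. z \<ominus> y \<in> ?B}"
        then have zc: "z \<in> carrier R" using ZR by blast
        have zy: "z = y \<oplus> (z \<ominus> y)" using minus_add_cancel(2)[OF zc y] by simp
        have "z \<ominus> y \<notin> J" using stab_diff_iff[OF J Z(2) zc y] z False by blast
        then show "z \<in> (\<lambda>b. y \<oplus> b) ` (?B - J)" using zy z by blast
      next
        fix z assume "z \<in> (\<lambda>b. y \<oplus> b) ` (?B - J)"
        then obtain b where b: "b \<in> ?B" "b \<notin> J" "z = y \<oplus> b" by blast
        have bc: "b \<in> carrier R" using b BR by blast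
        have "y \<oplus> b \<in> Z" using move[OF b0(1) b0J _ b(1,2)] b0 False by simp
        then show "z \<in> {z\<in>Z. z \<ominus> y \<in> ?B}" using b minus_add_cancel(3)[OF bc y] by simp
      qed
      moreover have "inj_on (\<lambda>b. y \<oplus> b) (?B - J)" using BR y by (auto simp: inj_on_def subset_iff)
      ultimately have "card {z\<in>Z. z \<ominus> y \<in> ?B} = card (?B - J)" by (simp add: card_image)
      also have "card (?B - J) = card ?B - card J"
        using colon_sup[OF J] finJ by (intro card_Diff_subset) auto
      finally have c: "card {z\<in>Z. z \<ominus> y \<in> ?B} = card ?B - card J" .
      have le: "card J \<le> card ?B" using colon_sup[OF J] finB by (intro card_mono) auto
      show ?thesis
      proof
        assume "card {z\<in>Z. q p \<otimes> z \<ominus> u \<otimes> y \<in> J} mod ?N = 0"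
        then have "?N dvd card ?B - card J" using c F by (simp add: dvd_eq_mod_eq_0)
        then have "?N dvd card J" using dvdB le dvd_diffD1 by blast
        then show False using NJ by (simp add: dvd_eq_mod_eq_0)
      qed
    qed
  qed
  show ?thesis unfolding blockset_def
  proof (intro conjI allI impI)
    show "defect J p Z \<subseteq> carrier R" by (auto simp: defect_def)
    fix x y assume xy: "same x y" and x: "x \<in> defect J p Z"
    have "same (u \<otimes> x) (u \<otimes> y)" by (rule same_unit[OF uU xy])
    then have "card {z\<in>Z. q p \<otimes> z \<ominus> u \<otimes> x \<in> J} mod ?N = card {z\<in>Z. q p \<otimes> z \<ominus> u \<otimes> y \<in> J} mod ?N"
      using prime_power_const[OF J Z primeP[OF p]] by (simp add: block_const_iff)
    then show "y \<in> defect J p Z" using key same_carr[OF xy] x by simp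
  qed
qed

definition same_ideals :: "'a \<Rightarrow> 'a \<Rightarrow> bool" where
  "same_ideals x y \<longleftrightarrow> (\<forall>L. block_ideal L \<longrightarrow> (x \<in> L \<longleftrightarrow> y \<in> L))"

text \<open>The stabilizer of a rational set is closed under units by \<open>stab_unit\<close>, and
  \<open>unit_invariant_ideal\<close> extends this to all multipliers.\<close>

lemma stab_block_ideal:
  assumes "rational V" shows "block_ideal (stab V)"
  unfolding block_ideal_def
proof
  have VR: "V \<subseteq> carrier R" "blockset V" using assms by (auto simp: rational_def blockset_def)
  show "blockset (stab V)" by (rule stab_blockset[OF VR(2)])
  show "ideal (stab V) R"
    by (rule unit_invariant_ideal) (use stab_carr stab_zero[OF VR(1)] stab_add[OF VR(1)] stab_unit[OF assms] in auto)
qed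

lemma block_ideal_rational: assumes "block_ideal L" shows "rational L"
  using assms block_ideal_mult[OF assms]
    unfolding rational_def by (simp add: block_ideal_def Units_closed)

text \<open>Induction on the index of \<open>J\<close> and then on the number of components outside \<open>Q\<close>. If \<open>W\<close> is minimal, it
  either lies in its defect at \<open>p\<close>, so that \<open>p\<close> can be added to \<open>Q\<close>, or its union with the defect is
  invariant under a larger ideal.\<close>

lemma rational_closed_same_ideals:
  assumes "block_ideal J" "Q \<subseteq> P" "rational W" "J \<subseteq> stab W" "\<And>w r. w \<in> W \<Longrightarrow> r \<in> Q \<Longrightarrow> e r \<otimes> w \<in> J"
    "x \<in> W" "y \<in> carrier R" "same_ideals x y"
  shows "y \<in> W"
  using assms
\<comment> \<open>The weight \<open>card P + 1\<close> exceeds every possible value of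
  \<open>card (P - Q)\<close>, so a larger \<open>J\<close> pays for a restart with empty
  \<open>Q\<close>.\<close>
proof (induction "(card (carrier R) - card J) * (card P + 1) + card (P - Q)" arbitrary: J Q W x y
    rule: less_induct)
  case less
  note J = less.prems(1) and QP = less.prems(2) and W = less.prems(3) and JW = less.prems(4)
    and WQ = less.prems(5) and x = less.prems(6) and y = less.prems(7) and xy = less.prems(8)
  have JR: "J \<subseteq> carrier R" by (rule block_ideal_sub[OF J])
  have WR: "W \<subseteq> carrier R" using W by (simp add: rational_def blockset_def)
  have xc: "x \<in> carrier R" using x WR by blast
  show ?case
  proof (cases "Q = P")
    case True
    \<comment> \<open>With all components in \<open>J\<close>, the set \<open>W\<close> lies in the
      block ideal \<open>J\<close>. Then \<open>y\<close> does so as well, and passing from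
      \<open>x\<close> to \<open>y\<close> is a translation by an element of
      \<open>J\<close>.\<close>
    have WJ: "W \<subseteq> J"
    proof
      fix w assume w: "w \<in> W"
      show "w \<in> J" by (rule comp_ideal[OF block_ideal_imp_ideal[OF J]]) (use w WR WQ True in auto)
    qed
    then have yJ: "y \<in> J" using xy J x by (auto simp: same_ideals_def)
    then have "y \<ominus> x \<in> J" using block_ideal_minus[OF J] WJ x by blast
    then have "x \<oplus> (y \<ominus> x) \<in> W" using stab_plus[OF JW x] by blast
    then show ?thesis using minus_add_cancel(2)[OF y xc] by simp
  next
    case False
    then obtain p where p: "p \<in> P" "p \<notin> Q" using QP by blast
    have ep: "e p \<in> carrier R" using e_closed p by simp
    \<comment> \<open>The smallest \<open>J\<close>-invariant rational set containing
      \<open>x\<close>. By \<open>minA\<close> it is an atom among such sets, so it is either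
      contained in its defect or disjoint from it.\<close>
    define A where "A = \<Inter>{V. rational V \<and> J \<subseteq> stab V \<and> x \<in> V}"
    have AW: "A \<subseteq> W" unfolding A_def using W JW x by blast
    have xA: "x \<in> A" by (simp add: A_def)
    have rA: "rational A"
      unfolding rational_def blockset_def
    proof (intro conjI allI impI ballI)
      show "A \<subseteq> carrier R" using AW WR by blast
      show "b \<in> A" if "same a b" "a \<in> A" for a b
        using that unfolding A_def rational_def blockset_def by blast
      show "u \<otimes> w \<in> A" if "u \<in> Units R" "w \<in> A" for u w
        using that unfolding A_def rational_def by blast
    qed
    have JA: "J \<subseteq> stab A"
    proof
      fix j assume j: "j \<in> J"
      have "z \<oplus> j \<in> A" if "z \<in> A" for z
        using that j stab_plus unfolding A_def by blast
      then show "j \<in> stab A" using j JR by (auto simp: stab_def)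
    qed
    have minA: "A \<subseteq> V \<or> A \<inter> V = {}" if V: "rational V" "J \<subseteq> stab V" for V
    proof (cases "x \<in> V")
      case True
      then show ?thesis unfolding A_def using V by blast
    next
      case False
      have "rational (A - V)"
        unfolding rational_def
      proof (intro conjI ballI)
        show "blockset (A - V)" using blockset_Diff rA V by (simp add: rational_def)
        fix u w assume u: "u \<in> Units R" and w: "w \<in> A - V"
        have wc: "w \<in> carrier R" using w AW WR by blast
        have "u \<otimes> w \<notin> V"
        proof
          assume "u \<otimes> w \<in> V"
          then have "inv u \<otimes> (u \<otimes> w) \<in> V" using V u by (simp add: rational_def)
          then show False using u wc w by (simp add: m_assoc[symmetric] Units_closed)
        qed
        then show "u \<otimes> w \<in> A - V" using rA u w by (simp add: rational_def)
      qed
      moreover have "J \<subseteq> stab (A - V)"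
      proof
        fix j assume j: "j \<in> J"
        have "z \<oplus> j \<in> A - V" if z: "z \<in> A - V" for z
        proof -
          have zc: "z \<in> carrier R" using z AW WR by blast
          show ?thesis using stab_plus[OF JA _ j] stab_iff[OF J V(2) zc j] z by blast
        qed
        then show "j \<in> stab (A - V)" using j JR by (auto simp: stab_def)
      qed
      ultimately have "A \<subseteq> A - V" unfolding A_def using False xA
        by (intro Inter_lower) (auto simp: A_def)
      then show ?thesis by blast
    qed
    have AR: "A \<subseteq> carrier R" using AW WR by blast
    have AQ: "e r \<otimes> w \<in> J" if "w \<in> A" "r \<in> Q" for w r using that AW WQ by blast
    have finPQ: "finite (P - Q)" using finP by simp
    have smaller: "card (P - insert p Q) < card (P - Q)"
      using finPQ p by (intro psubset_card_mono) auto
    have insQ: "insert p Q \<subseteq> P" using QP p by simp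
    note IHQ = less.hyps[of J "insert p Q", OF _ J insQ]
    have caseQ: "y \<in> V" if V: "rational V" "J \<subseteq> stab V" "\<And>w r. w \<in> V \<Longrightarrow> r \<in> Q \<Longrightarrow> e r \<otimes> w \<in> J"
      "\<And>w. w \<in> V \<Longrightarrow> e p \<otimes> w \<in> J" and xy: "x \<in> V" "y \<in> carrier R" "same_ideals x y" for V x y
      by (rule IHQ[OF _ V(1,2) _ xy]) (use V(3,4) smaller in auto)
    let ?B = "colon J p" and ?D = "defect J p A"
    have BR: "?B \<subseteq> carrier R" by (auto simp: colon_def)
    have Bid: "ideal ?B R" by (rule colon_ideal[OF J])
    have Ainv: "\<And>u z. u \<in> local_units p \<Longrightarrow> z \<in> A \<Longrightarrow> u \<otimes> z \<in> A"
      using rA by (simp add: rational_def local_units_def)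
    have uA: "u \<otimes> w \<in> A \<longleftrightarrow> w \<in> A" if u: "u \<in> Units R" and w: "w \<in> carrier R" for u w
    proof
      assume "u \<otimes> w \<in> A"
      then have "inv u \<otimes> (u \<otimes> w) \<in> A" using rA u by (simp add: rational_def)
      then show "w \<in> A" using u w by (simp add: m_assoc[symmetric] Units_closed)
    qed (use rA u in \<open>simp add: rational_def\<close>)
    have DR: "?D \<subseteq> carrier R" by (auto simp: defect_def)
    have De: "e p \<otimes> w \<in> J" if "w \<in> ?D" for w using that by (simp add: defect_def)
    have rD: "rational ?D"
      unfolding rational_def
    proof (intro conjI ballI)
      show "blockset ?D" using defect_blockset[OF J p(1) _ JA Ainv] rA by (simp add: rational_def)
      fix u w assume u: "u \<in> Units R" and w: "w \<in> ?D"
      obtain b where b: "b \<in> ?B" "(w \<in> A) \<noteq> (w \<oplus> b \<in> A)" using w by (auto simp: defect_def)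
      have c: "u \<in> carrier R" "w \<in> carrier R" "b \<in> carrier R" using u w DR b BR by auto
      have "u \<otimes> b \<in> ?B" using ideal_memb(6)[OF Bid b(1) c(1)] .
      moreover have "(u \<otimes> w \<in> A) \<noteq> (u \<otimes> w \<oplus> u \<otimes> b \<in> A)"
        using uA[OF u c(2)] uA[OF u, of "w \<oplus> b"] b c by (simp add: r_distr)
      moreover have "e p \<otimes> (u \<otimes> w) \<in> J"
        using block_ideal_mult[OF J De[OF w] c(1)] ep c by (simp add: m_lcomm)
      ultimately show "u \<otimes> w \<in> ?D" using c by (auto simp: defect_def)
    qed
    have JD: "J \<subseteq> stab ?D"
    proof
      fix j assume j: "j \<in> J"
      have jc: "j \<in> carrier R" using j JR by blast
      have "w \<oplus> j \<in> ?D" if w: "w \<in> ?D" for w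
      proof -
        obtain b where b: "b \<in> ?B" "(w \<in> A) \<noteq> (w \<oplus> b \<in> A)" using w by (auto simp: defect_def)
        have c: "w \<in> carrier R" "b \<in> carrier R" using w DR b BR by auto
        have "w \<oplus> j \<oplus> b = w \<oplus> b \<oplus> j" using c jc by (simp add: a_ac)
        then have "(w \<oplus> j \<in> A) \<noteq> (w \<oplus> j \<oplus> b \<in> A)"
          using stab_iff[OF J JA c(1) j] stab_iff[OF J JA _ j, of "w \<oplus> b"] b c by simp
        moreover have "e p \<otimes> (w \<oplus> j) \<in> J"
          using block_ideal_add[OF J De[OF w] block_ideal_mult[OF J j ep]] ep c jc by (simp add: r_distr)
        ultimately show ?thesis using b c jc by (auto simp: defect_def)
      qed
      then show "j \<in> stab ?D" using jc by (simp add: stab_def)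
    qed
    have "y \<in> A"
    proof (cases "A \<subseteq> ?D \<or> (\<forall>w\<in>A. e p \<otimes> w \<in> J)")
      case True
      then have "\<And>w. w \<in> A \<Longrightarrow> e p \<otimes> w \<in> J" using De by blast
      then show ?thesis using caseQ[OF rA JA AQ _ xA y xy] by blast
    next
      case False
      then have AD: "A \<inter> ?D = {}" using minA[OF rD JD] by blast
      have eJ: "e p \<notin> J"
      proof
        assume "e p \<in> J"
        then have "\<forall>w\<in>A. e p \<otimes> w \<in> J"
          using block_ideal_mult[OF J] ep AR m_comm by (metis subsetD)
        then show False using False by blast
      qed
      let ?V = "A \<union> ?D"
      have rV: "rational ?V" using rA rD blockset_Un by (auto simp: rational_def)
      have D_out: "y \<in> ?D \<longleftrightarrow> y \<in> carrier R \<and> e p \<otimes> y \<in> J \<and> y \<notin> A \<and> (\<exists>b\<in>?B. y \<oplus> b \<in> A)" for y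
        using AD by (auto simp: defect_def)
      have AinJ: "a \<notin> A" if "a \<in> carrier R" "e p \<otimes> a \<in> J" "b \<in> ?B" "a \<oplus> b \<notin> A" for a b
        using that AD by (auto simp: defect_def)
      have move: "a' \<in> A" if a: "a \<in> A" and a': "a' \<in> carrier R" and d: "a' \<ominus> a \<in> ?B"
        and ea': "e p \<otimes> a' \<notin> J" for a a'
      proof -
        have ac: "a \<in> carrier R" using a AR by blast
        have "a \<oplus> (a' \<ominus> a) = a'" using minus_add_cancel(2)[OF a' ac] .
        then have "e p \<otimes> a \<notin> J \<or> a' \<in> A" using AinJ[OF ac _ d] a by metis
        then show ?thesis using assoc_mem[OF J p(1) AR JA Ainv a a' d _ ea'] by blast
      qed
      \<comment> \<open>A coset of \<open>colon J p\<close> that meets \<open>?V\<close> contains a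
        point of \<open>A\<close>. Then its points with \<open>p\<close>-component outside
        \<open>J\<close> are in \<open>A\<close> by \<open>move\<close>, and its other points are in
        \<open>A\<close> or in the defect by \<open>D_out\<close>.\<close>
      have BV: "?B \<subseteq> stab ?V"
      proof
        fix b assume b: "b \<in> ?B"
        have bc: "b \<in> carrier R" using b BR by blast
        have "v \<oplus> b \<in> ?V" if v: "v \<in> ?V" for v
        proof -
          have vc: "v \<in> carrier R" using v AR DR by blast
          have vb: "v \<oplus> b \<in> carrier R" using vc bc by simp
          obtain a where a: "a \<in> A" "a \<ominus> v \<in> ?B"
          proof (cases "v \<in> A")
            case True
            then show ?thesis using that[of v] minus_self[OF vc] ideal_memb(2)[OF Bid] by simp
          next
            case False
            then obtain b1 where b1: "b1 \<in> ?B" "v \<oplus> b1 \<in> A" using v D_out by blast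
            have "b1 \<in> carrier R" using b1 BR by blast
            then show ?thesis using that[of "v \<oplus> b1"] b1 minus_add_cancel(3)[of b1 v] vc by simp
          qed
          have ac: "a \<in> carrier R" using a AR by blast
          have "(v \<oplus> b) \<ominus> a = b \<ominus> (a \<ominus> v)" using vc bc ac by (simp add: add_normal)
          then have d: "(v \<oplus> b) \<ominus> a \<in> ?B" using ideal_memb(4)[OF Bid b a(2)] by simp
          have "a \<ominus> (v \<oplus> b) = \<ominus> ((v \<oplus> b) \<ominus> a)" using vb ac by (simp add: add_normal)
          then have d': "a \<ominus> (v \<oplus> b) \<in> ?B" using ideal_memb(5)[OF Bid d] by simp
          show ?thesis
          proof (cases "e p \<otimes> (v \<oplus> b) \<in> J")
            case False
            then show ?thesis using move[OF a(1) vb d] by blast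
          next
            case True
            have "v \<oplus> b \<oplus> (a \<ominus> (v \<oplus> b)) = a" using minus_add_cancel(2)[OF ac vb] .
            then have "\<exists>b'\<in>?B. v \<oplus> b \<oplus> b' \<in> A" using d' a by metis
            then show ?thesis using D_out[of "v \<oplus> b"] True vb by blast
          qed
        qed
        then show "b \<in> stab ?V" using bc by (simp add: stab_def)
      qed
      have J': "block_ideal (stab ?V)" by (rule stab_block_ideal[OF rV])
      \<comment> \<open>The last multiple of \<open>e p\<close> by a power of \<open>p\<close> that
        is outside \<open>J\<close> lies in \<open>colon J p\<close>. So the stabilizer of
        \<open>?V\<close> is strictly larger than \<open>J\<close>, and the induction hypothesis
        applies to it.\<close>
      have "\<exists>b\<in>?B. b \<notin> J"
      proof -
        define n where "n = (LEAST n::nat. q p [^] n \<otimes> e p \<in> J)"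
        have "\<exists>n::nat. q p [^] n \<otimes> e p \<in> J" using e_nil[OF p(1)] block_ideal_zero[OF J] by metis
        then have n: "q p [^] n \<otimes> e p \<in> J" unfolding n_def by (rule LeastI_ex)
        have "n \<noteq> 0" using n eJ ep by (metis l_one nat_pow_0)
        then obtain m where m: "n = Suc m" by (cases n) auto
        have "q p [^] m \<otimes> e p \<notin> J"
          using not_less_Least[of m "\<lambda>n. q p [^] n \<otimes> e p \<in> J"] m unfolding n_def by simp
        moreover have "q p [^] m \<otimes> e p \<in> ?B"
          using n m ep by (simp add: colon_def m_ac)
        ultimately show ?thesis by blast
      qed
      then have "J \<subset> stab ?V" using colon_sup[OF J, of p] BV by blast
      then have cJ: "card J < card (stab ?V)"
        using stab_carr finR finite_subset psubset_card_mono by metis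
      have cR: "card (stab ?V) \<le> card (carrier R)" using stab_carr finR card_mono by blast
      have "(card (carrier R) - card (stab ?V)) * (card P + 1) + card (P - {})
        < (card (carrier R) - card J) * (card P + 1) + card (P - Q)"
      proof -
        have "(card (carrier R) - card (stab ?V) + 1) * (card P + 1)
          \<le> (card (carrier R) - card J) * (card P + 1)"
          using cJ cR by (intro mult_le_mono1) linarith
        then show ?thesis by simp
      qed
      from less.hyps[OF this J' _ rV _ _ _ y xy] have yV: "y \<in> ?V" using xA by blast
      \<comment> \<open>The hypothesis is symmetric in \<open>x\<close> and \<open>y\<close>. On the
        defect, \<open>p\<close> can be added to \<open>Q\<close>, so from \<open>y\<close> in the
        defect it would follow that \<open>x\<close> is there too, although \<open>x\<close> is in
        the disjoint set \<open>A\<close>.\<close>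
      have "y \<notin> ?D"
      proof
        assume yD: "y \<in> ?D"
        have yx: "same_ideals y x" using xy by (auto simp: same_ideals_def)
        have DQ: "e r \<otimes> w \<in> J" if w: "w \<in> ?D" and r: "r \<in> Q" for w r
        proof -
          obtain b where b: "b \<in> ?B" "w \<oplus> b \<in> A" using w D_out by blast
          have rP: "r \<in> P" "r \<noteq> p" using r QP p by auto
          have c: "w \<in> carrier R" "b \<in> carrier R" "e r \<in> carrier R" using w DR b BR e_closed rP by auto
          have "e r \<otimes> (w \<oplus> b) \<in> J" using AQ b r by blast
          moreover have "e r \<otimes> b \<in> J"
            using comp_other[OF block_ideal_imp_ideal[OF J] p(1) rP c(2)] b by (simp add: colon_def)
          ultimately have "e r \<otimes> (w \<oplus> b) \<ominus> e r \<otimes> b \<in> J" using block_ideal_minus[OF J] by blast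
          then show ?thesis using c by (simp add: r_distr minus_add_cancel)
        qed
        have "x \<in> ?D" using caseQ[OF rD JD DQ De yD xc yx] by blast
        then show False using AD xA by blast
      qed
      then show ?thesis using yV by blast
    qed
    then show ?thesis using AW by blast
  qed
qed

text \<open>The case of zero \<open>J\<close> and empty \<open>Q\<close>. From here on, membership
  in a rational class is proved by comparing the block ideals that contain the two elements.\<close>

lemma same_ideals_rsame:
  assumes "x \<in> carrier R" "y \<in> carrier R" "same_ideals x y" shows "rsame x y"
proof -
  have J: "block_ideal {\<zero>}"
    using zeroideal block_is_blockset[OF zero_block] by (simp add: block_ideal_def)
  have r: "rational (rclass x)" by (rule rational_rclass[OF assms(1)])
  have "{\<zero>} \<subseteq> stab (rclass x)" using stab_zero r by (simp add: rational_def blockset_def)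
  then have "y \<in> rclass x"
    using rational_closed_same_ideals[OF J _ r _ _ rclass_self[OF assms(1)] assms(2,3), of "{}"] by simp
  then show ?thesis by (simp add: rclass_def)
qed

text \<open>Units that are 1 outside the \<open>p\<close>-component fix \<open>z0\<close>, hence the
  set \<open>Z\<close>, so the defect of \<open>Z\<close> is a union of basic sets. A failure of
  invariance would place a unit multiple of \<open>Z\<close> in the defect and make all
  \<open>p\<close>-components on \<open>Z\<close> zero, whereas some element of \<open>Z\<close> has
  a non-zero one.\<close>

lemma block_socle_invariant:
  assumes p: "p \<in> P" and Z: "Z \<in> S" and z: "z \<in> Z" and socW: "socle p \<subseteq> stab (rclass z)"
    and z0: "z0 \<in> Z" "e p \<otimes> z0 = \<zero>"
  shows "socle p \<subseteq> stab Z"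
proof
  fix h assume h: "h \<in> socle p"
  have hc: "h \<in> carrier R" "e p \<otimes> h = h" "q p \<otimes> h = \<zero>" using h by (auto simp: socle_def)
  have ep: "e p \<in> carrier R" using e_closed p by simp
  have J: "block_ideal {\<zero>}"
    using zeroideal block_is_blockset[OF zero_block] by (simp add: block_ideal_def)
  have ZR: "Z \<subseteq> carrier R" using block_sub[OF Z] .
  have JZ: "{\<zero>} \<subseteq> stab Z" using stab_zero[OF ZR] by simp
  have zc: "z \<in> carrier R" and z0c: "z0 \<in> carrier R" using z z0 ZR by auto
  have sameZ: "same a b" if "a \<in> Z" "b \<in> Z" for a b using that Z by (auto simp: same_def)
  have Zinv: "u \<otimes> w \<in> Z" if u: "u \<in> local_units p" and w: "w \<in> Z" for u w
  proof -
    have uU: "u \<in> Units R" using u by (simp add: local_units_def)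
    have "u \<otimes> z0 = z0"
    proof (rule comp_ext)
      fix r assume r: "r \<in> P"
      have er: "e r \<in> carrier R" using e_closed r by simp
      show "e r \<otimes> (u \<otimes> z0) = e r \<otimes> z0"
      proof (cases "r = p")
        case True
        have "e p \<otimes> (u \<otimes> z0) = u \<otimes> (e p \<otimes> z0)" using ep uU z0c by (simp add: m_lcomm Units_closed)
        then show ?thesis using True z0 uU by (simp add: Units_closed)
      next
        case False
        then have "e r \<otimes> u = e r" using u r by (simp add: local_units_def)
        then show ?thesis using er uU z0c by (simp add: m_assoc[symmetric] Units_closed)
      qed
    qed (use uU z0c in \<open>auto simp: Units_closed\<close>)
    then have "same z0 (u \<otimes> w)" using same_unit[OF uU sameZ[OF z0(1) w]] by simp
    then show ?thesis using same_in_block[OF Z z0(1)] by blast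
  qed
  have sD: "blockset (defect {\<zero>} p Z)" by (rule defect_blockset[OF J p block_is_blockset[OF Z] JZ Zinv])
  have socB: "k \<in> colon {\<zero>} p" if "k \<in> socle p" for k using that by (auto simp: colon_def socle_def)
  have inW: "w \<in> rclass z" if "w \<in> Z" for w
    using same_rsame[OF sameZ[OF z that]] by (simp add: rclass_def)
  have "w \<oplus> h \<in> Z" if w: "w \<in> Z" for w
  proof (rule ccontr)
    assume nw: "w \<oplus> h \<notin> Z"
    have wc: "w \<in> carrier R" using w ZR by blast
    have h0: "h \<noteq> \<zero>" using nw w wc by auto
    have nh: "\<ominus> h \<in> socle p" using ideal_memb(5)[OF socle_ideal[OF p] h] .
    have whW: "w \<oplus> h \<in> rclass z" using stab_plus[OF socW inW[OF w] h] .
    have "e p \<otimes> w \<in> {\<zero>} \<or> e p \<otimes> (w \<oplus> h) \<in> {\<zero>}"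
      using assoc_mem[OF J p ZR JZ Zinv w, of "w \<oplus> h"] nw wc hc socB[OF h] minus_add_cancel(3)[OF hc(1) wc]
      by auto
    \<comment> \<open>Whichever of \<open>w\<close> and \<open>w \<oplus> h\<close> has zero
      \<open>p\<close>-component witnesses the defect; both are in the class because the socle
      stabilizes it.\<close>
    then have "\<exists>y\<in>rclass z. y \<in> defect {\<zero>} p Z"
    proof
      assume "e p \<otimes> w \<in> {\<zero>}"
      then have "w \<in> defect {\<zero>} p Z" unfolding defect_def using wc w nw socB[OF h] by blast
      then show ?thesis using inW[OF w] by blast
    next
      assume a: "e p \<otimes> (w \<oplus> h) \<in> {\<zero>}"
      have "w \<oplus> h \<oplus> \<ominus> h = w" using wc hc by (simp add: a_assoc r_neg)
      then have "(w \<oplus> h \<in> Z) \<noteq> (w \<oplus> h \<oplus> \<ominus> h \<in> Z)" using nw w by simp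
      then have "w \<oplus> h \<in> defect {\<zero>} p Z" unfolding defect_def using a wc hc socB[OF nh] by blast
      then show ?thesis using whW by blast
    qed
    then obtain y where y: "rsame z y" "y \<in> defect {\<zero>} p Z" by (auto simp: rclass_def)
    then obtain u where u: "u \<in> Units R" "same (u \<otimes> z) y" by (auto simp: rsame_def)
    \<comment> \<open>If \<open>w\<close> has zero \<open>p\<close>-component, the
      \<open>p\<close>-component of \<open>w \<oplus> h\<close> is \<open>h\<close>, and a unit
      multiple of \<open>w \<oplus> h\<close> lies in \<open>Z\<close>.\<close>
    obtain z1 where z1: "z1 \<in> Z" "e p \<otimes> z1 \<noteq> \<zero>"
    proof (cases "e p \<otimes> w = \<zero>")
      case False
      then show ?thesis using that w by blast
    next
      case True
      have "rsame z (w \<oplus> h)" using whW by (simp add: rclass_def)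
      then obtain v where v: "v \<in> Units R" "same (v \<otimes> z) (w \<oplus> h)" by (auto simp: rsame_def)
      have vc: "v \<in> carrier R" "inv v \<in> carrier R" using v by auto
      have "same z (inv v \<otimes> (w \<oplus> h))"
        using same_unit[of "inv v", OF _ v(2)] v vc zc by (simp add: m_assoc[symmetric])
      then have "inv v \<otimes> (w \<oplus> h) \<in> Z" using same_in_block[OF Z z] by blast
      moreover have "e p \<otimes> (inv v \<otimes> (w \<oplus> h)) = inv v \<otimes> h"
      proof -
        have "e p \<otimes> (inv v \<otimes> (w \<oplus> h)) = inv v \<otimes> (e p \<otimes> (w \<oplus> h))"
          using hc(1) ep vc wc by (simp add: m_lcomm)
        also have "e p \<otimes> (w \<oplus> h) = h" using True hc ep wc by (simp add: r_distr)
        finally show ?thesis .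
      qed
      moreover have "inv v \<otimes> h \<noteq> \<zero>"
      proof
        assume "inv v \<otimes> h = \<zero>"
        then have "v \<otimes> (inv v \<otimes> h) = \<zero>" using vc by simp
        then show False using v vc hc h0 by (simp add: m_assoc[symmetric])
      qed
      ultimately show ?thesis using that by metis
    qed
    have z1c: "z1 \<in> carrier R" using z1 ZR by blast
    have "same y (u \<otimes> z1)" using same_trans[OF same_sym[OF u(2)] same_unit[OF u(1) sameZ[OF z z1(1)]]] .
    then have "u \<otimes> z1 \<in> defect {\<zero>} p Z" using sD y by (auto simp: blockset_def)
    then have "e p \<otimes> (u \<otimes> z1) = \<zero>" by (simp add: defect_def)
    then have "inv u \<otimes> (u \<otimes> (e p \<otimes> z1)) = \<zero>" using u ep z1c by (simp add: m_lcomm[of u] Units_closed)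
    then show False using z1 u ep z1c by (simp add: m_assoc[symmetric] Units_closed)
  qed
  then show "h \<in> stab Z" using hc by (simp add: stab_def)
qed

end

section \<open>Maximal block ideals\<close>

context cg_schur_ring
begin

text \<open>Formulated with \<open>stab\<close> in place of \<open>I_L\<close>; the passage to
  \<open>I_L\<close> is \<open>I_L_sup\<close>.\<close>

definition wreath :: bool where
  "wreath \<longleftrightarrow> (\<exists>I J. block_ideal I \<and> block_ideal J \<and> J \<subseteq> I \<and> J \<noteq> {\<zero>} \<and> I \<noteq> carrier R \<and>
     (\<forall>X\<in>S. X \<subseteq> carrier R - I \<longrightarrow> J \<subseteq> stab X))"

text \<open>The last conjunct says that the component of \<open>R\<close> for \<open>F\<close> is not a field.\<close>

definition splits :: "nat set \<Rightarrow> bool" where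
  "splits F \<longleftrightarrow> F \<subseteq> P \<and> block_ideal {x\<in>carrier R. idem F \<otimes> x = x} \<and> block_ideal {x\<in>carrier R. idem F \<otimes> x = \<zero>} \<and>
     (\<forall>X\<in>S. \<forall>x\<in>X. \<forall>s\<in>carrier R. idem F \<otimes> s = s \<longrightarrow>
        idem F \<otimes> x \<noteq> \<zero> \<longrightarrow> idem F \<otimes> (x \<oplus> s) \<noteq> \<zero> \<longrightarrow> x \<oplus> s \<in> X) \<and>
     (\<exists>r\<in>F. \<exists>x\<in>max_ideal r. idem F \<otimes> x \<noteq> \<zero>)"

definition maximal :: "'a set \<Rightarrow> bool" where
  "maximal M \<longleftrightarrow> block_ideal M \<and> M \<noteq> carrier R \<and> (\<forall>L. block_ideal L \<and> L \<noteq> carrier R \<and> M \<subseteq> L \<longrightarrow> L = M)"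

text \<open>If \<open>D\<close> is non-zero and prime with respect to sums of block ideals, this is
  the largest block ideal not containing \<open>D\<close>; it is used for \<open>e p\<close> and for
  the socle.\<close>

definition avoid :: "'a set \<Rightarrow> 'a set" where
  "avoid D = {x\<in>carrier R. \<not> D \<subseteq> gen {x}}"

lemma maximal_ex:
  assumes "block_ideal I" "I \<noteq> carrier R" obtains M where "maximal M" "I \<subseteq> M"
proof -
  let ?A = "{L. block_ideal L \<and> L \<noteq> carrier R}"
  have "finite ?A" using block_ideal_sub finR by (intro finite_subset[of ?A "Pow (carrier R)"]) auto
  moreover have "I \<in> ?A" using assms by simp
  ultimately obtain M where "M \<in> ?A" "I \<subseteq> M" "\<forall>b\<in>?A. M \<subseteq> b \<longrightarrow> M = b"
    using finite_has_maximal2[of ?A I] by blast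
  then have "maximal M" unfolding maximal_def by blast
  then show ?thesis using that \<open>I \<subseteq> M\<close> by blast
qed

lemma ideal_e:
  assumes I: "ideal I R" and p: "p \<in> P" and a: "a \<in> I" "a \<notin> max_ideal p" shows "e p \<in> I"
proof -
  have ac: "a \<in> carrier R" using a ideal_memb(1)[OF I] by blast
  have ep: "e p \<in> carrier R" using e_closed p by simp
  obtain y where y: "y \<in> carrier R" "e p \<otimes> a \<otimes> y = e p" using max_ideal_iff[OF p ac] a by blast
  have "(e p \<otimes> y) \<otimes> a \<in> I" using ideal_memb(6)[OF I a(1)] ep y by simp
  moreover have "(e p \<otimes> y) \<otimes> a = e p \<otimes> a \<otimes> y" using ep y(1) ac by (simp add: m_ac)
  ultimately show ?thesis using y by simp
qed

text \<open>The \<open>p\<close>-component is local: if a sum of two elements is invertible there,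
  so is one of the summands, and \<open>ideal_e\<close> applies to it.\<close>

lemma e_prime:
  assumes I: "ideal I R" and J: "ideal J R" and p: "p \<in> P" and m: "e p \<in> I <+>\<^bsub>R\<^esub> J"
  shows "e p \<in> I \<or> e p \<in> J"
proof -
  obtain a b where ab: "a \<in> I" "b \<in> J" "e p = a \<oplus> b" using m by (auto simp: set_add_def')
  have "a \<notin> max_ideal p \<or> b \<notin> max_ideal p"
    using ideal_memb(3)[OF ideal_max_ideal[OF p]] e_notin_max_ideal[OF p] ab by metis
  then show ?thesis using ideal_e[OF I p ab(1)] ideal_e[OF J p ab(2)] by blast
qed

text \<open>If a non-zero element of the socle is a sum of elements of the two ideals, one summand
  has non-zero \<open>p\<close>-component, and \<open>socle_min\<close> applies to its
  ideal.\<close>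

lemma socle_prime:
  assumes I: "ideal I R" and J: "ideal J R" and p: "p \<in> P" and m: "socle p \<subseteq> I <+>\<^bsub>R\<^esub> J"
  shows "socle p \<subseteq> I \<or> socle p \<subseteq> J"
proof -
  obtain h where h: "h \<in> socle p" "h \<noteq> \<zero>" using socle_nontrivial[OF p] .
  obtain a b where ab: "a \<in> I" "b \<in> J" "h = a \<oplus> b" using h m by (auto simp: set_add_def')
  have ep: "e p \<in> carrier R" using e_closed p by simp
  have c: "a \<in> carrier R" "b \<in> carrier R" using ab ideal_memb(1)[OF I] ideal_memb(1)[OF J] by auto
  have "e p \<otimes> a \<oplus> e p \<otimes> b = h" using h ab ep c by (auto simp: socle_def r_distr)
  then have "e p \<otimes> a \<noteq> \<zero> \<or> e p \<otimes> b \<noteq> \<zero>" using h by auto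
  then show ?thesis using socle_min[OF I p ab(1)] socle_min[OF J p ab(2)] by blast
qed

lemma gen_single: "block_ideal L \<Longrightarrow> x \<in> L \<Longrightarrow> gen {x} \<subseteq> L"
  by (rule gen_least) auto

text \<open>Primality gives closure under addition: \<open>a \<oplus> b\<close> generates a block
  ideal inside the sum of those generated by \<open>a\<close> and by \<open>b\<close>.\<close>

lemma avoid_block_ideal:
  assumes D: "D \<subseteq> carrier R" "\<not> D \<subseteq> {\<zero>}"
    and prime: "\<And>I J. block_ideal I \<Longrightarrow> block_ideal J \<Longrightarrow> D \<subseteq> I <+>\<^bsub>R\<^esub> J \<Longrightarrow> D \<subseteq> I \<or> D \<subseteq> J"
  shows "block_ideal (avoid D)"
  unfolding block_ideal_def
proof
  have g: "block_ideal (gen {x})" if "x \<in> carrier R" for x by (rule gen_block_ideal) (use that in auto)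
  have xg: "x \<in> gen {x}" for x using gen_sub[of "{x}"] by simp
  show "ideal (avoid D) R"
  proof (rule ideal_closedI)
    show "avoid D \<subseteq> carrier R" by (auto simp: avoid_def)
    have "block_ideal {\<zero>}"
      using zeroideal block_is_blockset[OF zero_block] by (simp add: block_ideal_def)
    then have "gen {\<zero>} \<subseteq> {\<zero>}" by (rule gen_least) simp
    then show "\<zero> \<in> avoid D" using D by (auto simp: avoid_def)
  next
    fix a b assume ab: "a \<in> avoid D" "b \<in> avoid D"
    then have c: "a \<in> carrier R" "b \<in> carrier R" by (auto simp: avoid_def)
    have "a \<oplus> b \<in> gen {a} <+>\<^bsub>R\<^esub> gen {b}" using xg by (auto simp: set_add_def')
    then have "gen {a \<oplus> b} \<subseteq> gen {a} <+>\<^bsub>R\<^esub> gen {b}"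
      by (intro gen_single block_ideal_sum g c)
    then show "a \<oplus> b \<in> avoid D" using prime[OF g[OF c(1)] g[OF c(2)]] ab c
      unfolding avoid_def by blast
  next
    fix r a assume ra: "r \<in> carrier R" "a \<in> avoid D"
    then have c: "a \<in> carrier R" by (auto simp: avoid_def)
    have "gen {r \<otimes> a} \<subseteq> gen {a}" by (rule gen_single[OF g[OF c] block_ideal_mult[OF g[OF c] xg ra(1)]])
    then show "r \<otimes> a \<in> avoid D" using ra c unfolding avoid_def by auto
  qed
  show "blockset (avoid D)" unfolding blockset_def
  proof (intro conjI allI impI)
    show "avoid D \<subseteq> carrier R" by (auto simp: avoid_def)
    fix x y assume xy: "same x y" "x \<in> avoid D"
    have c: "x \<in> carrier R" "y \<in> carrier R" using same_carr[OF xy(1)] by auto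
    have "y \<in> gen {x}" using block_ideal_same[OF g[OF c(1)] xy(1)] xg by blast
    then have "gen {y} \<subseteq> gen {x}" by (rule gen_single[OF g[OF c(1)]])
    then show "y \<in> avoid D" using xy c by (auto simp: avoid_def)
  qed
qed

lemma avoid_sub: "block_ideal L \<Longrightarrow> \<not> D \<subseteq> L \<Longrightarrow> L \<subseteq> avoid D"
  using block_ideal_sub gen_single unfolding avoid_def by blast

text \<open>\<open>stab X\<close> alone need not be closed under units. The elements all of whose
  unit multiples stabilize \<open>X\<close> form a block ideal, and this ideal contains
  \<open>D\<close>.\<close>

lemma gen_stab:
  assumes X: "X \<in> S" and D: "ideal D R" "D \<subseteq> stab X" shows "gen D \<subseteq> stab X"
proof -
  define K where "K = {g\<in>carrier R. \<forall>u\<in>Units R. u \<otimes> g \<in> stab X}"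
  have XR: "X \<subseteq> carrier R" using block_sub[OF X] .
  have id: "ideal K R"
  proof (rule unit_invariant_ideal)
    show "K \<subseteq> carrier R" by (auto simp: K_def)
    show "\<zero> \<in> K" using stab_zero[OF XR] by (auto simp: K_def Units_closed)
    show "a \<oplus> b \<in> K" if "a \<in> K" "b \<in> K" for a b
      using that stab_add[OF XR] by (auto simp: K_def r_distr Units_closed)
    show "u \<otimes> a \<in> K" if "u \<in> Units R" "a \<in> K" for u a
    proof -
      have "v \<otimes> (u \<otimes> a) \<in> stab X" if v: "v \<in> Units R" for v
      proof -
        have "(v \<otimes> u) \<otimes> a \<in> stab X" using v \<open>u \<in> Units R\<close> \<open>a \<in> K\<close> by (simp add: K_def)
        then show ?thesis using v \<open>u \<in> Units R\<close> \<open>a \<in> K\<close> by (simp add: K_def m_assoc Units_closed)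
      qed
      then show ?thesis using that by (simp add: K_def Units_closed)
    qed
  qed
  have "blockset K" unfolding blockset_def
  proof (intro conjI allI impI)
    show "K \<subseteq> carrier R" by (auto simp: K_def)
    fix x y assume xy: "same x y" "x \<in> K"
    have "u \<otimes> y \<in> stab X" if u: "u \<in> Units R" for u
      using stab_blockset[OF block_is_blockset[OF X]] same_unit[OF u xy(1)] xy u
        unfolding blockset_def K_def by blast
    then show "y \<in> K" using same_carr[OF xy(1)] by (simp add: K_def)
  qed
  then have "block_ideal K" using id by (simp add: block_ideal_def)
  moreover have "D \<subseteq> K"
    using D ideal_memb(1)[OF D(1)] ideal_memb(6)[OF D(1)] by (auto simp: K_def Units_closed)
  ultimately have "gen D \<subseteq> K" by (rule gen_least)
  moreover have "K \<subseteq> stab X"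
  proof
    fix g assume g: "g \<in> K"
    then have "\<one> \<otimes> g \<in> stab X" unfolding K_def by blast
    then show "g \<in> stab X" using g by (simp add: K_def)
  qed
  ultimately show ?thesis by blast
qed

lemma single_block:
  assumes n: "block_count W J w \<le> 1" and J: "block_ideal J" and w: "w \<in> W" "w \<in> carrier R"
    and w': "w' \<in> W" "w' \<in> carrier R" "w' \<ominus> w \<in> J"
  shows "same w w'"
proof -
  let ?B = "{X\<in>S. \<exists>x\<in>X. x \<in> W \<and> x \<ominus> w \<in> J}"
  obtain X where X: "X \<in> S" "w \<in> X" using block_ex w by blast
  obtain Y where Y: "Y \<in> S" "w' \<in> Y" using block_ex w' by blast
  have "w \<ominus> w \<in> J" unfolding minus_self[OF w(2)] by (rule block_ideal_zero[OF J])
  then have "X \<in> ?B" using X w by blast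
  moreover have "Y \<in> ?B" using Y w' by auto
  moreover have "finite ?B" using finS by simp
  ultimately have "X = Y" using n unfolding block_count_def using card_le_Suc0_iff_eq[of ?B] by simp
  then show ?thesis using X Y by (auto simp: same_def)
qed

lemma gen_socle_nontrivial: assumes "p \<in> P" shows "gen (socle p) \<noteq> {\<zero>}"
proof -
  obtain h where "h \<in> socle p" "h \<noteq> \<zero>" using socle_nontrivial[OF assms] .
  then show ?thesis using gen_sub[of "socle p"] by blast
qed

lemma socle_sub: "socle p \<subseteq> carrier R"
  by (auto simp: socle_def)

text \<open>By the choice of \<open>I0\<close>, a block ideal containing a point outside
  \<open>I\<close> contains \<open>e p\<close>. So translations by elements of the
  \<open>p\<close>-component do not change which block ideals contain such a point, and its rational
  class is invariant under them.\<close>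

lemma wreath_case:
  assumes p: "p \<in> P" and all: "\<And>M. maximal M \<Longrightarrow> e p \<in> M"
  shows wreath
proof -
  have ep: "e p \<in> carrier R" using e_closed p by simp
  define J' where "J' = gen {e p}"
  define I0 where "I0 = avoid {e p}"
  \<comment> \<open>Adding \<open>J'\<close> to \<open>I0\<close> makes the complement of
    \<open>I\<close> stable under translations by the \<open>p\<close>-component. The sum is still
    proper, because a maximal block ideal above \<open>I0\<close> contains \<open>e p\<close> and
    hence \<open>J'\<close>.\<close>
  define I where "I = I0 <+>\<^bsub>R\<^esub> J'"
  define J where "J = gen (socle p)"
  have sJ': "block_ideal J'" unfolding J'_def by (rule gen_block_ideal) (use ep in simp)
  have e0: "e p \<noteq> \<zero>" using e_nonunit[OF p, of \<zero>] ep by auto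
  have sI0: "block_ideal I0" unfolding I0_def
  proof (rule avoid_block_ideal)
    show "{e p} \<subseteq> I \<or> {e p} \<subseteq> J" if "block_ideal I" "block_ideal J" "{e p} \<subseteq> I <+>\<^bsub>R\<^esub> J" for I J
      using e_prime[OF block_ideal_imp_ideal block_ideal_imp_ideal p] that by blast
  qed (use ep e0 in auto)
  have sI: "block_ideal I" unfolding I_def by (rule block_ideal_sum[OF sI0 sJ'])
  have eJ': "e p \<in> J'" using gen_sub[of "{e p}"] by (simp add: J'_def)
  have I0I: "I0 \<subseteq> I" and J'I: "J' \<subseteq> I"
  proof -
    show "I0 \<subseteq> I"
    proof
      fix x assume x: "x \<in> I0"
      then have "x \<oplus> \<zero> \<in> I"
        unfolding I_def using block_ideal_zero[OF sJ'] unfolding set_add_def' by blast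
      then show "x \<in> I" using x block_ideal_sub[OF sI0] by auto
    qed
    show "J' \<subseteq> I"
    proof
      fix x assume x: "x \<in> J'"
      then have "\<zero> \<oplus> x \<in> I"
        unfolding I_def using block_ideal_zero[OF sI0] unfolding set_add_def' by blast
      then show "x \<in> I" using x block_ideal_sub[OF sJ'] by auto
    qed
  qed
  have "e p \<notin> I0" using gen_sub[of "{e p}"] by (auto simp: I0_def avoid_def)
  then have "I0 \<noteq> carrier R" using ep by blast
  then obtain M where M: "maximal M" "I0 \<subseteq> M" using maximal_ex[OF sI0] by blast
  have sM: "block_ideal M" "M \<noteq> carrier R" using M by (auto simp: maximal_def)
  have "J' \<subseteq> M" unfolding J'_def by (rule gen_single[OF sM(1) all[OF M(1)]])
  then have "I \<subseteq> M" unfolding I_def set_add_def' using M(2) block_ideal_add[OF sM(1)] by blast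
  then have IR: "I \<noteq> carrier R" using sM block_ideal_sub[OF sM(1)] by blast
  have sJ: "block_ideal J" unfolding J_def by (rule gen_block_ideal[OF socle_sub])
  have "J \<subseteq> J'" unfolding J_def
  proof (rule gen_least[OF sJ'])
    show "socle p \<subseteq> J'"
    proof
      fix h assume h: "h \<in> socle p"
      then have "h \<otimes> e p \<in> J'" using block_ideal_mult[OF sJ' eJ'] by (simp add: socle_def)
      moreover have "h \<otimes> e p = h" using h ep m_comm[of h "e p"] by (simp add: socle_def)
      ultimately show "h \<in> J'" by simp
    qed
  qed
  then have JI: "J \<subseteq> I" using J'I by blast
  have "J \<subseteq> stab X" if X: "X \<in> S" "X \<subseteq> carrier R - I" for X
  proof -
    obtain z where z: "z \<in> X" using block_ne[OF X(1)] by blast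
    have zc: "z \<in> carrier R" and zI: "z \<notin> I" using z X by auto
    have notI: "w \<notin> I" if "rsame z w" for w
      using rational_rsame[OF block_ideal_rational[OF sI] _ rsame_sym[OF that zc]] zI by blast
    have step: "w \<oplus> t \<in> rclass z" if w: "w \<in> rclass z" and t: "t \<in> carrier R" "e p \<otimes> t = t" for w t
    proof -
      have wc: "w \<in> carrier R" using w rclass_carr[OF zc] by blast
      have tL: "t \<in> L" if "block_ideal L" "e p \<in> L" for L
        using block_ideal_mult[OF that t(1)] t ep by (simp add: m_comm)
      have wI: "w \<notin> I" using notI w by (simp add: rclass_def)
      have wtI: "w \<oplus> t \<notin> I"
      proof
        assume "w \<oplus> t \<in> I"
        moreover have "t \<in> I" using tL[OF sJ' eJ'] J'I by blast
        ultimately have "w \<oplus> t \<ominus> t \<in> I" using block_ideal_minus[OF sI] by blast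
        then show False using wI wc t by (simp add: minus_add_cancel)
      qed
      have eL: "e p \<in> L" if L: "block_ideal L" "v \<in> L" "v \<notin> I" for L v
        using avoid_sub[OF L(1), of "{e p}"] L I0I unfolding I0_def by blast
      have "same_ideals w (w \<oplus> t)" unfolding same_ideals_def
      proof (intro allI impI iffI)
        fix L assume L: "block_ideal L"
        { assume "w \<in> L"
          then show "w \<oplus> t \<in> L" using block_ideal_add[OF L] tL[OF L eL[OF L _ wI]] by blast }
        { assume wt: "w \<oplus> t \<in> L"
          then have "w \<oplus> t \<ominus> t \<in> L" using block_ideal_minus[OF L] tL[OF L eL[OF L _ wtI]] by blast
          then show "w \<in> L" using wc t by (simp add: minus_add_cancel) }
      qed
      then have "rsame w (w \<oplus> t)" using same_ideals_rsame wc t by simp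
      then show ?thesis using w rsame_trans[OF _ _ zc] by (auto simp: rclass_def)
    qed
    have "socle p \<subseteq> stab (rclass z)" unfolding stab_def using step by (auto simp: socle_def)
    \<comment> \<open>Subtracting the \<open>p\<close>-component from \<open>z\<close> stays in the
      class, so a unit multiple of the result lies in \<open>X\<close>.\<close>
    moreover obtain z0 where "z0 \<in> X" "e p \<otimes> z0 = \<zero>"
    proof -
      let ?t = "\<ominus> (e p \<otimes> z)"
      have ee: "e p \<otimes> (e p \<otimes> z) = e p \<otimes> z" using e_mult[OF p p zc] by simp
      have "z \<oplus> ?t \<in> rclass z"
        by (rule step[OF rclass_self[OF zc]]) (use ep zc ee in \<open>auto simp: r_minus\<close>)
      then obtain u where u: "u \<in> Units R" "same (u \<otimes> z) (z \<oplus> ?t)" by (auto simp: rclass_def rsame_def)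
      have uc: "u \<in> carrier R" "inv u \<in> carrier R" using u by auto
      have "same z (inv u \<otimes> (z \<oplus> ?t))"
        using same_unit[of "inv u", OF _ u(2)] u uc zc by (simp add: m_assoc[symmetric])
      then have "inv u \<otimes> (z \<oplus> ?t) \<in> X" using same_in_block[OF X(1) z] by blast
      moreover have "e p \<otimes> (inv u \<otimes> (z \<oplus> ?t)) = \<zero>"
      proof -
        have "e p \<otimes> (inv u \<otimes> (z \<oplus> ?t)) = inv u \<otimes> (e p \<otimes> (z \<oplus> ?t))"
          using ep uc zc by (simp add: m_lcomm)
        also have "e p \<otimes> (z \<oplus> ?t) = \<zero>" using ep zc ee by (simp add: r_distr r_minus r_neg)
        finally show ?thesis using uc by simp
      qed
      ultimately show ?thesis using that by blast
    qed
    ultimately have "socle p \<subseteq> stab X" using block_socle_invariant[OF p X(1) z] by blast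
    then show ?thesis unfolding J_def by (rule gen_stab[OF X(1) socle_ideal[OF p]])
  qed
  moreover have "J \<noteq> {\<zero>}" unfolding J_def by (rule gen_socle_nontrivial[OF p])
  ultimately show ?thesis unfolding wreath_def using sI sJ JI IR by blast
qed

end

section \<open>A maximal block ideal that does not contain the component of a bad prime\<close>

locale bad_maximal = cg_schur_ring +
  fixes M :: "'a set" and p :: nat
  assumes M: "maximal M" and p: "p \<in> P" and bad: "\<not> block_ideal (max_ideal p)" and epM: "e p \<notin> M"
begin

definition Q :: "nat set" where "Q = {r\<in>P. e r \<notin> M}"

abbreviation E :: 'a where "E \<equiv> idem Q"

lemma QP: "r \<in> Q \<Longrightarrow> r \<in> P" and pQ: "p \<in> Q"
  using p epM by (auto simp: Q_def)

lemma sM: "block_ideal M" and MR: "M \<noteq> carrier R"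
  and Mmax: "block_ideal L \<Longrightarrow> L \<noteq> carrier R \<Longrightarrow> M \<subseteq> L \<Longrightarrow> L = M"
  using M unfolding maximal_def by blast+

lemma M_max_ideal: "r \<in> Q \<Longrightarrow> M \<subseteq> max_ideal r"
  using ideal_e[OF block_ideal_imp_ideal[OF sM]] by (auto simp: Q_def)

text \<open>Maximality gives \<open>L + M = R\<close>, and for \<open>r\<close> in \<open>Q\<close>
  the idempotent \<open>e r\<close>, which is not in \<open>M\<close>, must lie in \<open>L\<close>
  by \<open>e_prime\<close>.\<close>

lemma E_mem:
  assumes L: "block_ideal L" "\<not> L \<subseteq> M" shows "E \<in> L"
proof -
  have s: "block_ideal (L <+>\<^bsub>R\<^esub> M)" by (rule block_ideal_sum[OF L(1) sM])
  have "M \<subseteq> L <+>\<^bsub>R\<^esub> M"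
  proof
    fix x assume x: "x \<in> M"
    then have "\<zero> \<oplus> x \<in> L <+>\<^bsub>R\<^esub> M" using block_ideal_zero[OF L(1)] unfolding set_add_def' by blast
    then show "x \<in> L <+>\<^bsub>R\<^esub> M" using x block_ideal_sub[OF sM] by auto
  qed
  moreover have "L \<subseteq> L <+>\<^bsub>R\<^esub> M"
  proof
    fix x assume x: "x \<in> L"
    then have "x \<oplus> \<zero> \<in> L <+>\<^bsub>R\<^esub> M" using block_ideal_zero[OF sM] unfolding set_add_def' by blast
    then show "x \<in> L <+>\<^bsub>R\<^esub> M" using x block_ideal_sub[OF L(1)] by auto
  qed
  ultimately have full: "L <+>\<^bsub>R\<^esub> M = carrier R" using Mmax[OF s] L(2) by blast
  show ?thesis
  proof (rule comp_ideal[OF block_ideal_imp_ideal[OF L(1)]])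
    fix r assume r: "r \<in> P"
    show "e r \<otimes> E \<in> L"
    proof (cases "r \<in> Q")
      case True
      then have "e r \<in> L"
        using e_prime[OF block_ideal_imp_ideal[OF L(1)] block_ideal_imp_ideal[OF sM] r] full e_closed[OF r] by (auto simp: Q_def)
      then show ?thesis using True r by (simp add: e_idem_set)
    next
      case False
      then show ?thesis using r block_ideal_zero[OF L(1)] by (simp add: e_idem_set)
    qed
  qed simp
qed

lemma M_out: assumes "y \<in> carrier R" "E \<otimes> y = \<zero>" shows "y \<in> M"
proof (rule comp_ideal[OF block_ideal_imp_ideal[OF sM] assms(1)])
  fix r assume r: "r \<in> P"
  have er: "e r \<in> carrier R" using e_closed r by simp
  show "e r \<otimes> y \<in> M"
  proof (cases "r \<in> Q")
    case True
    then have "e r \<otimes> y = e r \<otimes> (E \<otimes> y)" using e_idem_set'[OF r assms(1), of Q] by simp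
    then show ?thesis using assms er block_ideal_zero[OF sM] by simp
  next
    case False
    then have "e r \<in> M" using r by (simp add: Q_def)
    then show ?thesis using block_ideal_mult[OF sM _ assms(1)] er assms by (simp add: m_comm)
  qed
qed

text \<open>For \<open>r = p\<close> equality with \<open>M\<close> is excluded by
  \<open>bad\<close>; for any other \<open>r\<close> the ideal \<open>max_ideal r\<close> contains
  \<open>e p\<close>, while \<open>M\<close> does not.\<close>

lemma max_ideal_not_M: assumes r: "r \<in> Q" obtains x where "x \<in> max_ideal r" "x \<notin> M"
proof -
  have "M \<noteq> max_ideal r"
  proof
    assume eq: "M = max_ideal r"
    have "p = r"
    proof (rule ccontr)
      assume "p \<noteq> r"
      then have "e r \<otimes> e p = q r \<otimes> e r \<otimes> \<zero>" using e_orth[OF QP[OF r] p] e_closed[OF QP[OF r]] by simp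
      then have "e p \<in> max_ideal r" using e_closed[OF p] unfolding max_ideal_def by blast
      then show False using eq epM by simp
    qed
    then show False using eq bad sM by simp
  qed
  then show ?thesis using that M_max_ideal[OF r] by blast
qed

lemma E_e: "r \<in> Q \<Longrightarrow> E \<otimes> e r = e r"
  using e_idem_set[of r Q] e_closed QP by (simp add: m_comm)

lemma E_E: "y \<in> carrier R \<Longrightarrow> E \<otimes> (E \<otimes> y) = E \<otimes> y"
  using idem_idem[of Q] by (simp add: m_assoc[symmetric])

lemma M_add_iff: assumes "x \<in> carrier R" "m \<in> M" shows "x \<oplus> m \<in> M \<longleftrightarrow> x \<in> M"
proof
  assume "x \<oplus> m \<in> M"
  then have "x \<oplus> m \<ominus> m \<in> M" using block_ideal_minus[OF sM] assms by blast
  then show "x \<in> M" using assms block_ideal_sub[OF sM] by (simp add: minus_add_cancel subset_iff)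
qed (use assms block_ideal_add[OF sM] in blast)

text \<open>Block ideals inside \<open>M\<close> contain neither of the two elements, and all others
  contain \<open>E\<close> and therefore \<open>s\<close>.\<close>

lemma shift_E:
  assumes w: "w \<in> carrier R" "w \<notin> M" and s: "s \<in> carrier R" "E \<otimes> s = s" and ws: "w \<oplus> s \<notin> M"
  shows "rsame w (w \<oplus> s)"
proof (rule same_ideals_rsame)
  show "same_ideals w (w \<oplus> s)" unfolding same_ideals_def
  proof (intro allI impI)
    fix L assume L: "block_ideal L"
    show "w \<in> L \<longleftrightarrow> w \<oplus> s \<in> L"
    proof (cases "L \<subseteq> M")
      case False
      have "s \<otimes> E \<in> L" using block_ideal_mult[OF L E_mem[OF L False] s(1)] .
      then have sL: "s \<in> L" using s by (simp add: m_comm)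
      show ?thesis using block_ideal_add[OF L _ sL] block_ideal_minus[OF L _ sL, of "w \<oplus> s"] w s
        by (auto simp: minus_add_cancel)
    qed (use w ws in blast)
  qed
qed (use w s in auto)

text \<open>The counterpart of \<open>shift_E\<close> for translations inside \<open>M\<close>; the
  assumption on \<open>j\<close> places it in the block ideal generated by \<open>E\<close>.\<close>

lemma shift_M:
  assumes w: "w \<in> carrier R" "w \<notin> M" and j: "j \<in> M" and jL: "\<And>L. block_ideal L \<Longrightarrow> E \<in> L \<Longrightarrow> j \<in> L"
  shows "rsame w (w \<oplus> j)"
proof (rule same_ideals_rsame)
  have jc: "j \<in> carrier R" using j block_ideal_sub[OF sM] by blast
  show "w \<oplus> j \<in> carrier R" using w jc by simp
  show "same_ideals w (w \<oplus> j)" unfolding same_ideals_def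
  proof (intro allI impI)
    fix L assume L: "block_ideal L"
    show "w \<in> L \<longleftrightarrow> w \<oplus> j \<in> L"
    proof (cases "L \<subseteq> M")
      case False
      have jm: "j \<in> L" using jL[OF L E_mem[OF L False]] .
      show ?thesis using block_ideal_add[OF L _ jm] block_ideal_minus[OF L _ jm, of "w \<oplus> j"] w jc
        by (auto simp: minus_add_cancel)
    qed (use w M_add_iff[OF w(1) j] in blast)
  qed
qed (use w in auto)

lemma rclass_notM: assumes "z \<in> carrier R" "z \<notin> M" "w \<in> rclass z" shows "w \<notin> M"
  using rational_rsame[OF block_ideal_rational[OF sM] _ rsame_sym[OF _ assms(1)]] assms(2,3)
  by (auto simp: rclass_def)

lemma rclass_step: "z \<in> carrier R \<Longrightarrow> w \<in> rclass z \<Longrightarrow> rsame w v \<Longrightarrow> v \<in> rclass z"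
  using rsame_trans by (auto simp: rclass_def)

lemma rclass_shift_E:
  assumes z: "z \<in> carrier R" "z \<notin> M" and w: "w \<in> rclass z"
    and s: "s \<in> carrier R" "E \<otimes> s = s" and ws: "w \<oplus> s \<notin> M"
  shows "w \<oplus> s \<in> rclass z"
  using rclass_step[OF z(1) w shift_E[OF _ rclass_notM[OF z w] s ws]] rclass_carr[OF z(1)] w by blast

text \<open>Outside \<open>M\<close> the \<open>Q\<close>-component can be exchanged freely within a
  rational class. This supplies the special members \<open>w'\<close> and \<open>w1\<close> in the
  counting arguments.\<close>

lemma replace_E:
  assumes z: "z \<in> carrier R" "z \<notin> M" and x: "x \<in> carrier R" "x \<notin> M"
  shows "z \<oplus> E \<otimes> (x \<ominus> z) \<in> rclass z" and "r \<in> Q \<Longrightarrow> e r \<otimes> (z \<oplus> E \<otimes> (x \<ominus> z)) = e r \<otimes> x"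
    and "E \<otimes> (z \<oplus> E \<otimes> (x \<ominus> z)) = E \<otimes> x"
proof -
  let ?w = "z \<oplus> E \<otimes> (x \<ominus> z)"
  have wc: "?w \<in> carrier R" using z x by simp
  have "E \<otimes> ?w = E \<otimes> z \<oplus> E \<otimes> (x \<ominus> z)" using z x E_E[of "x \<ominus> z"] by (simp add: r_distr)
  also have "\<dots> = E \<otimes> (z \<oplus> (x \<ominus> z))" using z x by (simp add: r_distr)
  finally show EwE: "E \<otimes> ?w = E \<otimes> x" using minus_add_cancel(2)[OF x(1) z(1)] by simp
  then have "E \<otimes> (x \<ominus> ?w) = \<zero>" using wc x by (simp add: minus_eq r_distr r_minus r_neg)
  then have d: "x \<ominus> ?w \<in> M" by (intro M_out) (use wc x in auto)
  have "?w \<notin> M"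
  proof
    assume "?w \<in> M"
    then have "?w \<oplus> (x \<ominus> ?w) \<in> M" using block_ideal_add[OF sM _ d] by blast
    then show False using minus_add_cancel(2)[OF x(1) wc] x by simp
  qed
  then show "?w \<in> rclass z"
    by (intro rclass_shift_E[OF z rclass_self[OF z(1)]]) (use z x E_E in auto)
  show "e r \<otimes> ?w = e r \<otimes> x" if r: "r \<in> Q"
  proof -
    have "e r \<otimes> v = e r \<otimes> (E \<otimes> v)" if "v \<in> carrier R" for v
      using e_idem_set'[OF QP[OF r] that, of Q] r by simp
    then show ?thesis using EwE wc x by metis
  qed
qed

lemma e_notM: "r \<in> Q \<Longrightarrow> e r \<notin> M"
  by (simp add: Q_def)

text \<open>The assumption \<open>nf\<close> says that the \<open>r\<close>-component is not a
  field, so \<open>k\<close> in the socle has square zero and \<open>\<one> \<oplus> k\<close> is a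
  unit. It kills nothing but shifts: elements with \<open>r\<close>-component in the radical are
  fixed, and \<open>k\<close> is chosen so that \<open>w\<close> goes to
  \<open>w \<oplus> h\<close>. This covers all \<open>w\<close> outside \<open>max_ideal r\<close>,
  which are more than half of the class.\<close>

lemma agree_half:
  assumes z: "z \<in> carrier R" "z \<notin> M" and r: "r \<in> Q" and nf: "socle r \<subseteq> max_ideal r" and h: "h \<in> socle r"
  shows "card (rclass z) < 2 * agree (rclass z) h"
proof -
  let ?W = "rclass z"
  have rP: "r \<in> P" using QP[OF r] .
  have er: "e r \<in> carrier R" using e_closed[OF rP] .
  have WR: "?W \<subseteq> carrier R" by (rule rclass_carr[OF z(1)])
  have finW: "finite ?W" using WR finR finite_subset by blast
  have hc: "h \<in> carrier R" "e r \<otimes> h = h" using h by (auto simp: socle_def)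
  have kill: "k \<otimes> y = \<zero>" if k: "k \<in> socle r" and y: "y \<in> max_ideal r" for k y
  proof -
    obtain y' where y': "y \<in> carrier R" "y' \<in> carrier R" "e r \<otimes> y = q r \<otimes> e r \<otimes> y'"
      using y by (auto simp: max_ideal_def)
    have kc: "k \<in> carrier R" "e r \<otimes> k = k" "q r \<otimes> k = \<zero>" using k by (auto simp: socle_def)
    have "k \<otimes> y = (e r \<otimes> k) \<otimes> y" using kc by simp
    also have "\<dots> = k \<otimes> (e r \<otimes> y)" using kc(1) y'(1) er by (simp add: m_ac)
    also have "\<dots> = k \<otimes> (q r \<otimes> e r \<otimes> y')" using y' by simp
    also have "\<dots> = (q r \<otimes> k) \<otimes> (e r \<otimes> y')" using kc(1) y'(2) er by (simp add: m_ac)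
    finally show ?thesis using kc y' er by simp
  qed
  obtain x where x: "x \<in> max_ideal r" "x \<notin> M" using max_ideal_not_M[OF r] .
  have xc: "x \<in> carrier R" using x by (simp add: max_ideal_def)
  \<comment> \<open>A member of the class with \<open>r\<close>-component in the radical, available
    because \<open>M\<close> is strictly smaller than \<open>max_ideal r\<close>.\<close>
  define w' where "w' = z \<oplus> E \<otimes> (x \<ominus> z)"
  have w': "w' \<in> ?W" "w' \<in> max_ideal r"
  proof -
    show "w' \<in> ?W" unfolding w'_def by (rule replace_E(1)[OF z xc x(2)])
    then have "w' \<in> carrier R" using WR by blast
    moreover have "e r \<otimes> w' = e r \<otimes> x" unfolding w'_def by (rule replace_E(2)[OF z xc x(2) r])
    ultimately show "w' \<in> max_ideal r" using x by (simp add: max_ideal_def)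
  qed
  have w'c: "w' \<in> carrier R" using w' WR by blast
  have move: "same w (w \<oplus> h)" if w: "w \<in> ?W" "w \<notin> max_ideal r" for w
  proof -
    have wc: "w \<in> carrier R" using w WR by blast
    have "rsame w' w"
      using w'(1) w(1) rsame_sym[OF _ z(1)] rsame_trans[OF _ _ w'c] by (auto simp: rclass_def)
    then obtain u where u: "u \<in> Units R" "same (u \<otimes> w') w" by (auto simp: rsame_def)
    have y: "u \<otimes> w' \<in> max_ideal r"
      using ideal_memb(6)[OF ideal_max_ideal[OF rP] w'(2)] u by (simp add: Units_closed)
    obtain b where b: "b \<in> carrier R" "e r \<otimes> w \<otimes> b = e r" using max_ideal_iff[OF rP wc] w by blast
    \<comment> \<open>As \<open>b\<close> inverts \<open>w\<close> in the
      \<open>r\<close>-component, \<open>k \<otimes> w = h\<close>.\<close>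
    define k where "k = b \<otimes> h"
    have k: "k \<in> socle r" unfolding k_def using ideal_memb(6)[OF socle_ideal[OF rP] h b(1)] .
    have kc: "k \<in> carrier R" using k by (simp add: socle_def)
    have kw: "k \<otimes> w = h"
    proof -
      have "k \<otimes> w = b \<otimes> (e r \<otimes> h) \<otimes> w" using hc by (simp add: k_def)
      also have "\<dots> = (e r \<otimes> w \<otimes> b) \<otimes> h" using b(1) hc(1) wc er by (simp add: m_ac)
      finally show ?thesis using b hc by simp
    qed
    have kk: "k \<otimes> k = \<zero>" using kill[OF k] k nf by blast
    have v: "\<one> \<oplus> k \<in> Units R"
    proof -
      have "(\<one> \<oplus> k) \<otimes> (\<one> \<ominus> k) = \<one>"
        using kc kk by (simp add: minus_eq r_distr l_distr r_minus a_assoc l_neg r_neg add_normal)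
      moreover have "(\<one> \<ominus> k) \<otimes> (\<one> \<oplus> k) = \<one>" using calculation kc by (simp add: m_comm)
      ultimately show ?thesis using kc unfolding Units_def by auto
    qed
    have "(\<one> \<oplus> k) \<otimes> (u \<otimes> w') = u \<otimes> w'"
      using kill[OF k y] kc u w'c by (simp add: l_distr Units_closed)
    moreover have "(\<one> \<oplus> k) \<otimes> w = w \<oplus> h" using kw kc wc by (simp add: l_distr)
    ultimately have "same (u \<otimes> w') (w \<oplus> h)" using same_unit[OF v u(2)] by simp
    then show ?thesis using same_trans[OF same_sym[OF u(2)]] by blast
  qed
  let ?A = "{w\<in>?W. w \<in> max_ideal r}" and ?G = "{w\<in>?W. w \<notin> max_ideal r}"
  have Gag: "card ?G \<le> agree ?W h" unfolding agree_def using move finW by (intro card_mono) auto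
  have shift: "w \<oplus> e r \<in> ?G" if w: "w \<in> ?A" for w
  proof -
    have wc: "w \<in> carrier R" using w WR by blast
    have nm: "w \<oplus> e r \<notin> max_ideal r"
    proof
      assume "w \<oplus> e r \<in> max_ideal r"
      then have "w \<oplus> e r \<ominus> w \<in> max_ideal r" using ideal_memb(4)[OF ideal_max_ideal[OF rP]] w by blast
      then show False using e_notin_max_ideal[OF rP] minus_add_cancel(3)[OF er wc] by simp
    qed
    then have "w \<oplus> e r \<notin> M" using M_max_ideal[OF r] by blast
    then have "w \<oplus> e r \<in> ?W" by (intro rclass_shift_E[OF z]) (use w er E_e[OF r] in auto)
    then show ?thesis using nm by simp
  qed
  \<comment> \<open>A member with \<open>Q\<close>-component \<open>e r\<close>, which makes the
    inequality strict: if it were \<open>a \<oplus> e r\<close> with \<open>a\<close> in the class,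
    then \<open>a\<close> would have zero \<open>Q\<close>-component and lie in
    \<open>M\<close>.\<close>
  define w1 where "w1 = z \<oplus> E \<otimes> (e r \<ominus> z)"
  have w1: "w1 \<in> ?W" unfolding w1_def by (rule replace_E(1)[OF z er e_notM[OF r]])
  have w1c: "w1 \<in> carrier R" using w1 WR by blast
  have Ew1: "E \<otimes> w1 = e r" using replace_E(3)[OF z er e_notM[OF r]] E_e[OF r] by (simp add: w1_def)
  have "e r \<otimes> w1 = e r \<otimes> e r" unfolding w1_def by (rule replace_E(2)[OF z er e_notM[OF r] r])
  then have "w1 \<notin> max_ideal r"
    using max_ideal_iff[OF rP w1c] e_idem[OF rP] er by (auto intro!: bexI[of _ \<one>])
  then have w1G: "w1 \<in> ?G" using w1 by simp
  have "w1 \<notin> (\<lambda>w. w \<oplus> e r) ` ?A"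
  proof
    assume "w1 \<in> (\<lambda>w. w \<oplus> e r) ` ?A"
    then obtain a where a: "a \<in> ?A" "w1 = a \<oplus> e r" by blast
    have ac: "a \<in> carrier R" using a WR by blast
    have "E \<otimes> a \<oplus> e r = e r" using Ew1 a ac er E_e[OF r] by (simp add: r_distr)
    then have "E \<otimes> a = \<zero>" using ac er by (metis add.r_cancel_one' idem_closed m_closed)
    then show False using M_out[OF ac] rclass_notM[OF z] a by blast
  qed
  then have "(\<lambda>w. w \<oplus> e r) ` ?A \<subset> ?G" using shift w1G by blast
  then have "card ((\<lambda>w. w \<oplus> e r) ` ?A) < card ?G" using finW by (intro psubset_card_mono) auto
  moreover have "card ((\<lambda>w. w \<oplus> e r) ` ?A) = card ?A"
    using WR er by (intro card_image) (auto simp: inj_on_def subset_iff)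
  moreover have "card ?W = card ?A + card ?G"
  proof -
    have "?W = ?A \<union> ?G" "?A \<inter> ?G = {}" by auto
    then show ?thesis using finW by (metis (no_types, lifting) card_Un_disjoint finite_Un)
  qed
  ultimately show ?thesis using Gag by linarith
qed

text \<open>Each element of \<open>J - J0\<close> generates \<open>J\<close> as a block ideal, so
  the difference lies in one rational class and \<open>block_count_agree\<close> applies. With
  \<open>agree_half\<close> fewer than two basic sets of the class meet a coset of \<open>J\<close>,
  which then lies in one basic set.\<close>

lemma wreath_case_socle:
  assumes r: "r \<in> Q" and socM: "socle r \<subseteq> M"
  shows wreath
proof -
  have rP: "r \<in> P" using QP[OF r] .
  have er: "e r \<in> carrier R" using e_closed[OF rP] .
  define J where "J = gen (socle r)"
  have sJ: "block_ideal J" unfolding J_def by (rule gen_block_ideal[OF socle_sub])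
  have JM: "J \<subseteq> M" unfolding J_def by (rule gen_least[OF sM socM])
  have socJ: "socle r \<subseteq> J" unfolding J_def by (rule gen_sub)
  define J0 where "J0 = J \<inter> avoid (socle r)"
  obtain h where h: "h \<in> socle r" "h \<noteq> \<zero>" using socle_nontrivial[OF rP] .
  have hc: "h \<in> carrier R" "e r \<otimes> h = h" using h by (auto simp: socle_def)
  have sJ0: "block_ideal J0"
  proof -
    have av: "block_ideal (avoid (socle r))"
    proof (rule avoid_block_ideal[OF socle_sub])
      show "\<not> socle r \<subseteq> {\<zero>}" using h by blast
      show "socle r \<subseteq> I \<or> socle r \<subseteq> J" if "block_ideal I" "block_ideal J" "socle r \<subseteq> I <+>\<^bsub>R\<^esub> J" for I J
        using socle_prime[OF block_ideal_imp_ideal block_ideal_imp_ideal rP] that by blast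
    qed
    have "block_ideal (\<Inter>{J, avoid (socle r)})" by (rule block_ideal_Inter) (use sJ av in auto)
    then show ?thesis by (simp add: J0_def)
  qed
  have J_in: "J \<subseteq> L" if L: "block_ideal L" "g \<in> L" "g \<in> J - J0" for L g
  proof -
    have "g \<in> carrier R" using that(3) block_ideal_sub[OF sJ] by blast
    then have "socle r \<subseteq> gen {g}" using that(3) by (auto simp: J0_def avoid_def)
    then have "socle r \<subseteq> L" using gen_single[OF L(1,2)] by blast
    then show ?thesis unfolding J_def by (rule gen_least[OF L(1)])
  qed
  have hJ: "h \<in> J - J0"
  proof -
    have "socle r \<subseteq> gen {h}"
      by (rule socle_min[OF block_ideal_imp_ideal[OF gen_block_ideal] rP, of "{h}" h]) (use h hc gen_sub[of "{h}"] in auto)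
    then show ?thesis using h socJ by (auto simp: J0_def avoid_def)
  qed
  have "J \<subseteq> stab X" if X: "X \<in> S" "X \<subseteq> carrier R - M" for X
  proof
    fix j assume j: "j \<in> J"
    have jc: "j \<in> carrier R" using j block_ideal_sub[OF sJ] by blast
    have "x \<oplus> j \<in> X" if x: "x \<in> X" for x
    proof -
      have xc: "x \<in> carrier R" "x \<notin> M" using x X by auto
      let ?W = "rclass x"
      have inv: "w \<oplus> k \<in> ?W" if w: "w \<in> ?W" and k: "k \<in> J" for w k
      proof (rule rclass_step[OF xc(1) w shift_M])
        show "w \<in> carrier R" using w rclass_carr[OF xc(1)] by blast
        show "w \<notin> M" by (rule rclass_notM[OF xc w])
        show "k \<in> M" using k JM by blast
        fix L assume L: "block_ideal L" "E \<in> L"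
        have "socle r \<subseteq> L"
        proof
          fix g assume g: "g \<in> socle r"
          then have gc: "g \<in> carrier R" "e r \<otimes> g = g" by (auto simp: socle_def)
          have "(e r \<otimes> g) \<otimes> E \<in> L" using block_ideal_mult[OF L] er gc by simp
          moreover have "(e r \<otimes> g) \<otimes> E = (E \<otimes> e r) \<otimes> g" using er gc(1) by (simp add: m_ac)
          ultimately show "g \<in> L" using E_e[OF r] gc by simp
        qed
        then have "J \<subseteq> L" unfolding J_def by (rule gen_least[OF L(1)])
        then show "k \<in> L" using k by blast
      qed
      have "block_count ?W J x * agree ?W h \<le> card ?W"
      proof (rule block_count_agree[OF sJ sJ0 _ xc(1) rclass_self[OF xc(1)] _ hJ])
        show "J0 \<subseteq> J" by (auto simp: J0_def)
        show "J0 \<subseteq> stab ?W" using inv block_ideal_sub[OF sJ0] by (auto simp: stab_def J0_def)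
        fix g assume g: "g \<in> J - J0"
        have "same_ideals h g"
          unfolding same_ideals_def using J_in[OF _ _ hJ] J_in[OF _ _ g] g hJ by blast
        then show "rsame h g" using same_ideals_rsame hc g block_ideal_sub[OF sJ] by blast
      qed
      moreover have "card ?W < 2 * agree ?W h"
        using agree_half[OF xc r _ h(1)] socM M_max_ideal[OF r] by blast
      ultimately have "block_count ?W J x * agree ?W h < 2 * agree ?W h" by linarith
      then have "block_count ?W J x \<le> 1" by simp
      then have "same x (x \<oplus> j)"
        by (rule single_block[OF _ sJ rclass_self[OF xc(1)] xc(1) inv[OF rclass_self[OF xc(1)] j]])
          (use xc jc j in \<open>auto simp: minus_add_cancel\<close>)
      then show ?thesis using same_in_block[OF X(1) x] by blast
    qed
    then show "j \<in> stab X" using jc by (simp add: stab_def)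
  qed
  moreover have "J \<noteq> {\<zero>}" unfolding J_def by (rule gen_socle_nontrivial[OF rP])
  ultimately show ?thesis unfolding wreath_def using sM sJ JM MR by blast
qed

end

section \<open>Components that are fields\<close>

context cg_ring
begin

text \<open>Otherwise a Bezout relation between \<open>c\<close> and \<open>p\<close> would make
  \<open>e p\<close> zero. The integer multiples of \<open>e p\<close> thus form the prime
  field.\<close>

lemma int_e_dvd:
  assumes p: "p \<in> P" and qe: "q p \<otimes> e p = \<zero>" and c: "\<guillemotleft>c\<guillemotright> \<otimes> e p = \<zero>"
  shows "int p dvd c"
proof (rule ccontr)
  assume "\<not> int p dvd c"
  then have "coprime c (int p)"
    using primeP[OF p] prime_imp_coprime[of "int p" c] by (simp add: coprime_commute)
  then obtain a b where ab: "a * c + b * int p = 1"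
    using bezout_int[of c "int p"] by auto
  have ep: "e p \<in> carrier R" using e_closed p by simp
  have "e p = (\<guillemotleft>a\<guillemotright> \<otimes> \<guillemotleft>c\<guillemotright> \<oplus> \<guillemotleft>b\<guillemotright> \<otimes> q p) \<otimes> e p"
    using arg_cong[OF ab, of "\<lambda>i. \<guillemotleft>i\<guillemotright>"] ep by simp
  also have "\<dots> = \<guillemotleft>a\<guillemotright> \<otimes> (\<guillemotleft>c\<guillemotright> \<otimes> e p) \<oplus> \<guillemotleft>b\<guillemotright> \<otimes> (q p \<otimes> e p)" using ep by (simp add: l_distr m_assoc)
  finally have "e p = \<zero>" using qe c by simp
  then show False using e_nonunit[OF p, of \<zero>] by simp
qed

text \<open>If \<open>q p \<otimes> e p\<close> were not zero, it would be an element of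
  \<open>max_ideal p\<close> with non-zero \<open>p\<close>-component, and \<open>socle_min\<close>
  would put the socle inside \<open>max_ideal p\<close>.\<close>

lemma socle_field: assumes "p \<in> P" "\<not> socle p \<subseteq> max_ideal p" shows "q p \<otimes> e p = \<zero>"
proof (rule ccontr)
  assume ne: "q p \<otimes> e p \<noteq> \<zero>"
  have ep: "e p \<in> carrier R" using e_closed assms by simp
  have qe: "e p \<otimes> (q p \<otimes> e p) = q p \<otimes> e p \<otimes> \<one>"
    using ep e_idem[OF assms(1)] m_lcomm[of "e p" "q p" "e p"] by simp
  have "q p \<otimes> e p \<in> max_ideal p" unfolding max_ideal_def using ep qe by (auto intro!: bexI[of _ \<one>])
  moreover have "e p \<otimes> (q p \<otimes> e p) \<noteq> \<zero>" using qe ne ep by simp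
  ultimately show False using socle_min[OF ideal_max_ideal[OF assms(1)] assms(1)] assms(2) by blast
qed

end

context bad_maximal
begin

text \<open>When the \<open>r\<close>-component is a field, this is the slice of the class over an
  element of the prime field. An integer index suffices, since only the slices 0, 1, 2 and -1 are
  compared.\<close>

definition level :: "'a \<Rightarrow> nat \<Rightarrow> int \<Rightarrow> 'a set" where
  "level z r i = {w\<in>rclass z. e r \<otimes> w = \<guillemotleft>i\<guillemotright> \<otimes> e r}"

lemma notM_e: assumes "r \<in> Q" "q r \<otimes> e r = \<zero>" "w \<in> carrier R" "e r \<otimes> w \<noteq> \<zero>" shows "w \<notin> max_ideal r"
  using assms e_closed[OF QP[OF assms(1)]] by (auto simp: max_ideal_def)

text \<open>A point whose \<open>r\<close>-component is non-zero in the field is outside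
  \<open>max_ideal r\<close>, hence outside \<open>M\<close>, and \<open>rclass_shift_E\<close>
  keeps it in the class. Only the target level must be non-zero.\<close>

lemma level_shift:
  assumes z: "z \<in> carrier R" "z \<notin> M" and r: "r \<in> Q" and f: "q r \<otimes> e r = \<zero>"
    and j: "\<not> int r dvd j" and w: "w \<in> level z r i"
  shows "w \<oplus> \<guillemotleft>j - i\<guillemotright> \<otimes> e r \<in> level z r j"
proof -
  have rP: "r \<in> P" using QP[OF r] .
  have er: "e r \<in> carrier R" using e_closed[OF rP] .
  have w': "w \<in> rclass z" "e r \<otimes> w = \<guillemotleft>i\<guillemotright> \<otimes> e r" using w by (auto simp: level_def)
  have wc: "w \<in> carrier R" using w' rclass_carr[OF z(1)] by blast
  let ?v = "w \<oplus> \<guillemotleft>j - i\<guillemotright> \<otimes> e r"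
  have vc: "?v \<in> carrier R" using wc er by simp
  have "e r \<otimes> (\<guillemotleft>j - i\<guillemotright> \<otimes> e r) = \<guillemotleft>j - i\<guillemotright> \<otimes> e r"
    using m_lcomm[of "e r" "\<guillemotleft>j - i\<guillemotright>" "e r"] er e_idem[OF rP] by simp
  then have "e r \<otimes> ?v = \<guillemotleft>i\<guillemotright> \<otimes> e r \<oplus> \<guillemotleft>j - i\<guillemotright> \<otimes> e r" using wc er w' by (simp add: r_distr)
  also have "\<dots> = \<guillemotleft>i + (j - i)\<guillemotright> \<otimes> e r"
    unfolding of_int_add using er by (simp add: l_distr del: of_int_diff)
  finally have ev: "e r \<otimes> ?v = \<guillemotleft>j\<guillemotright> \<otimes> e r" by simp
  then have "e r \<otimes> ?v \<noteq> \<zero>" using int_e_dvd[OF rP f, of j] j by auto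
  then have "?v \<notin> M" using notM_e[OF r f vc] M_max_ideal[OF r] by blast
  then have "?v \<in> rclass z"
  proof (rule rclass_shift_E[OF z w'(1), rotated 2])
    show "E \<otimes> (\<guillemotleft>j - i\<guillemotright> \<otimes> e r) = \<guillemotleft>j - i\<guillemotright> \<otimes> e r"
      using m_lcomm[of E "\<guillemotleft>j - i\<guillemotright>" "e r"] er E_e[OF r] by simp
  qed (use er in simp)
  then show ?thesis using ev by (simp add: level_def)
qed

lemma finite_level: "z \<in> carrier R \<Longrightarrow> finite (level z r i)"
  by (rule finite_subset[OF _ finite_subset[OF rclass_carr finR]]) (auto simp: level_def)

lemma level_le:
  assumes z: "z \<in> carrier R" "z \<notin> M" and r: "r \<in> Q" and f: "q r \<otimes> e r = \<zero>" and j: "\<not> int r dvd j"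
  shows "card (level z r i) \<le> card (level z r j)"
proof (rule card_inj_on_le[where f = "\<lambda>w. w \<oplus> \<guillemotleft>j - i\<guillemotright> \<otimes> e r"])
  show "inj_on (\<lambda>w. w \<oplus> \<guillemotleft>j - i\<guillemotright> \<otimes> e r) (level z r i)"
    using rclass_carr[OF z(1)] e_closed[OF QP[OF r]]
      by (auto simp: inj_on_def level_def subset_iff simp del: of_int_diff)
  show "(\<lambda>w. w \<oplus> \<guillemotleft>j - i\<guillemotright> \<otimes> e r) ` level z r i \<subseteq> level z r j"
    using level_shift[OF z r f j] by blast
qed (rule finite_level[OF z(1)])

text \<open>The member \<open>w1\<close> with \<open>Q\<close>-component \<open>e r\<close> is in
  level 1 but not a translate of a point \<open>a\<close> of level 0, since \<open>a\<close> would
  have zero \<open>Q\<close>-component and lie in \<open>M\<close>.\<close>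

lemma level_less:
  assumes z: "z \<in> carrier R" "z \<notin> M" and r: "r \<in> Q" and f: "q r \<otimes> e r = \<zero>"
  shows "card (level z r 0) < card (level z r 1)"
proof -
  have rP: "r \<in> P" using QP[OF r] .
  have er: "e r \<in> carrier R" using e_closed[OF rP] .
  have WR: "rclass z \<subseteq> carrier R" by (rule rclass_carr[OF z(1)])
  have "\<not> int r dvd 1" using primeP[OF rP] by auto
  then have sh: "(\<lambda>w. w \<oplus> e r) ` level z r 0 \<subseteq> level z r 1"
    using level_shift[OF z r f, of 1 _ 0] er by auto
  define w1 where "w1 = z \<oplus> E \<otimes> (e r \<ominus> z)"
  have w1: "w1 \<in> rclass z" unfolding w1_def by (rule replace_E(1)[OF z er e_notM[OF r]])
  have w1c: "w1 \<in> carrier R" using w1 WR by blast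
  have Ew1: "E \<otimes> w1 = e r" using replace_E(3)[OF z er e_notM[OF r]] E_e[OF r] by (simp add: w1_def)
  have "e r \<otimes> w1 = e r \<otimes> e r" unfolding w1_def by (rule replace_E(2)[OF z er e_notM[OF r] r])
  then have w1l: "w1 \<in> level z r 1" using w1 e_idem[OF rP] er by (simp add: level_def)
  have "w1 \<notin> (\<lambda>w. w \<oplus> e r) ` level z r 0"
  proof
    assume "w1 \<in> (\<lambda>w. w \<oplus> e r) ` level z r 0"
    then obtain a where a: "a \<in> rclass z" "w1 = a \<oplus> e r" by (auto simp: level_def)
    have ac: "a \<in> carrier R" using a WR by blast
    have "E \<otimes> a \<oplus> e r = e r" using Ew1 a ac er E_e[OF r] by (simp add: r_distr)
    then have "E \<otimes> a = \<zero>" using ac er by (metis add.r_cancel_one' idem_closed m_closed)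
    then show False using M_out[OF ac] rclass_notM[OF z] a by blast
  qed
  then have "(\<lambda>w. w \<oplus> e r) ` level z r 0 \<subset> level z r 1" using sh w1l by blast
  then have "card ((\<lambda>w. w \<oplus> e r) ` level z r 0) < card (level z r 1)"
    using finite_level[OF z(1)] by (intro psubset_card_mono) auto
  moreover have "card ((\<lambda>w. w \<oplus> e r) ` level z r 0) = card (level z r 0)"
    using WR er by (intro card_image) (auto simp: inj_on_def level_def subset_iff)
  ultimately show ?thesis by simp
qed

text \<open>The second prime \<open>s\<close> supplies a member \<open>w'\<close> with zero
  \<open>r\<close>-component, whose multiples are fixed by every unit that is 1 outside
  \<open>r\<close>. The factor \<open>1 + 1/w\<close> at \<open>r\<close> carries \<open>w\<close>
  to \<open>w + e r\<close>; at level 0 the inverse is missing, and at level -1 the factor is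
  zero.\<close>

lemma field_move:
  assumes z: "z \<in> carrier R" "z \<notin> M" and r: "r \<in> Q" and s: "s \<in> Q" "s \<noteq> r" and f: "q r \<otimes> e r = \<zero>"
    and w: "w \<in> rclass z" "w \<notin> level z r 0" "w \<notin> level z r (-1)"
  shows "same w (w \<oplus> e r)"
proof -
  have rP: "r \<in> P" and sP: "s \<in> P" using QP r s by auto
  have er: "e r \<in> carrier R" and es: "e s \<in> carrier R" using e_closed rP sP by auto
  have WR: "rclass z \<subseteq> carrier R" by (rule rclass_carr[OF z(1)])
  have wc: "w \<in> carrier R" using w WR by blast
  define w' where "w' = z \<oplus> E \<otimes> (e s \<ominus> z)"
  have w': "w' \<in> rclass z" unfolding w'_def by (rule replace_E(1)[OF z es e_notM[OF s(1)]])
  have w'c: "w' \<in> carrier R" using w' WR by blast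
  have "e r \<otimes> w' = e r \<otimes> e s" unfolding w'_def by (rule replace_E(2)[OF z es e_notM[OF s(1)] r])
  then have ew': "e r \<otimes> w' = \<zero>" using e_orth[OF rP sP] s by simp
  have "rsame w' w" using w' w(1) rsame_sym[OF _ z(1)] rsame_trans[OF _ _ w'c] by (auto simp: rclass_def)
  then obtain u where u: "u \<in> Units R" "same (u \<otimes> w') w" by (auto simp: rsame_def)
  have uc: "u \<in> carrier R" using u by (simp add: Units_closed)
  have ew: "e r \<otimes> w \<noteq> \<zero>" using w er by (auto simp: level_def)
  have ew1: "e r \<otimes> w \<oplus> e r \<noteq> \<zero>"
  proof
    assume "e r \<otimes> w \<oplus> e r = \<zero>"
    then have "e r \<otimes> w = \<ominus> e r" using er wc by (simp add: minus_equality)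
    then have "e r \<otimes> w = \<guillemotleft>- 1\<guillemotright> \<otimes> e r" unfolding of_int_minus using er by (simp add: l_minus)
    then show False using w by (simp add: level_def)
  qed
  obtain b where b: "b \<in> carrier R" "e r \<otimes> w \<otimes> b = e r"
    using max_ideal_iff[OF rP wc] notM_e[OF r f wc ew] by blast
  have bc: "\<one> \<oplus> b \<in> carrier R" using b by simp
  have key: "e r \<otimes> (\<one> \<oplus> b) \<otimes> w = e r \<otimes> w \<oplus> e r"
  proof -
    have "e r \<otimes> (\<one> \<oplus> b) \<otimes> w = e r \<otimes> w \<oplus> e r \<otimes> w \<otimes> b"
      using er wc b(1) by (simp add: r_distr l_distr m_ac)
    then show ?thesis using b by simp
  qed
  have "e r \<otimes> (\<one> \<oplus> b) \<noteq> \<zero>"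
  proof
    assume "e r \<otimes> (\<one> \<oplus> b) = \<zero>"
    then have "e r \<otimes> (\<one> \<oplus> b) \<otimes> w = \<zero>" using wc by simp
    then show False using key ew1 by simp
  qed
  then have nb: "\<one> \<oplus> b \<notin> max_ideal r" using notM_e[OF r f bc] by blast
  define v where "v = glue (\<lambda>s. if s = r then \<one> \<oplus> b else \<one>)"
  have v: "v \<in> local_units r" "e r \<otimes> v = e r \<otimes> (\<one> \<oplus> b)"
    unfolding v_def using local_unit_glue[OF rP bc nb] by auto
  have vU: "v \<in> Units R" using v by (simp add: local_units_def)
  have vc: "v \<in> carrier R" using vU by (simp add: Units_closed)
  have vw: "v \<otimes> w = w \<oplus> e r"
  proof (rule comp_ext)
    fix t assume t: "t \<in> P"
    have et: "e t \<in> carrier R" using e_closed t by simp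
    show "e t \<otimes> (v \<otimes> w) = e t \<otimes> (w \<oplus> e r)"
    proof (cases "t = r")
      case True
      have "e r \<otimes> (v \<otimes> w) = e r \<otimes> w \<oplus> e r" using key v er vc wc by (simp add: m_assoc[symmetric])
      then show ?thesis using True er wc e_idem[OF rP] by (simp add: r_distr)
    next
      case False
      then have "e t \<otimes> v = e t" using v t by (simp add: local_units_def)
      then show ?thesis using False et vc wc er e_orth[OF t rP] by (simp add: m_assoc[symmetric] r_distr)
    qed
  qed (use vc wc er in auto)
  have vw': "v \<otimes> (u \<otimes> w') = u \<otimes> w'"
  proof (rule comp_ext)
    fix t assume t: "t \<in> P"
    have et: "e t \<in> carrier R" using e_closed t by simp
    show "e t \<otimes> (v \<otimes> (u \<otimes> w')) = e t \<otimes> (u \<otimes> w')"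
    proof (cases "t = r")
      case True
      have "e r \<otimes> (v \<otimes> (u \<otimes> w')) = v \<otimes> (u \<otimes> (e r \<otimes> w'))" "e r \<otimes> (u \<otimes> w') = u \<otimes> (e r \<otimes> w')"
        using er vc uc w'c by (simp_all add: m_ac)
      then show ?thesis using True ew' vc uc by simp
    next
      case False
      then have "e t \<otimes> v = e t" using v t by (simp add: local_units_def)
      then show ?thesis using et vc uc w'c by (simp add: m_assoc[symmetric])
    qed
  qed (use vc uc w'c in auto)
  have "same (u \<otimes> w') (w \<oplus> e r)" using same_unit[OF vU u(2)] vw vw' by simp
  then show ?thesis using same_trans[OF same_sym[OF u(2)]] by blast
qed

text \<open>\<open>agree\<close> counts at least the points outside the levels 0 and -1. Level 0 is
  smaller than level 1, and level -1 is at most as large as level 1 or level 2. Level 1 is among the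
  counted points for \<open>r \<ge> 3\<close>, and level 2 as well for \<open>r > 3\<close>; this
  gives the factors 3 and 2.\<close>

lemma agree_field:
  assumes z: "z \<in> carrier R" "z \<notin> M" and r: "r \<in> Q" and s: "s \<in> Q" "s \<noteq> r" and f: "q r \<otimes> e r = \<zero>"
    and r2: "r \<noteq> 2"
  shows "card (rclass z) < 3 * agree (rclass z) (e r)"
    and "r > 3 \<Longrightarrow> card (rclass z) < 2 * agree (rclass z) (e r)"
proof -
  let ?W = "rclass z" and ?F = "level z r"
  have rP: "r \<in> P" using QP[OF r] .
  have pr: "Factorial_Ring.prime r" by (rule primeP[OF rP])
  have r3: "r \<ge> 3" using prime_ge_2_nat[OF pr] r2 by simp
  have finW: "finite ?W" using rclass_carr[OF z(1)] finR finite_subset by blast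
  define G where "G = ?W - ?F 0 - ?F (-1)"
  have finG: "finite G" using finW by (simp add: G_def)
  have "card G \<le> agree ?W (e r)" unfolding agree_def
    using field_move[OF z r s f] finW by (intro card_mono) (auto simp: G_def)
  have "?W \<subseteq> ?F 0 \<union> ?F (-1) \<union> G" by (auto simp: G_def)
  then have "card ?W \<le> card (?F 0 \<union> ?F (-1) \<union> G)"
    using finite_level[OF z(1)] finG by (intro card_mono) auto
  also have "\<dots> \<le> card (?F 0) + card (?F (-1)) + card G"
    by (meson card_Un_le add_le_mono1 le_trans)
  finally have W: "card ?W \<le> card (?F 0) + card (?F (-1)) + card G" .
  have nd: "\<not> int r dvd c" if "0 < c" "c < int r" for c using that zdvd_not_zless by blast
  have disj: "?F i \<inter> ?F j = {}" if "\<not> int r dvd i - j" for i j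
  proof (rule ccontr)
    assume "?F i \<inter> ?F j \<noteq> {}"
    then have eq: "\<guillemotleft>i\<guillemotright> \<otimes> e r = \<guillemotleft>j\<guillemotright> \<otimes> e r" by (auto simp: level_def)
    have er: "e r \<in> carrier R" using e_closed[OF rP] .
    have "\<guillemotleft>i - j\<guillemotright> \<otimes> e r = \<guillemotleft>i\<guillemotright> \<otimes> e r \<ominus> \<guillemotleft>j\<guillemotright> \<otimes> e r"
      unfolding of_int_diff using er by (simp add: minus_eq l_distr l_minus)
    then have "\<guillemotleft>i - j\<guillemotright> \<otimes> e r = \<zero>" using eq er by (simp add: minus_self)
    then show False using int_e_dvd[OF rP f] that by blast
  qed
  have sub: "?F c \<subseteq> G" if c: "0 < c" "c + 1 < int r" for c
  proof -
    have "?F c \<inter> ?F 0 = {}" by (rule disj) (use c nd in auto)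
    moreover have "?F c \<inter> ?F (-1) = {}" by (rule disj) (use c nd[of "c + 1"] in auto)
    ultimately show ?thesis unfolding G_def level_def by blast
  qed
  have F1G: "?F 1 \<subseteq> G" by (rule sub) (use r3 in auto)
  have l0: "card (?F 0) < card (?F 1)" by (rule level_less[OF z r f])
  have l1: "card (?F (-1)) \<le> card (?F c)" if "0 < c" "c < int r" for c
    by (rule level_le[OF z r f nd[OF that]])
  have c1: "card (?F 1) \<le> card G" using F1G finG by (rule card_mono[rotated])
  show "card ?W < 3 * agree ?W (e r)"
    using W l0 l1[of 1] r3 c1 \<open>card G \<le> agree ?W (e r)\<close> by linarith
  assume "r > 3"
  then have r4: "int r > 3" by simp
  have "?F 2 \<subseteq> G" by (rule sub) (use r4 in auto)
  moreover have "?F 1 \<inter> ?F 2 = {}"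
    using disj[of 2 1] nd[of 1] r4 by auto
  ultimately have "card (?F 1) + card (?F 2) \<le> card G"
    using F1G finG finite_level[OF z(1)] card_Un_disjoint card_mono by (metis Un_least)
  then show "card ?W < 2 * agree ?W (e r)"
    using W l0 l1[of 2] r4 \<open>card G \<le> agree ?W (e r)\<close> by linarith
qed

text \<open>If the \<open>R\<^sub>r\<close> with \<open>r \<in> Q\<close> are fields, one of them of order \<open>2\<close>, then \<open>agree\<close> may be at most half of the
  class (as for \<open>Z\<^sub>6\<close>) but exceeds a third, and the number of basic sets meeting a coset is odd.\<close>

lemma final_case:
  assumes nsoc: "\<And>r. r \<in> Q \<Longrightarrow> \<not> socle r \<subseteq> M"
  shows "wreath \<or> splits Q"
proof -
  \<comment> \<open>By \<open>socle_min\<close>, an ideal containing no socle of a prime in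
    \<open>Q\<close> has zero \<open>Q\<close>-component. So \<open>M\<close> is exactly the
    complement of the \<open>Q\<close>-component.\<close>
  have M_iff: "x \<in> M \<longleftrightarrow> x \<in> carrier R \<and> E \<otimes> x = \<zero>" for x
  proof
    assume x: "x \<in> M"
      have xc: "x \<in> carrier R" using x block_ideal_sub[OF sM] by blast
      have "E \<otimes> x = \<zero>"
      proof (rule comp_ext)
        fix r assume r: "r \<in> P"
        have er: "e r \<in> carrier R" using e_closed r by simp
        show "e r \<otimes> (E \<otimes> x) = e r \<otimes> \<zero>"
        proof (cases "r \<in> Q")
          case True
          then have "e r \<otimes> x = \<zero>" using socle_min[OF block_ideal_imp_ideal[OF sM] r x] nsoc by blast
          then show ?thesis using True r xc er by (simp add: e_idem_set')
        qed (use r xc er in \<open>simp add: e_idem_set'\<close>)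
      qed (use xc in auto)
      then show "x \<in> carrier R \<and> E \<otimes> x = \<zero>" using xc by simp
  qed (use M_out in blast)
  have M_eq: "{x\<in>carrier R. E \<otimes> x = \<zero>} = M" using M_iff by blast
  define J where "J = gen {E}"
  have sJ: "block_ideal J" unfolding J_def by (rule gen_block_ideal) simp
  have EJ: "E \<in> J" unfolding J_def using gen_sub[of "{E}"] by simp
  have Jc: "J \<subseteq> carrier R" by (rule block_ideal_sub[OF sJ])
  have J_least: "J \<subseteq> L" if "block_ideal L" "E \<in> L" for L unfolding J_def by (rule gen_single[OF that])
  \<comment> \<open>A block ideal containing an element of \<open>J - J0\<close> is not inside
    \<open>M\<close>, hence contains \<open>E\<close> and thus \<open>J\<close>. So
    \<open>J - J0\<close> lies in one rational class.\<close>
  define J0 where "J0 = J \<inter> M"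
  have sJ0: "block_ideal J0"
  proof -
    have "block_ideal (\<Inter>{J, M})" by (rule block_ideal_Inter) (use sJ sM in auto)
    then show ?thesis by (simp add: J0_def)
  qed
  have J0c: "J0 \<subseteq> carrier R" by (rule block_ideal_sub[OF sJ0])
  have J0J: "J0 \<subseteq> J" and J0M: "J0 \<subseteq> M" by (auto simp: J0_def)
  have inv: "w \<oplus> k \<in> rclass z" if z: "z \<in> carrier R" "z \<notin> M" and w: "w \<in> rclass z" and k: "k \<in> J0"
    for z w k
  proof (rule rclass_step[OF z(1) w shift_M])
    show "w \<in> carrier R" using w rclass_carr[OF z(1)] by blast
    show "w \<notin> M" by (rule rclass_notM[OF z w])
    show "k \<in> M" using k J0M by blast
    show "k \<in> L" if "block_ideal L" "E \<in> L" for L using J_least[OF that] k J0J by blast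
  qed
  \<comment> \<open>The translation is split into its \<open>Q\<close>-component, handled by
    \<open>rclass_shift_E\<close>, and a remainder in \<open>J0\<close>.\<close>
  have inv2: "w \<oplus> j \<in> rclass z"
    if z: "z \<in> carrier R" "z \<notin> M" and w: "w \<in> rclass z" and j: "j \<in> J" and wj: "w \<oplus> j \<notin> M" for z w j
  proof -
    have wc: "w \<in> carrier R" using w rclass_carr[OF z(1)] by blast
    have jc: "j \<in> carrier R" using j Jc by blast
    let ?k = "j \<ominus> E \<otimes> j"
    have "E \<otimes> ?k = \<zero>" using jc E_E[OF jc] by (simp add: minus_eq r_distr r_minus r_neg)
    then have kM: "?k \<in> M" using M_out jc by simp
    have "j \<otimes> E \<in> J" using block_ideal_mult[OF sJ EJ jc] .
    then have "E \<otimes> j \<in> J" using jc by (simp add: m_comm)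
    then have "?k \<in> J" using block_ideal_minus[OF sJ j] by blast
    then have k: "?k \<in> J0" using kM by (simp add: J0_def)
    have split: "(w \<oplus> E \<otimes> j) \<oplus> ?k = w \<oplus> j" using wc jc by (simp add: add_normal)
    have "w \<oplus> E \<otimes> j \<notin> M"
      using M_add_iff[of "w \<oplus> E \<otimes> j", OF _ kM] wj split wc jc by simp
    then have "w \<oplus> E \<otimes> j \<in> rclass z" by (intro rclass_shift_E[OF z w]) (use jc E_E in auto)
    then show ?thesis using inv[OF z _ k] split by metis
  qed
  have e_J: "e r \<in> J - J0" if r: "r \<in> Q" for r
  proof -
    have er: "e r \<in> carrier R" using e_closed[OF QP[OF r]] .
    have "e r \<otimes> E \<in> J" using block_ideal_mult[OF sJ EJ er] .
    then have "e r \<in> J" using E_e[OF r] er by (simp add: m_comm)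
    then show ?thesis using e_notM[OF r] by (simp add: J0_def)
  qed
  have cardJ: "card J0 < card J"
    using J0J e_J[OF pQ] finite_subset[OF Jc finR] by (intro psubset_card_mono) auto
  \<comment> \<open>The coset \<open>z + J\<close> meets \<open>M\<close> in exactly one coset of
    \<open>J0\<close>, and its remaining points all belong to the class of \<open>z\<close>.\<close>
  have coset: "card {x\<in>rclass z. x \<ominus> z \<in> J} = card J - card J0" if z: "z \<in> carrier R" "z \<notin> M" for z
  proof -
    have "card {x\<in>rclass z. x \<ominus> z \<in> J} = card {j\<in>J. z \<oplus> j \<notin> M}"
    proof (rule bij_betw_same_card, rule bij_betw_byWitness[where f' = "\<lambda>j. z \<oplus> j"])
      show "\<forall>a\<in>{x \<in> rclass z. x \<ominus> z \<in> J}. z \<oplus> (a \<ominus> z) = a"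
        using rclass_carr[OF z(1)] z by (auto simp: minus_add_cancel subset_iff)
      show "\<forall>a'\<in>{j \<in> J. z \<oplus> j \<notin> M}. (z \<oplus> a') \<ominus> z = a'"
        using Jc z by (auto simp: minus_add_cancel subset_iff)
      show "(\<lambda>x. x \<ominus> z) ` {x \<in> rclass z. x \<ominus> z \<in> J} \<subseteq> {j \<in> J. z \<oplus> j \<notin> M}"
        using rclass_carr[OF z(1)] rclass_notM[OF z] z by (auto simp: minus_add_cancel subset_iff)
      show "(\<lambda>j. z \<oplus> j) ` {j \<in> J. z \<oplus> j \<notin> M} \<subseteq> {x \<in> rclass z. x \<ominus> z \<in> J}"
        using inv2[OF z rclass_self[OF z(1)]] Jc z by (auto simp: minus_add_cancel subset_iff)
    qed
    also have "{j\<in>J. z \<oplus> j \<notin> M} = J - (\<lambda>k. k \<ominus> E \<otimes> z) ` J0"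
    proof -
      have Ez: "E \<otimes> z \<in> J" using block_ideal_mult[OF sJ EJ z(1)] z by (simp add: m_comm)
      have zEz: "z \<ominus> E \<otimes> z \<in> M"
        by (rule M_out) (use z E_E in \<open>auto simp: minus_eq r_distr r_minus r_neg\<close>)
      have "z \<oplus> j \<in> M \<longleftrightarrow> j \<in> (\<lambda>k. k \<ominus> E \<otimes> z) ` J0" if j: "j \<in> J" for j
      proof
        have jc: "j \<in> carrier R" using j Jc by blast
        assume "z \<oplus> j \<in> M"
        then have "(z \<oplus> j) \<ominus> (z \<ominus> E \<otimes> z) \<in> M" using block_ideal_minus[OF sM _ zEz] by blast
        moreover have "(z \<oplus> j) \<ominus> (z \<ominus> E \<otimes> z) = j \<oplus> E \<otimes> z" using z jc by (simp add: add_normal)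
        ultimately have "j \<oplus> E \<otimes> z \<in> J0" using block_ideal_add[OF sJ j Ez] by (simp add: J0_def)
        moreover have "j = (j \<oplus> E \<otimes> z) \<ominus> E \<otimes> z" using z jc by (simp add: minus_add_cancel)
        ultimately show "j \<in> (\<lambda>k. k \<ominus> E \<otimes> z) ` J0" by blast
      next
        assume "j \<in> (\<lambda>k. k \<ominus> E \<otimes> z) ` J0"
        then obtain k where k: "k \<in> J0" "j = k \<ominus> E \<otimes> z" by blast
        have kc: "k \<in> carrier R" using k J0c by blast
        have "(z \<ominus> E \<otimes> z) \<oplus> k \<in> M" using block_ideal_add[OF sM zEz] k J0M by blast
        moreover have "z \<oplus> j = (z \<ominus> E \<otimes> z) \<oplus> k" using k kc z by (simp add: add_normal)
        ultimately show "z \<oplus> j \<in> M" by simp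
      qed
      then show ?thesis by blast
    qed
    also have "card \<dots> = card J - card ((\<lambda>k. k \<ominus> E \<otimes> z) ` J0)"
    proof (rule card_Diff_subset)
      show "finite ((\<lambda>k. k \<ominus> E \<otimes> z) ` J0)" using J0c finR finite_subset by blast
      show "(\<lambda>k. k \<ominus> E \<otimes> z) ` J0 \<subseteq> J"
        using J0J block_ideal_minus[OF sJ] block_ideal_mult[OF sJ EJ z(1)] z by (auto simp: m_comm)
    qed
    also have "card ((\<lambda>k. k \<ominus> E \<otimes> z) ` J0) = card J0"
      using J0c z by (intro card_image) (auto simp: inj_on_def minus_eq subset_iff)
    finally show ?thesis .
  qed
  have nb: "block_count (rclass z) J z * agree (rclass z) h \<le> card (rclass z)"
    if z: "z \<in> carrier R" "z \<notin> M" and h: "h \<in> J - J0" for z h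
  proof (rule block_count_agree[OF sJ sJ0 J0J z(1) rclass_self[OF z(1)] _ h])
    show "J0 \<subseteq> stab (rclass z)" using inv[OF z] J0c by (auto simp: stab_def)
    fix g assume g: "g \<in> J - J0"
    have "J \<subseteq> L" if "block_ideal L" "k \<in> L" "k \<in> J - J0" for L k
      using J_least[OF that(1) E_mem[OF that(1)]] that by (auto simp: J0_def)
    then have "h \<in> L \<longleftrightarrow> g \<in> L" if "block_ideal L" for L using that h g by (meson DiffD1 subsetD)
    then have "same_ideals h g" by (simp add: same_ideals_def)
    then show "rsame h g" using same_ideals_rsame h g Jc by blast
  qed
  have funpow2: "(f ^^ 2) a = f (f a)" for f :: "'a \<Rightarrow> 'a" and a
    by (simp add: numeral_2_eq_2)
  \<comment> \<open>Translation by \<open>e 2\<close> has no fixed point on \<open>J\<close>, so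
    \<open>card J\<close> is even. On \<open>J0\<close>, where the 2-component is zero, negation
    fixes only zero, so \<open>card J0\<close> is odd.\<close>
  have odd_case: "odd (card J - card J0)" if Q2: "2 \<in> Q" and f: "q 2 \<otimes> e 2 = \<zero>"
  proof -
    have P2: "2 \<in> P" using QP[OF Q2] .
    have e2: "e 2 \<in> carrier R" "e 2 \<noteq> \<zero>" using e_closed[OF P2] e_nonunit[OF P2, of \<zero>] by auto
    have finJ: "finite J" "finite J0" using Jc J0c finR finite_subset by auto
    have q2: "q 2 \<otimes> x = x \<oplus> x" if "x \<in> carrier R" for x
      using that of_int_2 by (simp add: l_distr)
    have "card J mod 2 = card {j\<in>J. j \<oplus> e 2 = j} mod 2"
    proof (rule card_mod_prime_fixpoints[OF finJ(1) two_is_prime_nat])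
      show "a \<oplus> e 2 \<in> J" if "a \<in> J" for a using block_ideal_add[OF sJ that] e_J[OF Q2] by blast
      show "((\<lambda>j. j \<oplus> e 2) ^^ 2) a = a" if "a \<in> J" for a
      proof -
        have "a \<in> carrier R" using that Jc by blast
        moreover have "e 2 \<oplus> e 2 = \<zero>" using f q2[OF e2(1)] by metis
        ultimately show ?thesis unfolding funpow2 using e2 by (simp add: a_assoc)
      qed
    qed
    also have "{j\<in>J. j \<oplus> e 2 = j} = {}" using Jc e2 by auto
    finally have "even (card J)" by (simp add: even_iff_mod_2_eq_zero)
    moreover have "card J0 mod 2 = card {j\<in>J0. \<ominus> j = j} mod 2"
    proof (rule card_mod_prime_fixpoints[OF finJ(2) two_is_prime_nat])
      show "\<ominus> a \<in> J0" if "a \<in> J0" for a using block_ideal_neg[OF sJ0 that] .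
      show "((\<lambda>j. \<ominus> j) ^^ 2) a = a" if "a \<in> J0" for a
        unfolding funpow2 using that J0c by (simp add: subset_iff)
    qed
    moreover have "{j\<in>J0. \<ominus> j = j} = {\<zero>}"
    proof -
      have "j = \<zero>" if j: "j \<in> J0" "\<ominus> j = j" for j
      proof -
        have jc: "j \<in> carrier R" using j J0c by blast
        have "j \<oplus> j = \<zero>" using j(2) jc r_neg[of j] by simp
        then have qj: "q 2 \<otimes> j \<in> {\<zero>}" using q2[OF jc] by simp
        show ?thesis
        proof (rule comp_ext[OF jc])
          fix r assume r: "r \<in> P"
          have er: "e r \<in> carrier R" using e_closed r by simp
          show "e r \<otimes> j = e r \<otimes> \<zero>"
          proof (cases "r = 2")
            case False
            then show ?thesis using comp_other[OF zeroideal P2 r False jc qj] er by simp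
          next
            case True
            have "e r \<otimes> j = e r \<otimes> (E \<otimes> j)" using e_idem_set'[OF r jc, of Q] True Q2 by simp
            moreover have "E \<otimes> j = \<zero>" using j J0M M_iff by blast
            ultimately show ?thesis by simp
          qed
        qed simp
      qed
      then have "{j\<in>J0. \<ominus> j = j} \<subseteq> {\<zero>}" by blast
      moreover have "\<zero> \<in> {j\<in>J0. \<ominus> j = j}" using block_ideal_zero[OF sJ0] by simp
      ultimately show ?thesis by blast
    qed
    ultimately have "odd (card J0)" by (simp add: odd_iff_mod_2_eq_one)
    then show ?thesis using \<open>even (card J)\<close> cardJ by simp
  qed
  have one: "block_count (rclass z) J z \<le> 1" if z: "z \<in> carrier R" "z \<notin> M" for z
  proof (cases "\<exists>r\<in>Q. socle r \<subseteq> max_ideal r")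
    case True
    then obtain r where r: "r \<in> Q" "socle r \<subseteq> max_ideal r" by blast
    have rP: "r \<in> P" using QP[OF r(1)] .
    obtain h where h: "h \<in> socle r" "h \<noteq> \<zero>" using socle_nontrivial[OF rP] .
    have hc: "h \<in> carrier R" "e r \<otimes> h = h" using h by (auto simp: socle_def)
    have er: "e r \<in> carrier R" using e_closed[OF rP] .
    have "h \<otimes> e r \<in> J" using block_ideal_mult[OF sJ _ hc(1)] e_J[OF r(1)] by blast
    then have "h \<in> J" using hc er m_comm[of h "e r"] by simp
    moreover have "E \<otimes> h = h"
    proof -
      have "E \<otimes> (e r \<otimes> h) = (E \<otimes> e r) \<otimes> h" using er hc(1) by (simp add: m_assoc)
      then show ?thesis using E_e[OF r(1)] hc by simp
    qed
    moreover have "h \<notin> M" if "E \<otimes> h = h" using that h M_iff[of h] by simp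
    ultimately have "h \<in> J - J0" by (simp add: J0_def)
    from nb[OF z this] agree_half[OF z r h(1)]
    have "block_count (rclass z) J z * agree (rclass z) h < 2 * agree (rclass z) h" by linarith
    then show ?thesis by simp
  next
    case False
    then have f: "q r \<otimes> e r = \<zero>" if "r \<in> Q" for r using socle_field[OF QP[OF that]] that by blast
    obtain x where x: "x \<in> max_ideal p" "x \<notin> M" using max_ideal_not_M[OF pQ] .
    have xc: "x \<in> carrier R" using x by (simp add: max_ideal_def)
    have epx: "e p \<otimes> x = \<zero>" using x f[OF pQ] e_closed[OF p] by (auto simp: max_ideal_def)
    \<comment> \<open>The radical of a field is zero. If \<open>p\<close> were the only prime in
      \<open>Q\<close>, every element of \<open>max_ideal p\<close> would have zero
      \<open>Q\<close>-component and lie in \<open>M\<close>.\<close>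
    have "\<exists>r\<in>Q. r \<noteq> p"
    proof (rule ccontr)
      assume only: "\<not> (\<exists>r\<in>Q. r \<noteq> p)"
      have "E \<otimes> x = \<zero>"
      proof (rule comp_ext)
        fix r assume r: "r \<in> P"
        show "e r \<otimes> (E \<otimes> x) = e r \<otimes> \<zero>"
          using only epx r xc e_closed[OF r] by (auto simp: e_idem_set')
      qed (use xc in auto)
      then show False using x M_out[OF xc] by blast
    qed
    then obtain s where s: "s \<in> Q" "s \<noteq> p" by blast
    show ?thesis
    proof (cases "2 \<in> Q")
      case True
      obtain r where r: "r \<in> Q" "r \<noteq> 2" using s pQ by metis
      \<comment> \<open>An odd prime of \<open>Q\<close> bounds the number of basic sets by 2, and 2
        itself is impossible because that number divides the odd number
        \<open>card J - card J0\<close>.\<close>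
      have a: "card (rclass z) < 3 * agree (rclass z) (e r)"
        by (rule agree_field(1)[OF z r(1) True r(2)[symmetric] f[OF r(1)] r(2)])
      have "block_count (rclass z) J z * agree (rclass z) (e r) < 3 * agree (rclass z) (e r)"
        using nb[OF z e_J[OF r(1)]] a by linarith
      then have "block_count (rclass z) J z < 3" by simp
      moreover have "odd (block_count (rclass z) J z)"
        using block_count_coset_count[OF sJ z(1) rclass_self[OF z(1)]] coset[OF z] odd_case[OF True f[OF True]]
        by (metis even_mult_iff)
      ultimately show ?thesis by (cases "block_count (rclass z) J z = 2") auto
    next
      case False
      have odds: "r \<noteq> 2" if "r \<in> Q" for r using that False by blast
      have ge3: "r \<ge> 3" if "r \<in> Q" for r
        using prime_ge_2_nat[OF primeP[OF QP[OF that]]] odds[OF that] by simp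
      \<comment> \<open>\<open>Q\<close> contains two different odd primes, and only one of them can
        be 3.\<close>
      obtain r t where r: "r \<in> Q" "t \<in> Q" "t \<noteq> r" "r > 3"
      proof (cases "p > 3")
        case True
        then show ?thesis using that[of p s] s pQ by blast
      next
        case False
        then have "s > 3" using ge3[OF pQ] ge3[OF s(1)] s by simp
        then show ?thesis using that[of s p] s pQ by blast
      qed
      have "card (rclass z) < 2 * agree (rclass z) (e r)"
        by (rule agree_field(2)[OF z r(1,2,3) f[OF r(1)] odds[OF r(1)] r(4)])
      then have "block_count (rclass z) J z * agree (rclass z) (e r) < 2 * agree (rclass z) (e r)"
        using nb[OF z e_J[OF r(1)]] by linarith
      then show ?thesis by simp
    qed
  qed
  have block: "x \<oplus> j \<in> X" if X: "X \<in> S" "x \<in> X" "x \<notin> M" and j: "j \<in> J" "x \<oplus> j \<notin> M" for X x j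
  proof -
    have xc: "x \<in> carrier R" using X block_sub by blast
    have jc: "j \<in> carrier R" using j Jc by blast
    have "same x (x \<oplus> j)"
      by (rule single_block[OF one[OF xc X(3)] sJ rclass_self[OF xc] xc inv2[OF xc X(3) rclass_self[OF xc] j]])
        (use xc jc j in \<open>auto simp: minus_add_cancel\<close>)
    then show ?thesis using same_in_block[OF X(1,2)] by blast
  qed
  show ?thesis
  proof (cases "J0 = {\<zero>}")
    case False
    have "J0 \<subseteq> stab X" if X: "X \<in> S" "X \<subseteq> carrier R - M" for X
    proof -
      have "x \<oplus> k \<in> X" if "x \<in> X" "k \<in> J0" for x k
        using block[OF X(1) that(1), of k] M_add_iff[of x k] that X(2) J0J J0M by blast
      then show ?thesis using J0c by (auto simp: stab_def)
    qed
    then have wreath unfolding wreath_def using sM sJ0 J0M False MR by blast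
    then show ?thesis by blast
  next
    case True
    have J_eq: "J = {x\<in>carrier R. E \<otimes> x = x}"
    proof (intro equalityI subsetI)
      fix j assume j: "j \<in> J"
      have jc: "j \<in> carrier R" using j Jc by blast
      have "E \<otimes> j \<in> J" using block_ideal_mult[OF sJ EJ jc] jc by (simp add: m_comm)
      then have "j \<ominus> E \<otimes> j \<in> J" using block_ideal_minus[OF sJ j] by blast
      moreover have "j \<ominus> E \<otimes> j \<in> M"
        by (rule M_out) (use jc E_E in \<open>auto simp: minus_eq r_distr r_minus r_neg\<close>)
      ultimately have "j \<ominus> E \<otimes> j = \<zero>" using True by (auto simp: J0_def)
      then have "j = E \<otimes> j" using jc minus_add_cancel(1)[of j "E \<otimes> j"] by simp
      then show "j \<in> {x\<in>carrier R. E \<otimes> x = x}" using jc by simp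
    next
      fix j assume j: "j \<in> {x\<in>carrier R. E \<otimes> x = x}"
      then have "j \<otimes> E \<in> J" using block_ideal_mult[OF sJ EJ] by blast
      then show "j \<in> J" using j m_comm[of j E] by simp
    qed
    have "\<exists>r\<in>Q. \<exists>x\<in>max_ideal r. E \<otimes> x \<noteq> \<zero>"
    proof -
      obtain x where x: "x \<in> max_ideal p" "x \<notin> M" using max_ideal_not_M[OF pQ] .
      then have "x \<in> carrier R" by (simp add: max_ideal_def)
      then have "E \<otimes> x \<noteq> \<zero>" using x M_iff by blast
      then show ?thesis using x pQ by blast
    qed
    moreover have "x \<oplus> s \<in> X" if "X \<in> S" "x \<in> X" "s \<in> carrier R" "E \<otimes> s = s" "E \<otimes> x \<noteq> \<zero>"
      "E \<otimes> (x \<oplus> s) \<noteq> \<zero>" for X x s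
    proof (rule block[OF that(1,2)])
      show "x \<notin> M" "x \<oplus> s \<notin> M" using that M_iff by auto
      show "s \<in> J" using that J_eq by blast
    qed
    ultimately have "splits Q" unfolding splits_def M_eq J_eq[symmetric] using sJ sM QP by blast
    then show ?thesis by blast
  qed
qed

end

theorem (in cg_schur_ring) wreath_or_tensor:
  assumes p: "p \<in> P" and bad: "\<not> block_ideal (max_ideal p)"
  shows "wreath \<or> (\<exists>F. splits F)"
proof (cases "\<forall>M. maximal M \<longrightarrow> e p \<in> M")
  case True
  then show ?thesis using wreath_case[OF p] by blast
next
  case False
  then obtain M where M: "maximal M" "e p \<notin> M" by blast
  interpret bad_maximal R S P e M p by unfold_locales (use M p bad in auto)
  show ?thesis
  proof (cases "\<exists>r\<in>Q. socle r \<subseteq> M")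
    case True
    then show ?thesis using wreath_case_socle by blast
  next
    case False
    then show ?thesis using final_case by blast
  qed
qed

section \<open>From coefficient functions to partitions\<close>

text \<open>This is the bridge between the span in the definition of S-rings and the block-constant
  functions of the locale \<open>schur_ring\<close>.\<close>

lemma int_span_partition:
  assumes fin: "finite \<Omega>" and part: "partition_on \<Omega> S"
  shows "int_span (indicator ` S) = {f. (\<forall>x. x \<notin> \<Omega> \<longrightarrow> f x = 0) \<and> block_const S f}"
proof (intro equalityI subsetI)
  fix f assume f: "f \<in> int_span (indicator ` S)"
  then obtain c where c: "f = (\<lambda>x. \<Sum>b\<in>indicator ` S. c b * b x)" by (auto simp: int_span_def)
  have "f x = 0" if x: "x \<notin> \<Omega>" for x
    unfolding c
  proof (rule sum.neutral, safe)
    fix X assume "X \<in> S"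
    then have "x \<notin> X" using part x by (auto simp: partition_on_def)
    then show "c (indicator X) * indicator X x = 0" by simp
  qed
  moreover have "block_const S f"
    unfolding block_const_def
  proof (intro ballI)
    have "disjoint S" using part by (simp add: partition_on_def)
    then show "f x = f y" if "X \<in> S" "x \<in> X" "y \<in> X" for X x y
      by (rule int_span_indicator_const[OF f _ that])
  qed
  ultimately show "f \<in> {f. (\<forall>x. x \<notin> \<Omega> \<longrightarrow> f x = 0) \<and> block_const S f}" by blast
next
  fix f :: "'a \<Rightarrow> int" assume f: "f \<in> {f. (\<forall>x. x \<notin> \<Omega> \<longrightarrow> f x = 0) \<and> block_const S f}"
  have finS: "finite S" using finite_elements[OF fin part] .
  \<comment> \<open>The coefficient belonging to a block is the value of \<open>f\<close> at any
    point where the indicator function is 1.\<close>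
  define c where "c b = f (SOME x. b x = (1::int))" for b
  have c: "c (indicator X) = f x" if X: "X \<in> S" "x \<in> X" for X x
  proof -
    have "(indicator X (SOME x. indicator X x = (1::int)) :: int) = 1"
      by (rule someI[of _ x]) (use X in simp)
    then have "(SOME x. indicator X x = (1::int)) \<in> X" by (simp add: indicator_def split: if_splits)
    then show ?thesis unfolding c_def using f X unfolding block_const_def by blast
  qed
  have "f x = (\<Sum>b\<in>indicator ` S. c b * b x)" for x
  proof (cases "x \<in> \<Omega>")
    case True
    then obtain X where X: "X \<in> S" "x \<in> X" using part by (auto simp: partition_on_def)
    have "(\<Sum>b\<in>indicator ` S. c b * b x) = (\<Sum>b\<in>{indicator X}. c b * b x)"
    proof (rule sum.mono_neutral_right)
      show "\<forall>b\<in>indicator ` S - {indicator X}. c b * b x = 0"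
      proof safe
        fix Y assume Y: "Y \<in> S" "c (indicator Y) * indicator Y x \<noteq> 0"
        then have "x \<in> Y" by (simp add: indicator_def split: if_splits)
        then have "Y = X" using X Y part by (auto simp: partition_on_def disjoint_def)
        then show "indicator Y = indicator X" by simp
      qed
    qed (use finS X in auto)
    then show ?thesis using c[OF X] X by simp
  next
    case False
    have "(\<Sum>b\<in>indicator ` S. c b * b x) = 0"
    proof (rule sum.neutral, safe)
      fix X assume "X \<in> S"
      then have "x \<notin> X" using part False by (auto simp: partition_on_def)
      then show "c (indicator X) * indicator X x = 0" by simp
    qed
    then show ?thesis using f False by simp
  qed
  then have "f = (\<lambda>x. \<Sum>b\<in>indicator ` S. c b * b x)" by blast
  then show "f \<in> int_span (indicator ` S)" unfolding int_span_def by blast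
qed

lemma int_basis_partition:
  assumes fin: "finite \<Omega>" and part: "partition_on \<Omega> S"
  shows "int_basis (indicator ` S) (int_span (indicator ` S))"
  unfolding int_basis_def
proof (intro conjI allI impI ballI refl)
  fix c :: "('a \<Rightarrow> int) \<Rightarrow> int" and b :: "'a \<Rightarrow> int"
  assume z: "(\<lambda>x. \<Sum>b\<in>indicator ` S. c b * b x) = (\<lambda>x. 0)" and b: "b \<in> indicator ` S"
  have finS: "finite S" using finite_elements[OF fin part] .
  obtain X where X: "X \<in> S" "b = indicator X" using b by blast
  have "X \<noteq> {}" using partition_onD3[OF part] X(1) by blast
  then obtain x where x: "x \<in> X" by blast
  have "(\<Sum>b\<in>indicator ` S. c b * b x) = (\<Sum>b\<in>{indicator X}. c b * b x)"
  proof (rule sum.mono_neutral_right)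
    show "\<forall>b\<in>indicator ` S - {indicator X}. c b * b x = 0"
    proof safe
      fix Y assume Y: "Y \<in> S" "c (indicator Y) * indicator Y x \<noteq> 0"
      then have "x \<in> Y" by (simp add: indicator_def split: if_splits)
      then have "Y = X" using X Y x part by (auto simp: partition_on_def disjoint_def)
      then show "indicator Y = indicator X" by simp
    qed
  qed (use finS X in auto)
  then show "c b = 0" using fun_cong[OF z, of x] X x by simp
qed

lemma basic_sets_eqI:
  assumes "S_ring G A" "schur_partition G A S" shows "basic_sets G A = S"
  using schur_partition_mono[of G A] schur_partition_basic_sets[OF assms(1)] assms
  unfolding S_ring_def by (meson subset_antisym)

context schur_ring
begin

text \<open>The way back from partitions to S-rings; it provides the tensor factors on the two
  corners.\<close>

lemma span_S_ring:
  shows "S_ring_over R (int_span (indicator ` S))" and "ring_basic_sets R (int_span (indicator ` S)) = S"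
proof -
  let ?G = "add_monoid R" and ?A = "int_span (indicator ` S)"
  let ?GR = "group_ring ?G"
  have A: "?A = {f. (\<forall>x. x \<notin> carrier R \<longrightarrow> f x = 0) \<and> block_const S f}"
    by (rule int_span_partition[OF finR part])
  have sub: "?A \<subseteq> carrier ?GR" unfolding A by (auto simp: group_ring_def)
  have minv: "inv\<^bsub>add_monoid ?GR\<^esub> f = (\<lambda>x. - f x)" if f: "f \<in> carrier ?GR" for f
    unfolding m_inv_def
  proof (rule the_equality)
    show "(\<lambda>x. - f x) \<in> carrier (add_monoid ?GR) \<and> f \<otimes>\<^bsub>add_monoid ?GR\<^esub> (\<lambda>x. - f x) = \<one>\<^bsub>add_monoid ?GR\<^esub>
      \<and> (\<lambda>x. - f x) \<otimes>\<^bsub>add_monoid ?GR\<^esub> f = \<one>\<^bsub>add_monoid ?GR\<^esub>"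
      using f by (auto simp: group_ring_def)
    fix g assume "g \<in> carrier (add_monoid ?GR) \<and> f \<otimes>\<^bsub>add_monoid ?GR\<^esub> g = \<one>\<^bsub>add_monoid ?GR\<^esub>
      \<and> g \<otimes>\<^bsub>add_monoid ?GR\<^esub> f = \<one>\<^bsub>add_monoid ?GR\<^esub>"
    then have "f x + g x = 0" for x by (auto simp: group_ring_def fun_eq_iff)
    then show "g = (\<lambda>x. - f x)" by (auto simp: fun_eq_iff add_eq_0_iff)
  qed
  have mult: "(\<lambda>x. \<Sum>(y, z)\<in>{(y, z)\<in>carrier R \<times> carrier R. y \<oplus> z = x}. f y * g z) \<in> ?A"
    if fg: "f \<in> ?A" "g \<in> ?A" for f g
  proof -
    have eq: "(\<Sum>(y, z)\<in>{(y, z)\<in>carrier R \<times> carrier R. y \<oplus> z = x}. f y * g z)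
      = (\<Sum>y\<in>carrier R. f y * g (x \<ominus> y))" if x: "x \<in> carrier R" for x
      by (rule sum.reindex_bij_witness[where i = "\<lambda>y. (y, x \<ominus> y)" and j = fst])
        (use x in \<open>auto simp: minus_add_cancel\<close>)
    have emp: "{(y, z)\<in>carrier R \<times> carrier R. y \<oplus> z = x} = {}" if "x \<notin> carrier R" for x
      using that by auto
    have "block_const S f" "block_const S g" using fg A by auto
    note c = conv[OF this]
    show ?thesis
      unfolding A
    proof (intro CollectI conjI allI impI)
      fix x assume "x \<notin> carrier R"
      then show "(\<Sum>(y, z)\<in>{(y, z)\<in>carrier R \<times> carrier R. y \<oplus> z = x}. f y * g z) = 0"
        by (subst emp) simp_all
    next
      show "block_const S (\<lambda>x. \<Sum>(y, z)\<in>{(y, z)\<in>carrier R \<times> carrier R. y \<oplus> z = x}. f y * g z)"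
        unfolding block_const_iff
      proof (intro allI impI)
        fix x y assume xy: "same x y"
        then have "(\<Sum>z\<in>carrier R. f z * g (x \<ominus> z)) = (\<Sum>z\<in>carrier R. f z * g (y \<ominus> z))"
          using c unfolding block_const_iff by blast
        then show "(\<Sum>(y, z)\<in>{(y, z)\<in>carrier R \<times> carrier R. y \<oplus> z = x}. f y * g z)
          = (\<Sum>(y', z)\<in>{(y', z)\<in>carrier R \<times> carrier R. y' \<oplus> z = y}. f y' * g z)"
          unfolding eq[OF same_carr(1)[OF xy]] eq[OF same_carr(2)[OF xy]] .
      qed
    qed
  qed
  have sr: "subring ?A ?GR"
  proof (rule subring.intro)
    show "subgroup ?A (add_monoid ?GR)"
    proof
      show "?A \<subseteq> carrier (add_monoid ?GR)" using sub by simp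
      show "f \<otimes>\<^bsub>add_monoid ?GR\<^esub> g \<in> ?A" if "f \<in> ?A" "g \<in> ?A" for f g
      proof -
        have "block_const S (\<lambda>x. f x + g x)"
          unfolding block_const_def
        proof (intro ballI)
          fix X x y assume X: "X \<in> S" "x \<in> X" "y \<in> X"
          have "f x = f y" "g x = g y" using that X unfolding A block_const_def by blast+
          then show "f x + g x = f y + g y" by simp
        qed
        then show ?thesis using that unfolding A by (simp add: group_ring_def)
      qed
      show "\<one>\<^bsub>add_monoid ?GR\<^esub> \<in> ?A" unfolding A by (simp add: group_ring_def block_const_def)
      show "inv\<^bsub>add_monoid ?GR\<^esub> f \<in> ?A" if "f \<in> ?A" for f
      proof -
        have "block_const S (\<lambda>x. - f x)"
          unfolding block_const_def
        proof (intro ballI)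
          fix X x y assume X: "X \<in> S" "x \<in> X" "y \<in> X"
          have "f x = f y" using that X unfolding A block_const_def by blast
          then show "- f x = - f y" by simp
        qed
        moreover have "inv\<^bsub>add_monoid ?GR\<^esub> f = (\<lambda>x. - f x)" using minv[OF subsetD[OF sub that]] .
        ultimately show ?thesis using that unfolding A by simp
      qed
    qed
    show "submonoid ?A ?GR"
    proof
      show "?A \<subseteq> carrier ?GR" by (rule sub)
      show "f \<otimes>\<^bsub>?GR\<^esub> g \<in> ?A" if "f \<in> ?A" "g \<in> ?A" for f g
        using mult[OF that] by (simp add: group_ring_def)
      have "indicator {\<zero>} \<in> ?A"
        unfolding A block_const_iff using same_zero same_sym by (simp add: indicator_def) blast
      then show "\<one>\<^bsub>?GR\<^esub> \<in> ?A" by (simp add: group_ring_def)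
    qed
  qed
  have sp: "schur_partition ?G ?A S"
    unfolding schur_partition_def
    using part zero_block neg_block int_basis_partition[OF finR part] by (simp add: a_inv_def)
  have SR: "S_ring ?G ?A"
    unfolding S_ring_def using sr sp finR add.group_axioms by auto
  show bs: "ring_basic_sets R ?A = S" by (rule basic_sets_eqI[OF SR sp])
  show "S_ring_over R ?A"
    unfolding S_ring_over_def bs using SR finR cring_axioms unit_block by auto
qed

end

lemma schur_ring_of_S_ring:
  assumes "S_ring_over R A"
  shows "schur_ring R (ring_basic_sets R A)" and "A = int_span (indicator ` ring_basic_sets R A)"
proof -
  let ?G = "add_monoid R" and ?S = "ring_basic_sets R A"
  interpret cring R using assms by (simp add: S_ring_over_def)
  have fin: "finite (carrier R)" and SR: "S_ring ?G A"
    and u: "\<And>X u. X \<in> ?S \<Longrightarrow> u \<in> Units R \<Longrightarrow> (\<lambda>x. u \<otimes>\<^bsub>R\<^esub> x) ` X \<in> ?S"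
    using assms by (auto simp: S_ring_over_def)
  have sp: "schur_partition ?G A ?S" by (rule schur_partition_basic_sets[OF SR])
  then have part: "partition_on (carrier R) ?S" and z: "{\<zero>\<^bsub>R\<^esub>} \<in> ?S"
    and n: "\<And>X. X \<in> ?S \<Longrightarrow> (\<lambda>x. \<ominus>\<^bsub>R\<^esub> x) ` X \<in> ?S"
    and A: "A = int_span (indicator ` ?S)"
    by (auto simp: schur_partition_def int_basis_def a_inv_def)
  show "A = int_span (indicator ` ring_basic_sets R A)" by (rule A)
  have A': "f \<in> A \<longleftrightarrow> (\<forall>x. x \<notin> carrier R \<longrightarrow> f x = 0) \<and> block_const ?S f" for f
  proof -
    have "f \<in> A \<longleftrightarrow> f \<in> int_span (indicator ` ?S)" by (rule arg_cong[OF A])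
    then show ?thesis using int_span_partition[OF fin part] by simp
  qed
  have sr: "subring A (group_ring ?G)" using SR by (simp add: S_ring_def)
  show "schur_ring R ?S"
  proof
    fix f g :: "'a \<Rightarrow> int" assume fg: "block_const ?S f" "block_const ?S g"
    \<comment> \<open>Elements of the group ring vanish outside the carrier, so arbitrary
      block-constant functions are first cut off; at points of the carrier the convolution stays the
      same.\<close>
    define f' g' where "f' x = (if x \<in> carrier R then f x else 0)"
      and "g' x = (if x \<in> carrier R then g x else 0)" for x
    have sub: "X \<subseteq> carrier R" if "X \<in> ?S" for X using that part by (auto simp: partition_on_def)
    have restr: "block_const ?S (\<lambda>x. if x \<in> carrier R then h x else 0)"
      if "block_const ?S h" for h :: "'a \<Rightarrow> int"
      unfolding block_const_def
    proof (intro ballI)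
      fix X x y assume X: "X \<in> ?S" "x \<in> X" "y \<in> X"
      then have c: "x \<in> carrier R" "y \<in> carrier R" using sub by blast+
      have "h x = h y" using that X unfolding block_const_def by blast
      then show "(if x \<in> carrier R then h x else 0) = (if y \<in> carrier R then h y else 0)" using c by simp
    qed
    have blk: "block_const ?S f'" "block_const ?S g'"
      using restr[OF fg(1)] restr[OF fg(2)] unfolding f'_def g'_def .
    have "f' \<in> A" "g' \<in> A" unfolding A' using blk(1,2) by (simp_all add: f'_def g'_def)
    then have "f' \<otimes>\<^bsub>group_ring ?G\<^esub> g' \<in> A"
      using submonoid.m_closed[OF subring.axioms(2)[OF sr]] by blast
    then have c: "block_const ?S (f' \<otimes>\<^bsub>group_ring ?G\<^esub> g')" by (simp add: A')
    have eq: "(f' \<otimes>\<^bsub>group_ring ?G\<^esub> g') x = (\<Sum>y\<in>carrier R. f y * g (x \<ominus>\<^bsub>R\<^esub> y))" if x: "x \<in> carrier R"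
      for x
    proof -
      have "(f' \<otimes>\<^bsub>group_ring ?G\<^esub> g') x
        = (\<Sum>(y, z)\<in>{(y, z)\<in>carrier R \<times> carrier R. y \<oplus>\<^bsub>R\<^esub> z = x}. f' y * g' z)"
        by (simp add: group_ring_def)
      also have "\<dots> = (\<Sum>y\<in>carrier R. f y * g (x \<ominus>\<^bsub>R\<^esub> y))"
        by (rule sum.reindex_bij_witness[where i = "\<lambda>y. (y, x \<ominus>\<^bsub>R\<^esub> y)" and j = fst])
          (use x in \<open>auto simp: f'_def g'_def minus_eq a_ac r_neg r_neg1 r_neg2 add_cancels\<close>)
      finally show ?thesis .
    qed
    show "block_const ?S (\<lambda>x. \<Sum>y\<in>carrier R. f y * g (x \<ominus>\<^bsub>R\<^esub> y))"
      unfolding block_const_def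
    proof (intro ballI)
      fix X x y assume X: "X \<in> ?S" "x \<in> X" "y \<in> X"
      have xy: "x \<in> carrier R" "y \<in> carrier R" using sub[OF X(1)] X by auto
      have "(f' \<otimes>\<^bsub>group_ring ?G\<^esub> g') x = (f' \<otimes>\<^bsub>group_ring ?G\<^esub> g') y"
        using c X unfolding block_const_def by blast
      then show "(\<Sum>z\<in>carrier R. f z * g (x \<ominus>\<^bsub>R\<^esub> z)) = (\<Sum>z\<in>carrier R. f z * g (y \<ominus>\<^bsub>R\<^esub> z))"
        unfolding eq[OF xy(1)] eq[OF xy(2)] .
    qed
  qed (use fin part z n u in auto)
qed

section \<open>Corner rings cut out by an idempotent\<close>

context cring
begin

lemma corner_cring:
  assumes E: "E \<in> carrier R" "E \<otimes> E = E"
  shows "cring (R\<lparr>carrier := {x\<in>carrier R. E \<otimes> x = x}, one := E\<rparr>)"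
    and "x \<in> carrier R \<Longrightarrow> E \<otimes> x = x \<Longrightarrow>
      \<ominus>\<^bsub>R\<lparr>carrier := {x\<in>carrier R. E \<otimes> x = x}, one := E\<rparr>\<^esub> x = \<ominus> x"
proof -
  let ?C = "R\<lparr>carrier := {x\<in>carrier R. E \<otimes> x = x}, one := E\<rparr>"
  have ag: "abelian_group ?C"
  proof (rule abelian_groupI)
    fix x assume "x \<in> carrier ?C"
    then have x: "x \<in> carrier R" "E \<otimes> x = x" by auto
    then show "\<exists>y\<in>carrier ?C. y \<oplus>\<^bsub>?C\<^esub> x = \<zero>\<^bsub>?C\<^esub>"
      using r_minus[OF E(1) x(1)] l_neg[OF x(1)] by (intro bexI[of _ "\<ominus> x"]) simp_all
  next
    fix x y assume "x \<in> carrier ?C" "y \<in> carrier ?C"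
    then show "x \<oplus>\<^bsub>?C\<^esub> y \<in> carrier ?C" "x \<oplus>\<^bsub>?C\<^esub> y = y \<oplus>\<^bsub>?C\<^esub> x"
      using E(1) a_comm by (simp_all add: r_distr)
  qed (use E(1) in \<open>auto simp: a_assoc\<close>)
  show C: "cring ?C"
  proof (rule cringI[OF ag])
    show "comm_monoid ?C"
    proof (rule comm_monoidI)
      show "x \<otimes>\<^bsub>?C\<^esub> y \<in> carrier ?C" if "x \<in> carrier ?C" "y \<in> carrier ?C" for x y
        using that E by (auto simp: m_assoc[symmetric])
      show "x \<otimes>\<^bsub>?C\<^esub> y = y \<otimes>\<^bsub>?C\<^esub> x" if "x \<in> carrier ?C" "y \<in> carrier ?C" for x y
        using that m_comm by auto
    qed (use E in \<open>auto simp: m_assoc\<close>)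
  qed (auto simp: l_distr)
  interpret C: cring ?C by (rule C)
  assume x: "x \<in> carrier R" "E \<otimes> x = x"
  show "\<ominus>\<^bsub>?C\<^esub> x = \<ominus> x"
  proof (rule C.minus_equality)
    show "\<ominus> x \<oplus>\<^bsub>?C\<^esub> x = \<zero>\<^bsub>?C\<^esub>" using l_neg[OF x(1)] by simp
    show "x \<in> carrier ?C" using x by simp
    show "\<ominus> x \<in> carrier ?C" using x r_minus[OF E(1) x(1)] by simp
  qed
qed

text \<open>Adding the complementary idempotent extends a unit of the corner to a unit of
  \<open>R\<close> with the same action on the corner. So the corner inherits invariance under
  units.\<close>

lemma corner_unit:
  assumes E: "E \<in> carrier R" "E \<otimes> E = E"
    and u: "u \<in> Units (R\<lparr>carrier := {x\<in>carrier R. E \<otimes> x = x}, one := E\<rparr>)"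
  shows "u \<oplus> (\<one> \<ominus> E) \<in> Units R" and "x \<in> carrier R \<Longrightarrow> E \<otimes> x = x \<Longrightarrow> (u \<oplus> (\<one> \<ominus> E)) \<otimes> x = u \<otimes> x"
proof -
  obtain v where v: "v \<in> carrier R" "E \<otimes> v = v" "u \<otimes> v = E" and uc: "u \<in> carrier R" "E \<otimes> u = u"
    using u unfolding Units_def by auto
  have uE: "u \<otimes> E = u" and vE: "v \<otimes> E = v" using uc v E m_comm by auto
  have "(u \<oplus> (\<one> \<ominus> E)) \<otimes> (v \<oplus> (\<one> \<ominus> E)) = \<one>"
  proof -
    have "(u \<oplus> (\<one> \<ominus> E)) \<otimes> (v \<oplus> (\<one> \<ominus> E))
      = u \<otimes> v \<oplus> (u \<ominus> u \<otimes> E) \<oplus> (v \<ominus> E \<otimes> v) \<oplus> ((\<one> \<ominus> E) \<ominus> (E \<ominus> E \<otimes> E))"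
      using uc(1) v(1) E(1) by (simp add: minus_eq r_distr l_distr r_minus l_minus minus_add a_ac)
    also have "\<dots> = \<one>" using uc v uE E by (simp add: minus_eq r_neg a_ac add_cancels r_neg1 r_neg2)
    finally show ?thesis .
  qed
  moreover have c: "u \<oplus> (\<one> \<ominus> E) \<in> carrier R" "v \<oplus> (\<one> \<ominus> E) \<in> carrier R" using uc v E by auto
  moreover have "(v \<oplus> (\<one> \<ominus> E)) \<otimes> (u \<oplus> (\<one> \<ominus> E)) = \<one>" using calculation m_comm by metis
  ultimately show "u \<oplus> (\<one> \<ominus> E) \<in> Units R" unfolding Units_def by blast
  assume x: "x \<in> carrier R" "E \<otimes> x = x"
  have "(u \<oplus> (\<one> \<ominus> E)) \<otimes> x = u \<otimes> x \<oplus> (x \<ominus> E \<otimes> x)"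
    using x(1) uc(1) E(1) by (simp add: minus_eq l_distr l_minus)
  then show "(u \<oplus> (\<one> \<ominus> E)) \<otimes> x = u \<otimes> x" using x uc by (simp add: minus_eq r_neg)
qed

end

context schur_ring
begin

text \<open>Functions on the corner are extended by zero. Because the corner is a block ideal, the
  extension is block-constant on \<open>R\<close>, and the two convolutions agree on the
  corner.\<close>

lemma corner_schur_ring:
  assumes E: "E \<in> carrier R" "E \<otimes> E = E" and L: "block_ideal {x\<in>carrier R. E \<otimes> x = x}"
  shows "schur_ring (R\<lparr>carrier := {x\<in>carrier R. E \<otimes> x = x}, one := E\<rparr>)
    {X\<in>S. X \<subseteq> {x\<in>carrier R. E \<otimes> x = x}}" (is "schur_ring ?C ?T")
proof -
  let ?L = "{x\<in>carrier R. E \<otimes> x = x}"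
  interpret C: cring ?C by (rule corner_cring(1)[OF E])
  have neg: "\<ominus>\<^bsub>?C\<^esub> x = \<ominus> x" if "x \<in> ?L" for x using corner_cring(2)[OF E] that by simp
  have minus: "x \<ominus>\<^bsub>?C\<^esub> y = x \<ominus> y" if "y \<in> ?L" for x y using neg[OF that] by (simp add: a_minus_def)
  have dich: "X \<subseteq> ?L" if "X \<in> S" "x \<in> X" "x \<in> ?L" for X x
    using that L unfolding block_ideal_def blockset_def same_def by blast
  show ?thesis
  proof
    show "finite (carrier ?C)" using finR by simp
    show "partition_on (carrier ?C) ?T"
    proof (rule partition_onI)
      show "\<Union>?T = carrier ?C" using dich block_ex by fastforce
      show "disjnt X Y" if "X \<in> ?T" "Y \<in> ?T" "X \<noteq> Y" for X Y
        using that block_unique unfolding disjnt_def by blast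
      show "{} \<notin> ?T" using block_ne by blast
    qed
    show "{\<zero>\<^bsub>?C\<^esub>} \<in> ?T" using zero_block E by simp
    show "(\<lambda>x. \<ominus>\<^bsub>?C\<^esub> x) ` X \<in> ?T" if X: "X \<in> ?T" for X
    proof -
      have "(\<lambda>x. \<ominus>\<^bsub>?C\<^esub> x) ` X = (\<lambda>x. \<ominus> x) ` X" using X neg by (intro image_cong) auto
      moreover have "(\<lambda>x. \<ominus> x) ` X \<subseteq> ?L" using X E by (auto simp: r_minus)
      ultimately show ?thesis using X neg_block[of X] by simp
    qed
    show "(\<lambda>x. u \<otimes>\<^bsub>?C\<^esub> x) ` X \<in> ?T" if X: "X \<in> ?T" and u: "u \<in> Units ?C" for X u
    proof -
      have uL: "u \<in> ?L" using u by (simp add: Units_def)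
      have "(\<lambda>x. u \<otimes>\<^bsub>?C\<^esub> x) ` X = (\<lambda>x. (u \<oplus> (\<one> \<ominus> E)) \<otimes> x) ` X"
        using X corner_unit(2)[OF E u] by (intro image_cong) auto
      moreover have "(\<lambda>x. u \<otimes>\<^bsub>?C\<^esub> x) ` X \<subseteq> ?L"
        using X uL E by (auto simp: m_assoc[symmetric])
      ultimately show ?thesis using X unit_block[of X, OF _ corner_unit(1)[OF E u]] by simp
    qed
    fix f g :: "'a \<Rightarrow> int" assume fg: "block_const ?T f" "block_const ?T g"
    define f' g' where "f' x = (if x \<in> ?L then f x else 0)" and "g' x = (if x \<in> ?L then g x else 0)"
      for x
    have restr: "block_const S (\<lambda>x. if x \<in> ?L then h x else 0)"
      if "block_const ?T h" for h :: "'a \<Rightarrow> int"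
      unfolding block_const_def
    proof (intro ballI)
      fix X x y assume X: "X \<in> S" "x \<in> X" "y \<in> X"
      show "(if x \<in> ?L then h x else 0) = (if y \<in> ?L then h y else 0)"
      proof (cases "x \<in> ?L")
        case True
        then have XL: "X \<subseteq> ?L" using dich X by blast
        then have "h x = h y" using that X unfolding block_const_def by blast
        moreover have "y \<in> ?L" using XL X by blast
        ultimately show ?thesis using True by presburger
      next
        case False
        then have "y \<notin> ?L" using dich[OF X(1,3)] X(2) by blast
        then show ?thesis using False by presburger
      qed
    qed
    have "block_const S f'" "block_const S g'"
      using restr[OF fg(1)] restr[OF fg(2)] unfolding f'_def g'_def .
    from conv[OF this] have c: "block_const S (\<lambda>x. \<Sum>y\<in>carrier R. f' y * g' (x \<ominus> y))" .
    have eq: "(\<Sum>y\<in>carrier R. f' y * g' (x \<ominus> y)) = (\<Sum>y\<in>carrier ?C. f y * g (x \<ominus>\<^bsub>?C\<^esub> y))" if x: "x \<in> ?L"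
      for x
    proof (rule sum.mono_neutral_cong_right)
      show "finite (carrier R)" "carrier ?C \<subseteq> carrier R" using finR by auto
      show "\<forall>y\<in>carrier R - carrier ?C. f' y * g' (x \<ominus> y) = 0" by (auto simp: f'_def)
      fix y assume y: "y \<in> carrier ?C"
      then have "x \<ominus> y \<in> ?L" using block_ideal_minus[OF L x, of y] by simp
      then show "f' y * g' (x \<ominus> y) = f y * g (x \<ominus>\<^bsub>?C\<^esub> y)"
        using y minus[of y x] by (simp add: f'_def g'_def)
    qed
    show "block_const ?T (\<lambda>x. \<Sum>y\<in>carrier ?C. f y * g (x \<ominus>\<^bsub>?C\<^esub> y))"
      unfolding block_const_def
    proof (intro ballI)
      fix X x y assume X: "X \<in> ?T" "x \<in> X" "y \<in> X"
      then have xy: "x \<in> ?L" "y \<in> ?L" by blast+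
      have "(\<Sum>z\<in>carrier R. f' z * g' (x \<ominus> z)) = (\<Sum>z\<in>carrier R. f' z * g' (y \<ominus> z))"
        using c X unfolding block_const_def by blast
      then show "(\<Sum>z\<in>carrier ?C. f z * g (x \<ominus>\<^bsub>?C\<^esub> z)) = (\<Sum>z\<in>carrier ?C. f z * g (y \<ominus>\<^bsub>?C\<^esub> z))"
        unfolding eq[OF xy(1)] eq[OF xy(2)] .
    qed
  qed
qed

end

section \<open>Splitting off a component\<close>

context cg_ring
begin

lemma idem_compl: assumes "F \<subseteq> P" shows "idem F \<oplus> idem (P - F) = \<one>"
  by (rule comp_ext) (auto simp: r_distr e_closed e_idem_set)

lemma idem_compl_mult:
  assumes F: "F \<subseteq> P" and x: "x \<in> carrier R" shows "idem F \<otimes> x \<oplus> idem (P - F) \<otimes> x = x"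
  using idem_compl[OF F] x by (simp add: l_distr[symmetric])

lemma idem_compl_iff:
  assumes F: "F \<subseteq> P" and x: "x \<in> carrier R"
  shows "idem (P - F) \<otimes> x = x \<longleftrightarrow> idem F \<otimes> x = \<zero>"
proof
  assume "idem (P - F) \<otimes> x = x"
  then have "idem F \<otimes> x \<oplus> x = x" using idem_compl_mult[OF F x] by simp
  then show "idem F \<otimes> x = \<zero>" using x by (metis add.r_cancel_one idem_closed m_closed)
next
  assume "idem F \<otimes> x = \<zero>"
  then show "idem (P - F) \<otimes> x = x" using idem_compl_mult[OF F x] x by simp
qed

lemma Q_component_idem:
  assumes G: "G \<subseteq> P" and syl: "\<And>p. p \<in> P \<Longrightarrow> sylow_part R p = {x\<in>carrier R. e p \<otimes> x = x}"
  shows "Q_component R G = R\<lparr>carrier := {x\<in>carrier R. idem G \<otimes> x = x}, one := idem G\<rparr>"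
proof -
  let ?L = "{x\<in>carrier R. idem G \<otimes> x = x}"
  have finG: "finite G" using G finP finite_subset by blast
  have c: "carrier (p_component R p) = {x\<in>carrier R. e p \<otimes> x = x}" if "p \<in> P" for p
    using syl[OF that] by (simp add: p_component_def component_on_def)
  have "{\<Oplus>p\<in>G. x p |x. \<forall>p\<in>G. x p \<in> carrier (p_component R p)} = ?L"
  proof (intro equalityI subsetI)
    fix y assume "y \<in> {\<Oplus>p\<in>G. x p |x. \<forall>p\<in>G. x p \<in> carrier (p_component R p)}"
    then obtain x where x: "y = (\<Oplus>p\<in>G. x p)" "\<And>p. p \<in> G \<Longrightarrow> x p \<in> carrier (p_component R p)" by blast
    have xp: "x p \<in> carrier R" "idem G \<otimes> x p = x p" if p: "p \<in> G" for p
    proof -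
      have pP: "p \<in> P" using p G by blast
      have xe: "x p \<in> carrier R" "e p \<otimes> x p = x p" using x(2)[OF p] c[OF pP] by auto
      then show "x p \<in> carrier R" by simp
      have "idem G \<otimes> x p = idem G \<otimes> (e p \<otimes> x p)" using xe by simp
      also have "\<dots> = e p \<otimes> idem G \<otimes> x p" using xe(1) e_closed[OF pP] by (simp add: m_ac)
      finally show "idem G \<otimes> x p = x p" using e_idem_set[OF pP, of G] p xe by simp
    qed
    have yc: "y \<in> carrier R" unfolding x(1) using xp by (intro finsum_closed) auto
    have "idem G \<otimes> y = (\<Oplus>p\<in>G. idem G \<otimes> x p)" unfolding x(1) using finG xp by (intro finsum_rdistr) auto
    also have "\<dots> = y" unfolding x(1) using xp by (intro finsum_cong') auto
    finally show "y \<in> ?L" using yc by simp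
  next
    fix y assume y: "y \<in> ?L"
    then have yc: "y \<in> carrier R" by simp
    have z: "e p \<otimes> y = \<zero>" if "p \<in> P - G" for p
      using e_idem_set'[of p y G] y that by simp
    have "y = (\<Oplus>p\<in>P. e p \<otimes> y)" by (rule decomp[OF yc])
    also have "\<dots> = (\<Oplus>p\<in>G. e p \<otimes> y)"
      using finP G z yc e_closed by (intro add.finprod_mono_neutral_cong_right) auto
    finally have "y = (\<Oplus>p\<in>G. e p \<otimes> y)" .
    moreover have "\<forall>p\<in>G. e p \<otimes> y \<in> carrier (p_component R p)"
    proof
      fix p assume "p \<in> G"
      then have pP: "p \<in> P" using G by blast
      show "e p \<otimes> y \<in> carrier (p_component R p)"
        using c[OF pP] e_mult[OF pP pP yc] e_closed[OF pP] yc by simp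
    qed
    ultimately show "y \<in> {\<Oplus>p\<in>G. x p |x. \<forall>p\<in>G. x p \<in> carrier (p_component R p)}" by blast
  qed
  moreover have "(THE u. u \<in> ?L \<and> (\<forall>x\<in>?L. u \<otimes> x = x \<and> x \<otimes> u = x)) = idem G"
  proof (rule the_equality)
    show "idem G \<in> ?L \<and> (\<forall>x\<in>?L. idem G \<otimes> x = x \<and> x \<otimes> idem G = x)"
    proof (intro conjI ballI)
      show "idem G \<in> ?L" using idem_idem by simp
      fix x assume x: "x \<in> ?L"
      then show "idem G \<otimes> x = x" by simp
      then show "x \<otimes> idem G = x" using m_comm[of x "idem G"] x by simp
    qed
    fix u assume u: "u \<in> ?L \<and> (\<forall>x\<in>?L. u \<otimes> x = x \<and> x \<otimes> u = x)"
    have "idem G \<in> ?L" using idem_idem by simp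
    with u have 1: "u \<otimes> idem G = idem G" and 2: "idem G \<otimes> u = u" and uc: "u \<in> carrier R" by blast+
    have "u = idem G \<otimes> u" using 2 by (rule sym)
    also have "\<dots> = u \<otimes> idem G" using uc by (intro m_comm) simp_all
    also note 1
    finally show "u = idem G" .
  qed
  ultimately show ?thesis by (simp add: Q_component_def component_on_def)
qed

end

context cg_schur_ring
begin

text \<open>By \<open>join\<close> each product of basic sets of the two corners lies in one basic
  set of \<open>R\<close>, and by \<open>proj\<close> each basic set of \<open>R\<close> projects
  into one basic set of either corner. Together they say that the basic sets of \<open>R\<close> are
  these products.\<close>

lemma splits_tensor_decomposition:
  assumes PR: "P = prime_set R" and syl: "\<And>p. p \<in> P \<Longrightarrow> sylow_part R p = {x\<in>carrier R. e p \<otimes> x = x}"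
    and t: "splits F"
  shows "\<exists>A1 A2. tensor_decomposition R F (int_span (indicator ` S)) A1 A2 \<and>
    rank_two_over_non_field (Q_component R F) A1"
proof -
  let ?E = "idem F" and ?E' = "idem (P - F)"
  let ?L = "{x\<in>carrier R. ?E \<otimes> x = x}" and ?L' = "{x\<in>carrier R. ?E' \<otimes> x = x}"
  have FP: "F \<subseteq> P" and sL: "block_ideal ?L" and sK: "block_ideal {x\<in>carrier R. ?E \<otimes> x = \<zero>}"
    and step: "\<And>X x s. X \<in> S \<Longrightarrow> x \<in> X \<Longrightarrow> s \<in> carrier R \<Longrightarrow> ?E \<otimes> s = s \<Longrightarrow> ?E \<otimes> x \<noteq> \<zero> \<Longrightarrow>
        ?E \<otimes> (x \<oplus> s) \<noteq> \<zero> \<Longrightarrow> x \<oplus> s \<in> X"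
    and nf: "\<exists>r\<in>F. \<exists>x\<in>max_ideal r. ?E \<otimes> x \<noteq> \<zero>"
    using t unfolding splits_def by blast+
  have L'_eq: "?L' = {x\<in>carrier R. ?E \<otimes> x = \<zero>}" using idem_compl_iff[OF FP] by blast
  then have sL': "block_ideal ?L'" using sK by simp
  have L'_iff: "x \<in> ?L' \<longleftrightarrow> ?E \<otimes> x = \<zero>" if "x \<in> carrier R" for x using that L'_eq by blast
  have split: "?E \<otimes> z \<oplus> ?E' \<otimes> z = z" if "z \<in> carrier R" for z by (rule idem_compl_mult[OF FP that])
  have EE: "?E \<otimes> (?E \<otimes> z) = ?E \<otimes> z" "?E' \<otimes> (?E' \<otimes> z) = ?E' \<otimes> z" if "z \<in> carrier R" for z
    using that idem_idem by (simp_all add: m_assoc[symmetric])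
  have EE': "?E \<otimes> (?E' \<otimes> z) = \<zero>" if "z \<in> carrier R" for z
    using L'_iff[of "?E' \<otimes> z"] EE(2)[OF that] that by simp
  have E'L: "?E' \<otimes> x = \<zero>" if "x \<in> ?L" for x
  proof -
    have xc: "x \<in> carrier R" "?E \<otimes> x = x" using that by auto
    then have "x \<oplus> ?E' \<otimes> x = x" using split[OF xc(1)] by simp
    then show ?thesis using xc by (metis add.l_cancel_one idem_closed m_closed)
  qed
  have same_step: "same z (z \<oplus> s)"
    if zs: "z \<in> carrier R" "s \<in> carrier R" "?E \<otimes> s = s" "?E \<otimes> z \<noteq> \<zero>" "?E \<otimes> (z \<oplus> s) \<noteq> \<zero>" for z s
  proof -
    obtain X where X: "X \<in> S" "z \<in> X" using block_ex[OF zs(1)] by blast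
    then have "z \<oplus> s \<in> X" by (rule step[OF _ _ zs(2-5)])
    then show ?thesis using X by (auto simp: same_def)
  qed
  have join: "same (x \<oplus> y) (x' \<oplus> y')"
    if x: "x \<in> ?L" "x' \<in> ?L" "same x x'" and y: "y \<in> ?L'" "y' \<in> ?L'" "same y y'" for x x' y y'
  proof (cases "x = \<zero>")
    case True
    then have "x' = \<zero>" using same_zero x by blast
    then show ?thesis using True y by simp
  next
    case False
    then have x'0: "x' \<noteq> \<zero>" using same_zero same_sym[OF x(3)] by blast
    have xc: "x \<in> carrier R" "?E \<otimes> x = x" "x' \<in> carrier R" "?E \<otimes> x' = x'" using x by auto
    have yc: "y \<in> carrier R" "?E \<otimes> y = \<zero>" "y' \<in> carrier R" "?E \<otimes> y' = \<zero>" using y L'_eq by blast+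
    obtain Z where Z: "Z \<in> S" "x \<oplus> y \<in> Z" using block_ex xc yc by (metis a_closed)
    have ZR: "Z \<subseteq> carrier R" by (rule block_sub[OF Z(1)])
    have "(x \<oplus> y) \<oplus> (x' \<ominus> x) = x' \<oplus> y" using xc(1,3) yc(1) by (simp add: add_normal)
    moreover have "(x \<oplus> y) \<oplus> (x' \<ominus> x) \<in> Z"
    proof (rule step[OF Z])
      show "?E \<otimes> (x' \<ominus> x) = x' \<ominus> x" using xc by (simp add: minus_eq r_distr r_minus)
      show "?E \<otimes> (x \<oplus> y) \<noteq> \<zero>" using xc yc False by (simp add: r_distr)
      show "?E \<otimes> ((x \<oplus> y) \<oplus> (x' \<ominus> x)) \<noteq> \<zero>"
        unfolding \<open>(x \<oplus> y) \<oplus> (x' \<ominus> x) = x' \<oplus> y\<close> using xc yc x'0 by (simp add: r_distr)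
    qed (use xc in simp)
    ultimately have x'y: "x' \<oplus> y \<in> Z" by simp
    \<comment> \<open>The coefficient of \<open>y\<close> in the product of \<open>Z\<close> and
      \<open>?L\<close> counts the points of \<open>Z\<close> whose second component is
      \<open>y\<close>. It has the same value at \<open>y'\<close>, which yields a point
      \<open>z\<close> of \<open>Z\<close> over \<open>y'\<close>.\<close>
    have cc: "card {z\<in>Z. y \<ominus> z \<in> ?L} = card {z\<in>Z. y' \<ominus> z \<in> ?L}"
      using conv_card[OF block_is_blockset[OF Z(1)], of ?L] sL y(3)
        by (auto simp: block_const_iff block_ideal_def)
    have finZ: "finite Z" by (rule block_finite[OF Z(1)])
    have "y \<ominus> (x' \<oplus> y) = \<ominus> x'" using xc(3) yc(1) by (simp add: add_normal)
    then have "x' \<oplus> y \<in> {z\<in>Z. y \<ominus> z \<in> ?L}" using x'y block_ideal_neg[OF sL x(2)] by simp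
    then have "card {z\<in>Z. y \<ominus> z \<in> ?L} > 0" using finZ by (auto simp: card_gt_0_iff)
    then have "{z\<in>Z. y' \<ominus> z \<in> ?L} \<noteq> {}" using cc by (metis card.empty less_nat_zero_code)
    then obtain z where z: "z \<in> Z" "y' \<ominus> z \<in> ?L" by blast
    have zc: "z \<in> carrier R" using z ZR by blast
    have "z \<ominus> y' \<in> ?L" using z(2) block_ideal_minus_comm[OF sL yc(3) zc] by blast
    then have l: "?E \<otimes> (z \<ominus> y') = z \<ominus> y'" by simp
    have Ez: "?E \<otimes> z \<noteq> \<zero>"
    proof
      assume "?E \<otimes> z = \<zero>"
      then have "z \<in> ?L'" using L'_iff[OF zc] by blast
      moreover have "same z (x \<oplus> y)" using Z z by (auto simp: same_def)
      ultimately have "x \<oplus> y \<in> ?L'" using block_ideal_same[OF sL'] by blast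
      then have "?E \<otimes> (x \<oplus> y) = \<zero>" using L'_iff xc yc by blast
      then show False using xc yc False by (simp add: r_distr)
    qed
    have eq: "z \<oplus> (x' \<ominus> (z \<ominus> y')) = x' \<oplus> y'" using zc xc(3) yc(3) by (simp add: add_normal)
    have "?E \<otimes> (x' \<oplus> y') \<noteq> \<zero>" using xc yc x'0 by (simp add: r_distr)
    then have ne: "?E \<otimes> (z \<oplus> (x' \<ominus> (z \<ominus> y'))) \<noteq> \<zero>" unfolding eq .
    have Es: "?E \<otimes> (x' \<ominus> (z \<ominus> y')) = x' \<ominus> (z \<ominus> y')"
    proof -
      have "?E \<otimes> (x' \<ominus> (z \<ominus> y')) = ?E \<otimes> x' \<ominus> ?E \<otimes> (z \<ominus> y')"
        using xc zc yc by (simp add: minus_eq r_distr r_minus minus_add)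
      then show ?thesis using l xc by simp
    qed
    have "z \<oplus> (x' \<ominus> (z \<ominus> y')) \<in> Z"
      by (rule step[OF Z(1) z(1) _ Es Ez ne]) (use xc(3) zc yc(3) in simp)
    then have "x' \<oplus> y' \<in> Z" using eq by simp
    then show ?thesis using Z by (auto simp: same_def)
  qed
  have proj: "same (?E \<otimes> z) (?E \<otimes> z')" "same (?E' \<otimes> z) (?E' \<otimes> z')" if zz: "same z z'" for z z'
  proof -
    have zc: "z \<in> carrier R" "z' \<in> carrier R" using same_carr[OF zz] by auto
    have iff: "?E \<otimes> z = \<zero> \<longleftrightarrow> ?E \<otimes> z' = \<zero>"
      using block_ideal_same[OF sL' zz] L'_iff[OF zc(1)] L'_iff[OF zc(2)] by blast
    show "same (?E \<otimes> z) (?E \<otimes> z')"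
    proof (cases "?E \<otimes> z = \<zero>")
      case True
      then show ?thesis using iff same_refl[of \<zero>] by simp
    next
      case False
      have eq: "?E \<otimes> z \<oplus> (?E \<otimes> z' \<ominus> ?E \<otimes> z) = ?E \<otimes> z'" using zc by (simp add: minus_add_cancel)
      have "same (?E \<otimes> z) (?E \<otimes> z \<oplus> (?E \<otimes> z' \<ominus> ?E \<otimes> z))"
        by (rule same_step) (use zc EE False iff eq in \<open>auto simp: minus_eq r_distr r_minus\<close>)
      then show ?thesis using eq by simp
    qed
    obtain Y where Y: "Y \<in> S" "?E' \<otimes> z \<in> Y" using block_ex zc by (metis idem_closed m_closed)
    have YL: "Y \<subseteq> ?L'"
    proof
      fix u assume "u \<in> Y"
      then have "same (?E' \<otimes> z) u" using Y by (auto simp: same_def)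
      moreover have "?E' \<otimes> z \<in> ?L'" using EE zc by simp
      ultimately show "u \<in> ?L'" using block_ideal_same[OF sL'] by blast
    qed
    \<comment> \<open>Since \<open>Y\<close> lies in the second corner, an element \<open>u\<close>
      of \<open>Y\<close> with \<open>z \<ominus> u \<in> ?L\<close> is the second component of
      \<open>z\<close>. The equal count at \<open>z'\<close> shows that the second component of
      \<open>z'\<close> is in \<open>Y\<close> too.\<close>
    have cc: "card {u\<in>Y. z \<ominus> u \<in> ?L} = card {u\<in>Y. z' \<ominus> u \<in> ?L}"
      using conv_card[OF block_is_blockset[OF Y(1)], of ?L] sL zz
        by (auto simp: block_const_iff block_ideal_def)
    have "z \<ominus> ?E' \<otimes> z = ?E \<otimes> z"
      using minus_add_cancel(4)[of "?E \<otimes> z" "?E' \<otimes> z"] split[OF zc(1)] zc by simp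
    then have "?E' \<otimes> z \<in> {u\<in>Y. z \<ominus> u \<in> ?L}" using Y EE zc by simp
    then have "card {u\<in>Y. z \<ominus> u \<in> ?L} > 0" using block_finite[OF Y(1)] by (auto simp: card_gt_0_iff)
    then have "{u\<in>Y. z' \<ominus> u \<in> ?L} \<noteq> {}" using cc by (metis card.empty less_nat_zero_code)
    then obtain u where u: "u \<in> Y" "z' \<ominus> u \<in> ?L" by blast
    have uc: "u \<in> carrier R" "?E' \<otimes> u = u" using u YL by auto
    have "?E' \<otimes> (z' \<ominus> u) = \<zero>" by (rule E'L[OF u(2)])
    then have "?E' \<otimes> z' \<ominus> u = \<zero>" using uc zc by (simp add: minus_eq r_distr r_minus)
    then have "?E' \<otimes> z' = u" using minus_add_cancel(1)[of "?E' \<otimes> z'" u] uc zc by simp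
    then show "same (?E' \<otimes> z) (?E' \<otimes> z')" using Y u by (auto simp: same_def)
  qed
  let ?R1 = "R\<lparr>carrier := ?L, one := ?E\<rparr>" and ?R2 = "R\<lparr>carrier := ?L', one := ?E'\<rparr>"
  have Q1: "Q_component R F = ?R1" by (rule Q_component_idem[OF FP syl])
  have Q2: "Q_component R (prime_set R - F) = ?R2"
    unfolding PR[symmetric] by (rule Q_component_idem[OF _ syl]) auto
  let ?S1 = "{X\<in>S. X \<subseteq> ?L}" and ?S2 = "{X\<in>S. X \<subseteq> ?L'}"
  interpret C1: schur_ring ?R1 ?S1 by (rule corner_schur_ring[OF idem_closed idem_idem sL])
  interpret C2: schur_ring ?R2 ?S2 by (rule corner_schur_ring[OF idem_closed idem_idem sL'])
  let ?A = "int_span (indicator ` S) :: ('a \<Rightarrow> int) set"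
  let ?A1 = "int_span (indicator ` ?S1) :: ('a \<Rightarrow> int) set"
  let ?A2 = "int_span (indicator ` ?S2) :: ('a \<Rightarrow> int) set"
  let ?T = "{X1 \<times> X2 |X1 X2. X1 \<in> ?S1 \<and> X2 \<in> ?S2}"
  have A: "f \<in> ?A \<longleftrightarrow> (\<forall>x. x \<notin> carrier R \<longrightarrow> f x = 0) \<and> block_const S f" for f
    using int_span_partition[OF finR part] by simp
  have partT: "partition_on (?L \<times> ?L') ?T"
  proof (rule partition_onI)
    show "\<Union>?T = ?L \<times> ?L'"
    proof (intro equalityI subsetI)
      fix a assume "a \<in> ?L \<times> ?L'"
      then obtain x y where a: "a = (x, y)" "x \<in> ?L" "y \<in> ?L'" by blast
      have "x \<in> \<Union>?S1" "y \<in> \<Union>?S2" using C1.part C2.part a by (auto simp: partition_on_def)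
      then show "a \<in> \<Union>?T" using a by blast
    qed blast
    show "disjnt X Y" if XYT: "X \<in> ?T" "Y \<in> ?T" "X \<noteq> Y" for X Y
    proof -
      obtain X1 X2 Y1 Y2 where XY: "X = X1 \<times> X2" "Y = Y1 \<times> Y2" "X1 \<in> S" "X2 \<in> S" "Y1 \<in> S" "Y2 \<in> S"
        using XYT(1,2) by blast
      show ?thesis unfolding disjnt_def
        using XY XYT(3) block_unique[OF XY(3,5)] block_unique[OF XY(4,6)] by blast
    qed
    show "{} \<notin> ?T"
    proof
      assume "{} \<in> ?T"
      then obtain X1 X2 where X12: "{} = X1 \<times> X2" "X1 \<in> S" "X2 \<in> S" by blast
      then obtain x y where "x \<in> X1" "y \<in> X2" using block_ne by blast
      then show False using X12(1) by blast
    qed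
  qed
  have finT: "finite (?L \<times> ?L')" using finR by simp
  have tp: "tensor_product (add_monoid ?R1) ?A1 (add_monoid ?R2) ?A2 = int_span (indicator ` ?T)"
    unfolding tensor_product_def C1.span_S_ring(2) C2.span_S_ring(2) ..
  have B: "g \<in> int_span (indicator ` ?T) \<longleftrightarrow> (\<forall>a. a \<notin> ?L \<times> ?L' \<longrightarrow> g a = 0) \<and> block_const ?T g" for g
    using int_span_partition[OF finT partT] by simp
  let ?\<Phi> = "\<lambda>f (x, y). if x \<in> carrier ?R1 \<and> y \<in> carrier ?R2 then f (x \<oplus> y) else (0::int)"
  have img: "?\<Phi> ` ?A = int_span (indicator ` ?T)"
  proof (intro equalityI subsetI)
    fix g assume "g \<in> ?\<Phi> ` ?A"
    then obtain f where f: "f \<in> ?A" "g = ?\<Phi> f" by blast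
    have "block_const ?T g" unfolding block_const_def
    proof (intro ballI)
      fix X a b assume X: "X \<in> ?T" "a \<in> X" "b \<in> X"
      then obtain X1 X2 where X12: "X = X1 \<times> X2" "X1 \<in> S" "X1 \<subseteq> ?L" "X2 \<in> S" "X2 \<subseteq> ?L'" by blast
      obtain x y where a: "a = (x, y)" "x \<in> X1" "y \<in> X2" using X X12 by blast
      obtain x' y' where b: "b = (x', y')" "x' \<in> X1" "y' \<in> X2" using X X12 by blast
      have "same (x \<oplus> y) (x' \<oplus> y')"
        by (rule join) (use a b X12 in \<open>auto simp: same_def\<close>)
      then have "f (x \<oplus> y) = f (x' \<oplus> y')" using f(1) A unfolding block_const_iff by blast
      moreover have "x \<in> ?L" "x' \<in> ?L" "y \<in> ?L'" "y' \<in> ?L'" using a b X12 by blast+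
      ultimately show "g a = g b" unfolding f(2) a(1) b(1) by simp
    qed
    moreover have "\<forall>a. a \<notin> ?L \<times> ?L' \<longrightarrow> g a = 0" unfolding f(2) by auto
    ultimately show "g \<in> int_span (indicator ` ?T)" using B by blast
  next
    fix g assume g: "g \<in> int_span (indicator ` ?T)"
    then have g0: "\<And>a. a \<notin> ?L \<times> ?L' \<Longrightarrow> g a = 0" and gc: "block_const ?T g" using B by blast+
    define f where "f z = (if z \<in> carrier R then g (?E \<otimes> z, ?E' \<otimes> z) else 0)" for z
    have "f \<in> ?A" unfolding A block_const_iff
    proof (intro conjI allI impI)
      show "f x = 0" if "x \<notin> carrier R" for x using that by (simp add: f_def)
      fix z z' assume zz: "same z z'"
      have zc: "z \<in> carrier R" "z' \<in> carrier R" using same_carr[OF zz] by auto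
      obtain X1 where X1: "X1 \<in> S" "?E \<otimes> z \<in> X1" "?E \<otimes> z' \<in> X1"
        using proj(1)[OF zz] by (auto simp: same_def)
      obtain X2 where X2: "X2 \<in> S" "?E' \<otimes> z \<in> X2" "?E' \<otimes> z' \<in> X2"
        using proj(2)[OF zz] by (auto simp: same_def)
      have m: "?E \<otimes> z \<in> ?L" "?E' \<otimes> z \<in> ?L'" using EE zc by auto
      have "X1 \<subseteq> ?L" using block_ideal_same[OF sL] same_in_block[OF X1(1,2)] m by blast
      moreover have "X2 \<subseteq> ?L'" using block_ideal_same[OF sL'] same_in_block[OF X2(1,2)] m by blast
      ultimately have X12: "X1 \<times> X2 \<in> ?T" using X1 X2 by blast
      have "g (?E \<otimes> z, ?E' \<otimes> z) = g (?E \<otimes> z', ?E' \<otimes> z')"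
        by (rule gc[unfolded block_const_def, rule_format, OF X12]) (use X1 X2 in simp_all)
      then show "f z = f z'" using zc by (simp add: f_def)
    qed
    moreover have "?\<Phi> f = g"
    proof
      fix a
      show "?\<Phi> f a = g a"
      proof (cases "a \<in> ?L \<times> ?L'")
        case False
        then show ?thesis using g0 by (cases a) auto
      next
        case True
        then obtain x y where a: "a = (x, y)" "x \<in> ?L" "y \<in> ?L'" by blast
        have c: "x \<in> carrier R" "?E \<otimes> x = x" "y \<in> carrier R" "?E' \<otimes> y = y" using a by auto
        have "?E \<otimes> (x \<oplus> y) = x" using c L'_iff[OF c(3)] a by (simp add: r_distr)
        moreover have "?E' \<otimes> (x \<oplus> y) = y" using c E'L[OF a(2)] by (simp add: r_distr)
        ultimately show ?thesis using a c by (simp add: f_def)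
      qed
    qed
    ultimately show "g \<in> ?\<Phi> ` ?A" by blast
  qed
  have td: "tensor_decomposition R F ?A ?A1 ?A2"
    unfolding tensor_decomposition_def Let_def Q1 Q2
    using C1.span_S_ring(1) C2.span_S_ring(1) img tp by simp
  obtain r x where rx: "r \<in> F" "x \<in> max_ideal r" "?E \<otimes> x \<noteq> \<zero>" using nf by blast
  have xc: "x \<in> carrier R" using rx by (simp add: max_ideal_def)
  have rP: "r \<in> P" using rx FP by blast
  \<comment> \<open>Inside the corner the translation condition of \<open>splits\<close> joins all
    non-zero elements, and \<open>?E \<otimes> x\<close> shows that there are some.\<close>
  have S1: "?S1 = {{\<zero>}, ?L - {\<zero>}}"
  proof (intro equalityI subsetI)
    have full: "X = ?L - {\<zero>}" if X: "X \<in> S" "X \<subseteq> ?L" "x \<in> X" "x \<noteq> \<zero>" for X x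
    proof
      show "X \<subseteq> ?L - {\<zero>}"
        using X same_in_block[OF X(1)] same_zero by blast
      show "?L - {\<zero>} \<subseteq> X"
      proof
        fix y assume y: "y \<in> ?L - {\<zero>}"
        have c: "x \<in> carrier R" "?E \<otimes> x = x" "y \<in> carrier R" "?E \<otimes> y = y" "y \<noteq> \<zero>" using X y by auto
        have "x \<oplus> (y \<ominus> x) \<in> X"
          by (rule step[OF X(1,3)]) (use c X(4) in \<open>auto simp: minus_eq r_distr r_minus add_normal\<close>)
        then show "y \<in> X" using c by (simp add: minus_add_cancel)
      qed
    qed
    { fix X assume X: "X \<in> ?S1"
      obtain y where y: "y \<in> X" using X block_ne by blast
      show "X \<in> {{\<zero>}, ?L - {\<zero>}}"
      proof (cases "y = \<zero>")
        case True
        then have "X = {\<zero>}" using block_unique[OF _ zero_block] X y by blast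
        then show ?thesis by simp
      next
        case False
        then show ?thesis using full[OF _ _ y] X by blast
      qed }
    { fix X assume "X \<in> {{\<zero>}, ?L - {\<zero>}}"
      moreover have "{\<zero>} \<in> ?S1" using zero_block by simp
      moreover have "?L - {\<zero>} \<in> ?S1"
      proof -
        have m: "?E \<otimes> x \<in> ?L" using EE xc by simp
        obtain X where X: "X \<in> S" "?E \<otimes> x \<in> X" using block_ex xc by (metis idem_closed m_closed)
        have XL: "X \<subseteq> ?L" using block_ideal_same[OF sL] same_in_block[OF X] m by blast
        show ?thesis using full[OF X(1) XL X(2) rx(3)] X(1) XL by simp
      qed
      ultimately show "X \<in> ?S1" by blast }
  qed
  have "S_rank (add_monoid ?R1) ?A1 = 2"
  proof -
    have "\<zero> \<in> {\<zero>} - (?L - {\<zero>})" by simp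
    then have ne: "{\<zero>} \<noteq> ?L - {\<zero>}" by blast
    have "S_rank (add_monoid ?R1) ?A1 = card ?S1" unfolding S_rank_def C1.span_S_ring(2) ..
    also have "\<dots> = 2" unfolding S1 using ne by simp
    finally show ?thesis .
  qed
  \<comment> \<open>The last condition of \<open>splits\<close> gives a non-zero element of the
    corner that is not invertible at \<open>r\<close>.\<close>
  moreover have "\<not> field ?R1"
  proof
    assume "field ?R1"
    then interpret K: field ?R1 .
    have "?E \<otimes> x \<in> carrier ?R1 - {\<zero>\<^bsub>?R1\<^esub>}" using EE xc rx by simp
    then have "?E \<otimes> x \<in> Units ?R1" using K.field_Units by blast
    then obtain y where y: "y \<in> carrier R" "?E \<otimes> x \<otimes> y = ?E" unfolding Units_def by auto
    have er: "e r \<in> carrier R" using e_closed[OF rP] .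
    have eE: "e r \<otimes> ?E = e r" using e_idem_set[OF rP, of F] rx by simp
    have "e r \<otimes> x \<otimes> y = (e r \<otimes> ?E) \<otimes> x \<otimes> y" using eE by simp
    also have "\<dots> = e r \<otimes> (?E \<otimes> x \<otimes> y)" using er xc y(1) by (simp add: m_assoc)
    also have "\<dots> = e r" using y eE by simp
    finally show False using max_ideal_iff[OF rP xc] rx y by blast
  qed
  ultimately have "rank_two_over_non_field (Q_component R F) ?A1"
    unfolding rank_two_over_non_field_def Q1 using C1.span_S_ring(1) by blast
  then show ?thesis using td by blast
qed

end

section \<open>The components of a CG-ring\<close>

text \<open>Chinese remainder theorem: \<open>c\<close> is 1 modulo the \<open>p\<close>-part of
  \<open>N\<close> and 0 modulo its cofactor. The image of \<open>c\<close> in a ring of order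
  \<open>N\<close> is the idempotent of the \<open>p\<close>-component.\<close>

lemma prime_component_coefficient:
  fixes N p :: nat
  assumes N: "N \<noteq> 0" and p: "Factorial_Ring.prime p"
  obtains c :: int where "int (p ^ multiplicity p N) dvd c - 1"
    and "\<And>r. Factorial_Ring.prime r \<Longrightarrow> r \<noteq> p \<Longrightarrow> int (r ^ multiplicity r N) dvd c"
    and "int N dvd int (p ^ multiplicity p N) * c"
proof -
  let ?k = "multiplicity p N"
  obtain m where m: "N = p ^ ?k * m" "\<not> p dvd m"
    using multiplicity_decompose'[of N p] N p prime_gt_1_nat[OF p] by auto
  have "coprime (int (p ^ ?k)) (int m)"
    using m(2) p by (simp add: prime_imp_coprime)
  then obtain a b where ab: "a * int (p ^ ?k) + b * int m = 1"
    using bezout_int[of "int (p ^ ?k)" "int m"] by auto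
  have "b * int m - 1 = int (p ^ ?k) * (- a)" using ab by (simp add: algebra_simps)
  then have 1: "int (p ^ ?k) dvd b * int m - 1" by simp
  have 2: "int (r ^ multiplicity r N) dvd b * int m" if r: "Factorial_Ring.prime r" "r \<noteq> p" for r
  proof -
    have "coprime (r ^ multiplicity r N) (p ^ ?k)" using primes_coprime[OF r(1) p r(2)] by simp
    moreover have "r ^ multiplicity r N dvd p ^ ?k * m" using multiplicity_dvd[of r N] m(1) by simp
    ultimately have "r ^ multiplicity r N dvd m" by (simp add: coprime_dvd_mult_right_iff)
    then show ?thesis by (simp del: of_nat_power)
  qed
  have 3: "int N dvd int (p ^ ?k) * (b * int m)"
  proof -
    have "int (p ^ ?k) * (b * int m) = int (p ^ ?k * m) * b" by simp
    then show ?thesis using m(1) by (metis dvd_triv_left)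
  qed
  show ?thesis by (rule that[OF 1 2 3])
qed

lemma dvd_by_prime_powers:
  fixes N :: nat and s :: int
  assumes N: "N \<noteq> 0"
    and p: "\<And>p. Factorial_Ring.prime p \<Longrightarrow> p dvd N \<Longrightarrow> int (p ^ multiplicity p N) dvd s"
  shows "int N dvd s"
proof (cases "s = 0")
  case False
  have "N dvd nat \<bar>s\<bar>"
  proof (rule multiplicity_le_imp_dvd[OF N])
    fix p :: nat assume pr: "Factorial_Ring.prime p"
    show "multiplicity p N \<le> multiplicity p (nat \<bar>s\<bar>)"
    proof (cases "p dvd N")
      case True
      have "p ^ multiplicity p N dvd nat \<bar>s\<bar>"
        using p[OF pr True] by (simp add: nat_dvd_iff int_dvd_int_iff[symmetric] del: of_nat_power)
      then show ?thesis using pr False prime_gt_1_nat[OF pr] by (intro multiplicity_geI) auto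
    next
      case False
      then show ?thesis by (simp add: not_dvd_imp_multiplicity_0)
    qed
  qed
  then show ?thesis by (simp add: int_dvd_int_iff[symmetric])
qed simp

context cring
begin

lemma add_pow_int: "x \<in> carrier R \<Longrightarrow> [(n::nat)] \<cdot> x = \<guillemotleft>int n\<guillemotright> \<otimes> x"
  by (induction n) (auto simp: add_pow_def l_distr a_comm)

lemma of_int_pow: "\<guillemotleft>i ^ n\<guillemotright> = \<guillemotleft>i\<guillemotright> [^] (n::nat)"
  by (induction n) (auto simp: m_comm)

lemma order_kills:
  assumes "finite (carrier R)" "x \<in> carrier R" shows "\<guillemotleft>int (card (carrier R))\<guillemotright> \<otimes> x = \<zero>"
  using add.pow_order_eq_1[OF assms(2)] add_pow_int[OF assms(2)]
  by (simp add: order_def add_pow_def)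

lemma of_int_cong:
  assumes fin: "finite (carrier R)" and d: "int (card (carrier R)) dvd a - b" shows "\<guillemotleft>a\<guillemotright> = \<guillemotleft>b\<guillemotright>"
proof -
  obtain k where k: "a - b = int (card (carrier R)) * k" using d by blast
  then have "a = b + int (card (carrier R)) * k" by simp
  then have "\<guillemotleft>a\<guillemotright> = \<guillemotleft>b\<guillemotright> \<oplus> \<guillemotleft>int (card (carrier R))\<guillemotright> \<otimes> \<guillemotleft>k\<guillemotright>" by (simp only: of_int_add of_int_mult)
  then show ?thesis using order_kills[OF fin, of "\<guillemotleft>k\<guillemotright>"] by simp
qed

lemma finsum_of_int: "finite A \<Longrightarrow> (\<Oplus>p\<in>A. \<guillemotleft>c p\<guillemotright>) = \<guillemotleft>\<Sum>p\<in>A. c p\<guillemotright>"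
  by (induction A rule: finite_induct) auto

text \<open>Both sides consist of the elements killed by the \<open>p\<close>-part of the order.
  \<open>main\<close> treats an arbitrary subgroup of that order, which settles uniqueness in the
  definite description; existence is Sylow's theorem.\<close>

lemma sylow_part_idem:
  assumes fin: "finite (carrier R)" and p: "Factorial_Ring.prime p"
    and c1: "int (p ^ multiplicity p (card (carrier R))) dvd c - 1"
    and c3: "int (card (carrier R)) dvd int (p ^ multiplicity p (card (carrier R))) * c"
  shows "sylow_part R p = {x\<in>carrier R. \<guillemotleft>c\<guillemotright> \<otimes> x = x}"
proof -
  let ?N = "card (carrier R)" and ?G = "add_monoid R"
  let ?k = "multiplicity p ?N"
  let ?q = "int (p ^ ?k)"
  have N: "?N \<noteq> 0" using fin zero_closed by auto
  have kill: "\<guillemotleft>?q\<guillemotright> \<otimes> x = \<zero>" if x: "x \<in> carrier R" "\<guillemotleft>c\<guillemotright> \<otimes> x = x" for x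
  proof -
    have "\<guillemotleft>?q\<guillemotright> \<otimes> x = \<guillemotleft>?q * c\<guillemotright> \<otimes> x" using x by (simp add: m_assoc del: of_nat_power)
    also have "\<guillemotleft>?q * c\<guillemotright> = \<guillemotleft>0\<guillemotright>" by (rule of_int_cong[OF fin]) (use c3 in simp)
    finally show ?thesis using x by simp
  qed
  have idc: "\<guillemotleft>c\<guillemotright> \<otimes> x = x" if x: "x \<in> carrier R" "\<guillemotleft>?q\<guillemotright> \<otimes> x = \<zero>" for x
  proof -
    obtain t where t: "c - 1 = ?q * t" using c1 by blast
    have "c = 1 + t * ?q" using t by (simp add: mult.commute)
    then have "\<guillemotleft>c\<guillemotright> = \<one> \<oplus> \<guillemotleft>t\<guillemotright> \<otimes> \<guillemotleft>?q\<guillemotright>" by (simp only: of_int_add of_int_mult of_int_1)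
    then have "\<guillemotleft>c\<guillemotright> \<otimes> x = x \<oplus> \<guillemotleft>t\<guillemotright> \<otimes> (\<guillemotleft>?q\<guillemotright> \<otimes> x)"
      using x(1) l_distr[of \<one> "\<guillemotleft>t\<guillemotright> \<otimes> \<guillemotleft>?q\<guillemotright>" x] m_assoc[of "\<guillemotleft>t\<guillemotright>" "\<guillemotleft>?q\<guillemotright>" x] by simp
    then show ?thesis using x by simp
  qed
  obtain m where m: "?N = p ^ ?k * m" "\<not> p dvd m"
    using multiplicity_decompose'[of ?N p] N p prime_gt_1_nat[OF p] by auto
  have main: "H = {x\<in>carrier R. \<guillemotleft>c\<guillemotright> \<otimes> x = x}" if H: "subgroup H ?G" "card H = p ^ ?k" for H
  proof
    have HR: "H \<subseteq> carrier R" using subgroup.subset[OF H(1)] by simp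
    have mult: "[(n::nat)] \<cdot> x = x [^]\<^bsub>?G\<^esub> n" for n x by (simp add: add_pow_def)
    show "H \<subseteq> {x\<in>carrier R. \<guillemotleft>c\<guillemotright> \<otimes> x = x}"
    proof
      fix x assume x: "x \<in> H"
      have xc: "x \<in> carrier R" using x HR by blast
      interpret HG: group "?G\<lparr>carrier := H\<rparr>" using subgroup.subgroup_is_group[OF H(1) add.group_axioms] .
      have "x [^]\<^bsub>?G\<lparr>carrier := H\<rparr>\<^esub> order (?G\<lparr>carrier := H\<rparr>) = \<one>\<^bsub>?G\<lparr>carrier := H\<rparr>\<^esub>"
        by (rule HG.pow_order_eq_1) (use x in simp)
      then have "x [^]\<^bsub>?G\<^esub> (p ^ ?k) = \<zero>"
        using H(2) by (simp add: order_def nat_pow_def)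
      then have "\<guillemotleft>?q\<guillemotright> \<otimes> x = \<zero>" using add_pow_int[OF xc, of "p ^ ?k"] by (simp add: mult)
      then show "x \<in> {x\<in>carrier R. \<guillemotleft>c\<guillemotright> \<otimes> x = x}" using idc xc by blast
    qed
    show "{x\<in>carrier R. \<guillemotleft>c\<guillemotright> \<otimes> x = x} \<subseteq> H"
    proof
      fix x assume "x \<in> {x\<in>carrier R. \<guillemotleft>c\<guillemotright> \<otimes> x = x}"
      then have xc: "x \<in> carrier R" and cx: "\<guillemotleft>c\<guillemotright> \<otimes> x = x" by auto
      have cg: "comm_group ?G" by (rule a_comm_group)
      have nH: "H \<lhd> ?G" by (rule comm_group.normal_iff_subgroup[OF cg, THEN iffD2, OF H(1)])
      interpret nH: normal H ?G by (rule nH)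
      interpret FG: group "?G Mod H" by (rule nH.factorgroup_is_group)
      \<comment> \<open>The quotient by \<open>H\<close> has order \<open>m\<close>, so
        \<open>m x\<close> lies in \<open>H\<close>. As the \<open>p\<close>-part of the order kills
        \<open>x\<close>, a Bezout relation then puts \<open>x\<close> itself in
        \<open>H\<close>.\<close>
      have "card (rcosets\<^bsub>?G\<^esub> H) * card H = order ?G" by (rule add.lagrange[OF H(1)])
      then have "card (rcosets\<^bsub>?G\<^esub> H) * p ^ ?k = m * p ^ ?k"
        using H(2) m(1) by (simp add: order_def mult.commute)
      then have om: "order (?G Mod H) = m" using p by (simp add: order_def FactGroup_def prime_gt_0_nat)
      have "(H #>\<^bsub>?G\<^esub> x) [^]\<^bsub>?G Mod H\<^esub> m = \<one>\<^bsub>?G Mod H\<^esub>"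
        unfolding om[symmetric]
          by (rule FG.pow_order_eq_1) (use xc in \<open>auto simp: FactGroup_def RCOSETS_def\<close>)
      then have "H #>\<^bsub>?G\<^esub> (x [^]\<^bsub>?G\<^esub> m) = H"
        using nH.FactGroup_pow[of x m] xc by (simp add: FactGroup_def)
      moreover have "x [^]\<^bsub>?G\<^esub> m \<in> carrier R" using add.nat_pow_closed[OF xc, of m] by (simp add: mult)
      ultimately have mx: "x [^]\<^bsub>?G\<^esub> m \<in> H"
        using add.rcos_self[OF _ H(1), of "x [^]\<^bsub>?G\<^esub> m"] by simp
      have pw: "\<guillemotleft>i\<guillemotright> \<otimes> y \<in> H" if y: "y \<in> H" for i y
      proof -
        have yc: "y \<in> carrier R" using y HR by blast
        have nn: "\<guillemotleft>int n\<guillemotright> \<otimes> y \<in> H" for n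
        proof (induction n)
          case 0
          then show ?case using subgroup.one_closed[OF H(1)] yc by simp
        next
          case (Suc n)
          then show ?case using subgroup.m_closed[OF H(1) y Suc] yc by (simp add: l_distr)
        qed
        show ?thesis
        proof (cases "0 \<le> i")
          case True
          then show ?thesis using nn[of "nat i"] by simp
        next
          case False
          have "\<ominus> (\<guillemotleft>int (nat (- i))\<guillemotright> \<otimes> y) \<in> H"
            unfolding a_inv_def by (rule subgroup.m_inv_closed[OF H(1) nn])
          moreover have "\<ominus> (\<guillemotleft>int (nat (- i))\<guillemotright> \<otimes> y) = \<guillemotleft>i\<guillemotright> \<otimes> y"
            using False yc by (simp add: l_minus)
          ultimately show ?thesis by simp
        qed
      qed
      have mx': "\<guillemotleft>int m\<guillemotright> \<otimes> x \<in> H" using mx add_pow_int[OF xc, of m] by (simp add: mult)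
      have "coprime (int (p ^ ?k)) (int m)"
        using m(2) p by (simp add: prime_imp_coprime)
      then obtain a b where ab: "a * ?q + b * int m = 1"
        using bezout_int[of ?q "int m"] by auto
      have "x = \<guillemotleft>a * ?q + b * int m\<guillemotright> \<otimes> x" unfolding ab using xc by simp
      also have "\<dots> = \<guillemotleft>a\<guillemotright> \<otimes> (\<guillemotleft>?q\<guillemotright> \<otimes> x) \<oplus> \<guillemotleft>b\<guillemotright> \<otimes> (\<guillemotleft>int m\<guillemotright> \<otimes> x)"
        using xc by (simp add: l_distr m_assoc del: of_nat_power)
      also have "\<dots> = \<guillemotleft>b\<guillemotright> \<otimes> (\<guillemotleft>int m\<guillemotright> \<otimes> x)" using kill[OF xc cx] xc by simp
      finally show "x \<in> H" using pw[OF mx', of b] by simp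
    qed
  qed
  have "\<exists>H. subgroup H ?G \<and> card H = p ^ ?k"
    by (rule sylow_thm[of p ?G ?k m]) (use p fin m add.group_axioms in \<open>auto simp: order_def\<close>)
  then obtain H where H: "subgroup H ?G" "card H = p ^ ?k" by blast
  show ?thesis unfolding sylow_part_def
  proof (rule the_equality)
    show "subgroup {x\<in>carrier R. \<guillemotleft>c\<guillemotright> \<otimes> x = x} ?G \<and> card {x\<in>carrier R. \<guillemotleft>c\<guillemotright> \<otimes> x = x} = p ^ ?k"
      using H main[OF H] by simp
  qed (use main in blast)
qed

lemma maximal_ideal_above:
  assumes fin: "finite (carrier R)" and I: "ideal I R" "I \<noteq> carrier R"
  obtains M where "maximalideal M R" "I \<subseteq> M"
proof -
  let ?A = "{L. ideal L R \<and> L \<noteq> carrier R}"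
  have "finite ?A" using ideal_memb(1) fin by (intro finite_subset[of ?A "Pow (carrier R)"]) auto
  moreover have "I \<in> ?A" using I by simp
  ultimately obtain M where M: "M \<in> ?A" "I \<subseteq> M" "\<forall>b\<in>?A. M \<subseteq> b \<longrightarrow> M = b"
    using finite_has_maximal2[of ?A I] by blast
  have "maximalideal M R"
  proof (rule maximalidealI)
    show "J = M \<or> J = carrier R" if "ideal J R" "M \<subseteq> J" "J \<subseteq> carrier R" for J
      using M that by blast
  qed (use M in auto)
  then show ?thesis using that M(2) by blast
qed

end

text \<open>The identities between the idempotents are congruences of integers modulo the order of
  the ring and are checked one prime power at a time.\<close>

lemma CG_ring_cg_ring:
  assumes "CG_ring R"
  obtains e where "cg_ring R (prime_set R) e"
    and "\<And>p. p \<in> prime_set R \<Longrightarrow> sylow_part R p = {x\<in>carrier R. e p \<otimes>\<^bsub>R\<^esub> x = x}"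
proof -
  interpret cring R using assms by (simp add: CG_ring_def)
  have fin: "finite (carrier R)" using assms by (simp add: CG_ring_def)
  let ?N = "card (carrier R)" and ?P = "prime_set R"
  have N: "?N \<noteq> 0" using fin zero_closed by auto
  have pr: "Factorial_Ring.prime p" "p dvd ?N" if "p \<in> ?P" for p using that by (auto simp: prime_set_def)
  have finP: "finite ?P"
    using N by (intro finite_subset[of ?P "{..?N}"]) (auto simp: prime_set_def dvd_imp_le)
  have "\<forall>p\<in>?P. \<exists>c. int (p ^ multiplicity p ?N) dvd c - 1 \<and>
      (\<forall>r. Factorial_Ring.prime r \<longrightarrow> r \<noteq> p \<longrightarrow> int (r ^ multiplicity r ?N) dvd c) \<and>
      int ?N dvd int (p ^ multiplicity p ?N) * c"
    using prime_component_coefficient[OF N] pr(1) by metis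
  then obtain c where c1: "\<And>p. p \<in> ?P \<Longrightarrow> int (p ^ multiplicity p ?N) dvd c p - 1"
    and c2: "\<And>p r. p \<in> ?P \<Longrightarrow> Factorial_Ring.prime r \<Longrightarrow> r \<noteq> p \<Longrightarrow> int (r ^ multiplicity r ?N) dvd c p"
    and c3: "\<And>p. p \<in> ?P \<Longrightarrow> int ?N dvd int (p ^ multiplicity p ?N) * c p"
    by metis
  define e where "e p = \<guillemotleft>c p\<guillemotright>\<^bsub>R\<^esub>" for p
  have ec: "e p \<in> carrier R" for p by (simp add: e_def)
  have syl: "sylow_part R p = {x\<in>carrier R. e p \<otimes>\<^bsub>R\<^esub> x = x}" if "p \<in> ?P" for p
    unfolding e_def by (rule sylow_part_idem[OF fin pr(1)[OF that] c1[OF that] c3[OF that]])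
  have idem: "e p \<otimes>\<^bsub>R\<^esub> e p = e p" if p: "p \<in> ?P" for p
  proof -
    have "int ?N dvd c p * c p - c p"
    proof (rule dvd_by_prime_powers[OF N])
      fix r assume r: "Factorial_Ring.prime r" "r dvd ?N"
      have "c p * c p - c p = c p * (c p - 1)" by (simp add: algebra_simps)
      then show "int (r ^ multiplicity r ?N) dvd c p * c p - c p"
        using c1[OF p] c2[OF p r(1)] by (cases "r = p") (auto simp del: of_nat_power)
    qed
    then show ?thesis using of_int_cong[OF fin, of "c p * c p" "c p"] by (simp add: e_def)
  qed
  have orth: "e p \<otimes>\<^bsub>R\<^esub> e r = \<zero>\<^bsub>R\<^esub>" if p: "p \<in> ?P" and r: "r \<in> ?P" and ne: "p \<noteq> r" for p r
  proof -
    have "int ?N dvd c p * c r - 0"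
    proof (rule dvd_by_prime_powers[OF N])
      fix s assume s: "Factorial_Ring.prime s" "s dvd ?N"
      show "int (s ^ multiplicity s ?N) dvd c p * c r - 0"
        using c2[OF p s(1)] c2[OF r s(1)] ne by (cases "s = p") (auto simp del: of_nat_power)
    qed
    then show ?thesis using of_int_cong[OF fin, of "c p * c r" 0] by (simp add: e_def)
  qed
  have one: "finsum R e ?P = \<one>\<^bsub>R\<^esub>"
  proof -
    have "int ?N dvd (\<Sum>p\<in>?P. c p) - 1"
    proof (rule dvd_by_prime_powers[OF N])
      fix r assume r: "Factorial_Ring.prime r" "r dvd ?N"
      have rP: "r \<in> ?P" using r by (simp add: prime_set_def)
      have "(\<Sum>p\<in>?P. c p) - 1 = (c r - 1) + (\<Sum>p\<in>?P - {r}. c p)"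
        using sum.remove[OF finP rP, of c] by simp
      moreover have "int (r ^ multiplicity r ?N) dvd (\<Sum>p\<in>?P - {r}. c p)"
        by (rule dvd_sum) (use c2 r in blast)
      ultimately show "int (r ^ multiplicity r ?N) dvd (\<Sum>p\<in>?P. c p) - 1"
        using c1[OF rP] by (metis dvd_add)
    qed
    then have "\<guillemotleft>\<Sum>p\<in>?P. c p\<guillemotright>\<^bsub>R\<^esub> = \<guillemotleft>1\<guillemotright>\<^bsub>R\<^esub>" by (rule of_int_cong[OF fin])
    moreover have "e = (\<lambda>p. \<guillemotleft>c p\<guillemotright>\<^bsub>R\<^esub>)" by (simp add: fun_eq_iff e_def)
    ultimately show ?thesis using finsum_of_int[OF finP, of c] by simp
  qed
  have nil: "\<exists>n::nat. \<guillemotleft>int p\<guillemotright>\<^bsub>R\<^esub> [^]\<^bsub>R\<^esub> n \<otimes>\<^bsub>R\<^esub> e p = \<zero>\<^bsub>R\<^esub>" if p: "p \<in> ?P" for p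
  proof
    have "\<guillemotleft>int (p ^ multiplicity p ?N) * c p\<guillemotright>\<^bsub>R\<^esub> = \<guillemotleft>0\<guillemotright>\<^bsub>R\<^esub>"
      by (rule of_int_cong[OF fin]) (use c3[OF p] in simp)
    then show "\<guillemotleft>int p\<guillemotright>\<^bsub>R\<^esub> [^]\<^bsub>R\<^esub> multiplicity p ?N \<otimes>\<^bsub>R\<^esub> e p = \<zero>\<^bsub>R\<^esub>"
      by (simp add: of_int_pow e_def)
  qed
  \<comment> \<open>In the local ring \<open>p_component R p\<close>, the ideal generated by the
    component of \<open>x\<close> is either everything or lies below the only maximal ideal, which
    consists of the multiples of \<open>p\<close>.\<close>
  have loc: "(\<exists>y\<in>carrier R. e p \<otimes>\<^bsub>R\<^esub> x \<otimes>\<^bsub>R\<^esub> y = e p) \<or>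
      (\<exists>y\<in>carrier R. e p \<otimes>\<^bsub>R\<^esub> x = \<guillemotleft>int p\<guillemotright>\<^bsub>R\<^esub> \<otimes>\<^bsub>R\<^esub> e p \<otimes>\<^bsub>R\<^esub> y)"
    and nonunit: "y \<in> carrier R \<Longrightarrow> e p \<noteq> \<guillemotleft>int p\<guillemotright>\<^bsub>R\<^esub> \<otimes>\<^bsub>R\<^esub> e p \<otimes>\<^bsub>R\<^esub> y"
    if p: "p \<in> ?P" and x: "x \<in> carrier R" for p x y
  proof -
    let ?L = "{x\<in>carrier R. e p \<otimes>\<^bsub>R\<^esub> x = x}"
    let ?C = "R\<lparr>carrier := ?L, one := e p\<rparr>"
    have one_eq: "(THE u. u \<in> ?L \<and> (\<forall>x\<in>?L. u \<otimes>\<^bsub>R\<^esub> x = x \<and> x \<otimes>\<^bsub>R\<^esub> u = x)) = e p"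
    proof (rule the_equality)
      show "e p \<in> ?L \<and> (\<forall>x\<in>?L. e p \<otimes>\<^bsub>R\<^esub> x = x \<and> x \<otimes>\<^bsub>R\<^esub> e p = x)"
      proof (intro conjI ballI)
        show "e p \<in> ?L" using ec idem[OF p] by simp
        fix x assume x: "x \<in> ?L"
        then show "e p \<otimes>\<^bsub>R\<^esub> x = x" by simp
        then show "x \<otimes>\<^bsub>R\<^esub> e p = x" using m_comm[of x "e p"] x ec by simp
      qed
      fix u assume u: "u \<in> ?L \<and> (\<forall>x\<in>?L. u \<otimes>\<^bsub>R\<^esub> x = x \<and> x \<otimes>\<^bsub>R\<^esub> u = x)"
      have "e p \<in> ?L" using ec idem[OF p] by simp
      with u have 1: "u \<otimes>\<^bsub>R\<^esub> e p = e p" and 2: "e p \<otimes>\<^bsub>R\<^esub> u = u" and uc: "u \<in> carrier R" by blast+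
      have "u = e p \<otimes>\<^bsub>R\<^esub> u" using 2 by (rule sym)
      also have "\<dots> = u \<otimes>\<^bsub>R\<^esub> e p" using uc ec by (intro m_comm) simp_all
      also note 1
      finally show "u = e p" .
    qed
    have C: "p_component R p = ?C"
      unfolding p_component_def component_on_def syl[OF p] one_eq ..
    have gal: "galois_ring p ?C" using assms p unfolding CG_ring_def C[symmetric] by blast
    interpret C: cring ?C using gal by (simp add: galois_ring_def)
    have finC: "finite (carrier ?C)" using fin by simp
    have pw: "[p] \<cdot>\<^bsub>?C\<^esub> y = \<guillemotleft>int p\<guillemotright>\<^bsub>R\<^esub> \<otimes>\<^bsub>R\<^esub> y" if "y \<in> ?L" for y
    proof -
      have "[p] \<cdot>\<^bsub>?C\<^esub> y = [p] \<cdot>\<^bsub>R\<^esub> y" by (simp add: add_pow_def nat_pow_def)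
      then show ?thesis using add_pow_int[of y p] that by simp
    qed
    have max: "\<Inter>(maximal_ideals ?C) = {[p] \<cdot>\<^bsub>?C\<^esub> x |x. x \<in> carrier ?C}"
      and ex1: "\<exists>!M. M \<in> maximal_ideals ?C"
      using gal by (auto simp: galois_ring_def)
    then obtain M where M: "maximalideal M ?C" and M_eq: "M = {[p] \<cdot>\<^bsub>?C\<^esub> x |x. x \<in> carrier ?C}"
      and M_uniq: "\<And>M'. maximalideal M' ?C \<Longrightarrow> M' = M"
    proof -
      obtain M where M: "maximal_ideals ?C = {M}" using ex1 by blast
      then show ?thesis using that[of M] max by (auto simp: maximal_ideals_def)
    qed
    show "(\<exists>y\<in>carrier R. e p \<otimes>\<^bsub>R\<^esub> x \<otimes>\<^bsub>R\<^esub> y = e p) \<or>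
      (\<exists>y\<in>carrier R. e p \<otimes>\<^bsub>R\<^esub> x = \<guillemotleft>int p\<guillemotright>\<^bsub>R\<^esub> \<otimes>\<^bsub>R\<^esub> e p \<otimes>\<^bsub>R\<^esub> y)"
    proof -
      let ?x = "e p \<otimes>\<^bsub>R\<^esub> x"
      have xL: "?x \<in> carrier ?C" using x ec idem[OF p] by (simp add: m_assoc[symmetric])
      let ?I = "PIdl\<^bsub>?C\<^esub> ?x"
      have I: "ideal ?I ?C" "?x \<in> ?I" using C.cgenideal_ideal[OF xL] C.cgenideal_self[OF xL] by auto
      show ?thesis
      proof (cases "?I = carrier ?C")
        case True
        have "e p \<in> ?I" unfolding True using ec idem[OF p] by simp
        then obtain y where y: "y \<in> carrier R" "e p = y \<otimes>\<^bsub>R\<^esub> ?x" unfolding cgenideal_def by auto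
        then have "?x \<otimes>\<^bsub>R\<^esub> y = e p" using m_comm[of ?x y] x ec by simp
        then show ?thesis using y by blast
      next
        case False
        then obtain M' where M': "maximalideal M' ?C" "?I \<subseteq> M'"
          using C.maximal_ideal_above[OF finC I(1)] by blast
        then have "?x \<in> M" using M_uniq I(2) by blast
        then obtain y where y: "y \<in> ?L" "?x = [p] \<cdot>\<^bsub>?C\<^esub> y" using M_eq by auto
        then have "?x = \<guillemotleft>int p\<guillemotright>\<^bsub>R\<^esub> \<otimes>\<^bsub>R\<^esub> (e p \<otimes>\<^bsub>R\<^esub> y)" using pw[OF y(1)] by simp
        then have "?x = \<guillemotleft>int p\<guillemotright>\<^bsub>R\<^esub> \<otimes>\<^bsub>R\<^esub> e p \<otimes>\<^bsub>R\<^esub> y" using y ec by (simp add: m_assoc)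
        then show ?thesis using y by blast
      qed
    qed
    assume y: "y \<in> carrier R"
    show "e p \<noteq> \<guillemotleft>int p\<guillemotright>\<^bsub>R\<^esub> \<otimes>\<^bsub>R\<^esub> e p \<otimes>\<^bsub>R\<^esub> y"
    proof
      assume eq: "e p = \<guillemotleft>int p\<guillemotright>\<^bsub>R\<^esub> \<otimes>\<^bsub>R\<^esub> e p \<otimes>\<^bsub>R\<^esub> y"
      have yL: "e p \<otimes>\<^bsub>R\<^esub> y \<in> ?L" using y ec idem[OF p] by (simp add: m_assoc[symmetric])
      have "e p = [p] \<cdot>\<^bsub>?C\<^esub> (e p \<otimes>\<^bsub>R\<^esub> y)" unfolding pw[OF yL] using eq y ec by (simp add: m_assoc)
      then have "\<one>\<^bsub>?C\<^esub> \<in> M" unfolding M_eq using yL by auto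
      then have "M = carrier ?C" using ideal.one_imp_carrier[OF maximalideal.axioms(1)[OF M]] by blast
      then show False using maximalideal.I_notcarr[OF M] by simp
    qed
  qed
  have "cg_ring R ?P e"
  proof
    show "\<exists>y. e p = \<guillemotleft>y\<guillemotright>\<^bsub>R\<^esub>" if "p \<in> ?P" for p by (auto simp: e_def)
    show "e p \<noteq> \<guillemotleft>int p\<guillemotright>\<^bsub>R\<^esub> \<otimes>\<^bsub>R\<^esub> e p \<otimes>\<^bsub>R\<^esub> y" if "p \<in> ?P" "y \<in> carrier R" for p y
      using nonunit[OF that(1) that(2) that(2)] .
  qed (use finP pr ec idem orth one nil loc in auto)
  then show ?thesis using that syl by blast
qed

section \<open>Maximal ideals of a CG-ring\<close>

context schur_ring
begin

text \<open>\<open>GREATEST\<close> needs an ideal that really is the largest. It is the set of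
  elements all of whose ring multiples stabilize \<open>X\<close>, because \<open>X + I = X\<close>
  means that \<open>I\<close> is contained in \<open>stab X\<close>.\<close>

lemma I_L_sup:
  assumes X: "X \<subseteq> carrier R" and J: "ideal J R" "J \<subseteq> stab X" shows "J \<subseteq> I_L R X"
proof -
  let ?P = "\<lambda>I. ideal I R \<and> X <+>\<^bsub>R\<^esub> I = X"
  define G where "G = {g\<in>carrier R. \<forall>r\<in>carrier R. r \<otimes> g \<in> stab X}"
  have G: "ideal G R"
  proof (rule ideal_closedI)
    show "G \<subseteq> carrier R" "\<zero> \<in> G" using stab_zero[OF X] by (auto simp: G_def)
    show "a \<oplus> b \<in> G" if "a \<in> G" "b \<in> G" for a b
      using that stab_add[OF X] by (auto simp: G_def r_distr)
    show "r \<otimes> a \<in> G" if "r \<in> carrier R" "a \<in> G" for r a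
      using that by (auto simp: G_def m_assoc[symmetric])
  qed
  have eq: "X <+>\<^bsub>R\<^esub> I = X \<longleftrightarrow> I \<subseteq> stab X" if I: "ideal I R" for I
  proof
    assume "X <+>\<^bsub>R\<^esub> I = X"
    then have "x \<oplus> i \<in> X" if "x \<in> X" "i \<in> I" for x i using that unfolding set_add_def' by blast
    then show "I \<subseteq> stab X" using ideal_memb(1)[OF I] by (auto simp: stab_def)
  next
    assume IX: "I \<subseteq> stab X"
    have "x \<in> X <+>\<^bsub>R\<^esub> I" if "x \<in> X" for x
    proof -
      have "x \<oplus> \<zero> \<in> X <+>\<^bsub>R\<^esub> I" using that ideal_memb(2)[OF I] unfolding set_add_def' by blast
      then show ?thesis using that X by auto
    qed
    moreover have "X <+>\<^bsub>R\<^esub> I \<subseteq> X" using IX unfolding set_add_def' stab_def by blast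
    ultimately show "X <+>\<^bsub>R\<^esub> I = X" by blast
  qed
  have le: "I \<subseteq> G" if I: "ideal I R" "I \<subseteq> stab X" for I
    using I(2) ideal_memb(1)[OF I(1)] ideal_memb(6)[OF I(1)] by (auto simp: G_def)
  have "G \<subseteq> stab X"
  proof
    fix g assume g: "g \<in> G"
    then have "\<one> \<otimes> g \<in> stab X" unfolding G_def by blast
    then show "g \<in> stab X" using g by (simp add: G_def)
  qed
  then have "?P G" using G eq by blast
  then have "I_L R X = G" unfolding I_L_def by (rule Greatest_equality) (use le eq in blast)
  then show ?thesis using le[OF J] by simp
qed

end

context cg_schur_ring
begin

text \<open>An ideal below no \<open>max_ideal p\<close> contains every \<open>e p\<close>, hence
  1.\<close>

lemma ideal_below_max_ideal:
  assumes I: "ideal I R" "I \<noteq> carrier R" obtains p where "p \<in> P" "I \<subseteq> max_ideal p"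
proof -
  have "\<exists>p\<in>P. I \<subseteq> max_ideal p"
  proof (rule ccontr)
    assume n: "\<not> (\<exists>p\<in>P. I \<subseteq> max_ideal p)"
    have "\<one> \<in> I"
    proof (rule comp_ideal[OF I(1) one_closed])
      fix p assume p: "p \<in> P"
      then obtain a where "a \<in> I" "a \<notin> max_ideal p" using n by blast
      then show "e p \<otimes> \<one> \<in> I" using ideal_e[OF I(1) p] e_closed[OF p] by simp
    qed
    then show False using ideal.one_imp_carrier[OF I(1)] I(2) by blast
  qed
  then show ?thesis using that by blast
qed

lemma max_ideal_proper: "p \<in> P \<Longrightarrow> max_ideal p \<noteq> carrier R"
  using one_notin_max_ideal by blast

lemma max_ideal_maximal:
  assumes p: "p \<in> P" and J: "ideal J R" "J \<noteq> carrier R" "max_ideal p \<subseteq> J" shows "J = max_ideal p"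
proof -
  obtain r where r: "r \<in> P" "J \<subseteq> max_ideal r" using ideal_below_max_ideal[OF J(1,2)] .
  have "r = p"
  proof (rule ccontr)
    assume "r \<noteq> p"
    then have "e p \<otimes> e r = q p \<otimes> e p \<otimes> \<zero>" using e_orth[OF p r(1)] e_closed[OF p] by simp
    then have "e r \<in> max_ideal p" using e_closed[OF r(1)] unfolding max_ideal_def by blast
    then show False using J(3) r e_notin_max_ideal by blast
  qed
  then show ?thesis using J r by blast
qed

lemma maximal_ideal_iff: "maximalideal M R \<longleftrightarrow> (\<exists>p\<in>P. M = max_ideal p)"
proof
  assume M: "maximalideal M R"
  obtain p where p: "p \<in> P" "M \<subseteq> max_ideal p"
    using ideal_below_max_ideal[OF maximalideal.axioms(1)[OF M] maximalideal.I_notcarr[OF M, symmetric]] .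
  have "max_ideal p = M \<or> max_ideal p = carrier R"
    by (rule maximalideal.I_maximal[OF M ideal_max_ideal[OF p(1)] p(2)]) (auto simp: max_ideal_def)
  then show "\<exists>p\<in>P. M = max_ideal p" using p max_ideal_proper by blast
next
  assume "\<exists>p\<in>P. M = max_ideal p"
  then obtain p where p: "p \<in> P" "M = max_ideal p" by blast
  show "maximalideal M R"
  proof (rule maximalidealI)
    show "ideal M R" using ideal_max_ideal p by simp
    show "carrier R \<noteq> M" using max_ideal_proper p by blast
    show "J = M \<or> J = carrier R" if "ideal J R" "M \<subseteq> J" "J \<subseteq> carrier R" for J
      using max_ideal_maximal[OF p(1) that(1)] that p(2) by blast
  qed
qed

text \<open>Used by contraposition: when the two sets of maximal ideals differ, some
  \<open>max_ideal p\<close> is not a block ideal, as \<open>wreath_or_tensor\<close>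
  requires.\<close>

lemma maximal_iff_maximalideal:
  assumes "\<And>p. p \<in> P \<Longrightarrow> block_ideal (max_ideal p)" shows "maximal M \<longleftrightarrow> maximalideal M R"
proof
  assume M: "maximal M"
  then have sM: "block_ideal M" "M \<noteq> carrier R" by (auto simp: maximal_def)
  obtain p where p: "p \<in> P" "M \<subseteq> max_ideal p"
    using ideal_below_max_ideal[OF block_ideal_imp_ideal[OF sM(1)] sM(2)] .
  have "\<forall>L. block_ideal L \<and> L \<noteq> carrier R \<and> M \<subseteq> L \<longrightarrow> L = M" using M by (simp add: maximal_def)
  then have "max_ideal p = M" using assms[OF p(1)] max_ideal_proper[OF p(1)] p(2) by simp
  then show "maximalideal M R" using maximal_ideal_iff p by blast
next
  assume "maximalideal M R"
  then obtain p where p: "p \<in> P" "M = max_ideal p" using maximal_ideal_iff by blast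
  show "maximal M" unfolding maximal_def
  proof (intro conjI allI impI)
    show "block_ideal M" "M \<noteq> carrier R" using assms[OF p(1)] max_ideal_proper[OF p(1)] p(2) by simp_all
    fix L assume L: "block_ideal L \<and> L \<noteq> carrier R \<and> M \<subseteq> L"
    then show "L = M" using max_ideal_maximal[OF p(1), of L] block_ideal_imp_ideal[of L] p(2) by simp
  qed
qed

end

theorem theorem7p1:
  fixes R :: "('a, 'm) ring_scheme" and A :: "('a \<Rightarrow> int) set"
  assumes "CG_ring R"
    and "S_ring_over R A"
    and "maximal_S_ideals R A \<noteq> maximal_ideals R"
  shows "nontrivial_gen_wreath R A \<or>
    (\<exists>Q A1 A2. Q \<subseteq> prime_set R \<and> tensor_decomposition R Q A A1 A2 \<and>
       (rank_two_over_non_field (Q_component R Q) A1 \<or>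
        rank_two_over_non_field (Q_component R (prime_set R - Q)) A2))"
proof -
  define S where "S = ring_basic_sets R A"
  obtain e where cg: "cg_ring R (prime_set R) e"
    and syl: "\<And>p. p \<in> prime_set R \<Longrightarrow> sylow_part R p = {x\<in>carrier R. e p \<otimes>\<^bsub>R\<^esub> x = x}"
    using CG_ring_cg_ring[OF assms(1)] by blast
  have sr: "schur_ring R S" and A: "A = int_span (indicator ` S)"
    using schur_ring_of_S_ring[OF assms(2)] unfolding S_def .
  note A' = A[symmetric]
  interpret cg_schur_ring R S "prime_set R" e
    using sr cg by (simp add: cg_schur_ring_def)
  have S_ideal_iff: "S_ideal R A I \<longleftrightarrow> block_ideal I" for I
    unfolding S_ideal_def block_ideal_def blockset_iff_Union S_def[symmetric] ..
  have max: "maximal_S_ideals R A = {M. maximal M}"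
    unfolding maximal_S_ideals_def maximal_def S_ideal_iff ..
  obtain p where p: "p \<in> prime_set R" "\<not> block_ideal (max_ideal p)"
    using assms(3) maximal_iff_maximalideal unfolding max maximal_ideals_def by blast
  from wreath_or_tensor[OF p] show ?thesis
  proof
    assume wreath
    then obtain I J where IJ: "block_ideal I" "block_ideal J" "J \<subseteq> I" "J \<noteq> {\<zero>\<^bsub>R\<^esub>}" "I \<noteq> carrier R"
      and stab: "\<forall>X\<in>S. X \<subseteq> carrier R - I \<longrightarrow> J \<subseteq> stab X"
      unfolding wreath_def by (elim exE conjE) (rule that)
    have "J \<subseteq> I_L R X" if "X \<in> S" "X \<subseteq> carrier R - I" for X
      by (rule I_L_sup[OF block_sub[OF that(1)] block_ideal_imp_ideal[OF IJ(2)] stab[rule_format, OF that]])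
    then have "\<forall>X\<in>S. X \<subseteq> carrier R - I \<longrightarrow> J \<subseteq> I_L R X" by simp
    with IJ have "nontrivial_gen_wreath R A"
      unfolding nontrivial_gen_wreath_def S_ideal_iff S_def[symmetric] by (intro exI conjI)
    then show ?thesis ..
  next
    assume "\<exists>F. splits F"
    then obtain F where F: "splits F" by blast
    then have "F \<subseteq> prime_set R" by (simp add: splits_def)
    moreover obtain A1 A2 where "tensor_decomposition R F A A1 A2"
      "rank_two_over_non_field (Q_component R F) A1"
      using splits_tensor_decomposition[OF refl syl F] unfolding A' by blast
    ultimately show ?thesis by blast
  qed
qed

end
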